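(* Let $\Omega\subset\mathbb{R}^n$ ($n\ge 2$) be a bounded open set, let $p>1$, and let $p^*$ be as in the context. Let $f=f(x,u,\xi):\Omega\times\mathbb{R}\times\mathbb{R}^n\to[0,+\infty)$ be a Carathéodory function, convex with respect to $\xi\in\mathbb{R}^n$ for a.e. $x\in\Omega$ and all $u\in\mathbb{R}$, with $D_\xi f$ a Carathéodory map, such that: (1) there are constants $M\ge m>1$ with $m\,f(x,u,\xi)\le f(x,u,2\xi)\le M\,f(x,u,\xi)$ for all $(x,u,\xi)\in\Omega\times\mathbb{R}\times\mathbb{R}^n$; (2) there is a constant $c_5>0$ with $f(x,u,\xi)\ge c_5|\xi|^p$ for a.e. $x\in\Omega$ and every $(u,\xi)\in\mathbb{R}\times\mathbb{R}^n$; (3) there is a constant $c_6>0$ with $f(x,v,\xi)\le c_6 f(x,u,\xi)$ for all $u,v\in\mathbb{R}$ with $|v|\le|u|$, for a.e. $x\in\Omega$ and all $\xi\in\mathbb{R}^n$; (4) $x\mapsto f(x,0,0)$ belongs to $L^1(\Omega)$. Let $a=a(x,u,\xi):\Omega\times\mathbb{R}\times\mathbb{R}^n\to\mathbb{R}^n$ be a Carathéodory vector field such that, for some constants $c_1,c_3>0$, $c_2,c_4\ge0$ and nonnegative functions $b_1\in L^{s_1}(\Omega)$ with $s_1>\max\{1,\tfrac np\}$ and $b_2\in L^1(\Omega)$, for a.e. $x\in\Omega$ and every $(u,\xi)\in\mathbb{R}\times\mathbb{R}^n$, $$(a(x,u,\xi),\xi)\ge c_1(D_\xi f(x,u,\xi),\xi)-c_2|u|^{p^*}-b_1(x),$$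 $$(a(x,u,\xi),\xi)\le c_3(D_\xi f(x,u,\xi),\xi)+c_4|u|^{p^*}+b_2(x).$$ Let $b=b(x,u,\xi):\Omega\times\mathbb{R}\times\mathbb{R}^n\to\mathbb{R}$ be a Carathéodory function satisfying, for a.e. $x\in\Omega$ and every $(u,\xi)\in\mathbb{R}\times\mathbb{R}^n$, either (A) the pair of inequalities $$\operatorname{sign}(u)\,b(x,u,\xi)\ge -c_7\big(f(x,u,\xi)^{1-\frac1{p^*}}+|\xi|^{p(1-\frac1{p^*})}+|u|^{p^*-1}\big)-b_3(x),$$ $$u\,b(x,u,\xi)\le c_8\big(f(x,u,\xi)+|u|^{p^*}\big)+b_4(x)$$ for some positive constants $c_7,c_8$ and nonnegative functions $b_3\in L^{\frac np+\varepsilon}(\Omega)$ for some $\varepsilon>0$ and $b_4\in L^1(\Omega)$, or (B) the inequality $$|b(x,u,\xi)|\le c_9\big(f(x,u,\xi)^{1-\frac1{p^*}}+|u|^{p^*-1}\big)+b_3(x)$$ for some constant $c_9\ge0$ and a nonnegative function $b_3\in L^{\frac np+\varepsilon}(\Omega)$ for some $\varepsilon>0$. Let $u_0\in L^\infty(\Omega)\cap W^{1,F}(\Omega)$ and let $u\in W^{1,F}(\Omega)$, $u\in u_0+W^{1,F}_0(\Omega)$, be a weak solution to the Dirichlet problem $$\sum_{i=1}^n\frac{\partial}{\partial x_i}a^i(x,u,Du)=b(x,u,Du)\ \text{ in }\Omega,\qquad u=u_0\ \text{ on }\partial\Omega.$$ Then $u$ is globally bounded, i.e. $u\in L^\inf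ty(\Omega)$.
   Context: $(\cdot,\cdot)$ is the scalar product in $\mathbb{R}^n$. A Carathéodory map on $\Omega\times\mathbb{R}\times\mathbb{R}^n$ is measurable in $x\in\Omega$ and continuous in $(u,\xi)\in\mathbb{R}\times\mathbb{R}^n$. $D_\xi f=(f_{\xi_1},\dots,f_{\xi_n})$ is the gradient of $f$ in $\xi$. Sobolev exponent: $p^*=\frac{np}{n-p}$ if $p<n$; if $p\ge n$, $p^*$ is an arbitrarily fixed real number greater than $p$. (For $p<n$ one has $p(1-\frac1{p^*})=p+\frac pn-1$.) Finite-energy class: $W^{1,F}(\Omega):=\{u\in W^{1,1}(\Omega): F(u):=\int_\Omega f(x,u,Du)\,dx<+\infty\}$ and $W^{1,F}_0(\Omega):=W^{1,F}(\Omega)\cap W^{1,p}_0(\Omega)$. The notation $u\in u_0+W_0^{1,F}(\Omega)$ means $u-u_0\in W_0^{1,F}(\Omega)$. Weak solution: $u$ is a weak solution of the Dirichlet problem if $$\int_\Omega\Big\{\sum_{i=1}^n a^i(x,u,Du)\varphi_{x_i}+b(x,u,Du)\varphi\Big\}dx=0\qquad\forall\,\varphi\in W^{1,F}_0(\Omega).$$ *)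

theory Defs
  imports "HOL-Analysis.Analysis"
begin

text \<open>Functions on \<open>\<Omega>\<close> are total functions on \<open>real ^ 'n\<close> of which only the values on \<open>\<Omega>\<close> matter;
  almost-everywhere equal functions are not identified. ``Measurable'' and ``almost every'' refer to
  Lebesgue measure on \<open>\<Omega>\<close>, i.e. to \<open>lebesgue_on \<Omega>\<close>.\<close>

section \<open>Lebesgue spaces\<close>

definition Lp :: "real \<Rightarrow> (real ^ 'n) set \<Rightarrow> (real ^ 'n \<Rightarrow> 'b::euclidean_space) set" where
  "Lp s \<Omega> = {g \<in> borel_measurable (lebesgue_on \<Omega>).
     integrable (lebesgue_on \<Omega>) (\<lambda>x. norm (g x) powr s)}"

definition Linf :: "(real ^ 'n) set \<Rightarrow> (real ^ 'n \<Rightarrow> 'b::euclidean_space) set" where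
  "Linf \<Omega> = {g \<in> borel_measurable (lebesgue_on \<Omega>). \<exists>C. AE x in lebesgue_on \<Omega>. norm (g x) \<le> C}"

definition L1_loc :: "(real ^ 'n) set \<Rightarrow> (real ^ 'n \<Rightarrow> 'b::euclidean_space) set" where
  "L1_loc \<Omega> = {g. \<forall>K. compact K \<and> K \<subseteq> \<Omega> \<longrightarrow> integrable (lebesgue_on K) g}"

section \<open>Test functions\<close>

definition partial :: "'n \<Rightarrow> (real ^ 'n \<Rightarrow> real) \<Rightarrow> real ^ 'n \<Rightarrow> real" where
  "partial i \<phi> x = frechet_derivative \<phi> (at x) (axis i 1)"

fun C_diff :: "nat \<Rightarrow> (real ^ 'n \<Rightarrow> real) \<Rightarrow> bool" where
  "C_diff 0 \<phi> \<longleftrightarrow> continuous_on UNIV \<phi>"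
| "C_diff (Suc k) \<phi> \<longleftrightarrow> (\<forall>x. \<phi> differentiable at x) \<and> (\<forall>i. C_diff k (partial i \<phi>))"

text \<open>\<open>C\<^sub>c\<^sup>\<infinity>(\<Omega>)\<close>, its elements being extended by zero to the whole space.\<close>

definition test_functions :: "(real ^ 'n) set \<Rightarrow> (real ^ 'n \<Rightarrow> real) set" where
  "test_functions \<Omega> = {\<phi>. (\<forall>k. C_diff k \<phi>) \<and>
     compact (closure {x. \<phi> x \<noteq> 0}) \<and> closure {x. \<phi> x \<noteq> 0} \<subseteq> \<Omega>}"

section \<open>Sobolev spaces\<close>

definition has_weak_gradient ::
  "(real ^ 'n) set \<Rightarrow> (real ^ 'n \<Rightarrow> real) \<Rightarrow> (real ^ 'n \<Rightarrow> real ^ 'n) \<Rightarrow> bool" where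
  "has_weak_gradient \<Omega> u G \<longleftrightarrow> u \<in> L1_loc \<Omega> \<and> G \<in> L1_loc \<Omega> \<and>
     (\<forall>\<phi>\<in>test_functions \<Omega>. \<forall>i.
        (LINT x|lebesgue_on \<Omega>. u x * partial i \<phi> x) = - (LINT x|lebesgue_on \<Omega>. G x $ i * \<phi> x))"

text \<open>The weak gradient is unique up to a null set only; this is an arbitrary representative.
  It is meaningful only for weakly differentiable \<open>u\<close>.\<close>

definition weak_gradient :: "(real ^ 'n) set \<Rightarrow> (real ^ 'n \<Rightarrow> real) \<Rightarrow> real ^ 'n \<Rightarrow> real ^ 'n" where
  "weak_gradient \<Omega> u = (SOME G. has_weak_gradient \<Omega> u G)"

definition W1 :: "real \<Rightarrow> (real ^ 'n) set \<Rightarrow> (real ^ 'n \<Rightarrow> real) set" where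
  "W1 p \<Omega> = {u \<in> Lp p \<Omega>. \<exists>G \<in> Lp p \<Omega>. has_weak_gradient \<Omega> u G}"

definition W1_norm :: "real \<Rightarrow> (real ^ 'n) set \<Rightarrow> (real ^ 'n \<Rightarrow> real) \<Rightarrow> real" where
  "W1_norm p \<Omega> u = ((LINT x|lebesgue_on \<Omega>. \<bar>u x\<bar> powr p) +
     (LINT x|lebesgue_on \<Omega>. norm (weak_gradient \<Omega> u x) powr p)) powr (1 / p)"

text \<open>The closure of \<open>C\<^sub>c\<^sup>\<infinity>(\<Omega>)\<close> in \<open>W\<^sup>1\<^sup>,\<^sup>p(\<Omega>)\<close>.\<close>

definition W1_0 :: "real \<Rightarrow> (real ^ 'n) set \<Rightarrow> (real ^ 'n \<Rightarrow> real) set" where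
  "W1_0 p \<Omega> = {u \<in> W1 p \<Omega>.
     \<forall>e>0. \<exists>\<phi>\<in>test_functions \<Omega>. W1_norm p \<Omega> (\<lambda>x. u x - \<phi> x) < e}"

text \<open>For \<open>p \<ge> n\<close> the Sobolev exponent is any fixed number greater than \<open>p\<close>, so it is
  a relation rather than a function of \<open>n\<close> and \<open>p\<close>.\<close>

definition sobolev_exponent :: "real \<Rightarrow> real \<Rightarrow> real \<Rightarrow> bool" where
  "sobolev_exponent n p ps \<longleftrightarrow> (if p < n then ps = n * p / (n - p) else ps > p)"

section \<open>Functions of finite energy and weak solutions\<close>

definition caratheodory ::
  "(real ^ 'n) set \<Rightarrow> (real ^ 'n \<Rightarrow> real \<Rightarrow> real ^ 'n \<Rightarrow> 'b::euclidean_space) \<Rightarrow> bool" where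
  "caratheodory \<Omega> g \<longleftrightarrow>
     (\<forall>u \<xi>. (\<lambda>x. g x u \<xi>) \<in> borel_measurable (lebesgue_on \<Omega>)) \<and>
     (AE x in lebesgue_on \<Omega>. continuous_on UNIV (\<lambda>(u, \<xi>). g x u \<xi>))"

text \<open>The energy takes values in \<open>[0, \<infinity>]\<close>; it is used for nonnegative \<open>f\<close> only
  (negative values would be truncated by \<open>ennreal\<close>).\<close>

definition energy :: "(real ^ 'n) set \<Rightarrow> (real ^ 'n \<Rightarrow> real \<Rightarrow> real ^ 'n \<Rightarrow> real) \<Rightarrow>
    (real ^ 'n \<Rightarrow> real) \<Rightarrow> ennreal" where
  "energy \<Omega> f u = (\<integral>\<^sup>+x. ennreal (f x (u x) (weak_gradient \<Omega> u x)) \<partial>lebesgue_on \<Omega>)"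

definition W1F :: "(real ^ 'n) set \<Rightarrow> (real ^ 'n \<Rightarrow> real \<Rightarrow> real ^ 'n \<Rightarrow> real) \<Rightarrow>
    (real ^ 'n \<Rightarrow> real) set" where
  "W1F \<Omega> f = {u \<in> W1 1 \<Omega>. energy \<Omega> f u < \<infinity>}"

definition W1F_0 :: "real \<Rightarrow> (real ^ 'n) set \<Rightarrow> (real ^ 'n \<Rightarrow> real \<Rightarrow> real ^ 'n \<Rightarrow> real) \<Rightarrow>
    (real ^ 'n \<Rightarrow> real) set" where
  "W1F_0 p \<Omega> f = W1F \<Omega> f \<inter> W1_0 p \<Omega>"

text \<open>The growth conditions do not guarantee that the integrand below is summable, and the integral
  of a non-integrable function is \<open>0\<close> in HOL. That the integral exists as a Lebesgue integral is
  therefore made explicit.\<close>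

definition weak_solution ::
  "real \<Rightarrow> (real ^ 'n) set \<Rightarrow> (real ^ 'n \<Rightarrow> real \<Rightarrow> real ^ 'n \<Rightarrow> real) \<Rightarrow>
   (real ^ 'n \<Rightarrow> real \<Rightarrow> real ^ 'n \<Rightarrow> real ^ 'n) \<Rightarrow> (real ^ 'n \<Rightarrow> real \<Rightarrow> real ^ 'n \<Rightarrow> real) \<Rightarrow>
   (real ^ 'n \<Rightarrow> real) \<Rightarrow> (real ^ 'n \<Rightarrow> real) \<Rightarrow> bool" where
  "weak_solution p \<Omega> f a b u0 u \<longleftrightarrow>
     u \<in> W1F \<Omega> f \<and> (\<lambda>x. u x - u0 x) \<in> W1F_0 p \<Omega> f \<and>
     (\<forall>\<phi>\<in>W1F_0 p \<Omega> f.
        has_bochner_integral (lebesgue_on \<Omega>)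
          (\<lambda>x. (\<Sum>i\<in>UNIV. a x (u x) (weak_gradient \<Omega> u x) $ i * weak_gradient \<Omega> \<phi> x $ i)
             + b x (u x) (weak_gradient \<Omega> u x) * \<phi> x) 0)"

end

theory Submission
  imports Defs
begin

text \<open>Let \<open>(t)\<^sub>k = sgn t \<cdot> max 0 (|t| - k)\<close> be the excess over a level \<open>k \<ge> sup |u\<^sub>0|\<close>, and let
  \<open>A\<^sub>k = {|u| > k}\<close>. The boundary values of \<open>|u|\<close> do not exceed \<open>k\<close>, so \<open>(u)\<^sub>k\<close> has zero boundary values;
  its gradient is \<open>Du\<close> on \<open>A\<^sub>k\<close> and \<open>0\<close> elsewhere. It has finite energy: the lower doubling inequality
  at \<open>\<xi> = 0\<close> forces \<open>f x v 0 = 0\<close>, hence by convexity \<open>f x v (t \<xi>) \<le> f x v \<xi>\<close> for \<open>0 \<le> t \<le> 1\<close>, and the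
  monotonicity condition replaces \<open>(u)\<^sub>k\<close> by \<open>u\<close> in the second argument. So \<open>(u)\<^sub>k\<close> may be used as a
  test function. Convexity also yields \<open>D\<^sub>\<xi>f \<cdot> \<xi> \<ge> f \<ge> c\<^sub>5 |\<xi>|^p\<close> (\<open>convex_gradient_ge\<close>). By Young's
  inequality the product of \<open>f^(1 - 1/p^*)\<close> with the test function costs a small part of \<open>f\<close> and a
  multiple of \<open>|u|^p^*\<close> (\<open>structure_absorption\<close>). What remains is, up to constants,
  \<open>\<integral>\<^bsub>A\<^sub>k\<^esub> |Du|^p \<le> \<integral>\<^bsub>A\<^sub>k\<^esub> |u|^p^* + b\<^sub>1 + b\<^sub>3 (|u| - k)\<close>. With the Sobolev inequality
  (\<open>Sobolev_W1_0_powr\<close>) the left-hand side dominates the \<open>p\<close>-th power of the \<open>L\<^sup>q\<close> norm of \<open>(u)\<^sub>k\<close>, where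
  \<open>q = p^*\<close> if \<open>p < n\<close>. If \<open>p = n\<close>, the Sobolev inequality is used with an exponent slightly below \<open>n\<close>,
  which makes \<open>q\<close> as large as needed. In both cases \<open>|u|^p^* \<le> |u|^q\<close> on \<open>A\<^sub>k\<close> once \<open>k \<ge> 1\<close>.

  The passage from this estimate to boundedness is \<open>bounded_if_level_set_estimate\<close>. The term \<open>|u|^q\<close>
  is critical. Up to a constant it is at most \<open>(|u| - k)^q + k^q\<close>. The integral of the first part over
  \<open>A\<^sub>k\<close> is \<open>\<parallel>(u)\<^sub>k\<parallel>^(q - p) \<cdot> \<parallel>(u)\<^sub>k\<parallel>^p\<close> and is absorbed for large \<open>k\<close>, since \<open>\<parallel>(u)\<^sub>k\<parallel> \<longrightarrow> 0\<close> for \<open>u \<in> L\<^sup>q\<close>. The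
  second part leaves \<open>k^q |A\<^sub>k|\<close>, which also tends to \<open>0\<close>, and by Hoelder's inequality \<open>b\<^sub>1\<close> and \<open>b\<^sub>3\<close> leave
  \<open>|A\<^sub>k|^\<sigma>\<close>, apart from another term that is absorbed; the integrability assumed for them is what makes \<open>\<sigma> > p/q\<close>. This is a superlinear
  recursion for \<open>|A\<^sub>k|\<close>, to which De Giorgi's iteration applies on the levels \<open>K (2 - 2^-j)\<close> with \<open>K\<close>
  large (\<open>De_Giorgi_vanishing\<close>). If \<open>p > n\<close>, the recursion follows from the Sobolev inequality and
  Hoelder's inequality for \<open>Du \<in> L\<^sup>p\<close>.

  Since the chain rule \<open>weak_gradient_chain_rule\<close> is proved for continuously differentiable functions,
  the excess is replaced by the \<open>C\<^sup>1\<close> function \<open>soft_excess \<delta> k\<close>, and \<open>\<delta>\<close> tends to \<open>0\<close> only in the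
  integrated estimate. That the truncations have zero boundary values is \<open>truncation_W1_0\<close>. The chain
  rule, the uniqueness of weak gradients and the density of test functions rest on mollification
  (\<open>conv_mollifier_Lp\<close>), the Sobolev inequality on \<open>Gagliardo_Nirenberg\<close>.\<close>

section \<open>Smooth functions with compact support\<close>

text \<open>The derivative of \<open>exp (-1/t) / t^j\<close> is a linear combination of functions of the same
  form, so this family produces smooth functions without any discussion of higher derivatives.\<close>

definition flat :: "nat \<Rightarrow> real \<Rightarrow> real" where
  "flat j t = (if t \<le> 0 then 0 else exp (- 1 / t) / t ^ j)"

lemma flat_nonneg: "0 \<le> flat j t"
  by (simp add: flat_def)

lemma flat_tendsto_0: "(flat j \<longlongrightarrow> 0) (at 0)"
proof -
  have 1: "((\<lambda>x::real. x ^ j / exp x) \<longlongrightarrow> 0) at_top"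
    by (rule tendsto_power_div_exp_0)
  have "((\<lambda>t::real. inverse t ^ j / exp (inverse t)) \<longlongrightarrow> 0) (at_right 0)"
    by (rule filterlim_compose[OF 1 filterlim_inverse_at_top_right])
  moreover have "eventually (\<lambda>t. inverse t ^ j / exp (inverse t) = flat j t) (at_right 0)"
    by (rule eventually_at_right_less[THEN eventually_mono])
      (auto simp: flat_def exp_minus field_simps)
  ultimately have R: "(flat j \<longlongrightarrow> 0) (at_right 0)"
    by (rule Lim_transform_eventually)
  have "eventually (\<lambda>t. 0 = flat j t) (at_left 0)"
    by (auto simp: flat_def eventually_at intro!: exI[of _ 1])
  then have L: "(flat j \<longlongrightarrow> 0) (at_left 0)"
    by (rule Lim_transform_eventually[OF tendsto_const])
  show ?thesis using L R by (simp add: filterlim_split_at)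
qed

lemma flat_has_derivative:
  "(flat j has_real_derivative (flat (j + 2) t - real j * flat (j + 1) t)) (at t)"
proof (cases "t = 0")
  case True
  have "((\<lambda>h. (flat j (0 + h) - flat j 0) / h) \<longlongrightarrow> 0) (at 0)"
  proof (rule Lim_transform_eventually[OF flat_tendsto_0[of "Suc j"]])
    show "eventually (\<lambda>h. flat (Suc j) h = (flat j (0 + h) - flat j 0) / h) (at 0)"
      by (auto simp: flat_def eventually_at intro!: exI[of _ 1])
  qed
  then show ?thesis using True by (simp add: DERIV_def flat_def)
next
  case False
  show ?thesis
  proof (cases "t > 0")
    case True
    have "((\<lambda>t. exp (- 1 / t) / t ^ j) has_real_derivative
        (exp (- 1 / t) / t ^ (j + 2) - real j * (exp (- 1 / t) / t ^ (j + 1)))) (at t)"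
    proof -
      have e: "((\<lambda>t. exp (- 1 / t)) has_real_derivative exp (- 1 / t) / t\<^sup>2) (at t)"
        using True by (auto intro!: derivative_eq_intros simp: power2_eq_square)
      have q: "((\<lambda>t. t ^ j) has_real_derivative real j * t ^ (j - 1)) (at t)"
        by (auto intro!: derivative_eq_intros)
      have "((\<lambda>t. exp (- 1 / t) / t ^ j) has_real_derivative
        (exp (- 1 / t) / t\<^sup>2 * t ^ j - exp (- 1 / t) * (real j * t ^ (j - 1))) / (t ^ j * t ^ j)) (at t)"
        by (rule DERIV_divide[OF e q]) (use True in simp)
      moreover have "(exp (- 1 / t) / t\<^sup>2 * t ^ j - exp (- 1 / t) * (real j * t ^ (j - 1))) / (t ^ j * t ^ j)
        = exp (- 1 / t) / t ^ (j + 2) - real j * (exp (- 1 / t) / t ^ (j + 1))"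
        using True by (cases j) (simp_all add: field_simps power2_eq_square)
      ultimately show ?thesis by simp
    qed
    moreover have "eventually (\<lambda>x. x > 0) (nhds t)"
      using eventually_nhds_in_open[of "{0<..}" t] True by simp
    then have "eventually (\<lambda>x. flat j x = exp (- 1 / x) / x ^ j) (nhds t)"
      by (rule eventually_mono) (auto simp: flat_def)
    ultimately show ?thesis
      using True by (subst DERIV_cong_ev[OF refl _ refl]) (auto simp: flat_def)
  next
    case f: False
    have "eventually (\<lambda>x. x < 0) (nhds t)"
      using eventually_nhds_in_open[of "{..<0}" t] f False by simp
    then have "eventually (\<lambda>x. flat j x = 0) (nhds t)"
      by (rule eventually_mono) (auto simp: flat_def)
    then show ?thesis using f
      by (subst DERIV_cong_ev[OF refl _ refl]) (auto simp: flat_def)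
  qed
qed

text \<open>Closed under partial derivatives by the sum, product and chain rules, so all its elements are
  smooth; it contains the standard bump function.\<close>

inductive flat_algebra :: "(real ^ 'n \<Rightarrow> real) \<Rightarrow> bool" where
  const: "flat_algebra (\<lambda>x. c)"
| coord: "flat_algebra (\<lambda>x. x $ i)"
| add: "flat_algebra \<phi> \<Longrightarrow> flat_algebra \<psi> \<Longrightarrow> flat_algebra (\<lambda>x. \<phi> x + \<psi> x)"
| mult: "flat_algebra \<phi> \<Longrightarrow> flat_algebra \<psi> \<Longrightarrow> flat_algebra (\<lambda>x. \<phi> x * \<psi> x)"
| comp: "flat_algebra \<phi> \<Longrightarrow> flat_algebra (\<lambda>x. flat j (\<phi> x))"

lemma flat_algebra_sum: "finite I \<Longrightarrow> (\<And>i. i \<in> I \<Longrightarrow> flat_algebra (\<phi> i)) \<Longrightarrow> flat_algebra (\<lambda>x. \<Sum>i\<in>I. \<phi> i x)"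
  by (induction I rule: finite_induct) (auto intro: flat_algebra.intros)

lemma flat_algebra_derivative:
  "flat_algebra (\<phi> :: real ^ 'n \<Rightarrow> real) \<Longrightarrow> \<exists>D. (\<forall>i. flat_algebra (D i)) \<and>
     (\<forall>x. (\<phi> has_derivative (\<lambda>h. \<Sum>i\<in>UNIV. h $ i * D i x)) (at x))"
proof (induction rule: flat_algebra.induct)
  case (const c)
  show ?case by (rule exI[of _ "\<lambda>i x. 0"]) (auto intro: flat_algebra.intros)
next
  case (coord k)
  have "(\<lambda>h::real^'n. \<Sum>i\<in>UNIV. h $ i * (if i = k then 1 else 0)) = (\<lambda>h. h $ k)"
    by (simp add: sum.delta if_distrib cong: if_cong)
  moreover have "((\<lambda>x::real^'n. x $ k) has_derivative (\<lambda>h. h $ k)) (at x)" for x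
    by (rule bounded_linear_imp_has_derivative[OF bounded_linear_vec_nth])
  ultimately show ?case
    by (intro exI[of _ "\<lambda>i x. if i = k then 1 else 0"])
      (auto intro: flat_algebra.const)
next
  case (add \<phi> \<psi>)
  then obtain D E where D: "\<forall>i. flat_algebra (D i)" "\<And>x. (\<phi> has_derivative (\<lambda>h. \<Sum>i\<in>UNIV. h $ i * D i x)) (at x)"
    and E: "\<forall>i. flat_algebra (E i)" "\<And>x. (\<psi> has_derivative (\<lambda>h. \<Sum>i\<in>UNIV. h $ i * E i x)) (at x)"
    by blast
  show ?case
  proof (intro exI[of _ "\<lambda>i x. D i x + E i x"] conjI allI)
    fix x show "((\<lambda>x. \<phi> x + \<psi> x) has_derivative (\<lambda>h. \<Sum>i\<in>UNIV. h $ i * (D i x + E i x))) (at x)"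
      using has_derivative_add[OF D(2)[of x] E(2)[of x]]
      by (simp add: sum.distrib algebra_simps)
  qed (use D E in \<open>auto intro: flat_algebra.add\<close>)
next
  case (mult \<phi> \<psi>)
  then obtain D E where D: "\<forall>i. flat_algebra (D i)" "\<And>x. (\<phi> has_derivative (\<lambda>h. \<Sum>i\<in>UNIV. h $ i * D i x)) (at x)"
    and E: "\<forall>i. flat_algebra (E i)" "\<And>x. (\<psi> has_derivative (\<lambda>h. \<Sum>i\<in>UNIV. h $ i * E i x)) (at x)"
    by blast
  show ?case
  proof (intro exI[of _ "\<lambda>i x. \<phi> x * E i x + D i x * \<psi> x"] conjI allI)
    fix x show "((\<lambda>x. \<phi> x * \<psi> x) has_derivative (\<lambda>h. \<Sum>i\<in>UNIV. h $ i * (\<phi> x * E i x + D i x * \<psi> x))) (at x)"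
      using has_derivative_mult[OF D(2)[of x] E(2)[of x]]
      by (simp add: sum.distrib sum_distrib_left sum_distrib_right algebra_simps)
  next
    fix i show "flat_algebra (\<lambda>x. \<phi> x * E i x + D i x * \<psi> x)"
      using D(1) E(1) mult.hyps by (intro flat_algebra.add flat_algebra.mult) auto
  qed
next
  case (comp \<phi> j)
  then obtain D where D: "\<forall>i. flat_algebra (D i)" "\<And>x. (\<phi> has_derivative (\<lambda>h. \<Sum>i\<in>UNIV. h $ i * D i x)) (at x)"
    by blast
  let ?f = "\<lambda>x. flat (j + 2) (\<phi> x) + (- real j) * flat (j + 1) (\<phi> x)"
  show ?case
  proof (intro exI[of _ "\<lambda>i x. ?f x * D i x"] conjI allI)
    fix x show "((\<lambda>x. flat j (\<phi> x)) has_derivative (\<lambda>h. \<Sum>i\<in>UNIV. h $ i * (?f x * D i x))) (at x)"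
      using has_derivative_compose[OF D(2)[of x] flat_has_derivative[of j "\<phi> x", unfolded has_field_derivative_def]]
      by (simp add: sum_distrib_left algebra_simps sum_subtractf)
  qed (use D comp in \<open>intro flat_algebra.add flat_algebra.mult flat_algebra.const flat_algebra.comp; auto\<close>)+
qed

lemma partial_eqI:
  assumes "(\<phi> has_derivative (\<lambda>h. \<Sum>i\<in>UNIV. h $ i * D i)) (at x)"
  shows "partial k \<phi> x = D k"
proof -
  have "frechet_derivative \<phi> (at x) = (\<lambda>h. \<Sum>i\<in>UNIV. h $ i * D i)"
    using frechet_derivative_at[OF assms] by simp
  then show ?thesis
    by (simp add: partial_def axis_def if_distrib if_distribR sum.delta cong: if_cong)
qed

lemma flat_algebra_C_diff: "flat_algebra \<phi> \<Longrightarrow> C_diff k \<phi>"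
proof (induction k arbitrary: \<phi>)
  case 0
  obtain D where "\<And>x. (\<phi> has_derivative (\<lambda>h. \<Sum>i\<in>UNIV. h $ i * D i x)) (at x)"
    using flat_algebra_derivative[OF 0] by blast
  then show ?case
    by (auto intro!: continuous_at_imp_continuous_on has_derivative_continuous)
next
  case (Suc k)
  obtain D where D: "\<forall>i. flat_algebra (D i)" "\<And>x. (\<phi> has_derivative (\<lambda>h. \<Sum>i\<in>UNIV. h $ i * D i x)) (at x)"
    using flat_algebra_derivative[OF Suc.prems] by blast
  have "partial i \<phi> = D i" for i
    using partial_eqI[OF D(2)] by auto
  then show ?case using D Suc.IH by (auto simp: differentiable_def)
qed

lemma C_diff_has_derivative:
  assumes "C_diff (Suc k) \<phi>"
  shows "(\<phi> has_derivative (\<lambda>h. \<Sum>i\<in>UNIV. h $ i * partial i \<phi> x)) (at x)"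
proof -
  have d: "(\<phi> has_derivative frechet_derivative \<phi> (at x)) (at x)"
    using assms by (simp add: frechet_derivative_works)
  then interpret bounded_linear "frechet_derivative \<phi> (at x)"
    by (rule has_derivative_bounded_linear)
  have "frechet_derivative \<phi> (at x) h = (\<Sum>i\<in>UNIV. h $ i * partial i \<phi> x)" for h
  proof -
    have "h = (\<Sum>i\<in>UNIV. h $ i *\<^sub>R axis i 1)"
      using basis_expansion[of h] by (simp add: scalar_mult_eq_scaleR)
    then have "frechet_derivative \<phi> (at x) h = frechet_derivative \<phi> (at x) (\<Sum>i\<in>UNIV. h $ i *\<^sub>R axis i 1)"
      by simp
    also have "\<dots> = (\<Sum>i\<in>UNIV. h $ i * partial i \<phi> x)"
      by (simp add: sum scaleR partial_def)
    finally show ?thesis .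
  qed
  then have "frechet_derivative \<phi> (at x) = (\<lambda>h. \<Sum>i\<in>UNIV. h $ i * partial i \<phi> x)" ..
  with d show ?thesis by simp
qed

lemma test_function_has_derivative:
  "\<phi> \<in> test_functions \<Omega> \<Longrightarrow> (\<phi> has_derivative (\<lambda>h. \<Sum>i\<in>UNIV. h $ i * partial i \<phi> x)) (at x)"
  by (rule C_diff_has_derivative[of 0]) (simp add: test_functions_def del: C_diff.simps)

lemma test_function_continuous: "\<phi> \<in> test_functions \<Omega> \<Longrightarrow> continuous_on S \<phi>"
  by (auto intro!: continuous_at_imp_continuous_on has_derivative_continuous test_function_has_derivative)

lemma test_function_borel [measurable_dest]: "\<phi> \<in> test_functions \<Omega> \<Longrightarrow> \<phi> \<in> borel_measurable borel"
  by (rule borel_measurable_continuous_onI[OF test_function_continuous])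

lemma test_function_mono: "\<phi> \<in> test_functions \<Omega> \<Longrightarrow> \<Omega> \<subseteq> \<Omega>' \<Longrightarrow> \<phi> \<in> test_functions \<Omega>'"
  by (auto simp: test_functions_def)

lemma partial_zero_outside:
  assumes "\<phi> \<in> test_functions \<Omega>" "x \<notin> closure {x. \<phi> x \<noteq> 0}"
  shows "partial i \<phi> x = 0"
proof -
  have "eventually (\<lambda>y. y \<in> - closure {x. \<phi> x \<noteq> 0}) (nhds x)"
    using assms by (intro eventually_nhds_in_open) auto
  then have ev: "eventually (\<lambda>y. 0 = \<phi> y) (nhds x)"
    by (rule eventually_mono) (use closure_subset[of "{x. \<phi> x \<noteq> 0}"] in auto)
  have "((\<lambda>x. 0) has_derivative (\<lambda>h. \<Sum>i\<in>UNIV. h $ i * (0::real))) (at x)" by simp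
  moreover have "\<phi> x = 0" using assms(2) closure_subset[of "{x. \<phi> x \<noteq> 0}"] by auto
  moreover have "\<forall>\<^sub>F y in at x. 0 = \<phi> y"
    using ev unfolding eventually_nhds_conv_at by (rule conjunct1)
  ultimately have "(\<phi> has_derivative (\<lambda>h. \<Sum>i\<in>UNIV. h $ i * (0::real))) (at x)"
    using has_derivative_transform_eventually[of "\<lambda>x. 0::real" "\<lambda>h. \<Sum>i\<in>UNIV. h $ i * (0::real)" x UNIV \<phi>]
    by simp
  from partial_eqI[OF this, of i] show ?thesis .
qed

lemma partial_test_function:
  assumes "\<phi> \<in> test_functions \<Omega>"
  shows "partial i \<phi> \<in> test_functions \<Omega>"
proof -
  have 1: "\<forall>k. C_diff k (partial i \<phi>)"
  proof
    fix k have "C_diff (Suc k) \<phi>" using assms by (simp add: test_functions_def del: C_diff.simps)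
    then show "C_diff k (partial i \<phi>)" by simp
  qed
  have "{x. partial i \<phi> x \<noteq> 0} \<subseteq> closure {x. \<phi> x \<noteq> 0}"
    using partial_zero_outside[OF assms] by blast
  then have 2: "closure {x. partial i \<phi> x \<noteq> 0} \<subseteq> closure {x. \<phi> x \<noteq> 0}"
    by (simp add: closure_minimal)
  have "compact (closure {x. \<phi> x \<noteq> 0})" "closure {x. \<phi> x \<noteq> 0} \<subseteq> \<Omega>"
    using assms by (auto simp: test_functions_def)
  with 2 have "compact (closure {x. partial i \<phi> x \<noteq> 0})" "closure {x. partial i \<phi> x \<noteq> 0} \<subseteq> \<Omega>"
    by (metis closed_closure compact_Int_closed inf.absorb_iff2) (use 2 \<open>closure {x. \<phi> x \<noteq> 0} \<subseteq> \<Omega>\<close> in blast)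
  with 1 show ?thesis by (simp add: test_functions_def)
qed

lemma test_function_bounded:
  assumes "\<phi> \<in> test_functions \<Omega>"
  obtains B where "B > 0" "\<And>x. \<bar>\<phi> x\<bar> \<le> B"
proof -
  have c: "compact (closure {x. \<phi> x \<noteq> 0})" using assms by (simp add: test_functions_def)
  have "compact (\<phi> ` closure {x. \<phi> x \<noteq> 0})"
    using c test_function_continuous[OF assms] by (rule compact_continuous_image[rotated])
  then obtain B where B: "B > 0" "\<And>x. x \<in> closure {x. \<phi> x \<noteq> 0} \<Longrightarrow> \<bar>\<phi> x\<bar> \<le> B"
    by (auto dest!: compact_imp_bounded simp: bounded_pos)
  have "\<bar>\<phi> x\<bar> \<le> B" for x
    using B closure_subset[of "{x. \<phi> x \<noteq> 0}"] by (cases "\<phi> x = 0") auto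
  with B(1) that show ?thesis by blast
qed

lemma continuous_compact_support_integrable:
  fixes F :: "real ^ 'n \<Rightarrow> real"
  assumes F: "continuous_on UNIV F" and S: "compact S" "\<And>x. x \<notin> S \<Longrightarrow> F x = 0"
  shows "integrable lborel F"
proof -
  have "integrable lborel (\<lambda>x. indicator S x *\<^sub>R F x)"
    by (rule borel_integrable_compact[OF S(1) continuous_on_subset[OF F]]) simp
  also have "(\<lambda>x. indicator S x *\<^sub>R F x) = F" using S by (auto simp: indicator_def fun_eq_iff)
  finally show ?thesis .
qed

lemma test_function_integrable:
  assumes "\<phi> \<in> test_functions \<Omega>"
  shows "integrable lborel \<phi>"
proof (rule continuous_compact_support_integrable[OF test_function_continuous[OF assms]])
  show "compact (closure {x. \<phi> x \<noteq> 0})" using assms by (simp add: test_functions_def)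
  show "\<phi> x = 0" if "x \<notin> closure {x. \<phi> x \<noteq> 0}" for x
    using that closure_subset[of "{x. \<phi> x \<noteq> 0}"] by auto
qed

lemma sum_components_le:
  fixes h :: "real ^ 'n"
  shows "\<bar>\<Sum>i\<in>UNIV. h $ i * D i\<bar> \<le> norm h * (\<Sum>i\<in>UNIV. \<bar>D i\<bar>)"
proof -
  have "\<bar>\<Sum>i\<in>UNIV. h $ i * D i\<bar> \<le> (\<Sum>i\<in>UNIV. \<bar>h $ i\<bar> * \<bar>D i\<bar>)"
    by (rule order_trans[OF sum_abs]) (simp add: abs_mult)
  also have "\<dots> \<le> (\<Sum>i\<in>UNIV. norm h * \<bar>D i\<bar>)"
    by (intro sum_mono mult_right_mono component_le_norm_cart) auto
  finally show ?thesis by (simp add: sum_distrib_left)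
qed

lemma Lipschitz_if_bounded_partials:
  fixes F :: "real ^ 'n \<Rightarrow> real"
  assumes F: "\<And>x. (F has_derivative (\<lambda>h. \<Sum>i\<in>UNIV. h $ i * D i x)) (at x)" and B: "\<And>i x. \<bar>D i x\<bar> \<le> B i"
  shows "\<bar>F x - F y\<bar> \<le> (\<Sum>i\<in>UNIV. B i) * norm (x - y)"
proof -
  have "norm (F x - F y) \<le> (\<Sum>i\<in>UNIV. B i) * norm (x - y)"
  proof (rule differentiable_bound[of UNIV F "\<lambda>x h. \<Sum>i\<in>UNIV. h $ i * D i x"])
    show "onorm (\<lambda>h::real^'n. \<Sum>i\<in>UNIV. h $ i * D i x) \<le> (\<Sum>i\<in>UNIV. B i)" for x
    proof (rule onorm_le)
      fix h :: "real^'n"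
      have "\<bar>\<Sum>i\<in>UNIV. h $ i * D i x\<bar> \<le> norm h * (\<Sum>i\<in>UNIV. \<bar>D i x\<bar>)"
        by (rule sum_components_le)
      also have "\<dots> \<le> norm h * (\<Sum>i\<in>UNIV. B i)"
        by (intro mult_left_mono sum_mono B) auto
      finally show "norm (\<Sum>i\<in>UNIV. h $ i * D i x) \<le> (\<Sum>i\<in>UNIV. B i) * norm h"
        by (simp add: mult.commute)
    qed
  qed (use F in auto)
  then show ?thesis by simp
qed

lemma test_function_Lipschitz:
  fixes \<phi> :: "real ^ 'n \<Rightarrow> real"
  assumes "\<phi> \<in> test_functions \<Omega>"
  obtains L where "L > 0" "\<And>x y. \<bar>\<phi> x - \<phi> y\<bar> \<le> L * norm (x - y)"
proof -
  have "\<exists>B. B > 0 \<and> (\<forall>x. \<bar>partial i \<phi> x\<bar> \<le> B)" for i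
    using test_function_bounded[OF partial_test_function[OF assms]] by metis
  then obtain B where B: "\<And>i. B i > 0" "\<And>i x. \<bar>partial i \<phi> x\<bar> \<le> B i" by metis
  have "(\<Sum>i\<in>UNIV. B i) > 0" using B(1) by (intro sum_pos) auto
  then show ?thesis
    using that Lipschitz_if_bounded_partials[OF test_function_has_derivative[OF assms] B(2)] by blast
qed

text \<open>The partial derivatives are test functions themselves, hence Lipschitz continuous; the mean value
  inequality for \<open>\<phi>\<close> minus its linearisation at \<open>x\<close> then gives the square of \<open>norm h\<close>, uniformly in \<open>x\<close>.\<close>

lemma test_function_Taylor:
  fixes \<phi> :: "real ^ 'n \<Rightarrow> real"
  assumes "\<phi> \<in> test_functions \<Omega>"
  obtains L where "L > 0"
    "\<And>x h. \<bar>\<phi> (x + h) - \<phi> x - (\<Sum>i\<in>UNIV. h $ i * partial i \<phi> x)\<bar> \<le> L * (norm h)\<^sup>2"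
proof -
  have "\<exists>L. L > 0 \<and> (\<forall>x y. \<bar>partial i \<phi> x - partial i \<phi> y\<bar> \<le> L * norm (x - y))" for i
    using test_function_Lipschitz[OF partial_test_function[OF assms]] by metis
  then obtain L where L: "\<And>i. L i > 0" "\<And>i x y. \<bar>partial i \<phi> x - partial i \<phi> y\<bar> \<le> L i * norm (x - y)" by metis
  have "\<bar>\<phi> (x + h) - \<phi> x - (\<Sum>i\<in>UNIV. h $ i * partial i \<phi> x)\<bar> \<le> (\<Sum>i\<in>UNIV. L i) * (norm h)\<^sup>2" for x h
  proof -
    define f' where "f' = (\<lambda>x (h::real^'n). \<Sum>i\<in>UNIV. h $ i * partial i \<phi> x)"
    have "norm (\<phi> (x+h) - \<phi> x - f' x (x + h - x)) \<le> norm (x + h - x) * ((\<Sum>i\<in>UNIV. L i) * norm h)"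
    proof (rule differentiable_bound_linearization[of x "x + h" "cball x (norm h)" \<phi> f' x])
      show "x + t *\<^sub>R (x + h - x) \<in> cball x (norm h)" if "t \<in> {0..1}" for t
        using that by (auto simp: dist_norm mult_left_le_one_le)
      show "(\<phi> has_derivative f' y) (at y within cball x (norm h))" for y
        unfolding f'_def by (rule has_derivative_at_withinI[OF test_function_has_derivative[OF assms]])
      show "onorm (f' y - f' x) \<le> (\<Sum>i\<in>UNIV. L i) * norm h" if y: "y \<in> cball x (norm h)" for y
      proof (rule onorm_le)
        fix v :: "real^'n"
        have "norm ((f' y - f' x) v) = \<bar>\<Sum>i\<in>UNIV. v $ i * (partial i \<phi> y - partial i \<phi> x)\<bar>"
          by (simp add: f'_def sum_subtractf right_diff_distrib)
        also have "\<dots> \<le> norm v * (\<Sum>i\<in>UNIV. \<bar>partial i \<phi> y - partial i \<phi> x\<bar>)"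
          by (rule sum_components_le)
        also have "\<dots> \<le> norm v * (\<Sum>i\<in>UNIV. L i * norm h)"
        proof (intro mult_left_mono sum_mono)
          fix i
          have "\<bar>partial i \<phi> y - partial i \<phi> x\<bar> \<le> L i * norm (y - x)" by (rule L)
          also have "\<dots> \<le> L i * norm h"
            using y L(1)[of i] by (intro mult_left_mono) (auto simp: dist_norm norm_minus_commute)
          finally show "\<bar>partial i \<phi> y - partial i \<phi> x\<bar> \<le> L i * norm h" .
        qed auto
        finally show "norm ((f' y - f' x) v) \<le> (\<Sum>i\<in>UNIV. L i) * norm h * norm v"
          by (simp add: sum_distrib_right sum_distrib_left mult_ac)
      qed
    qed auto
    then show ?thesis by (simp add: f'_def power2_eq_square mult_ac)
  qed
  moreover have "(\<Sum>i\<in>UNIV. L i) > 0" using L(1) by (intro sum_pos) auto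
  ultimately show ?thesis using that by blast
qed

section \<open>Mollification\<close>

definition bump :: "real \<Rightarrow> real ^ 'n \<Rightarrow> real" where
  "bump r x = flat 0 (r\<^sup>2 - x \<bullet> x)"

lemma flat_algebra_bump_shift:
  "flat_algebra (\<lambda>y :: real ^ 'n. bump r (x - y))"
proof -
  have "flat_algebra (\<lambda>y::real^'n. x $ i + (- 1) * y $ i)" for i
    by (rule flat_algebra.add[OF flat_algebra.const flat_algebra.mult[OF flat_algebra.const flat_algebra.coord]])
  then have "flat_algebra (\<lambda>y::real^'n. \<Sum>i\<in>UNIV. (x $ i + (- 1) * y $ i) * (x $ i + (- 1) * y $ i))"
    by (intro flat_algebra_sum flat_algebra.mult) auto
  from flat_algebra.comp[OF flat_algebra.add[OF flat_algebra.const flat_algebra.mult[OF flat_algebra.const this]], of 0 "r\<^sup>2" "- 1"]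
  show ?thesis by (simp add: bump_def[abs_def] inner_vec_def)
qed

lemma bump_nonzero_iff: "r > 0 \<Longrightarrow> bump r x \<noteq> 0 \<longleftrightarrow> norm x < r"
proof -
  assume "r > 0"
  have "(r\<^sup>2 - x \<bullet> x \<le> 0) \<longleftrightarrow> \<not> norm x < r"
    using \<open>r > 0\<close> by (simp add: power2_norm_eq_inner[symmetric] not_less power_mono_iff)
  then show ?thesis by (simp add: bump_def flat_def)
qed

definition mollifier :: "real \<Rightarrow> real ^ 'n \<Rightarrow> real" where
  "mollifier r x = bump r x / (LINT y|lborel. bump r (y :: real ^ 'n))"

lemma bump_shift_test_function:
  assumes "r > 0" "cball x r \<subseteq> \<Omega>"
  shows "(\<lambda>y. bump r (x - y)) \<in> test_functions \<Omega>"
proof -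
  have "{y. bump r (x - y) \<noteq> 0} = ball x r"
    by (simp add: bump_nonzero_iff[OF assms(1)] set_eq_iff dist_norm)
  then have "closure {y. bump r (x - y) \<noteq> 0} = cball x r"
    using assms(1) by simp
  then show ?thesis
    unfolding test_functions_def using assms(2) flat_algebra_C_diff[OF flat_algebra_bump_shift]
    by (intro CollectI conjI allI) (simp_all only: compact_cball)
qed

lemma bump_minus: "bump r (- x) = bump r x"
  by (simp add: bump_def)

lemma bump_test_function: "r > 0 \<Longrightarrow> bump r \<in> test_functions UNIV"
  using bump_shift_test_function[of r 0 UNIV] by (simp add: bump_minus)

lemma bump_integral_pos:
  assumes "r > 0" shows "(LINT y|lborel. bump r (y :: real ^ 'n)) > 0"
proof -
  let ?b = "bump r :: real ^ 'n \<Rightarrow> real"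
  have b: "?b \<in> test_functions UNIV" by (rule bump_test_function[OF assms])
  have i: "integrable lborel ?b" by (rule test_function_integrable[OF b])
  have "(LINT y|lborel. ?b y) \<noteq> 0"
  proof
    assume "(LINT y|lborel. ?b y) = 0"
    then have "AE x in lborel. ?b x = 0"
      by (subst (asm) integral_nonneg_eq_0_iff_AE[OF i]) (auto simp: bump_def flat_nonneg)
    then have "AE x in lborel. x \<notin> ball (0::real^'n) r"
      by (rule eventually_mono) (simp add: bump_nonzero_iff[OF assms, symmetric])
    then have "emeasure lborel (ball (0::real^'n) r) = 0"
      using AE_iff_measurable[of "ball (0::real^'n) r" lborel "\<lambda>x. x \<notin> ball 0 r"]
      by (auto simp: ball_def)
    then have "ball (0::real^'n) r = {}"
      using emeasure_lborel_cbox_eq content_ball_pos[OF assms, of "0::real^'n"]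
      by (simp add: measure_def)
    then show False using assms by simp
  qed
  moreover have "(LINT y|lborel. ?b y) \<ge> 0"
    by (rule Bochner_Integration.integral_nonneg) (simp add: bump_def flat_nonneg)
  ultimately show ?thesis by linarith
qed

definition conv :: "(real ^ 'n \<Rightarrow> real) \<Rightarrow> (real ^ 'n \<Rightarrow> real) \<Rightarrow> real ^ 'n \<Rightarrow> real" where
  "conv \<phi> g x = (LINT y|lborel. \<phi> (x - y) * g y)"

lemma integrable_mult_bounded:
  fixes g \<phi> :: "'a \<Rightarrow> real"
  assumes "integrable M g" "\<phi> \<in> borel_measurable M" "\<And>x. \<bar>\<phi> x\<bar> \<le> B"
  shows "integrable M (\<lambda>x. \<phi> x * g x)"
proof (rule Bochner_Integration.integrable_bound[of M "\<lambda>x. B * g x"])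
  show "AE x in M. norm (\<phi> x * g x) \<le> norm (B * g x)"
    using assms(3) by (intro AE_I2) (auto simp: abs_mult intro!: mult_mono order_trans[OF assms(3) abs_ge_self])
  show "(\<lambda>x. \<phi> x * g x) \<in> borel_measurable M"
    using assms(2) borel_measurable_integrable[OF assms(1)] by measurable
  show "integrable M (\<lambda>x. B * g x)" using assms(1) by simp
qed

lemma test_function_conv_integrable:
  assumes "\<phi> \<in> test_functions \<Omega>" "integrable lborel g"
  shows "integrable lborel (\<lambda>y. \<phi> (x - y) * g y)"
proof -
  obtain B where "\<And>x. \<bar>\<phi> x\<bar> \<le> B" using test_function_bounded[OF assms(1)] by metis
  with test_function_borel[OF assms(1)] show ?thesis
    by (intro integrable_mult_bounded[OF assms(2), of _ B]) auto
qed

text \<open>The Taylor remainder of \<open>\<phi>\<close> is quadratic uniformly in the base point, so it can be integrated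
  against \<open>g\<close>.\<close>

lemma conv_has_derivative:
  assumes \<phi>: "\<phi> \<in> test_functions \<Omega>" and g: "integrable lborel g"
  shows "(conv \<phi> g has_derivative (\<lambda>h. \<Sum>i\<in>UNIV. h $ i * conv (partial i \<phi>) g x)) (at x)"
proof -
  obtain L where L: "L > 0"
    "\<And>x h. \<bar>\<phi> (x + h) - \<phi> x - (\<Sum>i\<in>UNIV. h $ i * partial i \<phi> x)\<bar> \<le> L * (norm h)\<^sup>2"
    using test_function_Taylor[OF \<phi>] by blast
  note i1 = test_function_conv_integrable[OF \<phi> g]
  note i2 = test_function_conv_integrable[OF partial_test_function[OF \<phi>] g]
  define K where "K = L * (LINT y|lborel. \<bar>g y\<bar>)"
  have est: "\<bar>conv \<phi> g (x + h) - conv \<phi> g x - (\<Sum>i\<in>UNIV. h $ i * conv (partial i \<phi>) g x)\<bar> \<le> K * (norm h)\<^sup>2" for h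
  proof -
    have "conv \<phi> g (x + h) - conv \<phi> g x - (\<Sum>i\<in>UNIV. h $ i * conv (partial i \<phi>) g x)
      = (LINT y|lborel. (\<phi> (x - y + h) - \<phi> (x - y) - (\<Sum>i\<in>UNIV. h $ i * partial i \<phi> (x - y))) * g y)"
      (is "?lhs = ?rhs")
    proof -
      have "?lhs = (LINT y|lborel. \<phi> (x + h - y) * g y) - (LINT y|lborel. \<phi> (x - y) * g y)
          - (LINT y|lborel. (\<Sum>i\<in>UNIV. h $ i * (partial i \<phi> (x - y) * g y)))"
        using i2 by (simp add: conv_def)
      also have "\<dots> = (LINT y|lborel. \<phi> (x + h - y) * g y - \<phi> (x - y) * g y
          - (\<Sum>i\<in>UNIV. h $ i * (partial i \<phi> (x - y) * g y)))"
        using i1 i2 by simp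
      also have "\<dots> = ?rhs"
        by (intro Bochner_Integration.integral_cong refl)
          (simp add: left_diff_distrib sum_distrib_right mult.assoc diff_add_eq)
      finally show ?thesis .
    qed
    also have "\<bar>\<dots>\<bar> \<le> (LINT y|lborel. L * (norm h)\<^sup>2 * \<bar>g y\<bar>)"
    proof (rule integral_abs_bound[THEN order_trans], rule integral_mono)
      have "integrable lborel (\<lambda>y. \<phi> (x + h - y) * g y - \<phi> (x - y) * g y - (\<Sum>i\<in>UNIV. h $ i * (partial i \<phi> (x - y) * g y)))"
        using i1 i2 by (intro Bochner_Integration.integrable_diff Bochner_Integration.integrable_sum integrable_mult_right) auto
      then show "integrable lborel (\<lambda>y. \<bar>(\<phi> (x - y + h) - \<phi> (x - y) - (\<Sum>i\<in>UNIV. h $ i * partial i \<phi> (x - y))) * g y\<bar>)"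
        by (intro integrable_abs) (simp add: left_diff_distrib sum_distrib_right mult.assoc diff_add_eq)
      show "\<bar>(\<phi> (x - y + h) - \<phi> (x - y) - (\<Sum>i\<in>UNIV. h $ i * partial i \<phi> (x - y))) * g y\<bar> \<le> L * (norm h)\<^sup>2 * \<bar>g y\<bar>" for y
        unfolding abs_mult by (intro mult_right_mono L) auto
    qed (use g in auto)
    finally show ?thesis by (simp add: K_def mult_ac)
  qed
  show ?thesis
  proof (rule has_derivativeI_sandwich[of 1])
    show "bounded_linear (\<lambda>h. \<Sum>i\<in>UNIV. h $ i * conv (partial i \<phi>) g x)"
      by (intro bounded_linear_sum bounded_linear_mult_const bounded_linear_vec_nth)
    show "norm (conv \<phi> g y - conv \<phi> g x - (\<Sum>i\<in>UNIV. (y - x) $ i * conv (partial i \<phi>) g x)) / norm (y - x)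
      \<le> K * norm (y - x)" if "y \<noteq> x" for y
      using est[of "y - x"] that by (simp add: divide_le_eq power2_eq_square mult.assoc)
    show "((\<lambda>y. K * norm (y - x)) \<longlongrightarrow> 0) (at x)"
      by (rule tendsto_eq_intros refl | simp)+
  qed auto
qed

lemma partial_conv:
  assumes "\<phi> \<in> test_functions \<Omega>" "integrable lborel g"
  shows "partial i (conv \<phi> g) = conv (partial i \<phi>) g"
  using partial_eqI[OF conv_has_derivative[OF assms]] by auto

lemma C_diff_conv:
  assumes "\<phi> \<in> test_functions \<Omega>" "integrable lborel g"
  shows "C_diff k (conv \<phi> g)"
  using assms(1)
proof (induction k arbitrary: \<phi>)
  case 0
  then show ?case
    by (auto intro!: continuous_at_imp_continuous_on has_derivative_continuous conv_has_derivative assms(2))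
next
  case (Suc k)
  then show ?case
    using conv_has_derivative[OF Suc.prems assms(2)] Suc.IH[OF partial_test_function[OF Suc.prems]]
    by (auto simp: differentiable_def partial_conv[OF Suc.prems assms(2)])
qed

lemma mollifier_shift:
  fixes x :: "real ^ 'n"
  assumes "r > 0" "cball x r \<subseteq> \<Omega>"
  shows "(\<lambda>y. mollifier r (x - y)) \<in> test_functions \<Omega>"
proof -
  have 0: "{y. mollifier r (x - y) \<noteq> 0} = {y. bump r (x - y) \<noteq> 0}"
    using bump_integral_pos[OF assms(1), where 'n = 'n] by (auto simp: mollifier_def)
  have "flat_algebra (\<lambda>y. inverse (LINT y|lborel. bump r (y :: real ^ 'n)) * bump r (x - y))"
    by (intro flat_algebra.mult flat_algebra.const flat_algebra_bump_shift)
  then have "flat_algebra (\<lambda>y. mollifier r (x - y))"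
    by (simp add: mollifier_def field_simps)
  then show ?thesis
    using bump_shift_test_function[OF assms] flat_algebra_C_diff
    unfolding test_functions_def mem_Collect_eq 0 by blast
qed

lemma mollifier_minus: "mollifier r (- x) = mollifier r x"
  by (simp add: mollifier_def bump_minus)

lemma mollifier_test_function: "r > 0 \<Longrightarrow> mollifier r \<in> test_functions UNIV"
  using mollifier_shift[of r 0 UNIV] by (simp add: mollifier_minus)

lemma mollifier_nonneg: "r > 0 \<Longrightarrow> mollifier r (x :: real ^ 'n) \<ge> 0"
  using bump_integral_pos[where 'n = 'n] by (simp add: mollifier_def bump_def flat_nonneg less_imp_le)

lemma mollifier_eq_0: "r > 0 \<Longrightarrow> r \<le> norm x \<Longrightarrow> mollifier r x = 0"
  using bump_nonzero_iff[of r x] by (simp add: mollifier_def)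

lemma mollifier_integral: "r > 0 \<Longrightarrow> (LINT y|lborel. mollifier r (y :: real ^ 'n)) = 1"
  using less_imp_neq[OF bump_integral_pos[of r, where 'n = 'n]] by (simp add: mollifier_def)

lemma lborel_integral_shift:
  fixes f :: "'a::euclidean_space \<Rightarrow> 'b::{banach, second_countable_topology}"
  assumes [measurable]: "f \<in> borel_measurable borel"
  shows "(LINT y|lborel. f (c + y)) = (LINT y|lborel. f y)"
  by (subst (2) lborel_distr_plus[of c, symmetric]) (simp add: integral_distr)

lemma lborel_nn_integral_shift:
  fixes f :: "'a::euclidean_space \<Rightarrow> ennreal"
  assumes [measurable]: "f \<in> borel_measurable borel"
  shows "(\<integral>\<^sup>+y. f (c + y) \<partial>lborel) = (\<integral>\<^sup>+y. f y \<partial>lborel)"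
  by (subst (2) lborel_distr_plus[of c, symmetric]) (simp add: nn_integral_distr)

lemma lborel_distr_minus: "distr lborel borel uminus = (lborel :: 'a::euclidean_space measure)"
  by (subst lborel_affine[of "-1" 0]) (auto simp: density_1)

lemma lborel_integral_reflect:
  fixes f :: "'a::euclidean_space \<Rightarrow> 'b::{banach, second_countable_topology}"
  assumes [measurable]: "f \<in> borel_measurable borel"
  shows "(LINT y|lborel. f (x - y)) = (LINT y|lborel. f y)"
proof -
  have "(LINT y|lborel. f (x + - y)) = (LINT y|lborel. f (x + y))"
    by (subst (2) lborel_distr_minus[symmetric]) (simp add: integral_distr)
  then show ?thesis by (simp add: lborel_integral_shift)
qed

section \<open>Integral inequalities\<close>

lemma powr_add_le:
  fixes a b p :: real
  assumes "p \<ge> 0"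
  shows "\<bar>a + b\<bar> powr p \<le> 2 powr p * (\<bar>a\<bar> powr p + \<bar>b\<bar> powr p)"
proof -
  have "\<bar>a + b\<bar> powr p \<le> (2 * max \<bar>a\<bar> \<bar>b\<bar>) powr p"
    using assms by (intro powr_mono2) auto
  also have "\<dots> = 2 powr p * (max \<bar>a\<bar> \<bar>b\<bar>) powr p" by (simp add: powr_mult)
  also have "\<dots> \<le> 2 powr p * (\<bar>a\<bar> powr p + \<bar>b\<bar> powr p)"
    by (intro mult_left_mono) (auto simp: max_def)
  finally show ?thesis .
qed

lemma powr_le_one_add_powr:
  fixes y :: real
  assumes "0 \<le> t" "t \<le> s" "y \<ge> 0"
  shows "y powr t \<le> 1 + y powr s"
proof (cases "y \<le> 1")
  case True
  then have "y powr t \<le> 1 powr t" using assms by (intro powr_mono2) auto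
  then show ?thesis by (simp add: add_increasing2)
next
  case False
  then have "y powr t \<le> y powr s" using assms by (intro powr_mono) auto
  then show ?thesis by simp
qed

text \<open>Convexity of \<open>t \<mapsto> t^p\<close>, including the end point \<open>0\<close> of its domain.\<close>

lemma powr_above_tangent:
  fixes t m p :: real
  assumes "p \<ge> 1" "t \<ge> 0" "m \<ge> 0"
  shows "m powr p + p * m powr (p - 1) * (t - m) \<le> t powr p"
proof (cases "m = 0 \<or> t = 0")
  case True
  show ?thesis
  proof (cases "m = 0")
    case False
    then have "t = 0" "m > 0" using True assms by auto
    then have "p * m powr (p - 1) * m = p * m powr p" by (simp add: powr_diff mult.assoc)
    moreover have "1 * m powr p \<le> p * m powr p" using assms by (intro mult_right_mono) auto
    ultimately have "m powr p - p * m powr (p - 1) * m \<le> 0" by linarith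
    then show ?thesis unfolding \<open>t = 0\<close> by (simp del: mult_cancel_left)
  qed (use assms in simp)
next
  case False
  then have "m > 0" "t > 0" using assms by auto
  have "t powr p - m powr p \<ge> (p * m powr (p - 1)) * (t - m)"
  proof (rule convex_on_imp_above_tangent[OF powr_convex[OF assms(1)]])
    show "((\<lambda>x. x powr p) has_real_derivative p * m powr (p - 1)) (at m within {0<..})"
      using \<open>m > 0\<close> by (rule has_field_derivative_at_within[OF has_real_derivative_powr])
    show "m \<in> interior {0<..}" using \<open>m > 0\<close> by (simp add: interior_open)
    show "t \<in> {0<..}" "connected {0::real<..}" using \<open>t > 0\<close> by auto
  qed
  then show ?thesis by simp
qed

text \<open>Integrate the tangent line at the mean value. Without integrability of the right-hand side the
  integral is infinite.\<close>

lemma Jensen_powr: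
  fixes \<eta> w :: "'a \<Rightarrow> real"
  assumes p: "p \<ge> 1" and \<eta>: "integrable M \<eta>" "(LINT z|M. \<eta> z) = 1" "\<And>z. \<eta> z \<ge> 0"
    and w: "integrable M (\<lambda>z. \<eta> z * w z)" "w \<in> borel_measurable M" "\<And>z. w z \<ge> 0"
  shows "ennreal ((LINT z|M. \<eta> z * w z) powr p) \<le> (\<integral>\<^sup>+z. ennreal (\<eta> z * w z powr p) \<partial>M)"
proof (cases "integrable M (\<lambda>z. \<eta> z * w z powr p)")
  case True
  define m where "m = (LINT z|M. \<eta> z * w z)"
  have m0: "m \<ge> 0" unfolding m_def using \<eta> w by (intro Bochner_Integration.integral_nonneg) auto
  have "(LINT z|M. \<eta> z * m powr p + p * m powr (p - 1) * (\<eta> z * w z) - p * m powr (p - 1) * m * \<eta> z)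
     \<le> (LINT z|M. \<eta> z * w z powr p)"
  proof (rule integral_mono[OF _ True])
    show "integrable M (\<lambda>z. \<eta> z * m powr p + p * m powr (p - 1) * (\<eta> z * w z) - p * m powr (p - 1) * m * \<eta> z)"
      using \<eta> w by (intro Bochner_Integration.integrable_diff Bochner_Integration.integrable_add
          integrable_mult_right integrable_mult_left) auto
    fix z
    have "\<eta> z * (m powr p + p * m powr (p - 1) * (w z - m)) \<le> \<eta> z * w z powr p"
      using \<eta> w by (intro mult_left_mono powr_above_tangent p m0) auto
    then show "\<eta> z * m powr p + p * m powr (p - 1) * (\<eta> z * w z) - p * m powr (p - 1) * m * \<eta> z \<le> \<eta> z * w z powr p"
      by (simp add: algebra_simps)
  qed
  also have "(LINT z|M. \<eta> z * m powr p + p * m powr (p - 1) * (\<eta> z * w z) - p * m powr (p - 1) * m * \<eta> z) = m powr p"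
    using \<eta> w by (simp add: m_def[symmetric])
  finally have "m powr p \<le> (LINT z|M. \<eta> z * w z powr p)" .
  then have "ennreal (m powr p) \<le> ennreal (LINT z|M. \<eta> z * w z powr p)" by (rule ennreal_leI)
  also have "\<dots> = (\<integral>\<^sup>+z. ennreal (\<eta> z * w z powr p) \<partial>M)"
    using True \<eta> by (intro nn_integral_eq_integral[symmetric]) auto
  finally show ?thesis by (simp add: m_def)
next
  case False
  have "(\<integral>\<^sup>+z. ennreal (\<eta> z * w z powr p) \<partial>M) = \<infinity>"
  proof (rule ccontr)
    assume "(\<integral>\<^sup>+z. ennreal (\<eta> z * w z powr p) \<partial>M) \<noteq> \<infinity>"
    then have "integrable M (\<lambda>z. \<eta> z * w z powr p)"
      using borel_measurable_integrable[OF \<eta>(1)] w(2) \<eta>(3)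
      by (intro integrableI_nonneg) (auto simp: less_top)
    with False show False ..
  qed
  then show ?thesis by simp
qed

text \<open>Young's inequality, applied to \<open>f\<close> and \<open>g\<close> divided by their norms.\<close>

lemma Holder_inequality:
  fixes f g :: "'a \<Rightarrow> real"
  assumes pq: "p > 1" "q > 1" "1 / p + 1 / q = 1"
    and f: "f \<in> borel_measurable M" "integrable M (\<lambda>x. \<bar>f x\<bar> powr p)"
    and g: "g \<in> borel_measurable M" "integrable M (\<lambda>x. \<bar>g x\<bar> powr q)"
  shows "integrable M (\<lambda>x. f x * g x)"
    and "(LINT x|M. \<bar>f x * g x\<bar>) \<le>
      (LINT x|M. \<bar>f x\<bar> powr p) powr (1 / p) * (LINT x|M. \<bar>g x\<bar> powr q) powr (1 / q)"
proof -
  show i: "integrable M (\<lambda>x. f x * g x)"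
  proof (rule Bochner_Integration.integrable_bound)
    show "integrable M (\<lambda>x. \<bar>f x\<bar> powr p / p + \<bar>g x\<bar> powr q / q)" using f g by simp
    show "AE x in M. norm (f x * g x) \<le> norm (\<bar>f x\<bar> powr p / p + \<bar>g x\<bar> powr q / q)"
      using Youngs_inequality[OF pq] pq by (intro AE_I2) (auto simp: abs_mult intro!: order_trans[OF _ abs_ge_self])
  qed (use f g in measurable)
  let ?F = "LINT x|M. \<bar>f x\<bar> powr p" and ?G = "LINT x|M. \<bar>g x\<bar> powr q"
  have F0: "?F \<ge> 0" and G0: "?G \<ge> 0" by (auto intro!: Bochner_Integration.integral_nonneg)
  show "(LINT x|M. \<bar>f x * g x\<bar>) \<le> ?F powr (1 / p) * ?G powr (1 / q)"
  proof (cases "?F = 0 \<or> ?G = 0")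
    case True
    then have "AE x in M. f x * g x = 0"
    proof
      assume "?F = 0"
      then have "AE x in M. \<bar>f x\<bar> powr p = 0"
        using f by (subst (asm) integral_nonneg_eq_0_iff_AE) auto
      then show ?thesis by (rule eventually_mono) auto
    next
      assume "?G = 0"
      then have "AE x in M. \<bar>g x\<bar> powr q = 0"
        using g by (subst (asm) integral_nonneg_eq_0_iff_AE) auto
      then show ?thesis by (rule eventually_mono) auto
    qed
    then have "(LINT x|M. \<bar>f x * g x\<bar>) = (LINT x|M. 0)"
      using f g by (intro integral_cong_AE) (measurable, auto)
    then show ?thesis by simp
  next
    case False
    then have FG: "?F > 0" "?G > 0" using F0 G0 by (metis less_eq_real_def)+
    define A B where "A = ?F powr (1 / p)" and "B = ?G powr (1 / q)"
    have AB: "A > 0" "B > 0" using FG by (auto simp: A_def B_def)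
    have Ap: "A powr p = ?F" "B powr q = ?G" using FG pq by (auto simp: A_def B_def powr_powr)
    have "(LINT x|M. \<bar>f x * g x\<bar>) \<le> (LINT x|M. A * B * (\<bar>f x\<bar> powr p / (?F * p) + \<bar>g x\<bar> powr q / (?G * q)))"
    proof (rule integral_mono)
      fix x
      have "(\<bar>f x\<bar> / A) * (\<bar>g x\<bar> / B) \<le> (\<bar>f x\<bar> / A) powr p / p + (\<bar>g x\<bar> / B) powr q / q"
        using AB by (intro Youngs_inequality pq) auto
      also have "\<dots> = \<bar>f x\<bar> powr p / (?F * p) + \<bar>g x\<bar> powr q / (?G * q)"
        using AB by (simp add: powr_divide Ap)
      finally show "\<bar>f x * g x\<bar> \<le> A * B * (\<bar>f x\<bar> powr p / (?F * p) + \<bar>g x\<bar> powr q / (?G * q))"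
        using AB by (simp add: abs_mult field_simps)
    qed (use i f g in auto)
    also have "\<dots> = A * B * (?F / (?F * p) + ?G / (?G * q))" using f g by simp
    also have "\<dots> = A * B" using FG pq by simp
    finally show ?thesis by (simp add: A_def B_def)
  qed
qed

text \<open>Hoelder's inequality against an indicator function turns integrability into a power of the measure.\<close>

lemma (in finite_measure) Holder_on_set:
  fixes b :: "'a \<Rightarrow> real"
  assumes s: "s > 1" and b: "b \<in> borel_measurable M" "integrable M (\<lambda>x. \<bar>b x\<bar> powr s)" and A: "A \<in> sets M"
  shows "(LINT x|M. indicator A x * \<bar>b x\<bar>) \<le> (LINT x|M. \<bar>b x\<bar> powr s) powr (1 / s) * measure M A powr (1 - 1 / s)"
proof -
  note [measurable] = b(1) A
  have e: "s / (s - 1) > 1" "1 / s + 1 / (s / (s - 1)) = 1" using s by (auto simp: field_simps)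
  have j: "\<bar>indicator A x :: real\<bar> powr (s / (s - 1)) = indicator A x" for x by (simp add: indicator_def)
  have k: "integrable M (\<lambda>x. \<bar>indicator A x :: real\<bar> powr (s / (s - 1)))"
    unfolding j by (simp add: less_top[symmetric])
  have "(LINT x|M. \<bar>b x * indicator A x\<bar>) \<le>
    (LINT x|M. \<bar>b x\<bar> powr s) powr (1 / s) * (LINT x|M. \<bar>indicator A x :: real\<bar> powr (s / (s - 1))) powr (1 / (s / (s - 1)))"
    by (rule Holder_inequality(2)[OF s e b(1) b(2) _ k]) measurable
  moreover have "1 / (s / (s - 1)) = 1 - 1 / s" using s by (simp add: field_simps)
  moreover have "(LINT x|M. indicator A x) = measure M A"
    using sets.sets_into_space[OF A] by (simp add: Int_absorb2)
  ultimately show ?thesis unfolding j by (simp add: abs_mult mult.commute)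
qed

section \<open>Convergence of mollifications in \<open>L\<^sup>p\<close>\<close>

lemma lborel_integrable_shift:
  fixes f :: "'a::euclidean_space \<Rightarrow> real"
  assumes "integrable lborel f"
  shows "integrable lborel (\<lambda>x. f (c + x))"
proof -
  have [measurable]: "f \<in> borel_measurable borel" using borel_measurable_integrable[OF assms] by simp
  have "integrable (distr lborel borel ((+) c)) f" using assms by (simp add: lborel_distr_plus)
  then show ?thesis by (subst (asm) integrable_distr_eq) auto
qed

text \<open>Inner regularity is available for finite measures, hence the restriction of Lebesgue measure to
  \<open>A\<close>.\<close>

lemma compact_open_sandwich:
  fixes A :: "'a::euclidean_space set"
  assumes A: "A \<in> sets borel" "emeasure lborel A < \<infinity>" and e: "e > 0"
  obtains K U where "compact K" "open U" "K \<subseteq> A" "A \<subseteq> U" "emeasure lborel (U - K) < ennreal e"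
proof -
  define M where "M = density lborel (indicator A :: 'a \<Rightarrow> ennreal)"
  have M: "emeasure M B = emeasure lborel (A \<inter> B)" if "B \<in> sets borel" for B
  proof -
    have "emeasure M B = (\<integral>\<^sup>+x. indicator A x * indicator B x \<partial>lborel)"
      unfolding M_def using A that by (intro emeasure_density) auto
    also have "\<dots> = (\<integral>\<^sup>+x. indicator (A \<inter> B) x \<partial>lborel)"
      by (intro nn_integral_cong) (simp add: indicator_inter_arith)
    also have "\<dots> = emeasure lborel (A \<inter> B)" using A that by (intro nn_integral_indicator) auto
    finally show ?thesis .
  qed
  have "emeasure M A = (SUP K \<in> {K. K \<subseteq> A \<and> compact K}. emeasure M K)"
    by (rule inner_regular) (use A M[of UNIV] in \<open>auto simp: M_def\<close>)
  then have sup: "emeasure lborel A = (SUP K \<in> {K. K \<subseteq> A \<and> compact K}. emeasure M K)"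
    using M[OF A(1)] by simp
  have "\<exists>K. compact K \<and> K \<subseteq> A \<and> emeasure lborel A < emeasure lborel K + ennreal (e / 2)"
  proof -
    have ne: "{K. K \<subseteq> A \<and> compact K} \<noteq> {}" by (auto intro: exI[of _ "{}"])
    have "\<exists>K\<in>{K. K \<subseteq> A \<and> compact K}. emeasure lborel A < emeasure M K + ennreal (e / 2)"
      using e A by (intro SUP_approx_ennreal[OF _ ne sup]) auto
    then obtain K where K: "K \<subseteq> A" "compact K" "emeasure lborel A < emeasure M K + ennreal (e / 2)"
      by auto
    moreover have "emeasure M K = emeasure lborel K"
      using K M[of K] by (simp add: Int_absorb1 compact_imp_closed borel_closed)
    ultimately show ?thesis by auto
  qed
  then obtain K where K: "compact K" "K \<subseteq> A" "emeasure lborel A < emeasure lborel K + ennreal (e / 2)" by auto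
  have [measurable]: "K \<in> sets borel" using K(1) by (simp add: compact_imp_closed borel_closed)
  have Al: "A \<in> sets lebesgue" and e2: "e / 4 > 0" using A(1) e by auto
  obtain U where U': "open U" "A \<subseteq> U" "U - A \<in> lmeasurable" "emeasure lebesgue (U - A) < ennreal (e / 4)"
    by (rule sets_lebesgue_outer_open[OF Al e2])
  note U = U'(1,2,4)
  have UA: "emeasure lborel (U - A) < ennreal (e / 4)"
    using U A by simp
  have finK: "emeasure lborel K < \<infinity>" using le_less_trans[OF emeasure_mono[OF K(2), of lborel] A(2)] A(1) by simp
  have "emeasure lborel (A - K) = emeasure lborel A - emeasure lborel K"
    using K A finK by (intro emeasure_Diff) auto
  also have "\<dots> \<le> ennreal (e / 2)"
    using K(3) finK by (auto simp: ennreal_minus_le_iff less_imp_le)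
  finally have AK: "emeasure lborel (A - K) \<le> ennreal (e / 2)" .
  have "U - K = (U - A) \<union> (A - K)" using K U by auto
  then have "emeasure lborel (U - K) \<le> emeasure lborel (U - A) + emeasure lborel (A - K)"
    using U A by (auto intro!: emeasure_subadditive)
  also have "\<dots> \<le> ennreal (e / 4) + ennreal (e / 2)"
    using UA AK by (intro add_mono) auto
  also have "\<dots> = ennreal (e / 4 + e / 2)" using e by (intro ennreal_plus[symmetric]) auto
  also have "\<dots> < ennreal e" using e by (intro ennreal_lessI) auto
  finally show ?thesis using that K U by blast
qed

text \<open>For the indicator of \<open>A\<close> with \<open>K \<subseteq> A \<subseteq> U\<close>, a translation shorter than the distance of \<open>K\<close> to the
  complement of \<open>U\<close> changes values only on \<open>U - K\<close> and on its translate. Linear combinations and limits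
  of indicators follow by the induction principle for integrable functions.\<close>

lemma translation_continuous_L1:
  fixes g :: "'a::euclidean_space \<Rightarrow> real"
  assumes "integrable lborel g"
  shows "\<forall>e>0. \<exists>d>0. \<forall>h. norm h < d \<longrightarrow> (LINT x|lborel. \<bar>g (h + x) - g x\<bar>) < e"
  using assms
proof (induction rule: integrable_induct)
  case (base A c)
  show ?case
  proof (intro allI impI)
    fix e :: real assume "e > 0"
    define e' where "e' = e / (2 * (\<bar>c\<bar> + 1))"
    have e': "e' > 0" using \<open>e > 0\<close> by (simp add: e'_def)
    have A: "A \<in> sets borel" using base by simp
    obtain K U where KU: "compact K" "open U" "K \<subseteq> A" "A \<subseteq> U" "emeasure lborel (U - K) < ennreal e'"
      using compact_open_sandwich[OF A base(2) e'] .
    obtain d where d: "d > 0" "\<And>x y. x \<in> K \<Longrightarrow> dist x y < d \<Longrightarrow> y \<in> U"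
    proof (cases "K = {} \<or> U = UNIV")
      case False
      then have "setdist K (- U) > 0"
        using KU setdist_gt_0_compact_closed[of K "- U"] by (auto simp: closed_Compl)
      moreover have "y \<in> U" if "x \<in> K" "dist x y < setdist K (- U)" for x y
        using that setdist_le_dist[of x K y "- U"] by fastforce
      ultimately show ?thesis using that by blast
    qed (use that[of 1] in auto)
    let ?D = "U - K"
    have Dm[measurable]: "?D \<in> sets borel" using KU by (auto simp: compact_imp_closed borel_closed)
    have iD: "integrable lborel (indicator ?D :: 'a \<Rightarrow> real)"
      using KU(5) by (simp add: integrable_indicator_iff less_trans[OF _ ennreal_less_top])
    have mD: "measure lborel ?D < e'"
      using KU(5) e' by (simp add: measure_def enn2real_less_iff ennreal_less_top order.strict_trans[OF KU(5)])
    have "(LINT x|lborel. \<bar>indicator A (h + x) *\<^sub>R c - indicator A x *\<^sub>R c\<bar>) < e" if h: "norm h < d" for h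
    proof -
      have "(LINT x|lborel. \<bar>indicator A (h + x) *\<^sub>R c - indicator A x *\<^sub>R c\<bar>)
         \<le> (LINT x|lborel. \<bar>c\<bar> * (indicator ?D (h + x) + indicator ?D x))"
      proof (rule integral_mono')
        show "integrable lborel (\<lambda>x. \<bar>c\<bar> * (indicator ?D (h + x) + indicator ?D x))"
          using iD lborel_integrable_shift[OF iD] by (intro integrable_mult_right) auto
        fix x
        have "x \<in> K \<Longrightarrow> h + x \<in> U" using d(2)[of x "h + x"] h by (simp add: dist_norm)
        moreover have "h + x \<in> K \<Longrightarrow> x \<in> U" using d(2)[of "h + x" x] h by (simp add: dist_norm)
        ultimately show "\<bar>indicator A (h + x) *\<^sub>R c - indicator A x *\<^sub>R c\<bar> \<le> \<bar>c\<bar> * (indicator ?D (h + x) + indicator ?D x)"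
          using KU by (auto simp: indicator_def)
      qed auto
      also have "\<dots> = \<bar>c\<bar> * (2 * measure lborel ?D)"
        using iD lborel_integrable_shift[OF iD] lborel_integral_shift[of "indicator ?D :: 'a \<Rightarrow> real" h] by simp
      also have "\<dots> \<le> \<bar>c\<bar> * (2 * e')" using mD by (intro mult_left_mono) auto
      also have "\<dots> < e" using \<open>e > 0\<close> by (simp add: e'_def field_simps)
      finally show ?thesis .
    qed
    then show "\<exists>d>0. \<forall>h. norm h < d \<longrightarrow> (LINT x|lborel. \<bar>indicator A (h + x) *\<^sub>R c - indicator A x *\<^sub>R c\<bar>) < e"
      using d(1) by blast
  qed
next
  case (add f g)
  show ?case
  proof (intro allI impI)
    fix e :: real assume "e > 0"
    then have e2: "e / 2 > 0" by simp
    obtain d1 where d1: "d1 > 0" "\<And>h. norm h < d1 \<Longrightarrow> (LINT x|lborel. \<bar>f (h + x) - f x\<bar>) < e / 2"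
      using add.IH(1)[rule_format, OF e2] by blast
    obtain d2 where d2: "d2 > 0" "\<And>h. norm h < d2 \<Longrightarrow> (LINT x|lborel. \<bar>g (h + x) - g x\<bar>) < e / 2"
      using add.IH(2)[rule_format, OF e2] by blast
    note d = d1(1) d2(1) d1(2) d2(2)
    have "(LINT x|lborel. \<bar>(f (h + x) + g (h + x)) - (f x + g x)\<bar>) < e" if h: "norm h < min d1 d2" for h
    proof -
      note i = add.hyps lborel_integrable_shift[OF add.hyps(1), of h] lborel_integrable_shift[OF add.hyps(2), of h]
      have "(LINT x|lborel. \<bar>(f (h + x) + g (h + x)) - (f x + g x)\<bar>)
        \<le> (LINT x|lborel. \<bar>f (h + x) - f x\<bar> + \<bar>g (h + x) - g x\<bar>)"
        using i by (intro integral_mono) auto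
      also have "\<dots> = (LINT x|lborel. \<bar>f (h + x) - f x\<bar>) + (LINT x|lborel. \<bar>g (h + x) - g x\<bar>)"
        using i by simp
      also have "\<dots> < e" using d(3)[of h] d(4)[of h] h by simp
      finally show ?thesis .
    qed
    then show "\<exists>d>0. \<forall>h. norm h < d \<longrightarrow> (LINT x|lborel. \<bar>(f (h + x) + g (h + x)) - (f x + g x)\<bar>) < e"
      using d by (intro exI[of _ "min d1 d2"]) auto
  qed
next
  case (lim f s)
  show ?case
  proof (intro allI impI)
    fix e :: real assume "e > 0"
    have "(\<lambda>i. LINT x|lborel. \<bar>s i x - f x\<bar>) \<longlonglongrightarrow> (LINT x|(lborel :: 'a measure). 0)"
    proof (rule integral_dominated_convergence[where w = "\<lambda>x. 3 * norm (f x)"])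
      show "AE x in lborel. (\<lambda>i. \<bar>s i x - f x\<bar>) \<longlonglongrightarrow> 0"
        using lim.hyps(2) by (intro AE_I2) (auto intro!: tendsto_eq_intros)
      show "AE x in lborel. norm \<bar>s i x - f x\<bar> \<le> 3 * norm (f x)" for i
      proof (rule AE_I2)
        fix x :: 'a
        show "norm \<bar>s i x - f x\<bar> \<le> 3 * norm (f x)" using lim.hyps(3)[of x i] by auto
      qed
    qed (use lim in auto)
    then have "eventually (\<lambda>i. (LINT x|lborel. \<bar>s i x - f x\<bar>) < e / 4) sequentially"
      using \<open>e > 0\<close> by (intro order_tendstoD(2)[where y = 0]) auto
    then obtain i where i: "(LINT x|lborel. \<bar>s i x - f x\<bar>) < e / 4"
      by (auto simp: eventually_sequentially)
    obtain d where d: "d > 0" "\<And>h. norm h < d \<Longrightarrow> (LINT x|lborel. \<bar>s i (h + x) - s i x\<bar>) < e / 2"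
      using lim.IH[of i, rule_format, of "e / 2"] \<open>e > 0\<close> by auto
    have "(LINT x|lborel. \<bar>f (h + x) - f x\<bar>) < e" if h: "norm h < d" for h
    proof -
      have isf: "integrable lborel (\<lambda>x. \<bar>s i x - f x\<bar>)" using lim by auto
      have [measurable]: "(\<lambda>x. \<bar>s i x - f x\<bar>) \<in> borel_measurable borel"
        using borel_measurable_integrable[OF isf] by simp
      note i' = isf lborel_integrable_shift[OF isf, of h] lim.hyps(1)[of i] lim.hyps(4)
        lborel_integrable_shift[OF lim.hyps(1)[of i], of h] lborel_integrable_shift[OF lim.hyps(4), of h]
      have "(LINT x|lborel. \<bar>f (h + x) - f x\<bar>)
        \<le> (LINT x|lborel. \<bar>s i (h + x) - s i x\<bar> + \<bar>s i (h + x) - f (h + x)\<bar> + \<bar>s i x - f x\<bar>)"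
        using i' by (intro integral_mono) auto
      also have "\<dots> = (LINT x|lborel. \<bar>s i (h + x) - s i x\<bar>) + 2 * (LINT x|lborel. \<bar>s i x - f x\<bar>)"
        using i' lborel_integral_shift[of "\<lambda>x. \<bar>s i x - f x\<bar>" h] by simp
      also have "\<dots> < e" using d(2)[OF h] i by simp
      finally show ?thesis .
    qed
    then show "\<exists>d>0. \<forall>h. norm h < d \<longrightarrow> (LINT x|lborel. \<bar>f (h + x) - f x\<bar>) < e"
      using d(1) by blast
  qed
qed

lemma powr_add3_le:
  fixes a b c p :: real
  assumes "p \<ge> 0"
  shows "\<bar>a + b + c\<bar> powr p \<le> 3 powr p * (\<bar>a\<bar> powr p + \<bar>b\<bar> powr p + \<bar>c\<bar> powr p)"
proof -
  let ?m = "max (max \<bar>a\<bar> \<bar>b\<bar>) \<bar>c\<bar>"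
  have "\<bar>a + b + c\<bar> powr p \<le> (3 * ?m) powr p"
    using assms by (intro powr_mono2) auto
  also have "\<dots> = 3 powr p * ?m powr p" by (simp add: powr_mult)
  also have "\<dots> \<le> 3 powr p * (\<bar>a\<bar> powr p + \<bar>b\<bar> powr p + \<bar>c\<bar> powr p)"
    by (intro mult_left_mono) (auto simp: max_def)
  finally show ?thesis .
qed

text \<open>Truncating \<open>g\<close> at height \<open>N\<close> costs little in \<open>L\<^sup>p\<close>, and for functions bounded by \<open>N\<close> the
  \<open>L\<^sup>p\<close> distance is controlled by the \<open>L\<^sup>1\<close> distance.\<close>

lemma translation_continuous_Lp:
  fixes g :: "'a::euclidean_space \<Rightarrow> real"
  assumes p: "p \<ge> 1" and g: "integrable lborel g" "integrable lborel (\<lambda>x. \<bar>g x\<bar> powr p)" and e: "e > 0"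
  shows "\<exists>d>0. \<forall>h. norm h < d \<longrightarrow> (\<integral>\<^sup>+x. ennreal (\<bar>g (h + x) - g x\<bar> powr p) \<partial>lborel) \<le> ennreal e"
proof -
  have [measurable]: "g \<in> borel_measurable borel" using borel_measurable_integrable[OF g(1)] by simp
  define T where "T N x = max (- real N) (min (real N) (g x))" for N :: nat and x
  have Tm[measurable]: "T N \<in> borel_measurable borel" for N unfolding T_def by measurable
  have "(\<lambda>N. LINT x|lborel. \<bar>g x - T N x\<bar> powr p) \<longlonglongrightarrow> (LINT x|(lborel :: 'a measure). 0)"
  proof (rule integral_dominated_convergence[where w = "\<lambda>x. \<bar>g x\<bar> powr p"])
    show "AE x in lborel. (\<lambda>N. \<bar>g x - T N x\<bar> powr p) \<longlonglongrightarrow> 0"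
    proof (rule AE_I2)
      fix x
      obtain N0 :: nat where N0: "\<bar>g x\<bar> \<le> real N0" using real_arch_simple by blast
      have "T N x = g x" if "N \<ge> N0" for N
      proof -
        have "\<bar>g x\<bar> \<le> real N" using N0 that by simp
        then show ?thesis unfolding T_def by linarith
      qed
      then have "\<forall>\<^sub>F N in sequentially. 0 = \<bar>g x - T N x\<bar> powr p"
        unfolding eventually_sequentially by (intro exI[of _ N0]) auto
      then show "(\<lambda>N. \<bar>g x - T N x\<bar> powr p) \<longlonglongrightarrow> 0"
        by (rule Lim_transform_eventually[OF tendsto_const])
    qed
    show "AE x in lborel. norm (\<bar>g x - T N x\<bar> powr p) \<le> \<bar>g x\<bar> powr p" for N
    proof (rule AE_I2)
      fix x
      have "\<bar>g x - T N x\<bar> \<le> \<bar>g x\<bar>" unfolding T_def by linarith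
      then show "norm (\<bar>g x - T N x\<bar> powr p) \<le> \<bar>g x\<bar> powr p"
        using p by (auto intro!: powr_mono2)
    qed
  qed (use g in auto)
  then have "eventually (\<lambda>N. (LINT x|lborel. \<bar>g x - T N x\<bar> powr p) < e / (4 * 3 powr p)) sequentially"
    using e by (intro order_tendstoD(2)[where y = 0]) auto
  then obtain N where N: "(LINT x|lborel. \<bar>g x - T N x\<bar> powr p) < e / (4 * 3 powr p)"
    by (auto simp: eventually_sequentially)
  define r where "r x = g x - T N x" for x
  have rm[measurable]: "r \<in> borel_measurable borel" unfolding r_def by measurable
  have ri: "integrable lborel (\<lambda>x. \<bar>r x\<bar> powr p)"
  proof (rule Bochner_Integration.integrable_bound[OF g(2)])
    show "AE x in lborel. norm (\<bar>r x\<bar> powr p) \<le> norm (\<bar>g x\<bar> powr p)"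
    proof (rule AE_I2)
      fix x
      have "\<bar>r x\<bar> \<le> \<bar>g x\<bar>" unfolding T_def r_def by linarith
      then show "norm (\<bar>r x\<bar> powr p) \<le> norm (\<bar>g x\<bar> powr p)"
        using p by (auto intro!: powr_mono2)
    qed
  qed measurable
  have rI: "(\<integral>\<^sup>+x. ennreal (\<bar>r x\<bar> powr p) \<partial>lborel) \<le> ennreal (e / (4 * 3 powr p))"
    using N ri by (subst nn_integral_eq_integral) (auto simp: r_def intro!: ennreal_leI)
  \<comment> \<open>The difference of two truncated values is at most \<open>2 N\<close>, so its \<open>p\<close>-th power is at most
    \<open>(2 N)^(p - 1)\<close> times its absolute value; \<open>N + 1\<close> keeps the constant positive.\<close>
  define c where "c = (2 * (real N + 1)) powr (p - 1)"
  have c: "c > 0" by (simp add: c_def)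
  have e4: "e / (4 * 3 powr p * c) > 0" using e c by simp
  obtain d where d: "d > 0" "\<And>h. norm h < d \<Longrightarrow> (LINT x|lborel. \<bar>g (h + x) - g x\<bar>) < e / (4 * 3 powr p * c)"
    using translation_continuous_L1[OF g(1), rule_format, OF e4] by blast
  have "(\<integral>\<^sup>+x. ennreal (\<bar>g (h + x) - g x\<bar> powr p) \<partial>lborel) \<le> ennreal e" if h: "norm h < d" for h
  proof -
    have i: "integrable lborel (\<lambda>x. g (h + x) - g x)"
      using g(1) lborel_integrable_shift[OF g(1)] by auto
    have "(\<integral>\<^sup>+x. ennreal (\<bar>g (h + x) - g x\<bar> powr p) \<partial>lborel)
      \<le> (\<integral>\<^sup>+x. ennreal (3 powr p) * (ennreal (\<bar>r (h + x)\<bar> powr p) + ennreal c * ennreal \<bar>g (h + x) - g x\<bar> + ennreal (\<bar>r x\<bar> powr p)) \<partial>lborel)"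
    proof (rule nn_integral_mono)
      fix x
      let ?t = "\<bar>T N (h + x) - T N x\<bar>"
      have t1: "?t \<le> \<bar>g (h + x) - g x\<bar>" unfolding T_def by linarith
      have "\<bar>T N y\<bar> \<le> real N" for y unfolding T_def by simp
      then have "?t \<le> real N + real N"
        by (intro order_trans[OF abs_triangle_ineq4] add_mono)
      then have t2: "?t \<le> 2 * (real N + 1)" by simp
      have tp: "?t powr p \<le> c * \<bar>g (h + x) - g x\<bar>"
      proof (cases "?t = 0")
        case False
        then have "?t powr p = ?t powr (p - 1) * ?t" by (simp add: powr_diff)
        also have "\<dots> \<le> c * \<bar>g (h + x) - g x\<bar>"
          unfolding c_def using t1 t2 p by (intro mult_mono powr_mono2) auto
        finally show ?thesis .
      qed (use c in simp)
      have "\<bar>g (h + x) - g x\<bar> powr p = \<bar>r (h + x) + (T N (h + x) - T N x) + (- r x)\<bar> powr p"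
        by (simp add: r_def)
      also have "\<dots> \<le> 3 powr p * (\<bar>r (h + x)\<bar> powr p + ?t powr p + \<bar>- r x\<bar> powr p)"
        using p by (intro powr_add3_le) auto
      also have "\<dots> \<le> 3 powr p * (\<bar>r (h + x)\<bar> powr p + c * \<bar>g (h + x) - g x\<bar> + \<bar>r x\<bar> powr p)"
        using tp by (intro mult_left_mono add_mono) auto
      finally show "ennreal (\<bar>g (h + x) - g x\<bar> powr p) \<le> ennreal (3 powr p) * (ennreal (\<bar>r (h + x)\<bar> powr p) + ennreal c * ennreal \<bar>g (h + x) - g x\<bar> + ennreal (\<bar>r x\<bar> powr p))"
        using c by (simp add: ennreal_leI flip: ennreal_mult ennreal_plus)
    qed
    also have "\<dots> = ennreal (3 powr p) * ((\<integral>\<^sup>+x. ennreal (\<bar>r (h + x)\<bar> powr p) \<partial>lborel)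
       + ennreal c * (\<integral>\<^sup>+x. ennreal \<bar>g (h + x) - g x\<bar> \<partial>lborel) + (\<integral>\<^sup>+x. ennreal (\<bar>r x\<bar> powr p) \<partial>lborel))"
      by (simp add: nn_integral_cmult nn_integral_add)
    also have "(\<integral>\<^sup>+x. ennreal (\<bar>r (h + x)\<bar> powr p) \<partial>lborel) = (\<integral>\<^sup>+x. ennreal (\<bar>r x\<bar> powr p) \<partial>lborel)"
      by (rule lborel_nn_integral_shift[of "\<lambda>x. ennreal (\<bar>r x\<bar> powr p)"]) measurable
    also have "(\<integral>\<^sup>+x. ennreal \<bar>g (h + x) - g x\<bar> \<partial>lborel) = ennreal (LINT x|lborel. \<bar>g (h + x) - g x\<bar>)"
      using i by (intro nn_integral_eq_integral) auto
    also have "ennreal (3 powr p) * ((\<integral>\<^sup>+x. ennreal (\<bar>r x\<bar> powr p) \<partial>lborel) + ennreal c * ennreal (LINT x|lborel. \<bar>g (h + x) - g x\<bar>) + (\<integral>\<^sup>+x. ennreal (\<bar>r x\<bar> powr p) \<partial>lborel))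
      \<le> ennreal (3 powr p) * (ennreal (e / (4 * 3 powr p)) + ennreal c * ennreal (e / (4 * 3 powr p * c)) + ennreal (e / (4 * 3 powr p)))"
      using d(2)[OF h] by (intro mult_left_mono add_mono rI ennreal_leI) auto
    also have "\<dots> = ennreal (3 powr p * (e / (4 * 3 powr p) + c * (e / (4 * 3 powr p * c)) + e / (4 * 3 powr p)))"
      using e c by (simp flip: ennreal_mult ennreal_plus)
    also have "\<dots> \<le> ennreal e" using e c by (intro ennreal_leI) (simp add: field_simps)
    finally show ?thesis .
  qed
  with d(1) show ?thesis by blast
qed

text \<open>The difference \<open>conv (mollifier r) g - g\<close> is an average of differences between \<open>g\<close> and its
  translates by vectors shorter than \<open>r\<close>. By Jensen's inequality and Tonelli's theorem its \<open>L\<^sup>p\<close> distance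
  is at most the average of the distances between \<open>g\<close> and these translates.\<close>

lemma conv_mollifier_Lp:
  fixes g :: "real ^ 'n \<Rightarrow> real"
  assumes p: "p \<ge> 1" and g: "integrable lborel g" "integrable lborel (\<lambda>x. \<bar>g x\<bar> powr p)" and e: "e > 0"
  shows "\<exists>d>0. \<forall>r. 0 < r \<and> r < d \<longrightarrow> integrable lborel (\<lambda>x. \<bar>conv (mollifier r) g x - g x\<bar> powr p) \<and>
     (LINT x|lborel. \<bar>conv (mollifier r) g x - g x\<bar> powr p) \<le> e"
proof -
  have gm[measurable]: "g \<in> borel_measurable borel" using borel_measurable_integrable[OF g(1)] by simp
  obtain d where d: "d > 0"
    "\<And>h. norm h < d \<Longrightarrow> (\<integral>\<^sup>+x. ennreal (\<bar>g (h + x) - g x\<bar> powr p) \<partial>lborel) \<le> ennreal e"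
    using translation_continuous_Lp[OF p g e] by blast
  have "integrable lborel (\<lambda>x. \<bar>conv (mollifier r) g x - g x\<bar> powr p) \<and>
     (LINT x|lborel. \<bar>conv (mollifier r) g x - g x\<bar> powr p) \<le> e" if r: "0 < r" "r < d" for r
  proof -
    let ?\<eta> = "mollifier r :: real ^ 'n \<Rightarrow> real"
    have \<eta>: "?\<eta> \<in> test_functions UNIV" using r by (intro mollifier_test_function)
    note \<eta>i = test_function_integrable[OF \<eta>]
    have [measurable]: "?\<eta> \<in> borel_measurable borel" using \<eta> by (rule test_function_borel)
    have \<eta>0: "?\<eta> z \<ge> 0" for z using mollifier_nonneg[OF r(1)] .
    have [measurable]: "conv ?\<eta> g \<in> borel_measurable borel"
      using C_diff_conv[OF \<eta> g(1), of 0] by (auto intro: borel_measurable_continuous_onI)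
    have pt: "ennreal (\<bar>conv ?\<eta> g x - g x\<bar> powr p) \<le> (\<integral>\<^sup>+z. ennreal (?\<eta> z * \<bar>g (x - z) - g x\<bar> powr p) \<partial>lborel)" for x
    proof -
      have i1: "integrable lborel (\<lambda>z. ?\<eta> z * g (x - z))"
      proof -
        have "integrable lborel (\<lambda>y. g (x + y))" by (rule lborel_integrable_shift[OF g(1)])
        then have "integrable (distr lborel borel uminus) (\<lambda>y. g (x + y))" by (simp add: lborel_distr_minus)
        then have "integrable lborel (\<lambda>y. g (x - y))" by (subst (asm) integrable_distr_eq) auto
        moreover obtain B where "\<And>x. \<bar>?\<eta> x\<bar> \<le> B" using test_function_bounded[OF \<eta>] by metis
        ultimately show ?thesis by (intro integrable_mult_bounded[of _ _ _ B]) auto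
      qed
      have i2: "integrable lborel (\<lambda>z. ?\<eta> z * (g (x - z) - g x))"
        using i1 \<eta>i by (simp add: right_diff_distrib)
      have "conv ?\<eta> g x = (LINT z|lborel. ?\<eta> z * g (x - z))"
        unfolding conv_def using lborel_integral_reflect[of "\<lambda>z. ?\<eta> z * g (x - z)" x] by simp
      then have "conv ?\<eta> g x - g x = (LINT z|lborel. ?\<eta> z * (g (x - z) - g x))"
        using i1 \<eta>i mollifier_integral[OF r(1), where 'n = 'n] by (simp add: right_diff_distrib)
      then have "\<bar>conv ?\<eta> g x - g x\<bar> \<le> (LINT z|lborel. \<bar>?\<eta> z * (g (x - z) - g x)\<bar>)"
        by (simp add: integral_abs_bound)
      also have "\<dots> = (LINT z|lborel. ?\<eta> z * \<bar>g (x - z) - g x\<bar>)"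
        using \<eta>0 by (simp add: abs_mult)
      finally have "\<bar>conv ?\<eta> g x - g x\<bar> powr p \<le> (LINT z|lborel. ?\<eta> z * \<bar>g (x - z) - g x\<bar>) powr p"
        using p by (intro powr_mono2) auto
      then have "ennreal (\<bar>conv ?\<eta> g x - g x\<bar> powr p) \<le> ennreal ((LINT z|lborel. ?\<eta> z * \<bar>g (x - z) - g x\<bar>) powr p)"
        by (rule ennreal_leI)
      also have "\<dots> \<le> (\<integral>\<^sup>+z. ennreal (?\<eta> z * \<bar>g (x - z) - g x\<bar> powr p) \<partial>lborel)"
      proof (rule Jensen_powr[OF p \<eta>i mollifier_integral[OF r(1)] \<eta>0])
        show "integrable lborel (\<lambda>z. ?\<eta> z * \<bar>g (x - z) - g x\<bar>)"
          using integrable_abs[OF i2] \<eta>0 by (simp add: abs_mult)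
      qed auto
      finally show ?thesis .
    qed
    have "(\<integral>\<^sup>+x. ennreal (\<bar>conv ?\<eta> g x - g x\<bar> powr p) \<partial>lborel)
      \<le> (\<integral>\<^sup>+x. (\<integral>\<^sup>+z. ennreal (?\<eta> z * \<bar>g (x - z) - g x\<bar> powr p) \<partial>lborel) \<partial>lborel)"
      by (intro nn_integral_mono pt)
    also have "\<dots> = (\<integral>\<^sup>+z. (\<integral>\<^sup>+x. ennreal (?\<eta> z * \<bar>g (x - z) - g x\<bar> powr p) \<partial>lborel) \<partial>lborel)"
      by (rule lborel_pair.Fubini'[symmetric]) measurable
    also have "\<dots> \<le> (\<integral>\<^sup>+z. ennreal (?\<eta> z) * ennreal e \<partial>lborel)"
    proof (rule nn_integral_mono)
      fix z :: "real ^ 'n"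
      have "(\<integral>\<^sup>+x. ennreal (?\<eta> z * \<bar>g (x - z) - g x\<bar> powr p) \<partial>lborel)
        = ennreal (?\<eta> z) * (\<integral>\<^sup>+x. ennreal (\<bar>g (- z + x) - g x\<bar> powr p) \<partial>lborel)"
        using \<eta>0 by (simp add: ennreal_mult nn_integral_cmult)
      also have "\<dots> \<le> ennreal (?\<eta> z) * ennreal e"
      proof (cases "norm z < r")
        case True
        then show ?thesis using d(2)[of "- z"] r by (intro mult_left_mono) auto
      next
        case False
        then show ?thesis using mollifier_eq_0[OF r(1), of z] by simp
      qed
      finally show "(\<integral>\<^sup>+x. ennreal (?\<eta> z * \<bar>g (x - z) - g x\<bar> powr p) \<partial>lborel) \<le> ennreal (?\<eta> z) * ennreal e" .
    qed
    also have "\<dots> = (\<integral>\<^sup>+z. ennreal (?\<eta> z) \<partial>lborel) * ennreal e"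
      by (rule nn_integral_multc) measurable
    also have "(\<integral>\<^sup>+z. ennreal (?\<eta> z) \<partial>lborel) = 1"
      using \<eta>i \<eta>0 mollifier_integral[OF r(1), where 'n = 'n] by (subst nn_integral_eq_integral) auto
    finally have fin: "(\<integral>\<^sup>+x. ennreal (\<bar>conv ?\<eta> g x - g x\<bar> powr p) \<partial>lborel) \<le> ennreal e" by simp
    then have i: "integrable lborel (\<lambda>x. \<bar>conv ?\<eta> g x - g x\<bar> powr p)"
      by (intro integrableI_nonneg) (auto intro: le_less_trans)
    moreover have "(LINT x|lborel. \<bar>conv ?\<eta> g x - g x\<bar> powr p) \<le> e"
      using fin e by (subst (asm) nn_integral_eq_integral[OF i]) (auto simp: ennreal_le_iff)
    ultimately show ?thesis by blast
  qed
  with d(1) show ?thesis by blast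
qed

section \<open>Weak gradients\<close>

lemma borel_imp_lebesgue_on:
  fixes f :: "'a::euclidean_space \<Rightarrow> 'b::topological_space"
  assumes "f \<in> borel_measurable borel"
  shows "f \<in> borel_measurable (lebesgue_on S)"
  using assms by (intro measurable_restrict_space1 measurable_completion) simp

lemma integrable_lebesgue_on_subset:
  fixes f :: "'a::euclidean_space \<Rightarrow> 'b::{banach, second_countable_topology}"
  assumes "integrable (lebesgue_on S) f" "T \<subseteq> S" "S \<in> sets lebesgue" "T \<in> sets lebesgue"
  shows "integrable (lebesgue_on T) f"
  using assms by (simp add: integrable_restrict_space set_integrable_def[symmetric])
    (rule set_integrable_subset, auto)

lemma AE_lebesgue_on_iff:
  "S \<in> sets lebesgue \<Longrightarrow> (AE x in lebesgue_on S. P x) \<longleftrightarrow> (AE x in lebesgue. x \<in> S \<longrightarrow> P x)"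
  by (subst AE_restrict_space_iff) auto

text \<open>By Lindelof's theorem countably many of the neighbourhoods cover \<open>\<Omega>\<close>.\<close>

lemma AE_lebesgue_on_local:
  fixes \<Omega> :: "'a::euclidean_space set"
  assumes \<Omega>: "open \<Omega>" and loc: "\<And>a. a \<in> \<Omega> \<Longrightarrow> \<exists>U. open U \<and> a \<in> U \<and> (AE x in lebesgue. x \<in> U \<longrightarrow> P x)"
  shows "AE x in lebesgue_on \<Omega>. P x"
proof -
  define F where "F = {U :: 'a set. open U \<and> (AE x in lebesgue. x \<in> U \<longrightarrow> P x)}"
  obtain F' where F': "F' \<subseteq> F" "countable F'" "\<Union>F' = \<Union>F"
    using Lindelof[of F] unfolding F_def by blast
  have "AE x in lebesgue. \<forall>U\<in>F'. x \<in> U \<longrightarrow> P x"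
    using F' by (subst AE_ball_countable) (auto simp: F_def)
  moreover have "\<Omega> \<subseteq> \<Union>F'" using loc unfolding F'(3) F_def by blast
  ultimately have "AE x in lebesgue. x \<in> \<Omega> \<longrightarrow> P x"
    by (auto elim!: eventually_mono)
  then show ?thesis using \<Omega> by (simp add: AE_lebesgue_on_iff)
qed

lemma L1_loc_diff:
  assumes "f \<in> L1_loc \<Omega>" "g \<in> L1_loc \<Omega>" shows "(\<lambda>x. f x - g x) \<in> L1_loc \<Omega>"
  using assms by (auto simp: L1_loc_def)

lemma L1_loc_add:
  assumes "f \<in> L1_loc \<Omega>" "g \<in> L1_loc \<Omega>" shows "(\<lambda>x. f x + g x) \<in> L1_loc \<Omega>"
  using assms by (auto simp: L1_loc_def)

lemma L1_loc_component:
  fixes G :: "real ^ 'n \<Rightarrow> real ^ 'n"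
  assumes "G \<in> L1_loc \<Omega>" shows "(\<lambda>x. G x $ i) \<in> L1_loc \<Omega>"
  using assms by (auto simp: L1_loc_def cart_eq_inner_axis)

lemma continuous_L1_loc:
  fixes \<phi> :: "real ^ 'n \<Rightarrow> 'b::euclidean_space"
  assumes "continuous_on UNIV \<phi>"
  shows "\<phi> \<in> L1_loc \<Omega>"
proof -
  have "integrable (lebesgue_on K) \<phi>" if "compact K" for K
  proof -
    have "integrable lborel (\<lambda>x. indicator K x *\<^sub>R \<phi> x)"
      using that assms by (intro borel_integrable_compact continuous_on_subset[OF assms]) auto
    then have "integrable lebesgue (\<lambda>x. indicator K x *\<^sub>R \<phi> x)"
      by (subst integrable_completion) (auto dest: borel_measurable_integrable)
    then show ?thesis using that by (simp add: integrable_restrict_space lmeasurable_compact fmeasurableD)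
  qed
  then show ?thesis by (auto simp: L1_loc_def)
qed

lemma test_function_support:
  assumes "\<phi> \<in> test_functions \<Omega>"
  obtains S where "compact S" "S \<subseteq> \<Omega>" "\<And>x. x \<notin> S \<Longrightarrow> \<phi> x = 0" "\<And>x i. x \<notin> S \<Longrightarrow> partial i \<phi> x = 0"
proof (rule that[of "closure {x. \<phi> x \<noteq> 0}"])
  show "\<phi> x = 0" if "x \<notin> closure {x. \<phi> x \<noteq> 0}" for x
    using that closure_subset[of "{x. \<phi> x \<noteq> 0}"] by auto
  show "partial i \<phi> x = 0" if "x \<notin> closure {x. \<phi> x \<noteq> 0}" for x i
    using partial_zero_outside[OF assms that] .
qed (use assms in \<open>auto simp: test_functions_def\<close>)

text \<open>Convolutions need Borel functions on the whole space, so a locally integrable function is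
  cut off outside a compact set and altered on a null set.\<close>

definition borel_cut :: "(real ^ 'n) set \<Rightarrow> (real ^ 'n \<Rightarrow> real) \<Rightarrow> (real ^ 'n \<Rightarrow> real) \<Rightarrow> bool" where
  "borel_cut K u v \<longleftrightarrow> integrable lborel v \<and> (\<forall>x. x \<notin> K \<longrightarrow> v x = 0) \<and>
     (AE x in lebesgue. x \<in> K \<longrightarrow> v x = u x)"

lemma borel_cut_exists:
  fixes u :: "real ^ 'n \<Rightarrow> real"
  assumes K: "compact K" and u: "integrable (lebesgue_on K) u"
  obtains v where "borel_cut K u v"
proof -
  have Kl: "K \<in> sets lebesgue" and Kb: "K \<in> sets borel"
    using K by (auto simp: lmeasurable_compact fmeasurableD compact_imp_closed borel_closed)
  have i: "integrable lebesgue (\<lambda>x. indicator K x * u x)"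
    using u Kl by (simp add: integrable_restrict_space)
  then obtain v' where v': "v' \<in> borel_measurable lborel" "AE x in lborel. indicator K x * u x = v' x"
    using completion_ex_borel_measurable_real[OF borel_measurable_integrable] by blast
  have [measurable]: "v' \<in> borel_measurable borel" using v' by simp
  define v where "v x = indicator K x * v' x" for x
  have [measurable]: "v \<in> borel_measurable borel" using Kb unfolding v_def by measurable
  have AE: "AE x in lebesgue. indicator K x * u x = v x"
    using AE_completion[OF v'(2)] by (rule eventually_mono) (auto simp: v_def indicator_def)
  have "integrable lebesgue v"
    using i AE by (subst integrable_cong_AE[where g = "\<lambda>x. indicator K x * u x"])
      (auto dest: borel_measurable_integrable intro: measurable_completion elim!: eventually_mono)
  then have "integrable lborel v" by (subst (asm) integrable_completion) auto
  moreover have "AE x in lebesgue. x \<in> K \<longrightarrow> v x = u x"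
    using AE by (rule eventually_mono) (auto simp: indicator_def)
  ultimately have "borel_cut K u v" by (simp add: borel_cut_def v_def)
  then show ?thesis by (rule that)
qed

text \<open>The function \<open>h\<close> allows for composite integrands \<open>H (u x) \<cdot> \<phi> x\<close>, as they occur in the chain rule.\<close>

lemma borel_cut_integral:
  fixes h :: "real \<Rightarrow> real" and u :: "real ^ 'n \<Rightarrow> real"
  assumes v: "borel_cut K u v" and "K \<subseteq> \<Omega>" "\<Omega> \<in> sets lebesgue" "K \<in> sets lebesgue"
    and \<phi>: "\<phi> \<in> borel_measurable borel" "\<And>x. x \<notin> K \<Longrightarrow> \<phi> x = 0"
    and h: "h \<in> borel_measurable borel" and u: "u \<in> borel_measurable (lebesgue_on K)"
  shows "(LINT x|lebesgue_on \<Omega>. h (u x) * \<phi> x) = (LINT x|lborel. h (v x) * \<phi> x)"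
proof -
  have [measurable]: "v \<in> borel_measurable borel"
    using v by (auto simp: borel_cut_def dest: borel_measurable_integrable)
  note [measurable] = \<phi>(1) h
  have "(LINT x|lebesgue_on \<Omega>. h (u x) * \<phi> x) = (LINT x|lebesgue. indicator \<Omega> x * (h (u x) * \<phi> x))"
    using assms by (simp add: integral_restrict_space)
  also have "\<dots> = (LINT x|lebesgue. indicator K x * (h (u x) * \<phi> x))"
    using \<phi>(2) assms(2) by (intro Bochner_Integration.integral_cong) (auto simp: indicator_def)
  also have "\<dots> = (LINT x|lebesgue. h (v x) * \<phi> x)"
  proof (rule integral_cong_AE)
    have "(\<lambda>x. h (u x) * \<phi> x) \<in> borel_measurable (lebesgue_on K)"
      using u h borel_imp_lebesgue_on[OF \<phi>(1), of K] by (intro borel_measurable_times) (auto intro: measurable_compose)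
    then show "(\<lambda>x. indicator K x * (h (u x) * \<phi> x)) \<in> borel_measurable lebesgue"
      using assms(4) by (subst (asm) borel_measurable_restrict_space_iff) auto
    have "(\<lambda>x. h (v x) * \<phi> x) \<in> borel_measurable lborel" by measurable
    then show "(\<lambda>x. h (v x) * \<phi> x) \<in> borel_measurable lebesgue" by (rule measurable_completion)
    show "AE x in lebesgue. indicator K x * (h (u x) * \<phi> x) = h (v x) * \<phi> x"
      using v \<phi>(2) unfolding borel_cut_def by (auto elim!: eventually_mono simp: indicator_def)
  qed
  also have "\<dots> = (LINT x|lborel. h (v x) * \<phi> x)"
    by (rule integral_completion) measurable
  finally show ?thesis .
qed

lemma L1_loc_mult_test_integrable:
  assumes u: "u \<in> L1_loc \<Omega>" and \<Omega>: "\<Omega> \<in> sets lebesgue" and \<phi>: "\<phi> \<in> test_functions \<Omega>"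
  shows "integrable (lebesgue_on \<Omega>) (\<lambda>x. u x * \<phi> x)"
proof -
  obtain S where S: "compact S" "S \<subseteq> \<Omega>" "\<And>x. x \<notin> S \<Longrightarrow> \<phi> x = 0" using test_function_support[OF \<phi>] by metis
  obtain B where B: "\<And>x. \<bar>\<phi> x\<bar> \<le> B" using test_function_bounded[OF \<phi>] by metis
  have Sl: "S \<in> sets lebesgue" using S(1) by (auto simp: lmeasurable_compact fmeasurableD)
  have "integrable (lebesgue_on S) (\<lambda>x. \<phi> x * u x)"
    using u S B borel_imp_lebesgue_on[OF test_function_borel[OF \<phi>]]
    by (intro integrable_mult_bounded[of _ _ _ B]) (auto simp: L1_loc_def)
  then have "integrable lebesgue (\<lambda>x. indicator S x * (\<phi> x * u x))"
    using Sl by (simp add: integrable_restrict_space)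
  also have "(\<lambda>x. indicator S x * (\<phi> x * u x)) = (\<lambda>x. indicator \<Omega> x * (u x * \<phi> x))"
    using S by (auto simp: indicator_def fun_eq_iff)
  finally show ?thesis using \<Omega> by (simp add: integrable_restrict_space)
qed

text \<open>The integral of a derivative vanishes because difference quotients have integral \<open>0\<close> by
  translation invariance.\<close>

lemma integral_partial_derivative_eq_0:
  fixes F :: "real ^ 'n \<Rightarrow> real"
  assumes F: "\<And>x. (F has_derivative (\<lambda>h. \<Sum>i\<in>UNIV. h $ i * D i x)) (at x)"
    and D: "\<And>i. continuous_on UNIV (D i)"
    and S: "compact S" "\<And>x. x \<notin> S \<Longrightarrow> F x = 0" "\<And>x i. x \<notin> S \<Longrightarrow> D i x = 0"
  shows "(LINT x|lborel. D i x) = 0"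
proof -
  have Fc: "continuous_on UNIV F"
    by (auto intro!: continuous_at_imp_continuous_on has_derivative_continuous F)
  have [measurable]: "F \<in> borel_measurable borel" "D i \<in> borel_measurable borel" for i
    using Fc D by (auto intro: borel_measurable_continuous_onI)
  obtain R where R: "R > 0" "S \<subseteq> cball 0 R"
    using compact_imp_bounded[OF S(1)] by (auto simp: bounded_pos subset_iff)
  have "\<exists>B>0. \<forall>x. \<bar>D i x\<bar> \<le> B" for i
  proof -
    have "compact (D i ` S)" by (rule compact_continuous_image[OF continuous_on_subset[OF D] S(1)]) simp
    then obtain B where "B > 0" "\<And>x. x \<in> S \<Longrightarrow> \<bar>D i x\<bar> \<le> B" by (auto dest!: compact_imp_bounded simp: bounded_pos)
    then have "\<bar>D i x\<bar> \<le> B" for x using S(3)[of x i] by (cases "x \<in> S") auto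
    with \<open>B > 0\<close> show ?thesis by blast
  qed
  then obtain B where B: "\<And>i. B i > 0" "\<And>i x. \<bar>D i x\<bar> \<le> B i" by metis
  define L where "L = (\<Sum>i\<in>UNIV. B i)"
  have L: "L > 0" unfolding L_def using B(1) by (intro sum_pos) auto
  have lip: "\<bar>F x - F y\<bar> \<le> L * norm (x - y)" for x y
    unfolding L_def by (rule Lipschitz_if_bounded_partials[OF F B(2)])
  have Fi: "integrable lborel F" by (rule continuous_compact_support_integrable[OF Fc S(1,2)])
  define t :: "nat \<Rightarrow> real" where "t k = 1 / real (Suc k)" for k
  have t: "t k > 0" "t k \<le> 1" for k by (auto simp: t_def)
  let ?e = "axis i 1 :: real ^ 'n"
  define Q where "Q k x = (F (t k *\<^sub>R ?e + x) - F x) / t k" for k x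
  have "(\<lambda>k. LINT x|lborel. Q k x) \<longlonglongrightarrow> (LINT x|lborel. D i x)"
  proof (rule integral_dominated_convergence[where w = "\<lambda>x. indicator (cball 0 (R + 1)) x *\<^sub>R L"])
    show "integrable lborel (\<lambda>x::real^'n. indicator (cball 0 (R + 1)) x *\<^sub>R L)"
      by (rule borel_integrable_compact) (auto intro: continuous_intros)
    show "AE x in lborel. (\<lambda>k. Q k x) \<longlonglongrightarrow> D i x"
    proof (rule AE_I2)
      fix x
      have "((\<lambda>s. F (x + s *\<^sub>R ?e)) has_derivative (\<lambda>s. \<Sum>j\<in>UNIV. (s *\<^sub>R ?e) $ j * D j x)) (at 0)"
        by (rule has_derivative_compose[of "\<lambda>s. x + s *\<^sub>R ?e" "\<lambda>s. s *\<^sub>R ?e" 0 UNIV F])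
          (auto intro!: derivative_eq_intros F)
      moreover have "(\<lambda>s. \<Sum>j\<in>UNIV. (s *\<^sub>R ?e) $ j * D j x) = (\<lambda>s. s * D i x)"
        by (auto simp: axis_def if_distrib if_distribR sum.delta fun_eq_iff cong: if_cong)
      moreover have "(\<lambda>s. s * D i x) = (*) (D i x)" by (auto simp: mult.commute)
      ultimately have "((\<lambda>s. F (x + s *\<^sub>R ?e)) has_real_derivative D i x) (at 0)"
        unfolding has_field_derivative_def by simp
      then have lim: "((\<lambda>s. (F (x + s *\<^sub>R ?e) - F x) / s) \<longlongrightarrow> D i x) (at 0)"
        by (simp add: DERIV_def)
      have "filterlim t (at 0) sequentially"
        unfolding filterlim_at using LIMSEQ_inverse_real_of_nat t(1)
        by (auto simp: t_def[abs_def] inverse_eq_divide less_imp_neq[symmetric])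
      from filterlim_compose[OF lim this] show "(\<lambda>k. Q k x) \<longlonglongrightarrow> D i x"
        by (simp add: Q_def add.commute)
    qed
    show "AE x in lborel. norm (Q k x) \<le> indicator (cball 0 (R + 1)) x *\<^sub>R L" for k
    proof (rule AE_I2)
      fix x :: "real ^ 'n"
      show "norm (Q k x) \<le> indicator (cball 0 (R + 1)) x *\<^sub>R L"
      proof (cases "x \<in> cball 0 (R + 1)")
        case True
        have "\<bar>F (t k *\<^sub>R ?e + x) - F x\<bar> \<le> L * norm (t k *\<^sub>R ?e)" using lip[of "t k *\<^sub>R ?e + x" x] by simp
        also have "\<dots> = L * t k" using t[of k] by (simp add: norm_axis_1)
        finally show ?thesis using True t[of k] by (simp add: Q_def divide_le_eq)
      next
        case False
        then have "norm x > R + 1" by simp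
        moreover have "norm x \<le> norm (t k *\<^sub>R ?e + x) + norm (t k *\<^sub>R ?e)"
          using norm_triangle_ineq4[of "t k *\<^sub>R ?e + x" "t k *\<^sub>R ?e"] by simp
        ultimately have "t k *\<^sub>R ?e + x \<notin> cball 0 R" "x \<notin> cball 0 R"
          using t[of k] by (auto simp: norm_axis_1)
        then have "F (t k *\<^sub>R ?e + x) = 0" "F x = 0" using R S(2) by blast+
        then show ?thesis using False by (simp add: Q_def)
      qed
    qed
  qed (auto simp: Q_def)
  moreover have "(LINT x|lborel. Q k x) = 0" for k
    using Fi lborel_integrable_shift[OF Fi, of "t k *\<^sub>R ?e"] lborel_integral_shift[of F "t k *\<^sub>R ?e"]
    by (simp add: Q_def)
  ultimately show ?thesis by (simp add: LIMSEQ_const_iff)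
qed

lemma integral_lebesgue_on_eq_lborel:
  fixes f :: "'a::euclidean_space \<Rightarrow> real"
  assumes f: "f \<in> borel_measurable borel" "\<And>x. x \<notin> \<Omega> \<Longrightarrow> f x = 0" and \<Omega>: "\<Omega> \<in> sets lebesgue"
  shows "(LINT x|lebesgue_on \<Omega>. f x) = (LINT x|lborel. f x)"
proof -
  have "(LINT x|lebesgue_on \<Omega>. f x) = (LINT x|lebesgue. indicator \<Omega> x * f x)"
    using \<Omega> by (simp add: integral_restrict_space)
  also have "\<dots> = (LINT x|lebesgue. f x)"
    using f(2) by (intro Bochner_Integration.integral_cong) (auto simp: indicator_def)
  also have "\<dots> = (LINT x|lborel. f x)" using f by (intro integral_completion) simp
  finally show ?thesis .
qed

definition grad :: "(real ^ 'n \<Rightarrow> real) \<Rightarrow> real ^ 'n \<Rightarrow> real ^ 'n" where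
  "grad \<phi> x = (\<chi> i. partial i \<phi> x)"

lemma grad_nth [simp]: "grad \<phi> x $ i = partial i \<phi> x"
  by (simp add: grad_def)

lemma grad_continuous: "\<phi> \<in> test_functions \<Omega> \<Longrightarrow> continuous_on S (grad \<phi>)"
  unfolding grad_def[abs_def]
  by (intro continuous_on_vec_lambda test_function_continuous[OF partial_test_function])

text \<open>Integration by parts: the partial derivatives of the product of two test functions have integral
  \<open>0\<close>.\<close>

lemma test_function_weak_gradient:
  fixes \<psi> :: "real ^ 'n \<Rightarrow> real"
  assumes \<psi>: "\<psi> \<in> test_functions UNIV" and \<Omega>: "\<Omega> \<in> sets lebesgue"
  shows "has_weak_gradient \<Omega> \<psi> (grad \<psi>)"
  unfolding has_weak_gradient_def
proof (intro conjI ballI allI)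
  show "\<psi> \<in> L1_loc \<Omega>" by (rule continuous_L1_loc[OF test_function_continuous[OF \<psi>]])
  show "grad \<psi> \<in> L1_loc \<Omega>" by (rule continuous_L1_loc[OF grad_continuous[OF \<psi>]])
  fix \<phi> :: "real ^ 'n \<Rightarrow> real" and i assume \<phi>: "\<phi> \<in> test_functions \<Omega>"
  obtain S where S: "compact S" "S \<subseteq> \<Omega>" "\<And>x. x \<notin> S \<Longrightarrow> \<phi> x = 0" "\<And>x i. x \<notin> S \<Longrightarrow> partial i \<phi> x = 0"
    using test_function_support[OF \<phi>] by blast
  have Sl: "S \<in> sets lebesgue" using S(1) by (auto simp: lmeasurable_compact fmeasurableD)
  have 0: "(LINT x|lborel. \<psi> x * partial i \<phi> x + partial i \<psi> x * \<phi> x) = 0"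
  proof (rule integral_partial_derivative_eq_0[where S = S and F = "\<lambda>x. \<psi> x * \<phi> x" and D = "\<lambda>i x. \<psi> x * partial i \<phi> x + partial i \<psi> x * \<phi> x"])
    fix x show "((\<lambda>x. \<psi> x * \<phi> x) has_derivative (\<lambda>h. \<Sum>i\<in>UNIV. h $ i * (\<psi> x * partial i \<phi> x + partial i \<psi> x * \<phi> x))) (at x)"
      using has_derivative_mult[OF test_function_has_derivative[OF \<psi>, of x] test_function_has_derivative[OF \<phi>, of x]]
      by (simp add: sum.distrib sum_distrib_left sum_distrib_right algebra_simps)
  next
    fix i show "continuous_on UNIV (\<lambda>x. \<psi> x * partial i \<phi> x + partial i \<psi> x * \<phi> x)"
      using \<phi> \<psi> by (intro continuous_intros test_function_continuous partial_test_function)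
  qed (use S in auto)
  obtain B where B: "\<And>x. \<bar>\<psi> x\<bar> \<le> B" using test_function_bounded[OF \<psi>] by metis
  obtain B' where B': "\<And>x. \<bar>partial i \<psi> x\<bar> \<le> B'" using test_function_bounded[OF partial_test_function[OF \<psi>]] by metis
  have 1: "integrable lborel (\<lambda>x. \<psi> x * partial i \<phi> x)"
    using test_function_integrable[OF partial_test_function[OF \<phi>]] B test_function_borel[OF \<psi>]
    by (intro integrable_mult_bounded[of _ _ _ B]) auto
  have 2: "integrable lborel (\<lambda>x. partial i \<psi> x * \<phi> x)"
    using test_function_integrable[OF \<phi>] B' test_function_borel[OF partial_test_function[OF \<psi>]]
    by (intro integrable_mult_bounded[of _ _ _ B']) auto
  have T: "(LINT x|lebesgue_on \<Omega>. f x * g x) = (LINT x|lborel. f x * g x)"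
    if "f \<in> borel_measurable borel" "g \<in> borel_measurable borel" "\<And>x. x \<notin> S \<Longrightarrow> g x = 0" for f g :: "real ^ 'n \<Rightarrow> real"
    using that S(2) by (intro integral_lebesgue_on_eq_lborel[OF _ _ \<Omega>]) auto
  have "(LINT x|lborel. \<psi> x * partial i \<phi> x) = - (LINT x|lborel. partial i \<psi> x * \<phi> x)"
    using 0 1 2 by simp
  then show "(LINT x|lebesgue_on \<Omega>. \<psi> x * partial i \<phi> x) = - (LINT x|lebesgue_on \<Omega>. grad \<psi> x $ i * \<phi> x)"
    using S T[of \<psi> "partial i \<phi>"] T[of "partial i \<psi>" \<phi>]
      test_function_borel[OF \<phi>] test_function_borel[OF \<psi>]
      test_function_borel[OF partial_test_function[OF \<phi>]] test_function_borel[OF partial_test_function[OF \<psi>]]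
    by simp
qed

lemma has_weak_gradient_add:
  assumes \<Omega>: "\<Omega> \<in> sets lebesgue" and u: "has_weak_gradient \<Omega> u G" and v: "has_weak_gradient \<Omega> v H"
  shows "has_weak_gradient \<Omega> (\<lambda>x. u x + v x) (\<lambda>x. G x + H x)"
  using u v unfolding has_weak_gradient_def
  by (auto simp: L1_loc_add distrib_right L1_loc_mult_test_integrable[OF _ \<Omega>] partial_test_function L1_loc_component)

lemma has_weak_gradient_diff:
  assumes \<Omega>: "\<Omega> \<in> sets lebesgue" and u: "has_weak_gradient \<Omega> u G" and v: "has_weak_gradient \<Omega> v H"
  shows "has_weak_gradient \<Omega> (\<lambda>x. u x - v x) (\<lambda>x. G x - H x)"
  using u v unfolding has_weak_gradient_def
  by (auto simp: L1_loc_diff left_diff_distrib L1_loc_mult_test_integrable[OF _ \<Omega>] partial_test_function L1_loc_component)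

text \<open>This is the definition of the weak gradient, tested with \<open>y \<mapsto> \<eta> (x - y)\<close>; the ball must lie in
  \<open>K\<close> for the cut off functions to agree with \<open>u\<close> and \<open>G\<close> on the support.\<close>

lemma conv_partial_mollifier:
  fixes u :: "real ^ 'n \<Rightarrow> real"
  assumes \<Omega>: "open \<Omega>" and u: "has_weak_gradient \<Omega> u G"
    and K: "compact K" "K \<subseteq> \<Omega>" and v: "borel_cut K u v" and w: "borel_cut K (\<lambda>x. G x $ i) w"
    and r: "r > 0" "cball x r \<subseteq> K"
  shows "conv (partial i (mollifier r)) v x = conv (mollifier r) w x"
proof -
  let ?\<eta> = "mollifier r :: real ^ 'n \<Rightarrow> real"
  define \<phi> where "\<phi> y = ?\<eta> (x - y)" for y
  have \<eta>: "?\<eta> \<in> test_functions UNIV" by (rule mollifier_test_function[OF r(1)])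
  have \<phi>: "\<phi> \<in> test_functions \<Omega>" unfolding \<phi>_def[abs_def] using r K by (intro mollifier_shift) auto
  have \<phi>': "partial k \<phi> y = - partial k ?\<eta> (x - y)" for y k
  proof (rule partial_eqI)
    show "(\<phi> has_derivative (\<lambda>h. \<Sum>i\<in>UNIV. h $ i * (- partial i ?\<eta> (x - y)))) (at y)"
      unfolding \<phi>_def[abs_def]
    proof -
      have "((\<lambda>y. x - y) has_derivative (\<lambda>h. - h)) (at y)" by (auto intro!: derivative_eq_intros)
      from has_derivative_compose[OF this test_function_has_derivative[OF \<eta>]]
      show "((\<lambda>y. ?\<eta> (x - y)) has_derivative (\<lambda>h. \<Sum>i\<in>UNIV. h $ i * (- partial i ?\<eta> (x - y)))) (at y)"
        by simp
    qed
  qed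
  have \<phi>0: "\<phi> y = 0" if "y \<notin> K" for y
    using that r mollifier_eq_0[OF r(1), of "x - y"] by (force simp: \<phi>_def dist_norm subset_iff)
  have "{y. \<phi> y \<noteq> 0} \<subseteq> K" using \<phi>0 by blast
  then have "closure {y. \<phi> y \<noteq> 0} \<subseteq> K" using K(1) by (simp add: closure_minimal compact_imp_closed)
  then have \<phi>'0: "partial i \<phi> y = 0" if "y \<notin> K" for y using that partial_zero_outside[OF \<phi>] by blast
  have Kl: "K \<in> sets lebesgue" "\<Omega> \<in> sets lebesgue" using K(1) \<Omega> by (auto simp: lmeasurable_compact fmeasurableD)
  have ui: "integrable (lebesgue_on K) u" "integrable (lebesgue_on K) (\<lambda>x. G x $ i)"
    using u K L1_loc_component[of G \<Omega> i] by (auto simp: has_weak_gradient_def L1_loc_def)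
  have "(LINT y|lborel. v y * partial i \<phi> y) = (LINT y|lebesgue_on \<Omega>. u y * partial i \<phi> y)"
    using borel_cut_integral[OF v K(2) Kl(2,1) test_function_borel[OF partial_test_function[OF \<phi>]] \<phi>'0, of "\<lambda>t. t"] ui
    by (auto dest: borel_measurable_integrable)
  also have "\<dots> = - (LINT y|lebesgue_on \<Omega>. G y $ i * \<phi> y)"
    using u \<phi> by (simp add: has_weak_gradient_def)
  also have "(LINT y|lebesgue_on \<Omega>. G y $ i * \<phi> y) = (LINT y|lborel. w y * \<phi> y)"
    using borel_cut_integral[OF w K(2) Kl(2,1) test_function_borel[OF \<phi>] \<phi>0, of "\<lambda>t. t"] ui
    by (auto dest: borel_measurable_integrable)
  finally have "(LINT y|lborel. v y * - partial i ?\<eta> (x - y)) = - (LINT y|lborel. w y * ?\<eta> (x - y))"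
    unfolding \<phi>' unfolding \<phi>_def .
  then show ?thesis by (simp add: conv_def mult.commute)
qed

lemma conv_continuous:
  assumes "\<phi> \<in> test_functions \<Omega>" "integrable lborel g"
  shows "continuous_on S (conv \<phi> g)"
  using C_diff_conv[OF assms, of 0] by (auto intro: continuous_on_subset)

lemma conv_eq_0:
  assumes "\<And>y. g y \<noteq> 0 \<Longrightarrow> \<phi> (x - y) = 0"
  shows "conv \<phi> g x = 0"
  unfolding conv_def using assms by (intro integral_eq_zero_AE AE_I2) auto

lemma partial_mollifier_eq_0:
  fixes x :: "real ^ 'n"
  assumes "r > 0" "r < norm x" shows "partial i (mollifier r) x = 0"
proof -
  have "{x :: real ^ 'n. mollifier r x \<noteq> 0} \<subseteq> cball 0 r"
    using mollifier_eq_0[OF assms(1)] by (force simp: not_le)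
  then have "closure {x :: real ^ 'n. mollifier r x \<noteq> 0} \<subseteq> cball 0 r" by (rule closure_minimal) simp
  then have "x \<notin> closure {x :: real ^ 'n. mollifier r x \<noteq> 0}" using assms(2) by auto
  then show ?thesis by (rule partial_zero_outside[OF mollifier_test_function[OF assms(1)]])
qed

lemma conv_mollifier_Lp_family:
  fixes g :: "'i \<Rightarrow> real ^ 'n \<Rightarrow> real"
  assumes p: "p \<ge> 1" and I: "finite I"
    and g: "\<And>i. i \<in> I \<Longrightarrow> integrable lborel (g i)" "\<And>i. i \<in> I \<Longrightarrow> integrable lborel (\<lambda>x. \<bar>g i x\<bar> powr p)"
    and e: "e > 0"
  shows "\<exists>d>0. \<forall>r. 0 < r \<and> r < d \<longrightarrow> (\<forall>i\<in>I. integrable lborel (\<lambda>x. \<bar>conv (mollifier r) (g i) x - g i x\<bar> powr p) \<and>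
     (LINT x|lborel. \<bar>conv (mollifier r) (g i) x - g i x\<bar> powr p) \<le> e)"
  using I g
proof (induction I rule: finite_induct)
  case empty
  show ?case by (intro exI[of _ 1]) auto
next
  case (insert j I)
  obtain d1 where d1: "d1 > 0" "\<And>r. 0 < r \<Longrightarrow> r < d1 \<Longrightarrow> (\<forall>i\<in>I. integrable lborel (\<lambda>x. \<bar>conv (mollifier r) (g i) x - g i x\<bar> powr p) \<and>
     (LINT x|lborel. \<bar>conv (mollifier r) (g i) x - g i x\<bar> powr p) \<le> e)"
    using insert.IH insert.prems by auto
  obtain d2 where d2: "d2 > 0" "\<And>r. 0 < r \<Longrightarrow> r < d2 \<Longrightarrow> integrable lborel (\<lambda>x. \<bar>conv (mollifier r) (g j) x - g j x\<bar> powr p) \<and>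
     (LINT x|lborel. \<bar>conv (mollifier r) (g j) x - g j x\<bar> powr p) \<le> e"
    using conv_mollifier_Lp[OF p _ _ e, of "g j"] insert.prems by auto
  show ?case
    by (intro exI[of _ "min d1 d2"]) (use d1 d2 in auto)
qed

lemma compact_neighbourhood:
  fixes S :: "'a::euclidean_space set"
  assumes "compact S" "open \<Omega>" "S \<subseteq> \<Omega>"
  obtains K \<delta> where "compact K" "\<delta> > 0" "S \<subseteq> K" "K \<subseteq> \<Omega>" "\<And>x. x \<in> S \<Longrightarrow> cball x \<delta> \<subseteq> K"
proof (cases "S = {}")
  case True
  then show ?thesis using that[of "{}" 1] by auto
next
  case False
  obtain e where e: "e > 0" "{x. infdist x S \<le> e} \<subseteq> \<Omega>"
    using compact_in_open_separated[OF False assms] by blast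
  show ?thesis
  proof (rule that[of "{x. infdist x S \<le> e}" e])
    show "compact {x. infdist x S \<le> e}" using False assms(1) e(1) by (rule compact_infdist_le)
    show "cball x e \<subseteq> {x. infdist x S \<le> e}" if "x \<in> S" for x
      using infdist_le2[OF that] by (auto simp: dist_commute)
  qed (use e in auto)
qed

lemma integral_tendsto_0_if_dominated:
  fixes F d :: "nat \<Rightarrow> 'a \<Rightarrow> real"
  assumes le: "\<And>j x. \<bar>F j x\<bar> \<le> c * \<bar>d j x\<bar>" and i: "\<And>j. integrable M (d j)"
    and lim: "(\<lambda>j. LINT x|M. \<bar>d j x\<bar>) \<longlonglongrightarrow> 0"
  shows "(\<lambda>j. LINT x|M. F j x) \<longlonglongrightarrow> 0"
proof (rule Lim_null_comparison[OF always_eventually tendsto_mult_right_zero[OF lim, of c]], rule allI)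
  fix j
  have "\<bar>LINT x|M. F j x\<bar> \<le> (LINT x|M. \<bar>F j x\<bar>)" by (rule integral_abs_bound)
  also have "\<dots> \<le> (LINT x|M. c * \<bar>d j x\<bar>)"
    by (rule integral_mono') (use i le in \<open>auto intro: order_trans[OF abs_ge_zero]\<close>)
  finally show "norm (LINT x|M. F j x) \<le> c * (LINT x|M. \<bar>d j x\<bar>)" by simp
qed

text \<open>The difference of two weak gradients of \<open>u\<close> is a weak gradient of \<open>0\<close>. Its mollifications vanish
  at points whose distance to the complement of \<open>\<Omega>\<close> exceeds the radius, and they converge to it
  locally in \<open>L\<^sup>1\<close>.\<close>

lemma weak_gradient_unique:
  fixes u :: "real ^ 'n \<Rightarrow> real"
  assumes \<Omega>: "open \<Omega>" and G: "has_weak_gradient \<Omega> u G" and G': "has_weak_gradient \<Omega> u G'"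
  shows "AE x in lebesgue_on \<Omega>. G x = G' x"
proof (rule AE_lebesgue_on_local[OF \<Omega>])
  fix a assume "a \<in> \<Omega>"
  then obtain s' where s': "s' > 0" "cball a s' \<subseteq> \<Omega>" using \<Omega> open_contains_cball by blast
  define s where "s = s' / 2"
  have s: "s > 0" "cball a (2 * s) \<subseteq> \<Omega>" using s' by (auto simp: s_def)
  let ?K = "cball a (2 * s)"
  have D: "has_weak_gradient \<Omega> (\<lambda>x. 0) (\<lambda>x. G x - G' x)"
    using has_weak_gradient_diff[OF _ G G'] \<Omega> by simp
  have "AE x in lebesgue. x \<in> ball a s \<longrightarrow> (G x - G' x) $ i = 0" for i
  proof -
    have "integrable (lebesgue_on ?K) (\<lambda>x. (G x - G' x) $ i)"
      using D L1_loc_component[of "\<lambda>x. G x - G' x" \<Omega> i] s by (simp add: has_weak_gradient_def L1_loc_def)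
    then obtain w where w: "borel_cut ?K (\<lambda>x. (G x - G' x) $ i) w"
      by (rule borel_cut_exists[OF compact_cball])
    have wi: "integrable lborel w" using w by (simp add: borel_cut_def)
    have [measurable]: "w \<in> borel_measurable borel" using borel_measurable_integrable[OF wi] by simp
    have z: "borel_cut ?K (\<lambda>x. 0) (\<lambda>x. 0)" by (simp add: borel_cut_def)
    have "(LINT x|lborel. indicator (ball a s) x * \<bar>w x\<bar>) \<le> e" if e: "e > 0" for e
    proof -
      obtain d where d: "d > 0" "\<And>r. 0 < r \<Longrightarrow> r < d \<Longrightarrow> integrable lborel (\<lambda>x. \<bar>conv (mollifier r) w x - w x\<bar> powr 1) \<and>
         (LINT x|lborel. \<bar>conv (mollifier r) w x - w x\<bar> powr 1) \<le> e"
        using conv_mollifier_Lp[of 1 w e] wi e by auto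
      define r where "r = min (d / 2) s"
      have r: "0 < r" "r < d" "r \<le> s" using d s by (auto simp: r_def)
      have 0: "conv (mollifier r) w x = 0" if "x \<in> ball a s" for x
      proof -
        have "cball x r \<subseteq> ?K"
        proof
          fix y assume "y \<in> cball x r"
          then show "y \<in> ?K" using that r dist_triangle[of a y x] by auto
        qed
        then have "conv (partial i (mollifier r)) (\<lambda>x. 0) x = conv (mollifier r) w x"
          using D s w z r by (intro conv_partial_mollifier[OF \<Omega> D]) auto
        then show ?thesis by (simp add: conv_def)
      qed
      have i: "integrable lborel (\<lambda>x. \<bar>conv (mollifier r) w x - w x\<bar>)"
        using d(2)[OF r(1,2)] by simp
      have "(LINT x|lborel. indicator (ball a s) x * \<bar>w x\<bar>) \<le> (LINT x|lborel. \<bar>conv (mollifier r) w x - w x\<bar>)"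
        using i 0 by (intro integral_mono') (auto simp: indicator_def)
      also have "\<dots> \<le> e" using d(2)[OF r(1,2)] by simp
      finally show ?thesis .
    qed
    then have "(LINT x|lborel. indicator (ball a s) x * \<bar>w x\<bar>) \<le> 0"
      using field_le_epsilon[of _ "0::real"] by simp
    moreover have "(LINT x|lborel. indicator (ball a s) x * \<bar>w x\<bar>) \<ge> 0"
      by (intro Bochner_Integration.integral_nonneg) simp
    ultimately have "(LINT x|lborel. indicator (ball a s) x * \<bar>w x\<bar>) = 0" by simp
    moreover have "integrable lborel (\<lambda>x. indicator (ball a s) x * \<bar>w x\<bar>)"
      using wi by (intro integrable_mult_bounded[of _ _ _ 1]) (auto simp: indicator_def)
    ultimately have "AE x in lborel. indicator (ball a s) x * \<bar>w x\<bar> = 0"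
      by (subst (asm) integral_nonneg_eq_0_iff_AE) auto
    then have "AE x in lebesgue. indicator (ball a s) x * \<bar>w x\<bar> = 0" by (rule AE_completion)
    moreover have "AE x in lebesgue. x \<in> ?K \<longrightarrow> w x = (G x - G' x) $ i" using w by (simp add: borel_cut_def)
    ultimately show ?thesis
    proof eventually_elim
      case (elim x)
      show ?case
      proof
        assume "x \<in> ball a s"
        then show "(G x - G' x) $ i = 0" using elim s by (auto simp: indicator_def)
      qed
    qed
  qed
  then have "AE x in lebesgue. \<forall>i. x \<in> ball a s \<longrightarrow> (G x - G' x) $ i = 0"
    by (intro eventually_all_finite) auto
  then have "AE x in lebesgue. x \<in> ball a s \<longrightarrow> G x = G' x"
    by (rule eventually_mono) (auto simp: vec_eq_iff)
  then show "\<exists>U. open U \<and> a \<in> U \<and> (AE x in lebesgue. x \<in> U \<longrightarrow> G x = G' x)"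
    using s by (intro exI[of _ "ball a s"]) auto
qed

lemma weak_gradient_eq_AE:
  assumes "open \<Omega>" "has_weak_gradient \<Omega> u G"
  shows "has_weak_gradient \<Omega> u (weak_gradient \<Omega> u)" "AE x in lebesgue_on \<Omega>. weak_gradient \<Omega> u x = G x"
proof -
  show 1: "has_weak_gradient \<Omega> u (weak_gradient \<Omega> u)"
    unfolding weak_gradient_def by (rule someI[of "has_weak_gradient \<Omega> u", OF assms(2)])
  show "AE x in lebesgue_on \<Omega>. weak_gradient \<Omega> u x = G x"
    by (rule weak_gradient_unique[OF assms(1) 1 assms(2)])
qed

text \<open>On a neighbourhood of the support of the test function the mollifications \<open>u\<^sub>j\<close> of \<open>u\<close> satisfy
  the chain rule classically, and \<open>H' (u\<^sub>j)\<close> converges almost everywhere and boundedly.\<close>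

lemma weak_gradient_chain_rule:
  fixes u :: "real ^ 'n \<Rightarrow> real" and H H' :: "real \<Rightarrow> real"
  assumes \<Omega>: "open \<Omega>" and u: "has_weak_gradient \<Omega> u G"
    and H: "\<And>t. (H has_real_derivative H' t) (at t)" and H': "continuous_on UNIV H'" and L: "\<And>t. \<bar>H' t\<bar> \<le> L"
  shows "has_weak_gradient \<Omega> (\<lambda>x. H (u x)) (\<lambda>x. H' (u x) *\<^sub>R G x)"
proof -
  have L0: "L \<ge> 0" using L[of 0] by linarith
  have Hc: "continuous_on UNIV H" by (auto intro!: continuous_at_imp_continuous_on DERIV_isCont H)
  have [measurable]: "H \<in> borel_measurable borel" "H' \<in> borel_measurable borel"
    using Hc H' by (auto intro: borel_measurable_continuous_onI)
  have lip: "\<bar>H s - H t\<bar> \<le> L * \<bar>s - t\<bar>" for s t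
  proof -
    have "norm (H s - H t) \<le> L * norm (s - t)"
      by (rule field_differentiable_bound[of UNIV H H']) (use H L in auto)
    then show ?thesis by simp
  qed
  have \<Omega>l: "\<Omega> \<in> sets lebesgue" using \<Omega> by simp
  have uK: "integrable (lebesgue_on K) u" and GK: "integrable (lebesgue_on K) G"
    and GKi: "integrable (lebesgue_on K) (\<lambda>x. G x $ i)" if "compact K" "K \<subseteq> \<Omega>" for K i
    using u L1_loc_component[of G \<Omega> i] that by (auto simp: has_weak_gradient_def L1_loc_def)
  have HG: "integrable (lebesgue_on K) (\<lambda>x. H' (u x) *\<^sub>R G x)" if K: "compact K" "K \<subseteq> \<Omega>" for K
  proof (rule Bochner_Integration.integrable_bound)
    show "integrable (lebesgue_on K) (\<lambda>x. L *\<^sub>R G x)" using GK[OF K] by simp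
    have [measurable]: "u \<in> borel_measurable (lebesgue_on K)" "G \<in> borel_measurable (lebesgue_on K)"
      using uK[OF K] GK[OF K] by auto
    show "(\<lambda>x. H' (u x) *\<^sub>R G x) \<in> borel_measurable (lebesgue_on K)" by measurable
    show "AE x in lebesgue_on K. norm (H' (u x) *\<^sub>R G x) \<le> norm (L *\<^sub>R G x)"
      using L L0 by (intro AE_I2) (auto intro!: mult_right_mono)
  qed
  have Hu: "integrable (lebesgue_on K) (\<lambda>x. H (u x))" if K: "compact K" "K \<subseteq> \<Omega>" for K
  proof (rule Bochner_Integration.integrable_bound)
    interpret finite_measure "lebesgue_on K"
      using K by (intro finite_measure_lebesgue_on lmeasurable_compact)
    show "integrable (lebesgue_on K) (\<lambda>x. \<bar>H 0\<bar> + L * \<bar>u x\<bar>)" using uK[OF K] by auto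
    have [measurable]: "u \<in> borel_measurable (lebesgue_on K)" using uK[OF K] by auto
    show "(\<lambda>x. H (u x)) \<in> borel_measurable (lebesgue_on K)" by measurable
    show "AE x in lebesgue_on K. norm (H (u x)) \<le> norm (\<bar>H 0\<bar> + L * \<bar>u x\<bar>)"
    proof (rule AE_I2)
      fix x show "norm (H (u x)) \<le> norm (\<bar>H 0\<bar> + L * \<bar>u x\<bar>)" using lip[of "u x" 0] L0 by auto
    qed
  qed
  show ?thesis
    unfolding has_weak_gradient_def
  proof (intro conjI ballI allI)
    show "(\<lambda>x. H (u x)) \<in> L1_loc \<Omega>" "(\<lambda>x. H' (u x) *\<^sub>R G x) \<in> L1_loc \<Omega>"
      using Hu HG by (auto simp: L1_loc_def)
    fix \<phi> :: "real ^ 'n \<Rightarrow> real" and i assume \<phi>: "\<phi> \<in> test_functions \<Omega>"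
    obtain S where S: "compact S" "S \<subseteq> \<Omega>" "\<And>x. x \<notin> S \<Longrightarrow> \<phi> x = 0" "\<And>x i. x \<notin> S \<Longrightarrow> partial i \<phi> x = 0"
      using test_function_support[OF \<phi>] by blast
    obtain K \<delta> where K: "compact K" "\<delta> > 0" "S \<subseteq> K" "K \<subseteq> \<Omega>" "\<And>x. x \<in> S \<Longrightarrow> cball x \<delta> \<subseteq> K"
      using compact_neighbourhood[OF S(1) \<Omega> S(2)] by blast
    have Kl: "K \<in> sets lebesgue" using K(1) by (auto simp: lmeasurable_compact fmeasurableD)
    obtain v where v: "borel_cut K u v" using borel_cut_exists[OF K(1) uK[OF K(1,4)]] .
    obtain w where w: "borel_cut K (\<lambda>x. G x $ i) w" using borel_cut_exists[OF K(1) GKi[OF K(1,4)]] .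
    have vi: "integrable lborel v" and wi: "integrable lborel w" using v w by (auto simp: borel_cut_def)
    have [measurable]: "v \<in> borel_measurable borel" "w \<in> borel_measurable borel"
      using borel_measurable_integrable[OF vi] borel_measurable_integrable[OF wi] by auto
    define good where "good j r \<longleftrightarrow> 0 < r \<and> r < \<delta> \<and> (LINT x|lborel. \<bar>conv (mollifier r) v x - v x\<bar>) \<le> 1 / real (Suc j)
        \<and> integrable lborel (\<lambda>x. conv (mollifier r) v x - v x)
        \<and> (LINT x|lborel. \<bar>conv (mollifier r) w x - w x\<bar>) \<le> 1 / real (Suc j)
        \<and> integrable lborel (\<lambda>x. conv (mollifier r) w x - w x)" for j r
    have "\<exists>r. good j r" for j
    proof -
      have e: "1 / real (Suc j) > 0" by simp
      obtain d where d: "d > 0" "\<And>r. 0 < r \<Longrightarrow> r < d \<Longrightarrow> \<forall>g\<in>{v, w}. integrable lborel (\<lambda>x. \<bar>conv (mollifier r) g x - g x\<bar> powr 1) \<and>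
         (LINT x|lborel. \<bar>conv (mollifier r) g x - g x\<bar> powr 1) \<le> 1 / real (Suc j)"
        using conv_mollifier_Lp_family[of 1 "{v, w}" "\<lambda>g. g", OF _ _ _ _ e] vi wi by auto
      define r where "r = min d \<delta> / 2"
      have r: "0 < r" "r < d" "r < \<delta>" using d K by (auto simp: r_def min_def)
      have [measurable]: "conv (mollifier r) v \<in> borel_measurable borel" "conv (mollifier r) w \<in> borel_measurable borel"
        using conv_continuous[OF mollifier_test_function[OF r(1)]] vi wi by (auto intro: borel_measurable_continuous_onI)
      show ?thesis using d(2)[OF r(1,2)] r
        unfolding good_def by (intro exI[of _ r]) (auto simp: integrable_abs_iff)
    qed
    then obtain r where "\<And>j. good j (r j)" by metis
    then have r: "\<And>j. 0 < r j" "\<And>j. r j < \<delta>"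
      "\<And>j. (LINT x|lborel. \<bar>conv (mollifier (r j)) v x - v x\<bar>) \<le> 1 / real (Suc j)"
      "\<And>j. integrable lborel (\<lambda>x. conv (mollifier (r j)) v x - v x)"
      "\<And>j. (LINT x|lborel. \<bar>conv (mollifier (r j)) w x - w x\<bar>) \<le> 1 / real (Suc j)"
      "\<And>j. integrable lborel (\<lambda>x. conv (mollifier (r j)) w x - w x)"
      by (auto simp: good_def)
    have lim1: "(\<lambda>j. 1 / real (Suc j)) \<longlonglongrightarrow> 0"
      using LIMSEQ_inverse_real_of_nat by (simp add: inverse_eq_divide)
    have V0: "(\<lambda>j. LINT x|lborel. \<bar>conv (mollifier (r j)) v x - v x\<bar>) \<longlonglongrightarrow> 0"
      by (rule tendsto_sandwich[OF always_eventually always_eventually tendsto_const lim1]) (auto simp del: of_nat_Suc intro: r)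
    have W0: "(\<lambda>j. LINT x|lborel. \<bar>conv (mollifier (r j)) w x - w x\<bar>) \<longlonglongrightarrow> 0"
      by (rule tendsto_sandwich[OF always_eventually always_eventually tendsto_const lim1]) (auto simp del: of_nat_Suc intro: r)
    obtain \<rho> where \<rho>: "strict_mono \<rho>" "AE x in lborel. (\<lambda>j. conv (mollifier (r (\<rho> j))) v x - v x) \<longlonglongrightarrow> 0"
      using tendsto_L1_AE_subseq[of lborel "\<lambda>j x. conv (mollifier (r j)) v x - v x"] r(4) V0 by auto
    define \<eta> :: "nat \<Rightarrow> real ^ 'n \<Rightarrow> real" where "\<eta> j = mollifier (r (\<rho> j))" for j
    define U where "U j = conv (\<eta> j) v" for j
    define W where "W j = conv (\<eta> j) w" for j
    have \<eta>: "\<eta> j \<in> test_functions UNIV" for j unfolding \<eta>_def by (rule mollifier_test_function[OF r(1)])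
    have Uc: "continuous_on UNIV (U j)" and Wc: "continuous_on UNIV (W j)" for j
      unfolding U_def W_def by (auto intro: conv_continuous \<eta> vi wi)
    have [measurable]: "U j \<in> borel_measurable borel" "W j \<in> borel_measurable borel" for j
      using Uc Wc by (auto intro: borel_measurable_continuous_onI)
    have UV: "(\<lambda>j. LINT x|lborel. \<bar>U j x - v x\<bar>) \<longlonglongrightarrow> 0" and WW: "(\<lambda>j. LINT x|lborel. \<bar>W j x - w x\<bar>) \<longlonglongrightarrow> 0"
      using LIMSEQ_subseq_LIMSEQ[OF V0 \<rho>(1)] LIMSEQ_subseq_LIMSEQ[OF W0 \<rho>(1)]
      by (simp_all add: U_def W_def \<eta>_def comp_def)
    have Ui: "integrable lborel (\<lambda>x. U j x - v x)" and Wi: "integrable lborel (\<lambda>x. W j x - w x)" for j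
      using r(4,6) by (auto simp: U_def W_def \<eta>_def)
    have UAE: "AE x in lborel. (\<lambda>j. U j x) \<longlonglongrightarrow> v x"
      using \<rho>(2) by (rule eventually_mono) (auto simp: U_def \<eta>_def LIM_zero_iff)
    obtain B where B: "\<And>x. \<bar>\<phi> x\<bar> \<le> B" using test_function_bounded[OF \<phi>] by metis
    obtain B' where B': "\<And>x. \<bar>partial i \<phi> x\<bar> \<le> B'" using test_function_bounded[OF partial_test_function[OF \<phi>]] by metis
    have B0: "B \<ge> 0" "B' \<ge> 0" using B[of 0] B'[of 0] by linarith+
    note [measurable] = test_function_borel[OF \<phi>] test_function_borel[OF partial_test_function[OF \<phi>]]
    have ibp: "(LINT x|lborel. H (U j x) * partial i \<phi> x) = - (LINT x|lborel. H' (U j x) * W j x * \<phi> x)" for j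
    proof -
      define E where "E i x = H (U j x) * partial i \<phi> x + H' (U j x) * conv (partial i (\<eta> j)) v x * \<phi> x" for i x
      note \<eta>' = partial_test_function[OF \<eta>]
      have H'U: "continuous_on UNIV (\<lambda>x. H' (U j x))" and HU: "continuous_on UNIV (\<lambda>x. H (U j x))"
        using Uc by (auto intro: continuous_on_compose2[OF H'] continuous_on_compose2[OF Hc])
      have Ec: "continuous_on UNIV (E i)" for i
        unfolding E_def[abs_def]
        by (intro continuous_intros HU H'U conv_continuous[OF \<eta>' vi] test_function_continuous[OF \<phi>]
            test_function_continuous[OF partial_test_function[OF \<phi>]])
      have "(LINT x|lborel. E i x) = 0"
      proof (rule integral_partial_derivative_eq_0[where F = "\<lambda>x. H (U j x) * \<phi> x" and S = S])
        fix x
        have "((\<lambda>x. H (U j x)) has_derivative (\<lambda>h. H' (U j x) * (\<Sum>i\<in>UNIV. h $ i * conv (partial i (\<eta> j)) v x))) (at x)"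
          using has_derivative_compose[OF conv_has_derivative[OF \<eta>[of j] vi, of x] H[unfolded has_field_derivative_def]]
          by (simp add: U_def)
        from has_derivative_mult[OF this test_function_has_derivative[OF \<phi>]]
        show "((\<lambda>x. H (U j x) * \<phi> x) has_derivative (\<lambda>h. \<Sum>i\<in>UNIV. h $ i * E i x)) (at x)"
          by (simp add: E_def sum.distrib sum_distrib_left sum_distrib_right algebra_simps)
      qed (use Ec S in \<open>auto simp: E_def\<close>)
      also have "(LINT x|lborel. E i x) = (LINT x|lborel. H (U j x) * partial i \<phi> x + H' (U j x) * W j x * \<phi> x)"
      proof (intro Bochner_Integration.integral_cong refl)
        fix x
        show "E i x = H (U j x) * partial i \<phi> x + H' (U j x) * W j x * \<phi> x"
        proof (cases "x \<in> S")
          case True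
          have "cball x (r (\<rho> j)) \<subseteq> K" using K(5)[OF True] r(2)[of "\<rho> j"] by force
          then have "conv (partial i (\<eta> j)) v x = W j x"
            unfolding \<eta>_def W_def using r(1) by (intro conv_partial_mollifier[OF \<Omega> u K(1,4) v w]) auto
          then show ?thesis by (simp add: E_def)
        qed (use S in \<open>simp add: E_def\<close>)
      qed
      also have "\<dots> = (LINT x|lborel. H (U j x) * partial i \<phi> x) + (LINT x|lborel. H' (U j x) * W j x * \<phi> x)"
        using S by (intro Bochner_Integration.integral_add continuous_compact_support_integrable[where S = S]
            continuous_intros HU H'U Wc test_function_continuous[OF \<phi>] test_function_continuous[OF partial_test_function[OF \<phi>]]) auto
      finally show ?thesis by simp
    qed
    have i1: "integrable lborel (\<lambda>x. H (U j x) * partial i \<phi> x)" for j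
      using S by (intro continuous_compact_support_integrable[where S = S] continuous_intros continuous_on_compose2[OF Hc Uc]
          test_function_continuous[OF partial_test_function[OF \<phi>]]) auto
    have Hle: "\<bar>(H (U j x) - H (v x)) * partial i \<phi> x\<bar> \<le> L * B' * \<bar>U j x - v x\<bar>" for j x
    proof -
      have "\<bar>H (U j x) - H (v x)\<bar> * \<bar>partial i \<phi> x\<bar> \<le> (L * \<bar>U j x - v x\<bar>) * B'"
        using L0 by (intro mult_mono lip B') auto
      then show ?thesis by (simp add: abs_mult mult_ac)
    qed
    have idiff: "integrable lborel (\<lambda>x. (H (U j x) - H (v x)) * partial i \<phi> x)" for j
      by (rule Bochner_Integration.integrable_bound[of _ "\<lambda>x. L * B' * \<bar>U j x - v x\<bar>"])
        (use Ui Hle in \<open>auto intro!: AE_I2 intro: order_trans[OF _ abs_ge_self]\<close>)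
    have i2: "integrable lborel (\<lambda>x. H (v x) * partial i \<phi> x)"
      using Bochner_Integration.integrable_diff[OF i1[of 0] idiff[of 0]] by (simp add: left_diff_distrib)
    have "(LINT x|lborel. (H (U j x) - H (v x)) * partial i \<phi> x)
        = (LINT x|lborel. H (U j x) * partial i \<phi> x) - (LINT x|lborel. H (v x) * partial i \<phi> x)" for j
      unfolding left_diff_distrib by (rule Bochner_Integration.integral_diff[OF i1 i2])
    then have LHS: "(\<lambda>j. LINT x|lborel. H (U j x) * partial i \<phi> x) \<longlonglongrightarrow> (LINT x|lborel. H (v x) * partial i \<phi> x)"
      using integral_tendsto_0_if_dominated[OF Hle Ui UV] by (simp add: LIM_zero_iff)
    have bnd: "\<bar>H' t * s * \<phi> x\<bar> \<le> L * B * \<bar>s\<bar>" for t s x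
    proof -
      have "\<bar>H' t\<bar> * \<bar>s\<bar> * \<bar>\<phi> x\<bar> \<le> L * \<bar>s\<bar> * B"
        using L0 by (intro mult_mono L B) auto
      then show ?thesis by (simp add: abs_mult mult_ac)
    qed
    have R1: "(\<lambda>j. LINT x|lborel. H' (U j x) * w x * \<phi> x) \<longlonglongrightarrow> (LINT x|lborel. H' (v x) * w x * \<phi> x)"
    proof (rule integral_dominated_convergence[where w = "\<lambda>x. L * B * \<bar>w x\<bar>"])
      show "AE x in lborel. (\<lambda>j. H' (U j x) * w x * \<phi> x) \<longlonglongrightarrow> H' (v x) * w x * \<phi> x"
        using UAE
      proof eventually_elim
        case (elim x)
        have "isCont H' (v x)" using H' by (simp add: continuous_on_eq_continuous_at)
        from isCont_tendsto_compose[OF this elim] show ?case by (intro tendsto_intros)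
      qed
      show "AE x in lborel. norm (H' (U j x) * w x * \<phi> x) \<le> L * B * \<bar>w x\<bar>" for j
        using bnd by (intro AE_I2) simp
    qed (use wi in \<open>auto\<close>)
    have iw: "integrable lborel (\<lambda>x. H' (U j x) * w x * \<phi> x)" for j
      by (rule Bochner_Integration.integrable_bound[of _ "\<lambda>x. L * B * \<bar>w x\<bar>"])
        (use wi bnd in \<open>auto intro!: AE_I2 intro: order_trans[OF _ abs_ge_self]\<close>)
    have iWw: "integrable lborel (\<lambda>x. H' (U j x) * (W j x - w x) * \<phi> x)" for j
      by (rule Bochner_Integration.integrable_bound[of _ "\<lambda>x. L * B * \<bar>W j x - w x\<bar>"])
        (use Wi bnd in \<open>auto intro!: AE_I2 intro: order_trans[OF _ abs_ge_self]\<close>)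
    have R2: "(\<lambda>j. LINT x|lborel. H' (U j x) * (W j x - w x) * \<phi> x) \<longlonglongrightarrow> 0"
      by (rule integral_tendsto_0_if_dominated[OF bnd Wi WW])
    have "(LINT x|lborel. H' (U j x) * W j x * \<phi> x) = (LINT x|lborel. H' (U j x) * w x * \<phi> x) + (LINT x|lborel. H' (U j x) * (W j x - w x) * \<phi> x)" for j
      using iw[of j] iWw[of j] by (subst Bochner_Integration.integral_add[symmetric]) (auto simp: algebra_simps)
    then have RHS: "(\<lambda>j. LINT x|lborel. H' (U j x) * W j x * \<phi> x) \<longlonglongrightarrow> (LINT x|lborel. H' (v x) * w x * \<phi> x)"
      using tendsto_add[OF R1 R2] by simp
    have "(LINT x|lborel. H (v x) * partial i \<phi> x) = - (LINT x|lborel. H' (v x) * w x * \<phi> x)"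
      using LIMSEQ_unique[OF LHS] tendsto_minus[OF RHS] by (simp add: ibp)
    moreover have "(LINT x|lebesgue_on \<Omega>. H (u x) * partial i \<phi> x) = (LINT x|lborel. H (v x) * partial i \<phi> x)"
    proof (rule borel_cut_integral[OF v K(4) \<Omega>l Kl])
      show "partial i \<phi> x = 0" if "x \<notin> K" for x using S(4) K(3) that by blast
      show "u \<in> borel_measurable (lebesgue_on K)" using uK[OF K(1,4)] by auto
    qed measurable
    moreover have "(LINT x|lebesgue_on \<Omega>. (H' (u x) * G x $ i) * \<phi> x) = (LINT x|lborel. (H' (v x) * w x) * \<phi> x)"
    proof -
      have "integrable lborel (\<lambda>x. H' (v x) * w x)"
        using wi L by (intro integrable_mult_bounded[of _ _ _ L]) auto
      then have cut: "borel_cut K (\<lambda>x. H' (u x) * G x $ i) (\<lambda>x. H' (v x) * w x)"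
        using v w unfolding borel_cut_def by (auto elim!: eventually_elim2)
      show ?thesis
      proof (rule borel_cut_integral[OF cut K(4) \<Omega>l Kl, of \<phi> "\<lambda>t. t"])
        show "\<phi> x = 0" if "x \<notin> K" for x using S(3) K(3) that by blast
        have [measurable]: "u \<in> borel_measurable (lebesgue_on K)" "(\<lambda>x. G x $ i) \<in> borel_measurable (lebesgue_on K)"
          using uK[OF K(1,4)] GKi[OF K(1,4), of i] by auto
        show "(\<lambda>x. H' (u x) * G x $ i) \<in> borel_measurable (lebesgue_on K)" by measurable
      qed measurable
    qed
    ultimately show "(LINT x|lebesgue_on \<Omega>. H (u x) * partial i \<phi> x) = - (LINT x|lebesgue_on \<Omega>. (H' (u x) *\<^sub>R G x) $ i * \<phi> x)"
      by simp
  qed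
qed

section \<open>Lebesgue spaces\<close>

lemma norm_powr_le_components:
  fixes x :: "real ^ 'n"
  assumes "p \<ge> 0"
  shows "norm x powr p \<le> real CARD('n) powr p * (\<Sum>i\<in>UNIV. \<bar>x $ i\<bar> powr p)"
proof -
  obtain k where k: "\<And>i. \<bar>x $ i\<bar> \<le> \<bar>x $ k\<bar>"
  proof -
    have "Max (range (\<lambda>i. \<bar>x $ i\<bar>)) \<in> range (\<lambda>i. \<bar>x $ i\<bar>)" by (intro Max_in) auto
    then obtain k where "Max (range (\<lambda>i. \<bar>x $ i\<bar>)) = \<bar>x $ k\<bar>" by (rule imageE)
    moreover have "\<bar>x $ i\<bar> \<le> Max (range (\<lambda>i. \<bar>x $ i\<bar>))" for i by (intro Max_ge) auto
    ultimately show ?thesis by (intro that[of k]) simp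
  qed
  have "norm x \<le> (\<Sum>i\<in>UNIV. \<bar>x $ i\<bar>)" by (rule norm_le_l1_cart)
  also have "\<dots> \<le> real CARD('n) * \<bar>x $ k\<bar>" using sum_bounded_above[of UNIV "\<lambda>i. \<bar>x $ i\<bar>" "\<bar>x $ k\<bar>"] k by simp
  finally have "norm x powr p \<le> (real CARD('n) * \<bar>x $ k\<bar>) powr p" using assms by (intro powr_mono2) auto
  also have "\<dots> = real CARD('n) powr p * \<bar>x $ k\<bar> powr p" by (simp add: powr_mult)
  also have "\<dots> \<le> real CARD('n) powr p * (\<Sum>i\<in>UNIV. \<bar>x $ i\<bar> powr p)"
    by (intro mult_left_mono member_le_sum) auto
  finally show ?thesis .
qed

lemma norm_add_powr_le:
  fixes a b :: "'a::real_normed_vector"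
  assumes "p \<ge> 0"
  shows "norm (a + b) powr p \<le> 2 powr p * (norm a powr p + norm b powr p)"
proof -
  have "norm (a + b) powr p \<le> \<bar>norm a + norm b\<bar> powr p"
    using assms norm_triangle_ineq[of a b] by (intro powr_mono2) auto
  also have "\<dots> \<le> 2 powr p * (norm a powr p + norm b powr p)"
    using powr_add_le[OF assms, of "norm a" "norm b"] by simp
  finally show ?thesis .
qed

lemma LpD:
  assumes "g \<in> Lp s \<Omega>"
  shows "g \<in> borel_measurable (lebesgue_on \<Omega>)" "integrable (lebesgue_on \<Omega>) (\<lambda>x. norm (g x) powr s)"
  using assms by (auto simp: Lp_def)

lemma Lp_bound:
  assumes h: "h \<in> Lp s \<Omega>" and s: "s \<ge> 0" and g: "g \<in> borel_measurable (lebesgue_on \<Omega>)"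
    and le: "AE x in lebesgue_on \<Omega>. norm (g x) \<le> c * norm (h x)"
  shows "g \<in> Lp s \<Omega>"
proof -
  have "integrable (lebesgue_on \<Omega>) (\<lambda>x. norm (g x) powr s)"
  proof (rule Bochner_Integration.integrable_bound)
    show "integrable (lebesgue_on \<Omega>) (\<lambda>x. \<bar>c\<bar> powr s * norm (h x) powr s)" using LpD(2)[OF h] by simp
    show "AE x in lebesgue_on \<Omega>. norm (norm (g x) powr s) \<le> norm (\<bar>c\<bar> powr s * norm (h x) powr s)"
      using le
    proof eventually_elim
      case (elim x)
      then have "norm (g x) \<le> \<bar>c\<bar> * norm (h x)" by (meson abs_ge_self mult_right_mono norm_ge_zero order_trans)
      then have "norm (g x) powr s \<le> (\<bar>c\<bar> * norm (h x)) powr s" using s by (intro powr_mono2) auto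
      then show ?case by (simp add: powr_mult)
    qed
  qed (use g in measurable)
  with g show ?thesis by (simp add: Lp_def)
qed

lemma Lp_add:
  assumes "f \<in> Lp s \<Omega>" "g \<in> Lp s \<Omega>" "s \<ge> 0" shows "(\<lambda>x. f x + g x) \<in> Lp s \<Omega>"
proof -
  note [measurable] = LpD(1)[OF assms(1)] LpD(1)[OF assms(2)]
  have "integrable (lebesgue_on \<Omega>) (\<lambda>x. norm (f x + g x) powr s)"
  proof (rule Bochner_Integration.integrable_bound)
    show "integrable (lebesgue_on \<Omega>) (\<lambda>x. 2 powr s * (norm (f x) powr s + norm (g x) powr s))"
      using LpD(2)[OF assms(1)] LpD(2)[OF assms(2)] by simp
    show "AE x in lebesgue_on \<Omega>. norm (norm (f x + g x) powr s) \<le> norm (2 powr s * (norm (f x) powr s + norm (g x) powr s))"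
      using norm_add_powr_le[OF assms(3)] by (intro AE_I2) (auto intro!: order_trans[OF _ abs_ge_self])
  qed measurable
  then show ?thesis by (simp add: Lp_def)
qed

lemma Lp_uminus: "f \<in> Lp s \<Omega> \<Longrightarrow> (\<lambda>x. - f x) \<in> Lp s \<Omega>"
  by (simp add: Lp_def)

lemma Lp_diff:
  assumes "f \<in> Lp s \<Omega>" "g \<in> Lp s \<Omega>" "s \<ge> 0" shows "(\<lambda>x. f x - g x) \<in> Lp s \<Omega>"
  using Lp_add[OF assms(1) Lp_uminus[OF assms(2)] assms(3)] by simp

lemma Lp_mono:
  assumes \<Omega>: "\<Omega> \<in> lmeasurable" and g: "g \<in> Lp s \<Omega>" and t: "0 \<le> t" "t \<le> s"
  shows "g \<in> Lp t \<Omega>"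
proof -
  interpret finite_measure "lebesgue_on \<Omega>" using \<Omega> by (rule finite_measure_lebesgue_on)
  note [measurable] = LpD(1)[OF g]
  have "integrable (lebesgue_on \<Omega>) (\<lambda>x. norm (g x) powr t)"
  proof (rule Bochner_Integration.integrable_bound)
    show "integrable (lebesgue_on \<Omega>) (\<lambda>x. 1 + norm (g x) powr s)" using LpD(2)[OF g] by simp
    show "AE x in lebesgue_on \<Omega>. norm (norm (g x) powr t) \<le> norm (1 + norm (g x) powr s)"
      using powr_le_one_add_powr[OF t norm_ge_zero] by (intro AE_I2) simp
  qed measurable
  then show ?thesis by (simp add: Lp_def)
qed

lemma Lp_one_integrable:
  assumes "g \<in> Lp 1 \<Omega>" shows "integrable (lebesgue_on \<Omega>) g"
  using assms by (auto simp: Lp_def integrable_norm_iff)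

lemma bounded_imp_Lp:
  assumes \<Omega>: "\<Omega> \<in> lmeasurable" and g: "g \<in> borel_measurable (lebesgue_on \<Omega>)" "AE x in lebesgue_on \<Omega>. norm (g x) \<le> c" and s: "s \<ge> 0"
  shows "g \<in> Lp s \<Omega>"
proof -
  interpret finite_measure "lebesgue_on \<Omega>" using \<Omega> by (rule finite_measure_lebesgue_on)
  have "(\<lambda>x. 1 :: real) \<in> Lp s \<Omega>" by (simp add: Lp_def)
  from Lp_bound[OF this s g(1), of c] g(2) show ?thesis by simp
qed

lemma test_function_Lp:
  fixes \<phi> :: "real ^ 'n \<Rightarrow> real"
  assumes \<Omega>: "\<Omega> \<in> lmeasurable" and \<phi>: "\<phi> \<in> test_functions \<Omega>'" and s: "s \<ge> 0"
  shows "\<phi> \<in> Lp s \<Omega>" "grad \<phi> \<in> Lp s \<Omega>"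
proof -
  obtain B where B: "\<And>x. \<bar>\<phi> x\<bar> \<le> B" using test_function_bounded[OF \<phi>] by metis
  show "\<phi> \<in> Lp s \<Omega>"
    using B by (intro bounded_imp_Lp[OF \<Omega> borel_imp_lebesgue_on[OF test_function_borel[OF \<phi>]] _ s, of B]) auto
  have "\<exists>B. \<forall>x. \<bar>partial i \<phi> x\<bar> \<le> B" for i
    using test_function_bounded[OF partial_test_function[OF \<phi>]] by metis
  then obtain B' where B': "\<And>i x. \<bar>partial i \<phi> x\<bar> \<le> B' i" by metis
  have "norm (grad \<phi> x) \<le> (\<Sum>i\<in>UNIV. B' i)" for x
    by (rule order_trans[OF norm_le_l1_cart]) (auto intro!: sum_mono B')
  then show "grad \<phi> \<in> Lp s \<Omega>"
    by (intro bounded_imp_Lp[OF \<Omega> borel_imp_lebesgue_on[OF borel_measurable_continuous_onI[OF grad_continuous[OF \<phi>]]] _ s]) auto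
qed

lemma borel_measurable_lebesgue_on_AE:
  fixes f g :: "'a::euclidean_space \<Rightarrow> 'b::euclidean_space"
  assumes S: "S \<in> sets lebesgue" and f: "f \<in> borel_measurable (lebesgue_on S)" and ae: "AE x in lebesgue_on S. f x = g x"
  shows "g \<in> borel_measurable (lebesgue_on S)"
proof -
  have "(\<lambda>x. indicator S x *\<^sub>R f x) \<in> borel_measurable lebesgue"
    using f S by (subst (asm) borel_measurable_restrict_space_iff) auto
  then have "(\<lambda>x. indicator S x *\<^sub>R g x) \<in> borel_measurable lebesgue"
    by (rule borel_measurable_AE) (use ae S in \<open>auto simp: AE_lebesgue_on_iff indicator_def elim!: eventually_mono\<close>)
  then show ?thesis using S by (subst borel_measurable_restrict_space_iff) auto
qed

lemma integral_lebesgue_on_le_lborel: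
  fixes F f :: "'a::euclidean_space \<Rightarrow> real"
  assumes F: "integrable lborel F" "\<And>x. F x \<ge> 0" and S: "S \<in> sets lebesgue"
    and le: "AE x in lebesgue_on S. f x \<le> F x"
  shows "(LINT x|lebesgue_on S. f x) \<le> (LINT x|lborel. F x)"
proof -
  have Fl: "integrable lebesgue F" using F(1) by (subst integrable_completion) auto
  have FS: "integrable (lebesgue_on S) F" using S integrable_mult_indicator[OF S Fl] by (simp add: integrable_restrict_space)
  have "(LINT x|lebesgue_on S. f x) \<le> (LINT x|lebesgue_on S. F x)"
  proof (cases "integrable (lebesgue_on S) f")
    case True then show ?thesis by (rule integral_mono_AE[OF _ FS le])
  next
    case False
    then show ?thesis using F(2) by (simp add: not_integrable_integral_eq)
  qed
  also have "\<dots> = (LINT x|lebesgue. indicator S x * F x)" using S by (simp add: integral_restrict_space)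
  also have "\<dots> \<le> (LINT x|lebesgue. F x)"
    using Fl F(2) by (intro integral_mono') (auto simp: indicator_def)
  also have "\<dots> = (LINT x|lborel. F x)" using F(1) by (intro integral_completion) auto
  finally show ?thesis .
qed

lemma borel_cut_Lp:
  assumes u: "u \<in> Lp p \<Omega>" and K: "compact K" "K \<subseteq> \<Omega>" and \<Omega>: "\<Omega> \<in> sets lebesgue" and v: "borel_cut K u v"
  shows "integrable lborel (\<lambda>x. \<bar>v x\<bar> powr p)"
proof -
  have Kl: "K \<in> sets lebesgue" using K by (auto simp: lmeasurable_compact fmeasurableD)
  have [measurable]: "v \<in> borel_measurable borel" using v by (auto simp: borel_cut_def dest: borel_measurable_integrable)
  have "integrable (lebesgue_on K) (\<lambda>x. norm (u x) powr p)"
    by (rule integrable_lebesgue_on_subset[OF LpD(2)[OF u] K(2) \<Omega> Kl])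
  then have i: "integrable lebesgue (\<lambda>x. indicator K x * \<bar>u x\<bar> powr p)"
    using Kl by (simp add: integrable_restrict_space)
  have "(\<lambda>x. \<bar>v x\<bar> powr p) \<in> borel_measurable lborel" by measurable
  then have m: "(\<lambda>x. \<bar>v x\<bar> powr p) \<in> borel_measurable lebesgue" by (rule measurable_completion)
  have "AE x in lebesgue. indicator K x * \<bar>u x\<bar> powr p = \<bar>v x\<bar> powr p"
    using v by (auto simp: borel_cut_def indicator_def elim!: eventually_mono)
  then have "integrable lebesgue (\<lambda>x. \<bar>v x\<bar> powr p)"
    using i m by (subst integrable_cong_AE[where g = "\<lambda>x. indicator K x * \<bar>u x\<bar> powr p"]) (auto elim: eventually_mono)
  then show ?thesis by (subst (asm) integrable_completion) auto
qed

section \<open>Sobolev functions with zero boundary values\<close>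

text \<open>The mollification of \<open>u\<close> is a test function, and near \<open>S\<close> its gradient is the mollification of
  \<open>G\<close>; elsewhere both vanish. The convergence in \<open>L\<^sup>p\<close> therefore applies to \<open>u\<close> and to \<open>G\<close>. Two nested
  neighbourhoods of \<open>S\<close> are needed: \<open>K1\<close> contains the support of the mollification, and \<open>K\<close> contains
  the balls around the points of \<open>K1\<close> on which the weak gradient is tested.\<close>

lemma compact_support_approximation:
  fixes u :: "real ^ 'n \<Rightarrow> real"
  assumes \<Omega>: "open \<Omega>" and p: "p \<ge> 1" and u: "u \<in> Lp p \<Omega>" "G \<in> Lp p \<Omega>" "has_weak_gradient \<Omega> u G"
    and S: "compact S" "S \<subseteq> \<Omega>" "AE x in lebesgue_on \<Omega>. x \<notin> S \<longrightarrow> u x = 0 \<and> G x = 0" and e: "e > 0"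
  obtains \<phi> where "\<phi> \<in> test_functions \<Omega>" "(LINT x|lebesgue_on \<Omega>. \<bar>u x - \<phi> x\<bar> powr p) < e"
    "(LINT x|lebesgue_on \<Omega>. norm (G x - grad \<phi> x) powr p) < e"
proof -
  have \<Omega>l: "\<Omega> \<in> sets lebesgue" using \<Omega> by simp
  obtain K1 \<delta>1 where K1: "compact K1" "\<delta>1 > 0" "S \<subseteq> K1" "K1 \<subseteq> \<Omega>" "\<And>x. x \<in> S \<Longrightarrow> cball x \<delta>1 \<subseteq> K1"
    using compact_neighbourhood[OF S(1) \<Omega> S(2)] by blast
  obtain K \<delta>2 where K: "compact K" "\<delta>2 > 0" "K1 \<subseteq> K" "K \<subseteq> \<Omega>" "\<And>x. x \<in> K1 \<Longrightarrow> cball x \<delta>2 \<subseteq> K"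
    using compact_neighbourhood[OF K1(1) \<Omega> K1(4)] by blast
  have cut: "\<exists>v. borel_cut S g v \<and> borel_cut K g v \<and> integrable lborel (\<lambda>x. \<bar>v x\<bar> powr p)
      \<and> (AE x in lebesgue_on \<Omega>. g x = v x)"
    if g: "g \<in> L1_loc \<Omega>" "g \<in> Lp p \<Omega>" "AE x in lebesgue_on \<Omega>. x \<notin> S \<longrightarrow> g x = 0" for g
  proof -
    have "integrable (lebesgue_on S) g" using g S by (simp add: L1_loc_def)
    then obtain v where v: "borel_cut S g v" using borel_cut_exists[OF S(1)] by blast
    have ae: "AE x in lebesgue. x \<in> \<Omega> \<longrightarrow> g x = v x"
      using g(3) v unfolding AE_lebesgue_on_iff[OF \<Omega>l] borel_cut_def
      by (auto elim!: eventually_elim2)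
    have "borel_cut K g v" using v K1 K ae unfolding borel_cut_def by (auto elim!: eventually_mono)
    then show ?thesis
      using v ae borel_cut_Lp[OF g(2) S(1,2) \<Omega>l v] AE_lebesgue_on_iff[OF \<Omega>l] by auto
  qed
  obtain v where v: "borel_cut S u v" "borel_cut K u v" "integrable lborel (\<lambda>x. \<bar>v x\<bar> powr p)" "AE x in lebesgue_on \<Omega>. u x = v x"
  proof -
    have "AE x in lebesgue_on \<Omega>. x \<notin> S \<longrightarrow> u x = 0" using S(3) by (rule eventually_mono) auto
    then show ?thesis using cut[of u] u that by (auto simp: has_weak_gradient_def)
  qed
  define cutof where "cutof i w \<longleftrightarrow> borel_cut S (\<lambda>x. G x $ i) w \<and> borel_cut K (\<lambda>x. G x $ i) w \<and> integrable lborel (\<lambda>x. \<bar>w x\<bar> powr p)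
      \<and> (AE x in lebesgue_on \<Omega>. G x $ i = w x)" for i w
  have "\<exists>w. cutof i w" for i
    unfolding cutof_def
  proof (rule cut)
    show "(\<lambda>x. G x $ i) \<in> L1_loc \<Omega>" using u by (auto simp: has_weak_gradient_def intro: L1_loc_component)
    have "(\<lambda>x. G x \<bullet> axis i 1) \<in> borel_measurable (lebesgue_on \<Omega>)" using LpD(1)[OF u(2)] by measurable
    then have "(\<lambda>x. G x $ i) \<in> borel_measurable (lebesgue_on \<Omega>)" by (simp add: inner_axis)
    then show "(\<lambda>x. G x $ i) \<in> Lp p \<Omega>"
      using p by (intro Lp_bound[OF u(2), of _ 1]) (auto simp: component_le_norm_cart)
    show "AE x in lebesgue_on \<Omega>. x \<notin> S \<longrightarrow> G x $ i = 0" using S(3) by (rule eventually_mono) auto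
  qed
  then obtain w where "\<And>i. cutof i (w i)" by metis
  then have w: "\<And>i. borel_cut S (\<lambda>x. G x $ i) (w i)" "\<And>i. borel_cut K (\<lambda>x. G x $ i) (w i)"
    "\<And>i. integrable lborel (\<lambda>x. \<bar>w i x\<bar> powr p)" "\<And>i. AE x in lebesgue_on \<Omega>. G x $ i = w i x"
    by (auto simp: cutof_def)
  have vi: "integrable lborel v" and wi: "integrable lborel (w i)" for i
    using v w by (auto simp: borel_cut_def)
  define n where "n = real CARD('n)"
  have n: "n > 0" by (simp add: n_def)
  define e' where "e' = e / (2 * (1 + n powr p * n))"
  have d0: "1 + n powr p * n > 0" using n by (simp add: add_pos_pos)
  have e': "e' > 0" using e d0 by (simp add: e'_def)
  have e'2: "e' * (1 + n powr p * n) = e / 2" 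
  proof -
    have "e / (2 * c) * c = e / 2" if "c > 0" for c :: real using that by simp
    from this[OF d0] show ?thesis by (simp only: e'_def)
  qed
  obtain d1 where d1: "d1 > 0" "\<And>r. 0 < r \<Longrightarrow> r < d1 \<Longrightarrow> integrable lborel (\<lambda>x. \<bar>conv (mollifier r) v x - v x\<bar> powr p) \<and>
     (LINT x|lborel. \<bar>conv (mollifier r) v x - v x\<bar> powr p) \<le> e'"
    using conv_mollifier_Lp[OF p vi v(3) e'] by blast
  obtain d2 where d2: "d2 > 0" "\<And>r i. 0 < r \<Longrightarrow> r < d2 \<Longrightarrow> integrable lborel (\<lambda>x. \<bar>conv (mollifier r) (w i) x - w i x\<bar> powr p) \<and>
     (LINT x|lborel. \<bar>conv (mollifier r) (w i) x - w i x\<bar> powr p) \<le> e'"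
    using conv_mollifier_Lp_family[OF p finite[of UNIV], of w, OF wi w(3) e'] by blast
  define r where "r = Min {d1, d2, \<delta>1, \<delta>2} / 2"
  have r: "0 < r" "r < d1" "r < d2" "r < \<delta>1" "r < \<delta>2"
    using d1(1) d2(1) K(2) K1(2) by (auto simp: r_def min_def)
  let ?\<eta> = "mollifier r :: real ^ 'n \<Rightarrow> real"
  have \<eta>: "?\<eta> \<in> test_functions UNIV" using r by (intro mollifier_test_function)
  define \<phi> where "\<phi> = conv ?\<eta> v"
  have far: "r < norm (x - y)" if "x \<notin> K1" "y \<in> S" for x y
    using that K1(5)[of y] r by (force simp: dist_norm norm_minus_commute not_le)
  have g0: "g y = 0" if "borel_cut S h g" "y \<notin> S" for g h y using that by (simp add: borel_cut_def)
  have \<phi>0: "\<phi> x = 0" if "x \<notin> K1" for x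
    unfolding \<phi>_def
  proof (rule conv_eq_0)
    fix y assume "v y \<noteq> 0"
    then have "y \<in> S" using g0[OF v(1)] by blast
    then show "?\<eta> (x - y) = 0" using far[OF that] by (intro mollifier_eq_0[OF r(1)]) force
  qed
  have "{x. \<phi> x \<noteq> 0} \<subseteq> K1" using \<phi>0 by blast
  then have cl: "closure {x. \<phi> x \<noteq> 0} \<subseteq> K1" using K1(1) by (simp add: closure_minimal compact_imp_closed)
  then have "compact (closure {x. \<phi> x \<noteq> 0})"
    using K1(1) by (metis closed_closure compact_Int_closed inf.absorb_iff2)
  then have \<phi>: "\<phi> \<in> test_functions \<Omega>"
    using cl K1(4) C_diff_conv[OF \<eta> vi] unfolding test_functions_def \<phi>_def by blast
  have p\<phi>: "partial i \<phi> x = conv ?\<eta> (w i) x" for i x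
  proof -
    have 1: "partial i \<phi> x = conv (partial i ?\<eta>) v x" by (simp add: \<phi>_def partial_conv[OF \<eta> vi])
    show ?thesis
    proof (cases "x \<in> K1")
      case True
      have "cball x r \<subseteq> K" using K(5)[OF True] r by force
      then show ?thesis unfolding 1 by (intro conv_partial_mollifier[OF \<Omega> u(3) K(1,4) v(2) w(2)] r)
    next
      case False
      have "conv ?\<eta> (w i) x = 0"
      proof (rule conv_eq_0)
        fix y assume "w i y \<noteq> 0"
        then have "y \<in> S" using g0[OF w(1)] by blast
        then show "?\<eta> (x - y) = 0" using far[OF False] by (intro mollifier_eq_0[OF r(1)]) force
      qed
      moreover have "conv (partial i ?\<eta>) v x = 0"
      proof (rule conv_eq_0)
        fix y assume "v y \<noteq> 0"
        then have "y \<in> S" using g0[OF v(1)] by blast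
        then show "partial i ?\<eta> (x - y) = 0" using far[OF False] by (intro partial_mollifier_eq_0[OF r(1)])
      qed
      ultimately show ?thesis unfolding 1 by simp
    qed
  qed
  show ?thesis
  proof (rule that[OF \<phi>])
    have "(LINT x|lebesgue_on \<Omega>. \<bar>u x - \<phi> x\<bar> powr p) \<le> (LINT x|lborel. \<bar>conv ?\<eta> v x - v x\<bar> powr p)"
      using d1(2)[OF r(1,2)] v(4)
      by (intro integral_lebesgue_on_le_lborel[OF _ _ \<Omega>l]) (auto simp: \<phi>_def abs_minus_commute elim!: eventually_mono)
    also have "\<dots> \<le> e'" using d1(2)[OF r(1,2)] by blast
    also have "e' \<le> e' * (1 + n powr p * n)" using e' n by (simp add: distrib_left)
    also have "\<dots> = e / 2" by (rule e'2)
    also have "\<dots> < e" using e by simp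
    finally show "(LINT x|lebesgue_on \<Omega>. \<bar>u x - \<phi> x\<bar> powr p) < e" .
    let ?F = "\<lambda>x. n powr p * (\<Sum>i\<in>UNIV. \<bar>conv ?\<eta> (w i) x - w i x\<bar> powr p)"
    have iF: "integrable lborel ?F" using d2(2)[OF r(1,3)] by auto
    have "AE x in lebesgue_on \<Omega>. \<forall>i. G x $ i = w i x" by (intro eventually_all_finite w(4))
    then have "AE x in lebesgue_on \<Omega>. norm (G x - grad \<phi> x) powr p \<le> ?F x"
    proof eventually_elim
      case (elim x)
      have "norm (G x - grad \<phi> x) powr p \<le> n powr p * (\<Sum>i\<in>UNIV. \<bar>(G x - grad \<phi> x) $ i\<bar> powr p)"
        unfolding n_def using p by (intro norm_powr_le_components) auto
      also have "\<dots> = ?F x" using elim by (simp add: p\<phi> abs_minus_commute)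
      finally show ?case .
    qed
    then have "(LINT x|lebesgue_on \<Omega>. norm (G x - grad \<phi> x) powr p) \<le> (LINT x|lborel. ?F x)"
      by (intro integral_lebesgue_on_le_lborel[OF iF _ \<Omega>l]) (auto intro!: mult_nonneg_nonneg sum_nonneg)
    also have "\<dots> = n powr p * (\<Sum>i\<in>UNIV. (LINT x|lborel. \<bar>conv ?\<eta> (w i) x - w i x\<bar> powr p))"
      using d2(2)[OF r(1,3)] by simp
    also have "\<dots> \<le> n powr p * (\<Sum>i\<in>(UNIV :: 'n set). e')"
      using d2(2)[OF r(1,3)] by (intro mult_left_mono sum_mono) auto
    also have "\<dots> = n powr p * n * e'" by (simp add: n_def)
    also have "\<dots> \<le> e' * (1 + n powr p * n)" using e' by (simp add: distrib_left mult_ac)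
    also have "\<dots> = e / 2" by (rule e'2)
    also have "\<dots> < e" using e by simp
    finally show "(LINT x|lebesgue_on \<Omega>. norm (G x - grad \<phi> x) powr p) < e" .
  qed
qed

text \<open>The norm of \<open>W\<^sup>1\<^sup>,\<^sup>p\<close> refers to a representative of the weak gradient that is known only up to a
  null set. By uniqueness it can be replaced by any explicitly given weak gradient.\<close>

lemma W1_weak_gradient_Lp:
  assumes \<Omega>: "open \<Omega>" and w: "w \<in> W1 p \<Omega>" and G: "has_weak_gradient \<Omega> w G"
  shows "G \<in> Lp p \<Omega>"
proof -
  obtain G' where G': "G' \<in> Lp p \<Omega>" "has_weak_gradient \<Omega> w G'" using w by (auto simp: W1_def)
  have ae: "AE x in lebesgue_on \<Omega>. G' x = G x" by (rule weak_gradient_unique[OF \<Omega> G'(2) G])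
  have m: "G \<in> borel_measurable (lebesgue_on \<Omega>)"
    using \<Omega> by (intro borel_measurable_lebesgue_on_AE[OF _ LpD(1)[OF G'(1)] ae]) simp
  note [measurable] = m LpD(1)[OF G'(1)]
  have "integrable (lebesgue_on \<Omega>) (\<lambda>x. norm (G x) powr p)"
    using LpD(2)[OF G'(1)] ae
    by (subst integrable_cong_AE[where g = "\<lambda>x. norm (G' x) powr p"]) (measurable, auto elim: eventually_mono)
  with m show ?thesis by (simp add: Lp_def)
qed

lemma W1_norm_eq:
  assumes \<Omega>: "open \<Omega>" and G: "G \<in> borel_measurable (lebesgue_on \<Omega>)" "has_weak_gradient \<Omega> w G"
  shows "W1_norm p \<Omega> w = ((LINT x|lebesgue_on \<Omega>. \<bar>w x\<bar> powr p) + (LINT x|lebesgue_on \<Omega>. norm (G x) powr p)) powr (1 / p)"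
proof -
  note ae = weak_gradient_eq_AE(2)[OF \<Omega> G(2)]
  have "AE x in lebesgue_on \<Omega>. G x = weak_gradient \<Omega> w x" using ae by (rule eventually_mono) simp
  then have m: "weak_gradient \<Omega> w \<in> borel_measurable (lebesgue_on \<Omega>)"
    using \<Omega> by (intro borel_measurable_lebesgue_on_AE[OF _ G(1)]) simp
  note [measurable] = m G(1)
  have "(LINT x|lebesgue_on \<Omega>. norm (weak_gradient \<Omega> w x) powr p) = (LINT x|lebesgue_on \<Omega>. norm (G x) powr p)"
    using ae by (intro integral_cong_AE) (measurable, auto elim: eventually_mono)
  then show ?thesis by (simp add: W1_norm_def)
qed

lemma W1_0_approximation:
  fixes w :: "real ^ 'n \<Rightarrow> real"
  assumes \<Omega>: "open \<Omega>" "\<Omega> \<in> lmeasurable" and p: "p \<ge> 1" and w: "w \<in> W1_0 p \<Omega>" and G: "has_weak_gradient \<Omega> w G" and e: "e > 0"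
  obtains \<phi> where "\<phi> \<in> test_functions \<Omega>" "(LINT x|lebesgue_on \<Omega>. \<bar>w x - \<phi> x\<bar> powr p) < e"
    "(LINT x|lebesgue_on \<Omega>. norm (G x - grad \<phi> x) powr p) < e"
proof -
  have \<Omega>l: "\<Omega> \<in> sets lebesgue" using \<Omega> by simp
  have wW: "w \<in> W1 p \<Omega>" using w by (simp add: W1_0_def)
  have "e powr (1 / p) > 0" using e by simp
  then obtain \<phi> where \<phi>: "\<phi> \<in> test_functions \<Omega>" "W1_norm p \<Omega> (\<lambda>x. w x - \<phi> x) < e powr (1 / p)"
    using w unfolding W1_0_def by blast
  have gl: "G \<in> Lp p \<Omega>" by (rule W1_weak_gradient_Lp[OF \<Omega>(1) wW G])
  have g\<phi>: "has_weak_gradient \<Omega> \<phi> (grad \<phi>)"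
    by (rule test_function_weak_gradient[OF test_function_mono[OF \<phi>(1)] \<Omega>l]) simp
  have wg: "has_weak_gradient \<Omega> (\<lambda>x. w x - \<phi> x) (\<lambda>x. G x - grad \<phi> x)"
    by (rule has_weak_gradient_diff[OF \<Omega>l G g\<phi>])
  have lp: "(\<lambda>x. G x - grad \<phi> x) \<in> Lp p \<Omega>"
    using p by (intro Lp_diff gl test_function_Lp[OF \<Omega>(2) \<phi>(1)]) auto
  define A B where "A = (LINT x|lebesgue_on \<Omega>. \<bar>w x - \<phi> x\<bar> powr p)" and "B = (LINT x|lebesgue_on \<Omega>. norm (G x - grad \<phi> x) powr p)"
  have AB: "A \<ge> 0" "B \<ge> 0" by (auto simp: A_def B_def intro!: Bochner_Integration.integral_nonneg)
  have "(A + B) powr (1 / p) < e powr (1 / p)"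
    using \<phi>(2) unfolding W1_norm_eq[OF \<Omega>(1) LpD(1)[OF lp] wg] A_def B_def .
  then have "A + B < e"
    using p by (metis AB add_nonneg_nonneg e less_eq_real_def not_le powr_mono2 zero_le_divide_1_iff order_trans zero_le_one)
  then show ?thesis using that[OF \<phi>(1)] AB unfolding A_def B_def by linarith
qed

lemma W1_0_I:
  fixes w :: "real ^ 'n \<Rightarrow> real"
  assumes \<Omega>: "open \<Omega>" "\<Omega> \<in> lmeasurable" and p: "p \<ge> 1" and w: "w \<in> Lp p \<Omega>" and G: "G \<in> Lp p \<Omega>" "has_weak_gradient \<Omega> w G"
    and approx: "\<And>e. e > 0 \<Longrightarrow> \<exists>\<phi>\<in>test_functions \<Omega>. (LINT x|lebesgue_on \<Omega>. \<bar>w x - \<phi> x\<bar> powr p) \<le> e \<and>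
    (LINT x|lebesgue_on \<Omega>. norm (G x - grad \<phi> x) powr p) \<le> e"
  shows "w \<in> W1_0 p \<Omega>"
  unfolding W1_0_def
proof (intro CollectI conjI allI impI)
  show "w \<in> W1 p \<Omega>" using w G by (auto simp: W1_def)
  fix e :: real assume e: "e > 0"
  have \<Omega>l: "\<Omega> \<in> sets lebesgue" using \<Omega> by simp
  have "(e / 2) powr p / 2 > 0" using e by simp
  then obtain \<phi> where \<phi>: "\<phi> \<in> test_functions \<Omega>" "(LINT x|lebesgue_on \<Omega>. \<bar>w x - \<phi> x\<bar> powr p) \<le> (e / 2) powr p / 2"
    "(LINT x|lebesgue_on \<Omega>. norm (G x - grad \<phi> x) powr p) \<le> (e / 2) powr p / 2"
    using approx by blast
  have g\<phi>: "has_weak_gradient \<Omega> \<phi> (grad \<phi>)"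
    by (rule test_function_weak_gradient[OF test_function_mono[OF \<phi>(1)] \<Omega>l]) simp
  have wg: "has_weak_gradient \<Omega> (\<lambda>x. w x - \<phi> x) (\<lambda>x. G x - grad \<phi> x)"
    by (rule has_weak_gradient_diff[OF \<Omega>l G(2) g\<phi>])
  have lp: "(\<lambda>x. G x - grad \<phi> x) \<in> Lp p \<Omega>"
    using p by (intro Lp_diff G test_function_Lp[OF \<Omega>(2) \<phi>(1)]) auto
  have "W1_norm p \<Omega> (\<lambda>x. w x - \<phi> x) \<le> ((e / 2) powr p) powr (1 / p)"
    unfolding W1_norm_eq[OF \<Omega>(1) LpD(1)[OF lp] wg] using \<phi>(2,3) p
    by (intro powr_mono2) (auto intro!: add_nonneg_nonneg Bochner_Integration.integral_nonneg)
  also have "\<dots> = e / 2" using e p by (simp add: powr_powr)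
  also have "\<dots> < e" using e by simp
  finally show "\<exists>\<phi>\<in>test_functions \<Omega>. W1_norm p \<Omega> (\<lambda>x. w x - \<phi> x) < e" using \<phi>(1) by blast
qed

text \<open>Convergence almost everywhere, which a subsequence achieves, is what Fatou's lemma and the
  continuity of a derivative \<open>H'\<close> require later.\<close>

lemma W1_0_sequence:
  fixes w :: "real ^ 'n \<Rightarrow> real"
  assumes \<Omega>: "open \<Omega>" "\<Omega> \<in> lmeasurable" and p: "p \<ge> 1" and w: "w \<in> W1_0 p \<Omega>" and G: "has_weak_gradient \<Omega> w G"
  obtains \<psi> where "\<And>j. \<psi> j \<in> test_functions \<Omega>"
    "(\<lambda>j. LINT x|lebesgue_on \<Omega>. \<bar>w x - \<psi> j x\<bar> powr p) \<longlonglongrightarrow> 0"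
    "(\<lambda>j. LINT x|lebesgue_on \<Omega>. norm (G x - grad (\<psi> j) x) powr p) \<longlonglongrightarrow> 0"
    "AE x in lebesgue_on \<Omega>. (\<lambda>j. \<psi> j x) \<longlonglongrightarrow> w x"
proof -
  define good where "good j \<phi> \<longleftrightarrow> \<phi> \<in> test_functions \<Omega> \<and> (LINT x|lebesgue_on \<Omega>. \<bar>w x - \<phi> x\<bar> powr p) < 1 / real (Suc j) \<and>
    (LINT x|lebesgue_on \<Omega>. norm (G x - grad \<phi> x) powr p) < 1 / real (Suc j)" for j \<phi>
  have "\<exists>\<phi>. good j \<phi>" for j
    using W1_0_approximation[OF \<Omega> p w G, of "1 / real (Suc j)"] unfolding good_def by auto
  then obtain \<psi>0 where "\<And>j. good j (\<psi>0 j)" by metis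
  then have \<psi>0: "\<And>j. \<psi>0 j \<in> test_functions \<Omega>" "\<And>j. (LINT x|lebesgue_on \<Omega>. \<bar>w x - \<psi>0 j x\<bar> powr p) \<le> 1 / real (Suc j)"
    "\<And>j. (LINT x|lebesgue_on \<Omega>. norm (G x - grad (\<psi>0 j) x) powr p) \<le> 1 / real (Suc j)"
    by (auto simp: good_def less_imp_le)
  have lim1: "(\<lambda>j. 1 / real (Suc j)) \<longlonglongrightarrow> 0"
    using LIMSEQ_inverse_real_of_nat by (simp add: inverse_eq_divide)
  have 1: "(\<lambda>j. LINT x|lebesgue_on \<Omega>. \<bar>w x - \<psi>0 j x\<bar> powr p) \<longlonglongrightarrow> 0"
    by (rule tendsto_sandwich[OF always_eventually always_eventually tendsto_const lim1])
      (auto simp del: of_nat_Suc intro: \<psi>0 Bochner_Integration.integral_nonneg)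
  have 2: "(\<lambda>j. LINT x|lebesgue_on \<Omega>. norm (G x - grad (\<psi>0 j) x) powr p) \<longlonglongrightarrow> 0"
    by (rule tendsto_sandwich[OF always_eventually always_eventually tendsto_const lim1])
      (auto simp del: of_nat_Suc intro: \<psi>0 Bochner_Integration.integral_nonneg)
  have wLp: "w \<in> Lp p \<Omega>" using w by (auto simp: W1_0_def W1_def)
  have "(\<lambda>x. w x - \<psi>0 j x) \<in> Lp p \<Omega>" for j
    using p by (intro Lp_diff wLp test_function_Lp[OF \<Omega>(2) \<psi>0(1)]) auto
  then have i: "integrable (lebesgue_on \<Omega>) (\<lambda>x. \<bar>w x - \<psi>0 j x\<bar> powr p)" for j
    by (auto simp: Lp_def)
  obtain \<rho> where \<rho>: "strict_mono \<rho>" "AE x in lebesgue_on \<Omega>. (\<lambda>j. \<bar>w x - \<psi>0 (\<rho> j) x\<bar> powr p) \<longlonglongrightarrow> 0"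
    using tendsto_L1_AE_subseq[of "lebesgue_on \<Omega>" "\<lambda>j x. \<bar>w x - \<psi>0 j x\<bar> powr p", OF i] 1 by auto
  show ?thesis
  proof (rule that[of "\<lambda>j. \<psi>0 (\<rho> j)"])
    show "AE x in lebesgue_on \<Omega>. (\<lambda>j. \<psi>0 (\<rho> j) x) \<longlonglongrightarrow> w x"
      using \<rho>(2)
    proof eventually_elim
      case (elim x)
      have "(\<lambda>j. (\<bar>w x - \<psi>0 (\<rho> j) x\<bar> powr p) powr (1 / p)) \<longlonglongrightarrow> 0 powr (1 / p)"
        using p by (intro tendsto_powr' elim tendsto_const) auto
      then have "(\<lambda>j. \<bar>w x - \<psi>0 (\<rho> j) x\<bar>) \<longlonglongrightarrow> 0" using p by (simp add: powr_powr)
      then have "(\<lambda>j. w x - \<psi>0 (\<rho> j) x) \<longlonglongrightarrow> 0" by (simp add: tendsto_rabs_zero_iff)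
      then have "(\<lambda>j. w x - (w x - \<psi>0 (\<rho> j) x)) \<longlonglongrightarrow> w x - 0" by (intro tendsto_diff tendsto_const)
      then show ?case by simp
    qed
  qed (use \<psi>0(1) LIMSEQ_subseq_LIMSEQ[OF 1 \<rho>(1)] LIMSEQ_subseq_LIMSEQ[OF 2 \<rho>(1)] in \<open>auto simp: comp_def\<close>)
qed

text \<open>If \<open>H\<close> vanishes on \<open>[-k, k]\<close> and \<open>|u0| \<le> k\<close>, then \<open>H (u0 + \<psi>)\<close> has compact support for every
  test function \<open>\<psi>\<close>. Hence \<open>H (u0 + v)\<close> has zero boundary values whenever \<open>v\<close> has:
  approximate \<open>v\<close> by \<open>\<psi>\<close> and then \<open>H (u0 + \<psi>)\<close> by its mollifications. The first approximation converges
  in \<open>W\<^sup>1\<^sup>,\<^sup>p\<close> since \<open>H'\<close> is bounded and continuous.\<close>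

lemma truncation_W1_0:
  fixes u0 v :: "real ^ 'n \<Rightarrow> real"
  assumes \<Omega>: "open \<Omega>" "\<Omega> \<in> lmeasurable" and p: "p \<ge> 1"
    and v: "v \<in> W1_0 p \<Omega>" "has_weak_gradient \<Omega> v Gv"
    and u0: "u0 \<in> Lp p \<Omega>" "G0 \<in> Lp p \<Omega>" "has_weak_gradient \<Omega> u0 G0" "AE x in lebesgue_on \<Omega>. \<bar>u0 x\<bar> \<le> k"
    and H: "\<And>t. (H has_real_derivative H' t) (at t)" "continuous_on UNIV H'" "\<And>t. \<bar>H' t\<bar> \<le> 1"
    and Hk: "\<And>t. \<bar>t\<bar> \<le> k \<Longrightarrow> H t = 0" "\<And>t. \<bar>t\<bar> \<le> k \<Longrightarrow> H' t = 0"
  shows "(\<lambda>x. H (u0 x + v x)) \<in> W1_0 p \<Omega>"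
    and "has_weak_gradient \<Omega> (\<lambda>x. H (u0 x + v x)) (\<lambda>x. H' (u0 x + v x) *\<^sub>R (G0 x + Gv x))"
proof -
  have \<Omega>l: "\<Omega> \<in> sets lebesgue" using \<Omega> by simp
  have k: "AE x in lebesgue_on \<Omega>. k \<ge> 0" using u0(4) by (rule eventually_mono) auto
  have Hc: "continuous_on UNIV H" by (auto intro!: continuous_at_imp_continuous_on DERIV_isCont H)
  have [measurable]: "H \<in> borel_measurable borel" "H' \<in> borel_measurable borel"
    using Hc H(2) by (auto intro: borel_measurable_continuous_onI)
  have lip: "\<bar>H s - H t\<bar> \<le> \<bar>s - t\<bar>" for s t
  proof -
    have "norm (H s - H t) \<le> 1 * norm (s - t)"
      by (rule field_differentiable_bound[of UNIV H H']) (use H in auto)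
    then show ?thesis by simp
  qed
  have vW: "v \<in> W1 p \<Omega>" using v(1) by (simp add: W1_0_def)
  have vLp: "v \<in> Lp p \<Omega>" using vW by (simp add: W1_def)
  have GvLp: "Gv \<in> Lp p \<Omega>" by (rule W1_weak_gradient_Lp[OF \<Omega>(1) vW v(2)])
  have p0: "p \<ge> 0" using p by simp
  have HLp: "(\<lambda>x. H (u0 x + z x)) \<in> Lp p \<Omega>" if z: "z \<in> Lp p \<Omega>" for z
  proof (rule Lp_bound[OF Lp_add[OF u0(1) z p0] p0])
    note [measurable] = LpD(1)[OF u0(1)] LpD(1)[OF z]
    show "(\<lambda>x. H (u0 x + z x)) \<in> borel_measurable (lebesgue_on \<Omega>)" by measurable
    show "AE x in lebesgue_on \<Omega>. norm (H (u0 x + z x)) \<le> 1 * norm (u0 x + z x)"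
      using k
    proof eventually_elim
      case (elim x)
      then show ?case using lip[of "u0 x + z x" 0] Hk(1)[of 0] by simp
    qed
  qed
  have HGLp: "(\<lambda>x. H' (u0 x + z x) *\<^sub>R (G0 x + Gz x)) \<in> Lp p \<Omega>" if z: "z \<in> Lp p \<Omega>" "Gz \<in> Lp p \<Omega>" for z Gz
  proof (rule Lp_bound[OF Lp_add[OF u0(2) z(2) p0] p0])
    note [measurable] = LpD(1)[OF u0(1)] LpD(1)[OF z(1)] LpD(1)[OF u0(2)] LpD(1)[OF z(2)]
    show "(\<lambda>x. H' (u0 x + z x) *\<^sub>R (G0 x + Gz x)) \<in> borel_measurable (lebesgue_on \<Omega>)" by measurable
    show "AE x in lebesgue_on \<Omega>. norm (H' (u0 x + z x) *\<^sub>R (G0 x + Gz x)) \<le> 1 * norm (G0 x + Gz x)"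
      using H(3) by (intro AE_I2) (auto intro!: mult_left_le_one_le)
  qed
  have chain: "has_weak_gradient \<Omega> (\<lambda>x. H (u0 x + z x)) (\<lambda>x. H' (u0 x + z x) *\<^sub>R (G0 x + Gz x))"
    if z: "has_weak_gradient \<Omega> z Gz" for z Gz
    by (rule weak_gradient_chain_rule[OF \<Omega>(1) has_weak_gradient_add[OF \<Omega>l u0(3) z] H])
  show "has_weak_gradient \<Omega> (\<lambda>x. H (u0 x + v x)) (\<lambda>x. H' (u0 x + v x) *\<^sub>R (G0 x + Gv x))"
    by (rule chain[OF v(2)])
  obtain \<psi> where \<psi>: "\<And>j. \<psi> j \<in> test_functions \<Omega>"
    "(\<lambda>j. LINT x|lebesgue_on \<Omega>. \<bar>v x - \<psi> j x\<bar> powr p) \<longlonglongrightarrow> 0"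
    "(\<lambda>j. LINT x|lebesgue_on \<Omega>. norm (Gv x - grad (\<psi> j) x) powr p) \<longlonglongrightarrow> 0"
    "AE x in lebesgue_on \<Omega>. (\<lambda>j. \<psi> j x) \<longlonglongrightarrow> v x"
    using W1_0_sequence[OF \<Omega> p v] by blast
  note \<psi>Lp = test_function_Lp[OF \<Omega>(2) \<psi>(1) p0]
  have \<psi>g: "has_weak_gradient \<Omega> (\<psi> j) (grad (\<psi> j))" for j
    by (rule test_function_weak_gradient[OF test_function_mono[OF \<psi>(1)] \<Omega>l]) simp
  define \<Theta> where "\<Theta> j x = H' (u0 x + \<psi> j x) *\<^sub>R (G0 x + grad (\<psi> j) x)" for j x
  define \<Theta>' where "\<Theta>' x = H' (u0 x + v x) *\<^sub>R (G0 x + Gv x)" for x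
  have dLp: "(\<lambda>x. v x - \<psi> j x) \<in> Lp p \<Omega>" "(\<lambda>x. Gv x - grad (\<psi> j) x) \<in> Lp p \<Omega>" for j
    by (intro Lp_diff vLp GvLp \<psi>Lp p0)+
  have 1: "(LINT x|lebesgue_on \<Omega>. \<bar>H (u0 x + v x) - H (u0 x + \<psi> j x)\<bar> powr p) \<le> (LINT x|lebesgue_on \<Omega>. \<bar>v x - \<psi> j x\<bar> powr p)" for j
  proof (rule integral_mono')
    show "integrable (lebesgue_on \<Omega>) (\<lambda>x. \<bar>v x - \<psi> j x\<bar> powr p)" using LpD(2)[OF dLp(1)] by simp
    show "\<bar>H (u0 x + v x) - H (u0 x + \<psi> j x)\<bar> powr p \<le> \<bar>v x - \<psi> j x\<bar> powr p" for x
      using lip[of "u0 x + v x" "u0 x + \<psi> j x"] p0 by (intro powr_mono2) auto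
  qed auto
  have H1: "(\<lambda>j. LINT x|lebesgue_on \<Omega>. \<bar>H (u0 x + v x) - H (u0 x + \<psi> j x)\<bar> powr p) \<longlonglongrightarrow> 0"
    by (rule tendsto_sandwich[OF always_eventually always_eventually tendsto_const \<psi>(2)])
      (auto intro: 1 Bochner_Integration.integral_nonneg)
  note [measurable] = LpD(1)[OF u0(1)] LpD(1)[OF u0(2)] LpD(1)[OF vLp] LpD(1)[OF GvLp] LpD(1)[OF \<psi>Lp(1)] LpD(1)[OF \<psi>Lp(2)]
  have GLp: "(\<lambda>x. G0 x + Gv x) \<in> Lp p \<Omega>" by (rule Lp_add[OF u0(2) GvLp p0])
  let ?E = "\<lambda>j x. \<bar>H' (u0 x + v x) - H' (u0 x + \<psi> j x)\<bar> powr p * norm (G0 x + Gv x) powr p"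
  have T: "(\<lambda>j. LINT x|lebesgue_on \<Omega>. ?E j x) \<longlonglongrightarrow> (LINT x|lebesgue_on \<Omega>. 0)"
  proof (rule integral_dominated_convergence[where w = "\<lambda>x. 2 powr p * norm (G0 x + Gv x) powr p"])
    show "integrable (lebesgue_on \<Omega>) (\<lambda>x. 2 powr p * norm (G0 x + Gv x) powr p)" using LpD(2)[OF GLp] by simp
    show "AE x in lebesgue_on \<Omega>. (\<lambda>j. ?E j x) \<longlonglongrightarrow> 0"
      using \<psi>(4)
    proof eventually_elim
      case (elim x)
      have c: "isCont H' (u0 x + v x)" using H(2) by (simp add: continuous_on_eq_continuous_at)
      have "(\<lambda>j. H' (u0 x + \<psi> j x)) \<longlonglongrightarrow> H' (u0 x + v x)"
        by (rule isCont_tendsto_compose[OF c]) (intro tendsto_intros elim)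
      then have "(\<lambda>j. \<bar>H' (u0 x + v x) - H' (u0 x + \<psi> j x)\<bar>) \<longlonglongrightarrow> \<bar>H' (u0 x + v x) - H' (u0 x + v x)\<bar>"
        by (intro tendsto_intros)
      then have "(\<lambda>j. \<bar>H' (u0 x + v x) - H' (u0 x + \<psi> j x)\<bar> powr p) \<longlonglongrightarrow> 0 powr p"
        using p by (intro tendsto_powr' tendsto_const) auto
      from tendsto_mult_left_zero[OF this[simplified]] show ?case .
    qed
    show "AE x in lebesgue_on \<Omega>. norm (?E j x) \<le> 2 powr p * norm (G0 x + Gv x) powr p" for j
    proof (rule AE_I2)
      fix x
      have "\<bar>H' (u0 x + v x) - H' (u0 x + \<psi> j x)\<bar> \<le> 2" using H(3)[of "u0 x + v x"] H(3)[of "u0 x + \<psi> j x"] by linarith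
      then have "\<bar>H' (u0 x + v x) - H' (u0 x + \<psi> j x)\<bar> powr p \<le> 2 powr p" using p0 by (intro powr_mono2) auto
      then show "norm (?E j x) \<le> 2 powr p * norm (G0 x + Gv x) powr p"
        by (simp add: mult_right_mono)
    qed
  qed measurable
  have 2: "(LINT x|lebesgue_on \<Omega>. norm (\<Theta>' x - \<Theta> j x) powr p) \<le> 2 powr p * ((LINT x|lebesgue_on \<Omega>. ?E j x)
      + (LINT x|lebesgue_on \<Omega>. norm (Gv x - grad (\<psi> j) x) powr p))" for j
  proof -
    have i1: "integrable (lebesgue_on \<Omega>) (\<lambda>x. ?E j x)"
    proof (rule integrable_mult_bounded[of _ _ _ "2 powr p"])
      show "integrable (lebesgue_on \<Omega>) (\<lambda>x. norm (G0 x + Gv x) powr p)" using LpD(2)[OF GLp] by simp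
      show "\<bar>\<bar>H' (u0 x + v x) - H' (u0 x + \<psi> j x)\<bar> powr p\<bar> \<le> 2 powr p" for x
        using H(3)[of "u0 x + v x"] H(3)[of "u0 x + \<psi> j x"] p0 by (auto intro!: powr_mono2)
    qed measurable
    have "(LINT x|lebesgue_on \<Omega>. norm (\<Theta>' x - \<Theta> j x) powr p) \<le> (LINT x|lebesgue_on \<Omega>. 2 powr p * (?E j x
      + norm (Gv x - grad (\<psi> j) x) powr p))"
    proof (rule integral_mono')
      show "integrable (lebesgue_on \<Omega>) (\<lambda>x. 2 powr p * (?E j x
        + norm (Gv x - grad (\<psi> j) x) powr p))" using i1 LpD(2)[OF dLp(2)] by simp
      fix x
      have "\<Theta>' x - \<Theta> j x = (H' (u0 x + v x) - H' (u0 x + \<psi> j x)) *\<^sub>R (G0 x + Gv x) + H' (u0 x + \<psi> j x) *\<^sub>R (Gv x - grad (\<psi> j) x)"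
        by (simp add: \<Theta>_def \<Theta>'_def algebra_simps)
      then have "norm (\<Theta>' x - \<Theta> j x) powr p \<le> 2 powr p * (norm ((H' (u0 x + v x) - H' (u0 x + \<psi> j x)) *\<^sub>R (G0 x + Gv x)) powr p
         + norm (H' (u0 x + \<psi> j x) *\<^sub>R (Gv x - grad (\<psi> j) x)) powr p)"
        using norm_add_powr_le[OF p0] by (simp only:)
      also have "\<dots> \<le> 2 powr p * (?E j x + norm (Gv x - grad (\<psi> j) x) powr p)"
      proof (intro mult_left_mono add_mono)
        show "norm (H' (u0 x + \<psi> j x) *\<^sub>R (Gv x - grad (\<psi> j) x)) powr p \<le> norm (Gv x - grad (\<psi> j) x) powr p"
          using H(3) p0 by (intro powr_mono2) (auto intro!: mult_left_le_one_le)
      qed (auto simp: powr_mult)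
      finally show "norm (\<Theta>' x - \<Theta> j x) powr p \<le> 2 powr p * (?E j x + norm (Gv x - grad (\<psi> j) x) powr p)" .
    qed auto
    also have "\<dots> = 2 powr p * ((LINT x|lebesgue_on \<Omega>. ?E j x)
      + (LINT x|lebesgue_on \<Omega>. norm (Gv x - grad (\<psi> j) x) powr p))"
      using i1 LpD(2)[OF dLp(2)] by simp
    finally show ?thesis .
  qed
  have "(\<lambda>j. 2 powr p * ((LINT x|lebesgue_on \<Omega>. ?E j x)
      + (LINT x|lebesgue_on \<Omega>. norm (Gv x - grad (\<psi> j) x) powr p))) \<longlonglongrightarrow> 2 powr p * (0 + 0)"
    using T \<psi>(3) by (intro tendsto_intros) simp_all
  then have 20: "(\<lambda>j. 2 powr p * ((LINT x|lebesgue_on \<Omega>. ?E j x)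
      + (LINT x|lebesgue_on \<Omega>. norm (Gv x - grad (\<psi> j) x) powr p))) \<longlonglongrightarrow> 0" by simp
  have H2: "(\<lambda>j. LINT x|lebesgue_on \<Omega>. norm (\<Theta>' x - \<Theta> j x) powr p) \<longlonglongrightarrow> 0"
    by (rule tendsto_sandwich[OF always_eventually always_eventually tendsto_const 20])
      (auto intro: 2 Bochner_Integration.integral_nonneg)
  have \<Theta>Lp: "\<Theta> j \<in> Lp p \<Omega>" for j unfolding \<Theta>_def[abs_def] by (rule HGLp[OF \<psi>Lp])
  have \<Theta>'Lp: "\<Theta>' \<in> Lp p \<Omega>" unfolding \<Theta>'_def[abs_def] by (rule HGLp[OF vLp GvLp])
  show "(\<lambda>x. H (u0 x + v x)) \<in> W1_0 p \<Omega>"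
  proof (rule W1_0_I[OF \<Omega> p HLp[OF vLp] \<Theta>'Lp])
    show "has_weak_gradient \<Omega> (\<lambda>x. H (u0 x + v x)) \<Theta>'" unfolding \<Theta>'_def[abs_def] by (rule chain[OF v(2)])
    fix e :: real assume e: "e > 0"
    define e' where "e' = e / (2 * 2 powr p)"
    have e': "e' > 0" using e by (simp add: e'_def)
    have "\<forall>\<^sub>F j in sequentially. (LINT x|lebesgue_on \<Omega>. \<bar>H (u0 x + v x) - H (u0 x + \<psi> j x)\<bar> powr p) < e' \<and> (LINT x|lebesgue_on \<Omega>. norm (\<Theta>' x - \<Theta> j x) powr p) < e'"
      by (intro eventually_conj order_tendstoD(2)[OF H1] order_tendstoD(2)[OF H2] e')
    then obtain j where j: "(LINT x|lebesgue_on \<Omega>. \<bar>H (u0 x + v x) - H (u0 x + \<psi> j x)\<bar> powr p) < e'" "(LINT x|lebesgue_on \<Omega>. norm (\<Theta>' x - \<Theta> j x) powr p) < e'"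
      by (auto simp: eventually_sequentially)
    obtain S where S: "compact S" "S \<subseteq> \<Omega>" "\<And>x. x \<notin> S \<Longrightarrow> \<psi> j x = 0" "\<And>x i. x \<notin> S \<Longrightarrow> partial i (\<psi> j) x = 0"
      using test_function_support[OF \<psi>(1)] by blast
    have "AE x in lebesgue_on \<Omega>. x \<notin> S \<longrightarrow> H (u0 x + \<psi> j x) = 0 \<and> \<Theta> j x = 0"
      using u0(4) by eventually_elim (auto simp: S \<Theta>_def Hk)
    then obtain \<phi> where \<phi>: "\<phi> \<in> test_functions \<Omega>" "(LINT x|lebesgue_on \<Omega>. \<bar>H (u0 x + \<psi> j x) - \<phi> x\<bar> powr p) < e'"
      "(LINT x|lebesgue_on \<Omega>. norm (\<Theta> j x - grad \<phi> x) powr p) < e'"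
      using compact_support_approximation[OF \<Omega>(1) p HLp[OF \<psi>Lp(1)] \<Theta>Lp _ S(1,2) _ e'] chain[OF \<psi>g] unfolding \<Theta>_def[abs_def] by blast
    have tri: "(LINT x|lebesgue_on \<Omega>. norm (F x - h x) powr p) \<le> e"
      if "F \<in> Lp p \<Omega>" "g \<in> Lp p \<Omega>" "h \<in> Lp p \<Omega>" "(LINT x|lebesgue_on \<Omega>. norm (F x - g x) powr p) < e'" "(LINT x|lebesgue_on \<Omega>. norm (g x - h x) powr p) < e'"
      for F g h :: "real ^ 'n \<Rightarrow> 'b::euclidean_space"
    proof -
      note i = LpD(2)[OF Lp_diff[OF that(1,2) p0]] LpD(2)[OF Lp_diff[OF that(2,3) p0]]
      have "(LINT x|lebesgue_on \<Omega>. norm (F x - h x) powr p) \<le> (LINT x|lebesgue_on \<Omega>. 2 powr p * (norm (F x - g x) powr p + norm (g x - h x) powr p))"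
      proof (rule integral_mono')
        show "norm (F x - h x) powr p \<le> 2 powr p * (norm (F x - g x) powr p + norm (g x - h x) powr p)" for x
          using norm_add_powr_le[OF p0, of "F x - g x" "g x - h x"] by simp
      qed (use i in auto)
      also have "\<dots> = 2 powr p * ((LINT x|lebesgue_on \<Omega>. norm (F x - g x) powr p) + (LINT x|lebesgue_on \<Omega>. norm (g x - h x) powr p))"
        using i by simp
      also have "\<dots> \<le> 2 powr p * (e' + e')" using that by (intro mult_left_mono) auto
      also have "\<dots> = e" by (simp add: e'_def)
      finally show ?thesis .
    qed
    have "(LINT x|lebesgue_on \<Omega>. norm (H (u0 x + v x) - \<phi> x) powr p) \<le> e"
      by (rule tri[OF HLp[OF vLp] HLp[OF \<psi>Lp(1)] test_function_Lp(1)[OF \<Omega>(2) \<phi>(1) p0]]) (use j \<phi> in auto)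
    moreover have "(LINT x|lebesgue_on \<Omega>. norm (\<Theta>' x - grad \<phi> x) powr p) \<le> e"
      by (rule tri[OF \<Theta>'Lp \<Theta>Lp test_function_Lp(2)[OF \<Omega>(2) \<phi>(1) p0]]) (use j \<phi> in auto)
    ultimately show "\<exists>\<phi>\<in>test_functions \<Omega>. (LINT x|lebesgue_on \<Omega>. \<bar>H (u0 x + v x) - \<phi> x\<bar> powr p) \<le> e \<and>
      (LINT x|lebesgue_on \<Omega>. norm (\<Theta>' x - grad \<phi> x) powr p) \<le> e"
      using \<phi>(1) by auto
  qed
qed

section \<open>The Gagliardo--Nirenberg--Sobolev inequality\<close>

definition upd :: "real ^ 'n \<Rightarrow> 'n \<Rightarrow> real \<Rightarrow> real ^ 'n" where
  "upd x j t = (\<chi> i. if i = j then t else x $ i)"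

lemma upd_nth [simp]: "upd x j t $ i = (if i = j then t else x $ i)"
  by (simp add: upd_def)

lemma upd_upd_same [simp]: "upd (upd x j s) j t = upd x j t"
  by (simp add: vec_eq_iff)

lemma upd_commute: "i \<noteq> j \<Longrightarrow> upd (upd x i s) j t = upd (upd x j t) i s"
  by (simp add: vec_eq_iff)

lemma upd_self [simp]: "upd x j (x $ j) = x"
  by (simp add: vec_eq_iff)

lemma continuous_on_upd [continuous_intros]:
  assumes "continuous_on S f" "continuous_on S g"
  shows "continuous_on S (\<lambda>z. upd (f z) j (g z))"
  unfolding upd_def
proof (rule continuous_on_vec_lambda)
  fix i show "continuous_on S (\<lambda>z. if i = j then g z else f z $ i)"
    using assms by (cases "i = j") (auto intro!: continuous_intros)
qed

text \<open>Integration in the \<open>j\<close>-th coordinate over \<open>[-R, R]\<close>. The result is kept as a function on the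
  whole space, constant in that coordinate, so that all these operators act on one function space
  and commute.\<close>

definition integral_coord :: "real \<Rightarrow> 'n \<Rightarrow> (real ^ 'n \<Rightarrow> real) \<Rightarrow> real ^ 'n \<Rightarrow> real" where
  "integral_coord R j h x = integral {-R..R} (\<lambda>t. h (upd x j t))"

lemma continuous_section:
  fixes h :: "real ^ 'n \<Rightarrow> real"
  shows "continuous_on UNIV h \<Longrightarrow> continuous_on S (\<lambda>t. h (upd x j t))"
  by (rule continuous_on_compose2[of UNIV h]) (auto intro!: continuous_intros)

lemma integrable_section:
  fixes h :: "real ^ 'n \<Rightarrow> real"
  assumes "continuous_on UNIV h"
  shows "(\<lambda>t. h (upd x j t)) integrable_on {-R..R}"
  by (rule integrable_continuous_real) (rule continuous_section[OF assms])

lemma integral_coord_continuous: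
  assumes "continuous_on UNIV h"
  shows "continuous_on UNIV (integral_coord R j h)"
proof -
  have "continuous_on (UNIV \<times> cbox (-R) R) (\<lambda>(x, t). h (upd x j t))"
    unfolding case_prod_unfold
    by (rule continuous_on_compose2[OF assms]) (auto intro!: continuous_intros)
  from integral_continuous_on_param[OF this] show ?thesis
    by (simp add: integral_coord_def[abs_def])
qed

lemma integral_coord_upd [simp]: "integral_coord R j h (upd x j s) = integral_coord R j h x"
  by (simp add: integral_coord_def)

lemma integral_coord_nonneg: "(\<And>x. h x \<ge> 0) \<Longrightarrow> integral_coord R j h x \<ge> 0"
  unfolding integral_coord_def
  by (cases "(\<lambda>t. h (upd x j t)) integrable_on {-R..R}") (auto intro!: integral_nonneg simp: not_integrable_integral)

lemma integral_coord_mono: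
  assumes "continuous_on UNIV h" "continuous_on UNIV g" "\<And>x. h x \<le> g x"
  shows "integral_coord R j h x \<le> integral_coord R j g x"
  unfolding integral_coord_def using assms by (intro integral_le integrable_section) auto

lemma integral_coord_commute:
  assumes "continuous_on UNIV h"
  shows "integral_coord R i (integral_coord R j h) = integral_coord R j (integral_coord R i h)"
proof (cases "i = j")
  case False
  show ?thesis
  proof
    fix x
    have "continuous_on (cbox (-R, -R) (R, R)) (\<lambda>(s, t). h (upd (upd x i s) j t))"
      unfolding case_prod_unfold
      by (rule continuous_on_compose2[OF assms]) (auto intro!: continuous_intros)
    from integral_swap_continuous[OF this]
    show "integral_coord R i (integral_coord R j h) x = integral_coord R j (integral_coord R i h) x"
      using False by (simp add: integral_coord_def upd_commute[of j i])
  qed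
qed simp

text \<open>Divide each factor by its integral, apply the inequality of the arithmetic and the geometric mean
  pointwise and integrate.\<close>

lemma Holder_equal_exponents:
  fixes f :: "'i \<Rightarrow> real \<Rightarrow> real"
  assumes R: "R > 0" and T: "finite T" "T \<noteq> {}" and f: "\<And>i. i \<in> T \<Longrightarrow> continuous_on {-R..R} (f i)" "\<And>i t. i \<in> T \<Longrightarrow> f i t \<ge> 0"
  shows "integral {-R..R} (\<lambda>t. \<Prod>i\<in>T. f i t powr (1 / card T)) \<le> (\<Prod>i\<in>T. integral {-R..R} (f i) powr (1 / card T))"
proof -
  define A where "A i = integral {-R..R} (f i)" for i
  have cT: "real (card T) > 0" using T by (simp add: card_gt_0_iff)
  have A0: "A i \<ge> 0" if "i \<in> T" for i unfolding A_def using f that by (intro integral_nonneg integrable_continuous_real) auto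
  show ?thesis
  proof (cases "\<exists>i\<in>T. A i = 0")
    case True
    then obtain k where k: "k \<in> T" "A k = 0" by blast
    have "f k t = 0" if "t \<in> {-R..R}" for t
      using k integral_eq_0_iff[OF f(1)[OF k(1)]] R f(2) that by (auto simp: A_def)
    then have "integral {-R..R} (\<lambda>t. \<Prod>i\<in>T. f i t powr (1 / card T)) = integral {-R..R} (\<lambda>t. 0)"
      using k T by (intro Henstock_Kurzweil_Integration.integral_cong) (auto simp: prod_zero_iff)
    then show ?thesis by (simp add: prod_nonneg)
  next
    case False
    then have Ap: "A i > 0" if "i \<in> T" for i using A0[OF that] that less_eq_real_def by metis
    then have Anz: "A i \<noteq> 0" if "i \<in> T" for i using that by (simp add: less_imp_neq[symmetric])
    define P where "P = (\<Prod>i\<in>T. A i powr (1 / card T))"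
    have P0: "P > 0" unfolding P_def using Ap by (intro prod_pos) (force simp: powr_gt_zero)
    have cp: "continuous_on {-R..R} (\<lambda>t. \<Prod>i\<in>T. f i t powr (1 / card T))"
      using f cT by (intro continuous_on_prod continuous_on_powr') (auto intro: continuous_intros)
    have cs: "continuous_on {-R..R} (\<lambda>t. P * (\<Sum>i\<in>T. f i t / A i / card T))"
      using f Anz cT by (intro continuous_intros) auto
    have "integral {-R..R} (\<lambda>t. \<Prod>i\<in>T. f i t powr (1 / card T)) \<le> integral {-R..R} (\<lambda>t. P * (\<Sum>i\<in>T. f i t / A i / card T))"
    proof (rule integral_le)
      fix t assume "t \<in> {-R..R}"
      have "(\<Prod>i\<in>T. f i t / A i) powr (1 / card T) \<le> (\<Sum>i\<in>T. f i t / A i / card T)"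
        using T f(2) A0 by (intro arith_geom_mean) auto
      moreover have "(\<Prod>i\<in>T. f i t / A i) powr (1 / card T) = (\<Prod>i\<in>T. f i t powr (1 / card T)) / P"
        unfolding P_def using f(2) A0
        by (simp add: prod_powr_distrib powr_divide prod_dividef flip: prod_dividef)
      ultimately show "(\<Prod>i\<in>T. f i t powr (1 / card T)) \<le> P * (\<Sum>i\<in>T. f i t / A i / card T)"
        using P0 by (simp add: divide_le_eq mult.commute)
    qed (rule integrable_continuous_real[OF cp] integrable_continuous_real[OF cs])+
    also have "\<dots> = P * (\<Sum>i\<in>T. A i / A i / card T)"
    proof -
      have "integral {-R..R} (\<lambda>t. \<Sum>i\<in>T. f i t / A i / card T) = (\<Sum>i\<in>T. integral {-R..R} (\<lambda>t. f i t / A i / card T))"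
        using f Anz cT T(1) by (intro integral_sum integrable_continuous_real continuous_intros) auto
      also have "\<dots> = (\<Sum>i\<in>T. A i / A i / card T)" unfolding A_def by (intro sum.cong refl) (simp only: integral_divide)
      finally show ?thesis by (subst integral_mult_right) simp
    qed
    also have "\<dots> = P" using Anz cT by simp
    finally show ?thesis by (simp add: P_def A_def)
  qed
qed

definition integral_coords :: "real \<Rightarrow> 'n list \<Rightarrow> (real ^ 'n \<Rightarrow> real) \<Rightarrow> real ^ 'n \<Rightarrow> real" where
  "integral_coords R xs h = foldr (integral_coord R) xs h"

lemma integral_coords_simps [simp]:
  "integral_coords R [] h = h" "integral_coords R (j # xs) h = integral_coord R j (integral_coords R xs h)"
  by (simp_all add: integral_coords_def)

lemma integral_coords_continuous: "continuous_on UNIV h \<Longrightarrow> continuous_on UNIV (integral_coords R xs h)"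
  by (induction xs) (auto intro: integral_coord_continuous)

lemma integral_coords_nonneg: "(\<And>x. h x \<ge> 0) \<Longrightarrow> integral_coords R xs h x \<ge> 0"
  by (induction xs arbitrary: x) (auto intro: integral_coord_nonneg)

lemma integral_coords_mono:
  assumes "continuous_on UNIV h" "continuous_on UNIV g" "\<And>x. h x \<le> g x"
  shows "integral_coords R xs h x \<le> integral_coords R xs g x"
  by (induction xs arbitrary: x) (auto intro!: integral_coord_mono integral_coords_continuous assms)

lemma integral_coords_commute:
  "continuous_on UNIV h \<Longrightarrow> integral_coords R xs (integral_coord R j h) = integral_coord R j (integral_coords R xs h)"
  by (induction xs) (auto simp: integral_coord_commute integral_coords_continuous)

text \<open>The coordinates are integrated one after the other. In each step one factor does not depend
  on the current coordinate, and Hoelder's inequality applies to the other \<open>n - 1\<close> of them.\<close>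

lemma Gagliardo_Nirenberg_coords:
  fixes F :: "'n::finite \<Rightarrow> real ^ 'n \<Rightarrow> real"
  assumes R: "R > 0" and n: "CARD('n) \<ge> 2" and F: "\<And>i. continuous_on UNIV (F i)" "\<And>i x. F i x \<ge> 0"
    and xs: "distinct xs"
  defines "\<theta> \<equiv> 1 / (real CARD('n) - 1)"
  shows "integral_coords R xs (\<lambda>x. \<Prod>i\<in>UNIV. integral_coord R i (F i) x powr \<theta>) x
    \<le> (\<Prod>i\<in>UNIV. (if i \<in> set xs then integral_coords R xs (F i) x else integral_coords R xs (integral_coord R i (F i)) x) powr \<theta>)"
  using xs
proof (induction xs arbitrary: x)
  case Nil
  then show ?case by simp
next
  case (Cons j xs)
  define g where "g i = (if i \<in> set xs then integral_coords R xs (F i) else integral_coords R xs (integral_coord R i (F i)))" for i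
  let ?f = "\<lambda>i. if i \<in> set (j # xs) then integral_coords R (j # xs) (F i) x else integral_coords R (j # xs) (integral_coord R i (F i)) x"
  have \<theta>: "\<theta> > 0" using n by (simp add: \<theta>_def)
  have gc: "continuous_on UNIV (g i)" for i
    unfolding g_def by (auto intro!: integral_coords_continuous integral_coord_continuous F)
  have g0: "g i x \<ge> 0" for i x
    unfolding g_def by (auto intro!: integral_coords_nonneg integral_coord_nonneg F)
  have pc: "continuous_on UNIV (\<lambda>x. \<Prod>i\<in>I. f i x powr \<theta>)" if "\<And>i. continuous_on UNIV (f i)" "\<And>i x. f i x \<ge> 0" for I :: "'n set" and f :: "'n \<Rightarrow> real ^ 'n \<Rightarrow> real"
    using that \<theta> by (intro continuous_on_prod continuous_on_powr') (auto intro: continuous_intros)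
  have j: "j \<notin> set xs" "distinct xs" using Cons.prems by auto
  have gj: "g j = integral_coord R j (integral_coords R xs (F j))"
    using j by (simp add: g_def integral_coords_commute F)
  have "integral_coords R (j # xs) (\<lambda>x. \<Prod>i\<in>UNIV. integral_coord R i (F i) x powr \<theta>) x
    \<le> integral_coord R j (\<lambda>x. \<Prod>i\<in>UNIV. g i x powr \<theta>) x"
    unfolding integral_coords_simps
  proof (rule integral_coord_mono)
    show "continuous_on UNIV (integral_coords R xs (\<lambda>x. \<Prod>i\<in>UNIV. integral_coord R i (F i) x powr \<theta>))"
      by (intro integral_coords_continuous pc integral_coord_continuous integral_coord_nonneg F)
    show "integral_coords R xs (\<lambda>x. \<Prod>i\<in>UNIV. integral_coord R i (F i) x powr \<theta>) x \<le> (\<Prod>i\<in>UNIV. g i x powr \<theta>)" for x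
      using Cons.IH[OF j(2), of x] by (simp add: g_def if_distrib if_distribR cong: if_cong)
  qed (intro pc gc g0)
  also have "\<dots> = g j x powr \<theta> * integral_coord R j (\<lambda>x. \<Prod>i\<in>UNIV - {j}. g i x powr \<theta>) x"
  proof -
    have "g j (upd x j t) = g j x" for t by (simp add: gj)
    then have "(\<Prod>i\<in>UNIV. g i (upd x j t) powr \<theta>) = g j x powr \<theta> * (\<Prod>i\<in>UNIV - {j}. g i (upd x j t) powr \<theta>)" for t
      by (subst prod.remove[of UNIV j]) auto
    then show ?thesis unfolding integral_coord_def by simp
  qed
  also have "\<dots> \<le> g j x powr \<theta> * (\<Prod>i\<in>UNIV - {j}. integral_coord R j (g i) x powr \<theta>)"
  proof (intro mult_left_mono)
    have c: "real (card (UNIV - {j} :: 'n set)) = real CARD('n) - 1" using n by (simp add: card_Diff_singleton)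
    have "UNIV - {j} \<noteq> {}"
    proof
      assume "UNIV - {j} = {}"
      with c n show False by simp
    qed
    then show "integral_coord R j (\<lambda>x. \<Prod>i\<in>UNIV - {j}. g i x powr \<theta>) x \<le> (\<Prod>i\<in>UNIV - {j}. integral_coord R j (g i) x powr \<theta>)"
      using Holder_equal_exponents[of R "UNIV - {j}" "\<lambda>i t. g i (upd x j t)"] R g0 continuous_section[OF gc]
      unfolding integral_coord_def \<theta>_def c by auto
  qed auto
  also have "\<dots> = (\<Prod>i\<in>UNIV. ?f i powr \<theta>)"
  proof -
    have "(\<Prod>i\<in>UNIV. ?f i powr \<theta>)
      = integral_coords R (j # xs) (F j) x powr \<theta> * (\<Prod>i\<in>UNIV - {j}. ?f i powr \<theta>)"
      by (subst prod.remove[of UNIV j]) simp_all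
    also have "\<dots> = g j x powr \<theta> * (\<Prod>i\<in>UNIV - {j}. integral_coord R j (g i) x powr \<theta>)"
    proof -
      have "?f i
          = integral_coord R j (g i) x" if "i \<noteq> j" for i
        using that by (cases "i \<in> set xs") (simp_all add: g_def)
      then have "(\<Prod>i\<in>UNIV - {j}. ?f i powr \<theta>)
          = (\<Prod>i\<in>UNIV - {j}. integral_coord R j (g i) x powr \<theta>)"
        by (intro prod.cong) auto
      then show ?thesis by (simp add: gj)
    qed
    finally show ?thesis by simp
  qed
  finally show ?case .
qed

text \<open>The counterpart of \<open>integral_coord\<close> for the integral of nonnegative functions over the whole
  line. It connects the iterated integrals with the product measure, hence with Lebesgue measure.\<close>

definition nn_coord :: "'n \<Rightarrow> (real ^ 'n \<Rightarrow> ennreal) \<Rightarrow> real ^ 'n \<Rightarrow> ennreal" where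
  "nn_coord j h x = (\<integral>\<^sup>+t. h (upd x j t) \<partial>lborel)"

lemma measurable_vec_lambda:
  fixes f :: "'a \<Rightarrow> 'n::finite \<Rightarrow> real"
  assumes "\<And>i. (\<lambda>x. f x i) \<in> borel_measurable M"
  shows "(\<lambda>x. \<chi> i. f x i) \<in> borel_measurable M"
  using assms by (subst borel_measurable_euclidean_space) (auto simp: Basis_vec_def inner_axis)

lemma lborel_vec_eq_distr_PiM:
  "(lborel :: (real ^ 'n) measure) = distr (\<Pi>\<^sub>M i\<in>UNIV. lborel) borel (\<lambda>f. \<chi> i. f i)"
proof (rule lborel_eqI)
  interpret product_sigma_finite "\<lambda>_::'n. lborel :: real measure" ..
  let ?P = "\<Pi>\<^sub>M i\<in>(UNIV::'n set). (lborel :: real measure)"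
  have m[measurable]: "(\<lambda>f. \<chi> i. f i) \<in> borel_measurable ?P"
    by (intro measurable_vec_lambda) measurable
  fix l u :: "real ^ 'n"
  assume lu: "\<And>b. b \<in> Basis \<Longrightarrow> l \<bullet> b \<le> u \<bullet> b"
  have lu': "l $ i \<le> u $ i" for i using lu[of "axis i 1"] by (simp add: inner_axis axis_in_Basis_iff)
  have "emeasure (distr ?P borel (\<lambda>f. \<chi> i. f i)) (box l u) = emeasure ?P ((\<lambda>f. \<chi> i. f i) -` box l u \<inter> space ?P)"
    by (intro emeasure_distr) auto
  also have "(\<lambda>f. \<chi> i. f i) -` box l u \<inter> space ?P = (\<Pi>\<^sub>E i\<in>UNIV. {l $ i<..<u $ i})"
    by (auto simp: space_PiM mem_box_cart PiE_def Pi_iff)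
  also have "emeasure ?P \<dots> = (\<Prod>i\<in>UNIV. emeasure lborel {l $ i<..<u $ i})"
    by (rule emeasure_PiM) auto
  also have "\<dots> = ennreal (\<Prod>i\<in>UNIV. u $ i - l $ i)"
    using lu' by (simp add: prod_ennreal)
  also have "(\<Prod>i\<in>UNIV. u $ i - l $ i) = (\<Prod>b\<in>Basis. (u - l) \<bullet> b)"
  proof -
    have B: "(Basis :: (real ^ 'n) set) = (\<lambda>i. axis i 1) ` UNIV" by (auto simp: Basis_vec_def)
    have "inj (\<lambda>i :: 'n. axis i (1::real))" by (auto simp: inj_on_def axis_eq_axis)
    then show ?thesis unfolding B by (subst prod.reindex) (simp_all add: inner_axis)
  qed
  finally show "emeasure (distr ?P borel (\<lambda>f. \<chi> i. f i)) (box l u) = ennreal (\<Prod>b\<in>Basis. (u - l) \<bullet> b)" .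
qed simp

lemma foldr_nn_coord:
  fixes h :: "real ^ 'n \<Rightarrow> ennreal"
  assumes h: "h \<in> borel_measurable borel" and "distinct xs"
  shows "foldr nn_coord xs h x = (\<integral>\<^sup>+f. h (\<chi> i. if i \<in> set xs then f i else x $ i) \<partial>(\<Pi>\<^sub>M i\<in>set xs. lborel))"
  using assms(2)
proof (induction xs arbitrary: x)
  case Nil
  have "(\<chi> i. x $ i) = x" by (simp add: vec_eq_iff)
  then show ?case by (simp add: nn_integral_empty PiM_empty nn_integral_count_space_finite)
next
  case (Cons j xs)
  interpret product_sigma_finite "\<lambda>_::'n. lborel :: real measure" ..
  have m: "(\<lambda>f. h (\<chi> i. if i \<in> insert j (set xs) then f i else x $ i)) \<in> borel_measurable (\<Pi>\<^sub>M i\<in>insert j (set xs). lborel)"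
  proof (rule measurable_compose[OF measurable_vec_lambda h])
    fix i show "(\<lambda>f. if i \<in> insert j (set xs) then f i else x $ i) \<in> borel_measurable (\<Pi>\<^sub>M i\<in>insert j (set xs). lborel)"
    proof (cases "i \<in> insert j (set xs)")
      case True
      have "(\<lambda>f. f i) \<in> measurable (\<Pi>\<^sub>M i\<in>insert j (set xs). lborel) (lborel :: real measure)"
        by (rule measurable_component_singleton[OF True])
      then show ?thesis using True by simp
    qed simp
  qed
  have "foldr nn_coord (j # xs) h x = (\<integral>\<^sup>+t. (\<integral>\<^sup>+f. h (\<chi> i. if i \<in> set xs then f i else upd x j t $ i) \<partial>(\<Pi>\<^sub>M i\<in>set xs. lborel)) \<partial>lborel)"
    using Cons.prems by (simp add: nn_coord_def[of j] Cons.IH)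
  also have "\<dots> = (\<integral>\<^sup>+t. (\<integral>\<^sup>+f. h (\<chi> i. if i \<in> insert j (set xs) then (f(j := t)) i else x $ i) \<partial>(\<Pi>\<^sub>M i\<in>set xs. lborel)) \<partial>lborel)"
    using Cons.prems by (intro nn_integral_cong arg_cong[of _ _ h]) (auto simp: vec_eq_iff)
  also have "\<dots> = (\<integral>\<^sup>+f. h (\<chi> i. if i \<in> insert j (set xs) then f i else x $ i) \<partial>(\<Pi>\<^sub>M i\<in>insert j (set xs). lborel))"
    using Cons.prems by (intro product_nn_integral_insert_rev[symmetric] m) auto
  finally show ?case by simp
qed

lemma nn_integral_eq_integral_coords:
  fixes h :: "real ^ 'n \<Rightarrow> real"
  assumes h: "continuous_on UNIV h" "\<And>x. h x \<ge> 0" "\<And>x i. \<bar>x $ i\<bar> > R \<Longrightarrow> h x = 0" and xs: "distinct xs" "set xs = UNIV"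
  shows "(\<integral>\<^sup>+x. ennreal (h x) \<partial>lborel) = ennreal (integral_coords R xs h x)"
proof -
  have eq: "foldr nn_coord ys (\<lambda>x. ennreal (h x)) x = ennreal (integral_coords R ys h x) \<and>
     (\<forall>x i. i \<notin> set ys \<longrightarrow> \<bar>x $ i\<bar> > R \<longrightarrow> integral_coords R ys h x = 0)" if "distinct ys" for ys x
    using that
  proof (induction ys arbitrary: x)
    case Nil then show ?case using h(3) by auto
  next
    case (Cons j ys)
    have c: "continuous_on UNIV (integral_coords R ys h)" by (rule integral_coords_continuous[OF h(1)])
    have IH1: "foldr nn_coord ys (\<lambda>x. ennreal (h x)) y = ennreal (integral_coords R ys h y)" for y using Cons by auto
    have IH2: "integral_coords R ys h y = 0" if "i \<notin> set ys" "\<bar>y $ i\<bar> > R" for i y using Cons that by auto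
    have "foldr nn_coord (j # ys) (\<lambda>x. ennreal (h x)) x = (\<integral>\<^sup>+t. ennreal (integral_coords R ys h (upd x j t)) \<partial>lborel)"
      by (simp add: nn_coord_def IH1)
    also have "\<dots> = (\<integral>\<^sup>+t. ennreal (integral_coords R ys h (upd x j t)) * indicator {-R..R} t \<partial>lborel)"
    proof (intro nn_integral_cong)
      fix t
      show "ennreal (integral_coords R ys h (upd x j t)) = ennreal (integral_coords R ys h (upd x j t)) * indicator {-R..R} t"
      proof (cases "\<bar>t\<bar> > R")
        case True
        then show ?thesis using IH2[of j "upd x j t"] Cons.prems by simp
      qed (auto simp: indicator_def)
    qed
    also have "\<dots> = ennreal (integral {-R..R} (\<lambda>t. integral_coords R ys h (upd x j t)))"
      by (rule nn_integral_has_integral_lebesgue'[OF _ integrable_integral[OF integrable_section[OF c]]])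
        (auto intro: integral_coords_nonneg h)
    finally have 1: "foldr nn_coord (j # ys) (\<lambda>x. ennreal (h x)) x = ennreal (integral_coords R (j # ys) h x)"
      by (simp add: integral_coord_def)
    have "integral_coords R (j # ys) h y = 0" if i: "i \<notin> set (j # ys)" "\<bar>y $ i\<bar> > R" for i y
    proof -
      have "integral_coords R ys h (upd y j t) = 0" for t using IH2[of i "upd y j t"] i by auto
      then show ?thesis by (simp add: integral_coord_def)
    qed
    with 1 show ?case by blast
  qed
  have hm: "(\<lambda>x. ennreal (h x)) \<in> borel_measurable borel"
    using borel_measurable_continuous_onI[OF h(1)] by measurable
  have "(\<integral>\<^sup>+x. ennreal (h x) \<partial>lborel) = (\<integral>\<^sup>+f. ennreal (h (\<chi> i. f i)) \<partial>(\<Pi>\<^sub>M i\<in>UNIV. lborel))"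
    by (subst lborel_vec_eq_distr_PiM, rule nn_integral_distr) (auto intro!: measurable_vec_lambda hm)
  also have "\<dots> = foldr nn_coord xs (\<lambda>x. ennreal (h x)) x"
    using foldr_nn_coord[OF hm xs(1), of x] xs(2) by simp
  finally show ?thesis using eq[OF xs(1)] by simp
qed

lemma lborel_integral_eq_integral_coords:
  fixes h :: "real ^ 'n \<Rightarrow> real"
  assumes h: "continuous_on UNIV h" "\<And>x. h x \<ge> 0" "\<And>x i. \<bar>x $ i\<bar> > R \<Longrightarrow> h x = 0" and xs: "distinct xs" "set xs = UNIV"
  shows "(LINT x|lborel. h x) = integral_coords R xs h x"
proof -
  have "(LINT x|lborel. h x) = enn2real (\<integral>\<^sup>+x. ennreal (h x) \<partial>lborel)"
    using borel_measurable_continuous_onI[OF h(1)] h(2) by (intro integral_eq_nn_integral) auto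
  moreover have "(\<integral>\<^sup>+x. ennreal (h x) \<partial>lborel) = ennreal (integral_coords R xs h x)"
    by (rule nn_integral_eq_integral_coords) (use h xs in auto)
  moreover have "integral_coords R xs h x \<ge> 0" by (rule integral_coords_nonneg[OF h(2)])
  ultimately show ?thesis by simp
qed

text \<open>Write \<open>w^(\<nu>/(\<nu>-1))\<close> as the product of \<open>\<nu>\<close> factors \<open>w^(1/(\<nu>-1))\<close>, and bound the \<open>i\<close>-th one by the
  integral of \<open>F i\<close> along the \<open>i\<close>-th coordinate, which does not depend on that coordinate.\<close>

lemma Gagliardo_Nirenberg:
  fixes w :: "real ^ 'n \<Rightarrow> real" and F :: "'n \<Rightarrow> real ^ 'n \<Rightarrow> real"
  assumes R: "R > 0" and n: "CARD('n) \<ge> 2"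
    and w: "continuous_on UNIV w" "\<And>x. w x \<ge> 0" "\<And>x i. \<bar>x $ i\<bar> > R \<Longrightarrow> w x = 0"
    and F: "\<And>i. continuous_on UNIV (F i)" "\<And>i x. F i x \<ge> 0" "\<And>k x i. \<bar>x $ i\<bar> > R \<Longrightarrow> F k x = 0"
    and wF: "\<And>i x. w x \<le> integral_coord R i (F i) x"
  defines "\<nu> \<equiv> real CARD('n)"
  shows "(LINT x|lborel. w x powr (\<nu> / (\<nu> - 1))) \<le> (\<Prod>i\<in>UNIV. (LINT x|lborel. F i x) powr (1 / (\<nu> - 1)))"
proof -
  have \<nu>: "\<nu> \<ge> 2" using n by (simp add: \<nu>_def)
  obtain xs :: "'n list" where xs: "distinct xs" "set xs = UNIV"
    using finite_distinct_list[OF finite[of UNIV]] by blast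
  have wc: "continuous_on UNIV (\<lambda>x. w x powr (\<nu> / (\<nu> - 1)))"
    using w \<nu> by (intro continuous_on_powr') (auto intro: continuous_intros)
  have gc: "continuous_on UNIV (\<lambda>x. \<Prod>i\<in>UNIV. integral_coord R i (F i) x powr (1 / (\<nu> - 1)))"
    using F \<nu> by (intro continuous_on_prod continuous_on_powr')
      (auto intro: continuous_intros integral_coord_continuous integral_coord_nonneg)
  have "(LINT x|lborel. w x powr (\<nu> / (\<nu> - 1))) = integral_coords R xs (\<lambda>x. w x powr (\<nu> / (\<nu> - 1))) 0"
    using w by (intro lborel_integral_eq_integral_coords wc xs) auto
  also have "\<dots> \<le> integral_coords R xs (\<lambda>x. \<Prod>i\<in>UNIV. integral_coord R i (F i) x powr (1 / (\<nu> - 1))) 0"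
  proof (rule integral_coords_mono[OF wc gc])
    fix x
    have "w x powr (\<nu> / (\<nu> - 1)) = (\<Prod>i\<in>(UNIV :: 'n set). w x powr (1 / (\<nu> - 1)))"
      by (cases "w x = 0") (simp_all add: \<nu>_def powr_power)
    also have "\<dots> \<le> (\<Prod>i\<in>UNIV. integral_coord R i (F i) x powr (1 / (\<nu> - 1)))"
      using w \<nu> wF by (intro prod_mono conjI powr_mono2) auto
    finally show "w x powr (\<nu> / (\<nu> - 1)) \<le> (\<Prod>i\<in>UNIV. integral_coord R i (F i) x powr (1 / (\<nu> - 1)))" .
  qed
  also have "\<dots> \<le> (\<Prod>i\<in>UNIV. integral_coords R xs (F i) 0 powr (1 / (\<nu> - 1)))"
    using Gagliardo_Nirenberg_coords[of R F, OF R n F(1,2) xs(1), where x = 0] xs(2) by (simp add: \<nu>_def)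
  also have "\<dots> = (\<Prod>i\<in>UNIV. (LINT x|lborel. F i x) powr (1 / (\<nu> - 1)))"
  proof -
    have "(LINT x|lborel. F i x) = integral_coords R xs (F i) 0" for i
      by (rule lborel_integral_eq_integral_coords) (use F xs in auto)
    then show ?thesis by simp
  qed
  finally show ?thesis .
qed

lemma abs_powr_has_derivative:
  fixes s :: real
  assumes \<gamma>: "\<gamma> > 1"
  shows "((\<lambda>s. \<bar>s\<bar> powr \<gamma>) has_real_derivative \<gamma> * \<bar>s\<bar> powr (\<gamma> - 1) * sgn s) (at s)"
proof -
  consider "s > 0" | "s < 0" | "s = 0" by linarith
  then show ?thesis
  proof cases
    case 1
    have "\<forall>\<^sub>F x in nhds s. \<bar>x\<bar> powr \<gamma> = x powr \<gamma>"
      using eventually_nhds_in_open[of "{0<..}" s] 1 by (auto elim: eventually_mono)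
    then show ?thesis using has_real_derivative_powr[OF 1, of \<gamma>] 1
      by (subst DERIV_cong_ev[OF refl _ refl]) auto
  next
    case 2
    have "\<forall>\<^sub>F x in nhds s. \<bar>x\<bar> powr \<gamma> = (- x) powr \<gamma>"
      using eventually_nhds_in_open[of "{..<0}" s] 2 by (auto elim: eventually_mono)
    moreover have "((\<lambda>x. (- x) powr \<gamma>) has_real_derivative (\<gamma> * (- s) powr (\<gamma> - 1)) * (- 1)) (at s)"
      by (rule DERIV_chain2[of "\<lambda>x. x powr \<gamma>"]) (use 2 in \<open>auto intro!: has_real_derivative_powr derivative_eq_intros\<close>)
    ultimately show ?thesis using 2
      by (subst DERIV_cong_ev[OF refl _ refl]) auto
  next
    case 3
    have "((\<lambda>h. \<bar>h\<bar> powr (\<gamma> - 1)) \<longlongrightarrow> 0 powr (\<gamma> - 1)) (at (0::real))"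
      using \<gamma> by (intro tendsto_powr') (auto intro!: tendsto_eq_intros)
    then have l: "((\<lambda>h. \<bar>h\<bar> powr (\<gamma> - 1)) \<longlongrightarrow> 0) (at (0::real))" by simp
    have "((\<lambda>h. (\<bar>0 + h\<bar> powr \<gamma> - \<bar>0\<bar> powr \<gamma>) / h) \<longlongrightarrow> 0) (at (0::real))"
    proof (rule Lim_null_comparison[OF _ l])
      show "\<forall>\<^sub>F h in at (0::real). norm ((\<bar>0 + h\<bar> powr \<gamma> - \<bar>0\<bar> powr \<gamma>) / h) \<le> \<bar>h\<bar> powr (\<gamma> - 1)"
        by (auto simp: eventually_at powr_diff intro!: exI[of _ 1])
    qed
    then show ?thesis using 3 by (simp add: DERIV_def)
  qed
qed

lemma partial_section:
  assumes "\<phi> \<in> test_functions \<Omega>"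
  shows "((\<lambda>t. \<phi> (upd x i t)) has_real_derivative partial i \<phi> (upd x i t)) (at t)"
proof -
  have u: "upd x i = (\<lambda>t. upd x i 0 + t *\<^sub>R axis i 1)" by (auto simp: fun_eq_iff vec_eq_iff axis_def)
  have "(upd x i has_derivative (\<lambda>s. s *\<^sub>R axis i 1)) (at t)"
    by (subst u) (auto intro!: derivative_eq_intros)
  from has_derivative_compose[OF this test_function_has_derivative[OF assms]]
  have "((\<lambda>t. \<phi> (upd x i t)) has_derivative (\<lambda>s. \<Sum>j\<in>UNIV. (s *\<^sub>R axis i 1) $ j * partial j \<phi> (upd x i t))) (at t)" .
  moreover have "(\<lambda>s. \<Sum>j\<in>UNIV. (s *\<^sub>R axis i 1) $ j * partial j \<phi> (upd x i t)) = (*) (partial i \<phi> (upd x i t))"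
    by (auto simp: axis_def if_distrib if_distribR sum.delta fun_eq_iff cong: if_cong)
  ultimately show ?thesis unfolding has_field_derivative_def by simp
qed

text \<open>Apply the case \<open>p = 1\<close> to \<open>|\<phi>|^\<gamma>\<close> with the exponent \<open>\<gamma>\<close> for which Hoelder's inequality
  reproduces the integral of \<open>|\<phi>|^q\<close> on the right-hand side.\<close>

lemma Sobolev_test_function:
  fixes \<phi> :: "real ^ 'n \<Rightarrow> real"
  assumes n: "CARD('n) \<ge> 2" and \<phi>: "\<phi> \<in> test_functions UNIV"
  defines "\<nu> \<equiv> real CARD('n)"
  assumes p: "1 < p" "p < \<nu>"
  shows "(LINT x|lborel. \<bar>\<phi> x\<bar> powr (\<nu> * p / (\<nu> - p))) powr ((\<nu> - p) / (\<nu> * p))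
    \<le> p * (\<nu> - 1) / (\<nu> - p) * (LINT x|lborel. norm (grad \<phi> x) powr p) powr (1 / p)"
proof -
  have \<nu>: "\<nu> \<ge> 2" using n by (simp add: \<nu>_def)
  define \<gamma> where "\<gamma> = p * (\<nu> - 1) / (\<nu> - p)"
  define q where "q = \<nu> * p / (\<nu> - p)"
  have \<gamma>: "\<gamma> > 1"
  proof -
    have "\<nu> - p < p * (\<nu> - 1)" using p \<nu> mult_strict_left_mono[of 1 p \<nu>] by (simp add: algebra_simps)
    then show ?thesis using p by (simp add: \<gamma>_def)
  qed
  have q: "q > 0" using p by (simp add: q_def)
  have \<gamma>q: "\<gamma> * (\<nu> / (\<nu> - 1)) = q" using \<nu> by (simp add: \<gamma>_def q_def)
  have \<gamma>1: "\<gamma> - 1 = \<nu> * (p - 1) / (\<nu> - p)" using p by (simp add: \<gamma>_def field_simps)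
  have \<gamma>1q: "(\<gamma> - 1) * (p / (p - 1)) = q" unfolding \<gamma>1 q_def using p by simp
  then have \<gamma>1q': "(\<gamma> - 1) * p / (p - 1) = q" by simp
  have \<phi>c: "continuous_on UNIV \<phi>" by (rule test_function_continuous[OF \<phi>])
  have \<phi>'c: "continuous_on UNIV (partial i \<phi>)" for i by (rule test_function_continuous[OF partial_test_function[OF \<phi>]])
  obtain S where S: "compact S" "\<And>x. x \<notin> S \<Longrightarrow> \<phi> x = 0" "\<And>x i. x \<notin> S \<Longrightarrow> partial i \<phi> x = 0"
    using test_function_support[OF \<phi>] by metis
  obtain R0 where R0: "R0 > 0" "\<And>x. x \<in> S \<Longrightarrow> norm x \<le> R0"
    using compact_imp_bounded[OF S(1)] by (auto simp: bounded_pos)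
  define R where "R = R0 + 1"
  have R: "R > 0" using R0 by (simp add: R_def)
  have out: "\<phi> x = 0" "partial k \<phi> x = 0" if "\<bar>x $ i\<bar> \<ge> R" for x i k
  proof -
    have "norm x \<ge> R" using that component_le_norm_cart[of x i] by linarith
    then have "x \<notin> S" using R0(2)[of x] by (auto simp: R_def)
    then show "\<phi> x = 0" "partial k \<phi> x = 0" using S by auto
  qed
  define w where "w x = \<bar>\<phi> x\<bar> powr \<gamma>" for x
  define F where "F i x = \<gamma> * \<bar>\<phi> x\<bar> powr (\<gamma> - 1) * \<bar>partial i \<phi> x\<bar>" for i x
  have wc: "continuous_on UNIV w" unfolding w_def[abs_def]
    using \<phi>c \<gamma> by (intro continuous_on_powr') (auto intro: continuous_intros)
  have pc: "continuous_on UNIV (\<lambda>x. \<bar>\<phi> x\<bar> powr (\<gamma> - 1))"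
    using \<phi>c \<gamma> by (intro continuous_on_powr') (auto intro: continuous_intros)
  have Fc: "continuous_on UNIV (F i)" for i unfolding F_def[abs_def]
    by (intro continuous_intros pc \<phi>'c)
  have wF: "w x \<le> integral_coord R i (F i) x" for i x
  proof (cases "\<bar>x $ i\<bar> \<ge> R")
    case True
    then show ?thesis using integral_coord_nonneg[of "F i"] out(1) \<gamma> by (simp add: w_def F_def)
  next
    case False
    define w' where "w' t = \<gamma> * \<bar>\<phi> (upd x i t)\<bar> powr (\<gamma> - 1) * sgn (\<phi> (upd x i t)) * partial i \<phi> (upd x i t)" for t
    have "((\<lambda>t. w (upd x i t)) has_real_derivative w' t) (at t)" for t
      unfolding w_def w'_def by (rule DERIV_chain2[OF abs_powr_has_derivative[OF \<gamma>] partial_section[OF \<phi>]])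
    then have "((\<lambda>t. w (upd x i t)) has_vector_derivative w' t) (at t within {-R..x $ i})" for t
      by (simp add: has_real_derivative_iff_has_vector_derivative has_vector_derivative_at_within)
    then have int: "(w' has_integral (w (upd x i (x $ i)) - w (upd x i (-R)))) {-R..x $ i}"
      using False by (intro fundamental_theorem_of_calculus) auto
    have "w (upd x i (-R)) = 0" using out(1)[of "upd x i (-R)" i] R \<gamma> by (simp add: w_def)
    with int have int: "(w' has_integral w x) {-R..x $ i}" by simp
    have FI: "(\<lambda>t. F i (upd x i t)) integrable_on {-R..R}" by (rule integrable_section[OF Fc])
    have FI': "(\<lambda>t. F i (upd x i t)) integrable_on {-R..x $ i}"
      by (rule integrable_on_subinterval[OF FI]) (use False in auto)
    have "w x \<le> integral {-R..x $ i} (\<lambda>t. F i (upd x i t))"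
    proof (rule has_integral_le[OF int integrable_integral[OF FI']])
      fix t
      have "w' t \<le> \<bar>w' t\<bar>" by simp
      also have "\<dots> \<le> F i (upd x i t)" using \<gamma> by (simp add: w'_def F_def abs_mult abs_sgn_eq mult_right_mono)
      finally show "w' t \<le> F i (upd x i t)" .
    qed
    also have "\<dots> \<le> integral {-R..R} (\<lambda>t. F i (upd x i t))"
      using False \<gamma> by (intro integral_subset_le FI FI') (auto simp: F_def)
    finally show ?thesis by (simp add: integral_coord_def)
  qed
  define I where "I = (LINT x|lborel. \<bar>\<phi> x\<bar> powr q)"
  define D where "D = (LINT x|lborel. norm (grad \<phi> x) powr p)"
  have I0: "I \<ge> 0" and D0: "D \<ge> 0" unfolding I_def D_def by (auto intro!: Bochner_Integration.integral_nonneg)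
  have gc: "continuous_on UNIV (grad \<phi>)" by (rule grad_continuous[OF \<phi>])
  have g0: "grad \<phi> x = 0" if "x \<notin> S" for x using S(3)[OF that] by (simp add: vec_eq_iff)
  have HI: "integrable lborel (\<lambda>x. \<bar>\<bar>\<phi> x\<bar> powr (\<gamma> - 1)\<bar> powr (p / (p - 1)))"
    using S(2) p q by (intro continuous_compact_support_integrable[OF _ S(1)] continuous_on_powr' continuous_intros pc) (auto simp: \<gamma>)
  have HD: "integrable lborel (\<lambda>x. \<bar>norm (grad \<phi> x)\<bar> powr p)"
    using g0 p by (intro continuous_compact_support_integrable[OF _ S(1)] continuous_on_powr' continuous_intros gc) auto
  have [measurable]: "\<phi> \<in> borel_measurable borel" "grad \<phi> \<in> borel_measurable borel"
    using \<phi>c gc by (auto intro: borel_measurable_continuous_onI)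
  have conj: "1 / (p / (p - 1)) + 1 / p = 1" using p by (simp add: field_simps)
  have pp: "p / (p - 1) > 1" using p by (simp add: field_simps)
  have H: "integrable lborel (\<lambda>x. \<bar>\<phi> x\<bar> powr (\<gamma> - 1) * norm (grad \<phi> x))"
    "(LINT x|lborel. \<bar>\<bar>\<phi> x\<bar> powr (\<gamma> - 1) * norm (grad \<phi> x)\<bar>) \<le>
      (LINT x|lborel. \<bar>\<bar>\<phi> x\<bar> powr (\<gamma> - 1)\<bar> powr (p / (p - 1))) powr (1 / (p / (p - 1))) * (LINT x|lborel. \<bar>norm (grad \<phi> x)\<bar> powr p) powr (1 / p)"
    by (rule Holder_inequality[OF pp p(1) conj _ HI _ HD]; measurable)+
  have HH: "(LINT x|lborel. \<bar>\<phi> x\<bar> powr (\<gamma> - 1) * norm (grad \<phi> x)) \<le> I powr ((p - 1) / p) * D powr (1 / p)"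
    using H(2) by (simp add: powr_powr \<gamma>1q' I_def D_def)
  have FL: "(LINT x|lborel. F i x) \<le> \<gamma> * (I powr ((p - 1) / p) * D powr (1 / p))" for i
  proof -
    have "(LINT x|lborel. F i x) \<le> (LINT x|lborel. \<gamma> * (\<bar>\<phi> x\<bar> powr (\<gamma> - 1) * norm (grad \<phi> x)))"
    proof (rule integral_mono')
      fix x
      show "F i x \<le> \<gamma> * (\<bar>\<phi> x\<bar> powr (\<gamma> - 1) * norm (grad \<phi> x))"
        using component_le_norm_cart[of "grad \<phi> x" i] \<gamma> by (simp add: F_def mult.assoc mult_left_mono)
    qed (use H(1) \<gamma> in auto)
    also have "\<dots> = \<gamma> * (LINT x|lborel. \<bar>\<phi> x\<bar> powr (\<gamma> - 1) * norm (grad \<phi> x))" by simp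
    also have "\<dots> \<le> \<gamma> * (I powr ((p - 1) / p) * D powr (1 / p))" using HH \<gamma> by (intro mult_left_mono) auto
    finally show ?thesis .
  qed
  have "(LINT x|lborel. w x powr (\<nu> / (\<nu> - 1))) \<le> (\<Prod>i\<in>UNIV. (LINT x|lborel. F i x) powr (1 / (\<nu> - 1)))"
    unfolding \<nu>_def
  proof (rule Gagliardo_Nirenberg[OF R n wc _ _ Fc _ _ wF])
    show "w x = 0" if "\<bar>x $ i\<bar> > R" for x i using out(1)[of x i] that by (simp add: w_def)
    show "F k x = 0" if "\<bar>x $ i\<bar> > R" for k x i using out(2)[of x i k] that by (simp add: F_def)
  qed (use \<gamma> in \<open>auto simp: w_def F_def\<close>)
  also have "\<dots> \<le> (\<Prod>i\<in>(UNIV :: 'n set). (\<gamma> * (I powr ((p - 1) / p) * D powr (1 / p))) powr (1 / (\<nu> - 1)))"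
    using \<nu> \<gamma> by (intro prod_mono conjI powr_mono2 FL) (auto simp: F_def intro!: Bochner_Integration.integral_nonneg)
  also have "\<dots> = ((\<gamma> * (I powr ((p - 1) / p) * D powr (1 / p))) powr (1 / (\<nu> - 1))) powr \<nu>"
    using \<nu> by (simp add: \<nu>_def powr_realpow')
  also have "(LINT x|lborel. w x powr (\<nu> / (\<nu> - 1))) = I"
    using \<gamma>q by (simp add: w_def I_def powr_powr)
  finally have main: "I \<le> (\<gamma> * (I powr ((p - 1) / p) * D powr (1 / p))) powr (\<nu> / (\<nu> - 1))"
    by (simp add: powr_powr)
  have "I powr ((\<nu> - p) / (\<nu> * p)) \<le> \<gamma> * D powr (1 / p)"
  proof (cases "I = 0")
    case True
    then show ?thesis using \<gamma> by simp
  next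
    case False
    with I0 have Ip: "I > 0" by simp
    have "I powr ((\<nu> - 1) / \<nu>) \<le> ((\<gamma> * (I powr ((p - 1) / p) * D powr (1 / p))) powr (\<nu> / (\<nu> - 1))) powr ((\<nu> - 1) / \<nu>)"
      using main I0 \<nu> by (intro powr_mono2) auto
    also have "\<dots> = \<gamma> * (I powr ((p - 1) / p) * D powr (1 / p))"
      using \<nu> \<gamma> by (simp add: powr_powr)
    finally have "I powr ((\<nu> - 1) / \<nu>) / I powr ((p - 1) / p) \<le> \<gamma> * D powr (1 / p)"
      using Ip by (simp add: divide_le_eq mult_ac)
    also have "I powr ((\<nu> - 1) / \<nu>) / I powr ((p - 1) / p) = I powr ((\<nu> - 1) / \<nu> - (p - 1) / p)"
      by (simp add: powr_diff)
    also have "(\<nu> - 1) / \<nu> - (p - 1) / p = (\<nu> - p) / (\<nu> * p)"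
      using \<nu> p by (simp add: field_simps)
    finally show ?thesis .
  qed
  then show ?thesis by (simp add: I_def D_def q_def \<gamma>_def)
qed

lemma integral_powr_le_measure_powr:
  assumes \<Omega>: "\<Omega> \<in> lmeasurable" and g: "g \<in> Lp p \<Omega>" and r: "0 < r" "r < p" and A: "A \<in> sets (lebesgue_on \<Omega>)"
  shows "(LINT x|lebesgue_on \<Omega>. indicator A x * norm (g x) powr r) \<le>
    (LINT x|lebesgue_on \<Omega>. norm (g x) powr p) powr (r / p) * measure (lebesgue_on \<Omega>) A powr (1 - r / p)"
proof -
  interpret finite_measure "lebesgue_on \<Omega>" using \<Omega> by (rule finite_measure_lebesgue_on)
  note [measurable] = LpD(1)[OF g]
  have "integrable (lebesgue_on \<Omega>) (\<lambda>x. \<bar>norm (g x) powr r\<bar> powr (p / r))"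
    using LpD(2)[OF g] r by (simp add: powr_powr)
  then show ?thesis
    using Holder_on_set[of "p / r" "\<lambda>x. norm (g x) powr r" A] A r by (simp add: powr_powr)
qed

lemma Lp_convergence_lower_exponent:
  assumes \<Omega>: "\<Omega> \<in> lmeasurable" and g: "\<And>j::nat. g j \<in> Lp p \<Omega>" and r: "0 < r" "r \<le> p"
    and lim: "(\<lambda>j. LINT x|lebesgue_on \<Omega>. norm (g j x) powr p) \<longlonglongrightarrow> 0"
  shows "(\<lambda>j. LINT x|lebesgue_on \<Omega>. norm (g j x) powr r) \<longlonglongrightarrow> 0"
proof (cases "r = p")
  case False
  with r have r': "r < p" by simp
  have s: "\<Omega> \<in> sets (lebesgue_on \<Omega>)" using \<Omega> by (metis sets.top space_lebesgue_on)
  have "(\<lambda>j. (LINT x|lebesgue_on \<Omega>. norm (g j x) powr p) powr (r / p)) \<longlonglongrightarrow> 0 powr (r / p)"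
    using lim r r' by (intro tendsto_powr') (auto intro: tendsto_const)
  then have l: "(\<lambda>j. (LINT x|lebesgue_on \<Omega>. norm (g j x) powr p) powr (r / p) * measure (lebesgue_on \<Omega>) \<Omega> powr (1 - r / p)) \<longlonglongrightarrow> 0"
    by (intro tendsto_mult_left_zero) simp
  show ?thesis
  proof (rule tendsto_sandwich[OF always_eventually always_eventually tendsto_const l])
    show "\<forall>j. (LINT x|lebesgue_on \<Omega>. norm (g j x) powr r) \<le> (LINT x|lebesgue_on \<Omega>. norm (g j x) powr p) powr (r / p) * measure (lebesgue_on \<Omega>) \<Omega> powr (1 - r / p)"
    proof
      fix j
      have "(LINT x|lebesgue_on \<Omega>. norm (g j x) powr r) = (LINT x|lebesgue_on \<Omega>. indicator \<Omega> x * norm (g j x) powr r)"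
        by (intro Bochner_Integration.integral_cong) auto
      with integral_powr_le_measure_powr[OF \<Omega> g r(1) r' s, of j]
      show "(LINT x|lebesgue_on \<Omega>. norm (g j x) powr r) \<le> (LINT x|lebesgue_on \<Omega>. norm (g j x) powr p) powr (r / p) * measure (lebesgue_on \<Omega>) \<Omega> powr (1 - r / p)"
        by simp
    qed
  qed (auto intro!: Bochner_Integration.integral_nonneg)
qed (use lim in simp)

text \<open>Apply the inequality to an approximating sequence and pass to the limit by Fatou's lemma. The
  gradients of the sequence are estimated crudely, which costs a factor \<open>2\<close>.\<close>

lemma Sobolev_W1_0:
  fixes w :: "real ^ 'n \<Rightarrow> real"
  assumes n: "CARD('n) \<ge> 2" and \<Omega>: "open \<Omega>" "\<Omega> \<in> lmeasurable"
    and w: "w \<in> W1_0 p \<Omega>" "has_weak_gradient \<Omega> w G"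
  defines "\<nu> \<equiv> real CARD('n)"
  assumes r: "1 < r" "r < \<nu>" "r \<le> p"
  defines "q \<equiv> \<nu> * r / (\<nu> - r)"
  shows "w \<in> Lp q \<Omega>"
    and "(LINT x|lebesgue_on \<Omega>. \<bar>w x\<bar> powr q) powr (1 / q) \<le>
      2 * (r * (\<nu> - 1) / (\<nu> - r)) * (LINT x|lebesgue_on \<Omega>. norm (G x) powr r) powr (1 / r)"
proof -
  have p: "p \<ge> 1" using r by simp
  have \<Omega>l: "\<Omega> \<in> sets lebesgue" using \<Omega> by simp
  have wW: "w \<in> W1 p \<Omega>" using w(1) by (simp add: W1_0_def)
  have wLp: "w \<in> Lp p \<Omega>" using wW by (simp add: W1_def)
  have GLp: "G \<in> Lp p \<Omega>" by (rule W1_weak_gradient_Lp[OF \<Omega>(1) wW w(2)])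
  have q: "q > 0" using r by (simp add: q_def)
  define c where "c = r * (\<nu> - 1) / (\<nu> - r)"
  have c: "c > 0" using r by (simp add: c_def)
  obtain \<psi> where \<psi>: "\<And>j. \<psi> j \<in> test_functions \<Omega>"
    "(\<lambda>j. LINT x|lebesgue_on \<Omega>. \<bar>w x - \<psi> j x\<bar> powr p) \<longlonglongrightarrow> 0"
    "(\<lambda>j. LINT x|lebesgue_on \<Omega>. norm (G x - grad (\<psi> j) x) powr p) \<longlonglongrightarrow> 0"
    "AE x in lebesgue_on \<Omega>. (\<lambda>j. \<psi> j x) \<longlonglongrightarrow> w x"
    using W1_0_sequence[OF \<Omega> p w] by blast
  have \<psi>U: "\<psi> j \<in> test_functions UNIV" for j using test_function_mono[OF \<psi>(1)] by simp
  have p0: "p \<ge> 0" and r0: "r \<ge> 0" using p r by auto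
  have dLp: "(\<lambda>x. G x - grad (\<psi> j) x) \<in> Lp p \<Omega>" for j
    by (intro Lp_diff GLp test_function_Lp[OF \<Omega>(2) \<psi>(1)] p0)
  define D where "D = (LINT x|lebesgue_on \<Omega>. norm (G x) powr r)"
  define d where "d j = (LINT x|lebesgue_on \<Omega>. norm (G x - grad (\<psi> j) x) powr r)" for j
  have D0: "D \<ge> 0" and d0: "d j \<ge> 0" for j by (auto simp: D_def d_def intro!: Bochner_Integration.integral_nonneg)
  have dlim: "d \<longlonglongrightarrow> 0"
    unfolding d_def[abs_def] using r by (intro Lp_convergence_lower_exponent[OF \<Omega>(2) dLp _ _ \<psi>(3)]) auto
  note trans = integral_lebesgue_on_eq_lborel[OF _ _ \<Omega>l, symmetric]
  have out: "\<psi> j x = 0 \<and> grad (\<psi> j) x = 0" if "x \<notin> \<Omega>" for j x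
  proof -
    obtain S where "S \<subseteq> \<Omega>" "\<And>x. x \<notin> S \<Longrightarrow> \<psi> j x = 0" "\<And>x i. x \<notin> S \<Longrightarrow> partial i (\<psi> j) x = 0"
      using test_function_support[OF \<psi>(1)] by metis
    with that show ?thesis by (auto simp: vec_eq_iff)
  qed
  have mb[measurable]: "\<psi> j \<in> borel_measurable borel" "grad (\<psi> j) \<in> borel_measurable borel" for j
    using test_function_continuous[OF \<psi>(1)] grad_continuous[OF \<psi>(1)] by (auto intro: borel_measurable_continuous_onI)
  have gi: "(LINT x|lebesgue_on \<Omega>. norm (grad (\<psi> j) x) powr r) \<le> 2 powr r * (D + d j)" for j
  proof -
    have i1: "integrable (lebesgue_on \<Omega>) (\<lambda>x. norm (G x) powr r)"
      using LpD(2)[OF Lp_mono[OF \<Omega>(2) GLp r0 r(3)]] .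
    have i2: "integrable (lebesgue_on \<Omega>) (\<lambda>x. norm (G x - grad (\<psi> j) x) powr r)"
      using LpD(2)[OF Lp_mono[OF \<Omega>(2) dLp r0 r(3)]] .
    have "(LINT x|lebesgue_on \<Omega>. norm (grad (\<psi> j) x) powr r) \<le> (LINT x|lebesgue_on \<Omega>. 2 powr r * (norm (G x) powr r + norm (G x - grad (\<psi> j) x) powr r))"
    proof (rule integral_mono')
      show "norm (grad (\<psi> j) x) powr r \<le> 2 powr r * (norm (G x) powr r + norm (G x - grad (\<psi> j) x) powr r)" for x
        using norm_add_powr_le[OF r0, of "G x" "grad (\<psi> j) x - G x"] by (simp add: norm_minus_commute)
    qed (use i1 i2 in auto)
    also have "\<dots> = 2 powr r * (D + d j)" using i1 i2 by (simp add: D_def d_def)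
    finally show ?thesis .
  qed
  define b where "b j = (c * (2 powr r * (D + d j)) powr (1 / r)) powr q" for j
  have bnd: "(LINT x|lebesgue_on \<Omega>. \<bar>\<psi> j x\<bar> powr q) \<le> b j" for j
  proof -
    define I where "I = (LINT x|lebesgue_on \<Omega>. \<bar>\<psi> j x\<bar> powr q)"
    have I0: "I \<ge> 0" by (auto simp: I_def intro!: Bochner_Integration.integral_nonneg)
    have "(LINT x|lborel. \<bar>\<psi> j x\<bar> powr q) powr ((\<nu> - r) / (\<nu> * r)) \<le> c * (LINT x|lborel. norm (grad (\<psi> j) x) powr r) powr (1 / r)"
      using Sobolev_test_function[OF n \<psi>U r(1) r(2)[unfolded \<nu>_def]] by (simp add: q_def c_def \<nu>_def)
    also have "(LINT x|lborel. norm (grad (\<psi> j) x) powr r) = (LINT x|lebesgue_on \<Omega>. norm (grad (\<psi> j) x) powr r)"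
      by (rule trans) (use out in auto)
    also have "(LINT x|lborel. \<bar>\<psi> j x\<bar> powr q) = I"
      unfolding I_def by (rule trans) (use out in auto)
    also have "(\<nu> - r) / (\<nu> * r) = 1 / q" by (simp add: q_def)
    also have "c * (LINT x|lebesgue_on \<Omega>. norm (grad (\<psi> j) x) powr r) powr (1 / r) \<le> c * (2 powr r * (D + d j)) powr (1 / r)"
      using c r gi by (intro mult_left_mono powr_mono2) (auto intro!: Bochner_Integration.integral_nonneg)
    finally have "(I powr (1 / q)) powr q \<le> b j" unfolding b_def using q by (intro powr_mono2) auto
    then show ?thesis using I0 q by (simp add: powr_powr I_def)
  qed
  have "b \<longlonglongrightarrow> (c * (2 powr r * (D + 0)) powr (1 / r)) powr q"
    unfolding b_def[abs_def] using c q r D0 d0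
    by (intro tendsto_powr' tendsto_mult tendsto_const tendsto_add dlim) (auto intro!: always_eventually)
  moreover have "(2 powr r * (D + 0)) powr (1 / r) = 2 * D powr (1 / r)" using r by (simp add: powr_mult powr_powr)
  ultimately have blim: "b \<longlonglongrightarrow> (2 * c * D powr (1 / r)) powr q" by (simp add: mult_ac)
  have mw[measurable]: "w \<in> borel_measurable (lebesgue_on \<Omega>)" by (rule LpD(1)[OF wLp])
  have m\<psi>[measurable]: "\<psi> j \<in> borel_measurable (lebesgue_on \<Omega>)" for j by (rule borel_imp_lebesgue_on[OF mb(1)])
  have "(\<integral>\<^sup>+x. ennreal (\<bar>w x\<bar> powr q) \<partial>lebesgue_on \<Omega>) = (\<integral>\<^sup>+x. liminf (\<lambda>j. ennreal (\<bar>\<psi> j x\<bar> powr q)) \<partial>lebesgue_on \<Omega>)"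
  proof (rule nn_integral_cong_AE)
    show "AE x in lebesgue_on \<Omega>. ennreal (\<bar>w x\<bar> powr q) = liminf (\<lambda>j. ennreal (\<bar>\<psi> j x\<bar> powr q))"
      using \<psi>(4)
    proof eventually_elim
      case (elim x)
      have "(\<lambda>j. \<bar>\<psi> j x\<bar> powr q) \<longlonglongrightarrow> \<bar>w x\<bar> powr q"
        using q elim by (intro tendsto_powr' tendsto_rabs tendsto_const) auto
      then have "(\<lambda>j. ennreal (\<bar>\<psi> j x\<bar> powr q)) \<longlonglongrightarrow> ennreal (\<bar>w x\<bar> powr q)" by (rule tendsto_ennrealI)
      then show ?case by (intro lim_imp_Liminf[symmetric]) auto
    qed
  qed
  also have "\<dots> \<le> liminf (\<lambda>j. \<integral>\<^sup>+x. ennreal (\<bar>\<psi> j x\<bar> powr q) \<partial>lebesgue_on \<Omega>)"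
    by (rule nn_integral_liminf) measurable
  also have "\<dots> \<le> liminf (\<lambda>j. ennreal (b j))"
  proof (rule Liminf_mono, rule always_eventually, rule allI)
    fix j
    have "integrable (lebesgue_on \<Omega>) (\<lambda>x. \<bar>\<psi> j x\<bar> powr q)"
      using LpD(2)[OF test_function_Lp(1)[OF \<Omega>(2) \<psi>(1), of q j]] q by simp
    then show "(\<integral>\<^sup>+x. ennreal (\<bar>\<psi> j x\<bar> powr q) \<partial>lebesgue_on \<Omega>) \<le> ennreal (b j)"
      using bnd by (subst nn_integral_eq_integral) (auto intro: ennreal_leI)
  qed
  also have "\<dots> = ennreal ((2 * c * D powr (1 / r)) powr q)"
    using tendsto_ennrealI[OF blim] by (intro lim_imp_Liminf) auto
  finally have fin: "(\<integral>\<^sup>+x. ennreal (\<bar>w x\<bar> powr q) \<partial>lebesgue_on \<Omega>) \<le> ennreal ((2 * c * D powr (1 / r)) powr q)" .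
  then have i: "integrable (lebesgue_on \<Omega>) (\<lambda>x. \<bar>w x\<bar> powr q)"
    by (intro integrableI_nonneg) (auto intro: le_less_trans)
  then show "w \<in> Lp q \<Omega>" by (simp add: Lp_def)
  have "(LINT x|lebesgue_on \<Omega>. \<bar>w x\<bar> powr q) \<le> (2 * c * D powr (1 / r)) powr q"
    using fin by (subst (asm) nn_integral_eq_integral[OF i]) (auto simp: ennreal_le_iff)
  then have "(LINT x|lebesgue_on \<Omega>. \<bar>w x\<bar> powr q) powr (1 / q) \<le> ((2 * c * D powr (1 / r)) powr q) powr (1 / q)"
    using q by (intro powr_mono2) (auto intro!: Bochner_Integration.integral_nonneg)
  also have "\<dots> = 2 * c * D powr (1 / r)" using q c by (simp add: powr_powr)
  finally show "(LINT x|lebesgue_on \<Omega>. \<bar>w x\<bar> powr q) powr (1 / q) \<le>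
      2 * (r * (\<nu> - 1) / (\<nu> - r)) * (LINT x|lebesgue_on \<Omega>. norm (G x) powr r) powr (1 / r)"
    by (simp add: c_def D_def)
qed

text \<open>With \<open>p\<close>-th powers on both sides the estimate can absorb terms proportional to the right-hand side.
  If \<open>r < p\<close>, the exponent of the gradient is raised from \<open>r\<close> to \<open>p\<close> by Hoelder's inequality.\<close>

lemma Sobolev_W1_0_powr:
  fixes \<Omega> :: "(real ^ 'n) set"
  assumes n: "CARD('n) \<ge> 2" and \<Omega>: "open \<Omega>" "\<Omega> \<in> lmeasurable"
  defines "\<nu> \<equiv> real CARD('n)"
  assumes r: "1 < r" "r < \<nu>" "r \<le> p"
  defines "q \<equiv> \<nu> * r / (\<nu> - r)"
  shows "\<exists>S\<ge>0. \<forall>w G. w \<in> W1_0 p \<Omega> \<and> has_weak_gradient \<Omega> w G \<longrightarrow>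
    (LINT x|lebesgue_on \<Omega>. \<bar>w x\<bar> powr q) powr (p / q) \<le> S * (LINT x|lebesgue_on \<Omega>. norm (G x) powr p)"
proof -
  interpret finite_measure "lebesgue_on \<Omega>" using \<Omega>(2) by (rule finite_measure_lebesgue_on)
  have q: "q > 0" using r by (simp add: q_def)
  define c where "c = 2 * (r * (\<nu> - 1) / (\<nu> - r))"
  have c: "c \<ge> 0" using r by (simp add: c_def)
  define \<kappa> where "\<kappa> = max 1 (measure (lebesgue_on \<Omega>) \<Omega> powr (1 - r / p))"
  have \<kappa>: "\<kappa> \<ge> 1" by (simp add: \<kappa>_def)
  show ?thesis
  proof (intro exI[of _ "c powr p * \<kappa> powr (p / r)"] conjI allI impI)
    fix w G assume w: "w \<in> W1_0 p \<Omega> \<and> has_weak_gradient \<Omega> w G"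
    have GLp: "G \<in> Lp p \<Omega>" using w W1_weak_gradient_Lp[OF \<Omega>(1)] by (auto simp: W1_0_def)
    define I where "I = (LINT x|lebesgue_on \<Omega>. \<bar>w x\<bar> powr q)"
    define D where "D = (LINT x|lebesgue_on \<Omega>. norm (G x) powr p)"
    have D0: "D \<ge> 0" by (auto simp: D_def intro!: Bochner_Integration.integral_nonneg)
    have Dr: "(LINT x|lebesgue_on \<Omega>. norm (G x) powr r) \<le> D powr (r / p) * \<kappa>"
    proof (cases "r = p")
      case True
      have "D * 1 \<le> D * \<kappa>" using D0 \<kappa> by (intro mult_left_mono) auto
      then show ?thesis using True r D0 by (simp add: D_def)
    next
      case False
      with r have rp: "0 < r" "r < p" by auto
      have s: "\<Omega> \<in> sets (lebesgue_on \<Omega>)" by (metis sets.top space_lebesgue_on)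
      have "(LINT x|lebesgue_on \<Omega>. norm (G x) powr r) = (LINT x|lebesgue_on \<Omega>. indicator \<Omega> x * norm (G x) powr r)"
        by (intro Bochner_Integration.integral_cong) auto
      also have "\<dots> \<le> D powr (r / p) * measure (lebesgue_on \<Omega>) \<Omega> powr (1 - r / p)"
        unfolding D_def by (rule integral_powr_le_measure_powr[OF \<Omega>(2) GLp rp s])
      also have "\<dots> \<le> D powr (r / p) * \<kappa>" by (intro mult_left_mono) (auto simp: \<kappa>_def)
      finally show ?thesis .
    qed
    have "I powr (1 / q) \<le> c * (LINT x|lebesgue_on \<Omega>. norm (G x) powr r) powr (1 / r)"
      using Sobolev_W1_0(2)[OF n \<Omega> _ _ r(1) r(2)[unfolded \<nu>_def] r(3), of w G] w
      by (simp add: I_def q_def c_def \<nu>_def)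
    also have "\<dots> \<le> c * (D powr (r / p) * \<kappa>) powr (1 / r)"
      using c r Dr by (intro mult_left_mono powr_mono2) (auto intro!: Bochner_Integration.integral_nonneg)
    finally have "(I powr (1 / q)) powr p \<le> (c * (D powr (r / p) * \<kappa>) powr (1 / r)) powr p"
      using r by (intro powr_mono2) auto
    also have "\<dots> = c powr p * \<kappa> powr (p / r) * D"
      using r c D0 \<kappa> by (simp add: powr_mult powr_powr mult_ac)
    finally show "I powr (p / q) \<le> c powr p * \<kappa> powr (p / r) * D" by (simp add: powr_powr)
  qed simp
qed

section \<open>Boundedness from a decay estimate on level sets\<close>

text \<open>The ratio \<open>\<mu>\<close> satisfies \<open>B \<mu>^\<alpha> = 1\<close>, so the superlinear power \<open>Y^\<alpha>\<close> of a sequence that decays like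
  \<open>\<mu>^j\<close> compensates the growth of the coefficients \<open>B^j\<close>.\<close>

lemma fast_geometric_convergence:
  fixes Y :: "nat \<Rightarrow> real"
  assumes Y: "\<And>j. Y j \<ge> 0" and A: "A > 0" and B: "B > 1" and \<alpha>: "\<alpha> > 0"
    and rec: "\<And>j. Y j \<le> 1 \<Longrightarrow> Y (Suc j) \<le> A * B ^ j * Y j powr (1 + \<alpha>)"
    and \<mu>: "\<mu> = B powr (- 1 / \<alpha>)" and \<delta>: "0 < \<delta>" "\<delta> \<le> 1" "A * \<delta> powr \<alpha> \<le> \<mu>" and Y0: "Y 0 \<le> \<delta>"
  shows "Y j \<le> \<delta> * \<mu> ^ j"
proof (induction j)
  case 0 then show ?case using Y0 by simp
next
  case (Suc j)
  have \<mu>0: "\<mu> > 0" using \<mu> B by simp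
  have \<mu>1: "\<mu> \<le> 1" using \<mu> B \<alpha> by (simp add: powr_less_one less_imp_le)
  have "\<mu> powr \<alpha> = B powr (- 1 / \<alpha> * \<alpha>)" unfolding \<mu> by (rule powr_powr)
  also have "\<dots> = B powr (- 1)" using \<alpha> by simp
  finally have B\<mu>: "B * \<mu> powr \<alpha> = 1" using B by (simp add: powr_minus)
  have "Y j \<le> 1" using Suc.IH \<delta> \<mu>0 \<mu>1 by (meson mult_le_one order_trans power_le_one less_imp_le zero_le_power)
  then have "Y (Suc j) \<le> A * B ^ j * Y j powr (1 + \<alpha>)" by (rule rec)
  also have "\<dots> \<le> A * B ^ j * (\<delta> * \<mu> ^ j) powr (1 + \<alpha>)"
    using Suc.IH Y A B \<alpha> by (intro mult_left_mono powr_mono2) auto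
  also have "(\<delta> * \<mu> ^ j) powr (1 + \<alpha>) = \<delta> powr \<alpha> * (\<mu> powr \<alpha>) ^ j * (\<delta> * \<mu> ^ j)"
    using \<delta> \<mu>0 by (simp add: powr_add powr_mult powr_power powr_realpow[symmetric] powr_powr mult.commute)
  also have "A * B ^ j * (\<delta> powr \<alpha> * (\<mu> powr \<alpha>) ^ j * (\<delta> * \<mu> ^ j)) = (A * \<delta> powr \<alpha>) * (B * \<mu> powr \<alpha>) ^ j * (\<delta> * \<mu> ^ j)"
    by (simp add: power_mult_distrib mult_ac)
  also have "\<dots> = (A * \<delta> powr \<alpha>) * (\<delta> * \<mu> ^ j)" by (simp add: B\<mu>)
  also have "\<dots> \<le> \<mu> * (\<delta> * \<mu> ^ j)" using \<delta> \<mu>0 by (intro mult_right_mono) auto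
  finally show ?case by (simp add: mult_ac)
qed

text \<open>The term \<open>k^q g k\<close> has the critical homogeneity: at the scale \<open>K\<close> of the levels
  \<open>K (2 - 2^-j)\<close> the quantity \<open>K^q g\<close> satisfies a recursion with constants that do not depend on \<open>K\<close>,
  and its initial value is small for large \<open>K\<close>.\<close>

lemma De_Giorgi_vanishing:
  fixes g :: "real \<Rightarrow> real"
  assumes p: "0 < p" and q: "0 < q" and \<sigma>: "p / q < \<sigma>" "\<sigma> \<le> 1" and C: "C \<ge> 0"
    and g0: "\<And>k. g k \<ge> 0" and mono: "\<And>h k. k \<le> h \<Longrightarrow> g h \<le> g k"
    and rec: "\<And>h k. k1 \<le> k \<Longrightarrow> k < h \<Longrightarrow> (h - k) powr p * g h powr (p / q) \<le> C * (k powr q * g k + g k powr \<sigma>)"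
    and lim: "((\<lambda>k. k powr q * g k) \<longlongrightarrow> 0) at_top"
  shows "\<exists>K. g K = 0"
proof -
  define \<tau> where "\<tau> = p / q"
  have \<tau>: "\<tau> > 0" "\<tau> < \<sigma>" using p q \<sigma> by (auto simp: \<tau>_def)
  define \<alpha> where "\<alpha> = \<sigma> / \<tau> - 1"
  have \<alpha>: "\<alpha> > 0" using \<tau> by (simp add: \<alpha>_def)
  \<comment> \<open>The recursion bounds \<open>Y (j + 1)^\<tau>\<close> by \<open>C' 2^(p j) Y j^\<sigma>\<close>; \<open>\<alpha>\<close>, \<open>A\<close> and \<open>B = 2^(p/\<tau>)\<close> arise from
    taking the power \<open>1/\<tau>\<close>.\<close>
  define C' where "C' = C * (2 powr q + 1) * 2 powr p + 1"
  have C': "C' > 0" using C by (simp add: C'_def add_nonneg_pos)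
  define A where "A = C' powr (1 / \<tau>)"
  have A: "A > 0" using C' by (simp add: A_def)
  define B where "B = 2 powr q"
  have B: "B > 1" using q by (simp add: B_def)
  define \<mu> where "\<mu> = B powr (- 1 / \<alpha>)"
  have \<mu>0: "\<mu> > 0" using B by (simp add: \<mu>_def)
  have \<mu>1: "\<mu> < 1" using B \<alpha> by (simp add: \<mu>_def powr_less_one)
  define \<delta> where "\<delta> = min 1 ((\<mu> / A) powr (1 / \<alpha>))"
  have \<delta>: "0 < \<delta>" "\<delta> \<le> 1" using \<mu>0 A by (auto simp: \<delta>_def)
  have \<delta>A: "A * \<delta> powr \<alpha> \<le> \<mu>"
  proof -
    have "\<delta> powr \<alpha> \<le> ((\<mu> / A) powr (1 / \<alpha>)) powr \<alpha>" using \<delta> \<alpha> by (intro powr_mono2) (auto simp: \<delta>_def)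
    also have "\<dots> = \<mu> / A" using \<alpha> \<mu>0 A by (simp add: powr_powr)
    finally show ?thesis using A by (simp add: pos_le_divide_eq mult.commute)
  qed
  have "\<forall>\<^sub>F K in at_top. K powr q * g K < \<delta>" using order_tendstoD(2)[OF lim \<delta>(1)] .
  moreover have "\<forall>\<^sub>F K in at_top. K \<ge> max k1 1" by (rule eventually_ge_at_top)
  ultimately have "\<forall>\<^sub>F K in at_top. K powr q * g K < \<delta> \<and> K \<ge> max k1 1" by eventually_elim simp
  then obtain K where K: "K powr q * g K < \<delta>" "K \<ge> k1" "K \<ge> 1"
    by (auto simp: eventually_at_top_linorder)
  define k where "k j = K * (2 - (1 / 2) ^ j)" for j :: nat
  have kK: "K \<le> k j" "k j \<le> 2 * K" for j
  proof -
    have "(1 / 2 :: real) ^ j \<le> 1" by (rule power_le_one) auto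
    then have "K * 1 \<le> k j" unfolding k_def using K by (intro mult_left_mono) auto
    then show "K \<le> k j" by simp
    have "k j \<le> K * 2" unfolding k_def using K by (intro mult_left_mono) auto
    then show "k j \<le> 2 * K" by simp
  qed
  have kS: "k (Suc j) - k j = K * (1 / 2) ^ Suc j" for j by (simp add: k_def algebra_simps)
  define Y where "Y j = K powr q * g (k j)" for j
  have Y0: "Y j \<ge> 0" for j by (simp add: Y_def g0)
  have recY: "Y (Suc j) \<le> A * B ^ j * Y j powr (1 + \<alpha>)" if "Y j \<le> 1" for j
  proof -
    have kl: "k j < k (Suc j)" using kS[of j] K by (metis diff_gt_0_iff_gt mult_pos_pos order.strict_trans2 zero_less_divide_1_iff zero_less_numeral zero_less_one zero_less_power)
    have gY: "g (k i) = K powr (- q) * Y i" for i using K by (simp add: Y_def powr_minus)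
    have "(K * (1 / 2) ^ Suc j) powr p * g (k (Suc j)) powr \<tau> \<le> C * (k j powr q * g (k j) + g (k j) powr \<sigma>)"
      using rec[of "k j" "k (Suc j)"] kl kK(1)[of j] K unfolding kS \<tau>_def by simp
    also have "\<dots> \<le> C * ((2 * K) powr q * g (k j) + Y j powr \<sigma>)"
    proof (intro mult_left_mono[OF _ C] add_mono)
      have "k j powr q \<le> (2 * K) powr q" using kK[of j] K q by (intro powr_mono2) auto
      then show "k j powr q * g (k j) \<le> (2 * K) powr q * g (k j)" using g0 by (rule mult_right_mono)
      have "1 * g (k j) \<le> K powr q * g (k j)" using K q g0 by (intro mult_right_mono ge_one_powr_ge_zero) auto
      then show "g (k j) powr \<sigma> \<le> Y j powr \<sigma>" using \<tau> g0 by (intro powr_mono2) (auto simp: Y_def)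
    qed
    also have "(2 * K) powr q * g (k j) = 2 powr q * Y j" using K by (simp add: powr_mult Y_def)
    also have "C * (2 powr q * Y j + Y j powr \<sigma>) \<le> C * (2 powr q * Y j powr \<sigma> + Y j powr \<sigma>)"
    proof (intro mult_left_mono add_right_mono C)
      show "Y j \<le> Y j powr \<sigma>"
      proof (cases "Y j = 0")
        case False
        then have "Y j > 0" using Y0[of j] by simp
        then have "Y j powr 1 \<le> Y j powr \<sigma>" using that \<sigma> by (intro powr_mono') auto
        then show ?thesis using \<open>Y j > 0\<close> by simp
      qed simp
    qed simp
    also have "\<dots> = C * (2 powr q + 1) * Y j powr \<sigma>" by (simp add: algebra_simps)
    finally have 1: "(K * (1 / 2) ^ Suc j) powr p * g (k (Suc j)) powr \<tau> \<le> C * (2 powr q + 1) * Y j powr \<sigma>" .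
    have "(K * (1 / 2) ^ Suc j) powr p * g (k (Suc j)) powr \<tau> = ((1 / 2) ^ Suc j) powr p * Y (Suc j) powr \<tau>"
    proof -
      have "(K * u) powr p * G powr \<tau> = u powr p * (K powr q * G) powr \<tau>" if "u \<ge> 0" "G \<ge> 0" for u G :: real
        using K p q that by (simp add: powr_mult powr_powr \<tau>_def)
      from this[of "(1 / 2) ^ Suc j" "g (k (Suc j))"] show ?thesis using g0 by (simp add: Y_def del: power_Suc)
    qed
    with 1 have "((1 / 2) ^ Suc j) powr p * Y (Suc j) powr \<tau> \<le> C * (2 powr q + 1) * Y j powr \<sigma>" by simp
    moreover have h: "((1 / 2 :: real) ^ Suc j) powr p = 1 / (2 powr p * (2 powr p) ^ j)"
      by (simp add: powr_powr powr_divide powr_mult power_divide mult.commute flip: powr_realpow)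
    ultimately have "Y (Suc j) powr \<tau> \<le> C * (2 powr q + 1) * Y j powr \<sigma> * (2 powr p * (2 powr p) ^ j)"
      unfolding h by (simp add: pos_divide_le_eq del: mult_le_cancel_left)
    also have "\<dots> = (C * (2 powr q + 1) * 2 powr p) * ((2 powr p) ^ j * Y j powr \<sigma>)" by (simp add: mult_ac)
    also have "\<dots> \<le> C' * ((2 powr p) ^ j * Y j powr \<sigma>)" unfolding C'_def by (intro mult_right_mono) auto
    finally have "(Y (Suc j) powr \<tau>) powr (1 / \<tau>) \<le> (C' * ((2 powr p) ^ j * Y j powr \<sigma>)) powr (1 / \<tau>)"
      using \<tau> by (intro powr_mono2) auto
    also have "\<dots> = A * ((2 powr p) ^ j) powr (1 / \<tau>) * Y j powr (\<sigma> / \<tau>)"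
      using C' by (simp add: A_def powr_mult powr_powr)
    also have "((2 powr p) ^ j) powr (1 / \<tau>) = B ^ j"
      using p q by (simp add: B_def \<tau>_def powr_power powr_powr mult.commute flip: powr_realpow)
    finally show ?thesis using \<tau> Y0 by (simp add: \<alpha>_def powr_powr)
  qed
  have Yle: "Y j \<le> \<delta> * \<mu> ^ j" for j
  proof (rule fast_geometric_convergence[OF Y0 A B \<alpha> recY \<mu>_def \<delta> \<delta>A])
    show "Y 0 \<le> \<delta>" using K by (simp add: Y_def k_def)
  qed
  have "g (2 * K) \<le> \<delta> * \<mu> ^ j" for j
  proof -
    have "g (2 * K) \<le> 1 * g (k j)" using mono[OF kK(2)] by simp
    also have "\<dots> \<le> K powr q * g (k j)" using K q g0 by (intro mult_right_mono ge_one_powr_ge_zero) auto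
    also have "\<dots> \<le> \<delta> * \<mu> ^ j" using Yle by (simp add: Y_def)
    finally show ?thesis .
  qed
  moreover have "(\<lambda>j. \<delta> * \<mu> ^ j) \<longlonglongrightarrow> \<delta> * 0" using \<mu>0 \<mu>1 by (intro tendsto_intros LIMSEQ_realpow_zero) auto
  ultimately have "g (2 * K) \<le> 0" by (intro LIMSEQ_le_const[of _ "0::real"]) auto
  then show ?thesis using g0[of "2 * K"] by (intro exI[of _ "2 * K"]) simp
qed

lemma (in finite_measure) integral_superlevel_tendsto_0:
  fixes z f :: "'a \<Rightarrow> real"
  assumes [measurable]: "z \<in> borel_measurable M" and f: "integrable M f"
  shows "((\<lambda>k. LINT x|M. indicator {x \<in> space M. z x > k} x * f x) \<longlongrightarrow> 0) at_top"
proof -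
  have [measurable]: "f \<in> borel_measurable M" using f by auto
  have "((\<lambda>k. LINT x|M. indicator {x \<in> space M. z x > k} x * f x) \<longlongrightarrow> (LINT x|M. 0)) at_top"
  proof (rule integral_dominated_convergence_at_top[where w = "\<lambda>x. \<bar>f x\<bar>"])
    show "AE x in M. ((\<lambda>k. indicator {x \<in> space M. z x > k} x * f x) \<longlongrightarrow> 0) at_top"
    proof (rule AE_I2)
      fix x
      have "\<forall>\<^sub>F k in at_top. 0 = indicator {x \<in> space M. z x > k} x * f x"
        using eventually_ge_at_top[of "z x"] by eventually_elim auto
      then show "((\<lambda>k. indicator {x \<in> space M. z x > k} x * f x) \<longlongrightarrow> 0) at_top"
        by (rule Lim_transform_eventually[OF tendsto_const])
    qed
    show "\<forall>\<^sub>F k in at_top. AE x in M. norm (indicator {x \<in> space M. z x > k} x * f x) \<le> \<bar>f x\<bar>"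
      by (intro always_eventually allI AE_I2) (auto simp: indicator_def)
  qed (use f in auto)
  then show ?thesis by simp
qed

text \<open>Chebyshev's inequality on the set itself, so that the tail of the integral remains on the right.\<close>

lemma (in finite_measure) measure_superlevel_tendsto_0:
  fixes z :: "'a \<Rightarrow> real"
  assumes z: "z \<in> borel_measurable M" "integrable M (\<lambda>x. z x powr q)" and q: "q > 0"
  shows "((\<lambda>k. k powr q * measure M {x \<in> space M. z x > k}) \<longlongrightarrow> 0) at_top"
proof (rule tendsto_sandwich[OF _ _ tendsto_const integral_superlevel_tendsto_0[OF z]])
  note [measurable] = z(1)
  show "\<forall>\<^sub>F k in at_top. k powr q * measure M {x \<in> space M. z x > k} \<le> (LINT x|M. indicator {x \<in> space M. z x > k} x * z x powr q)"
    using eventually_ge_at_top[of 0]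
  proof eventually_elim
    case (elim k)
    have A: "{x \<in> space M. z x > k} \<in> sets M" by measurable
    have "k powr q * measure M {x \<in> space M. z x > k} = (LINT x|M. indicator {x \<in> space M. z x > k} x * k powr q)"
      using sets.sets_into_space[OF A] by (simp add: Int_absorb2)
    also have "\<dots> \<le> (LINT x|M. indicator {x \<in> space M. z x > k} x * z x powr q)"
      using elim q by (intro integral_mono' integrable_mult_bounded[OF z(2), of _ 1])
        (auto simp: indicator_def intro!: powr_mono2)
    finally show ?case .
  qed
qed simp

text \<open>By Chebyshev's inequality \<open>(h - k)^q\<close> times the measure of the superlevel set at \<open>h\<close> is at most the
  integral of \<open>((z - k)\<^sub>+)^q\<close>, so these measures satisfy the recursion of \<open>De_Giorgi_vanishing\<close>.\<close>

lemma (in finite_measure) bounded_if_superlevel_decay: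
  fixes z :: "'a \<Rightarrow> real"
  assumes p: "0 < p" and q: "0 < q" and \<sigma>: "p / q < \<sigma>" "\<sigma> \<le> 1" and C: "C \<ge> 0" and k1: "k1 \<ge> 0"
    and z: "z \<in> borel_measurable M" "\<And>x. z x \<ge> 0" "integrable M (\<lambda>x. z x powr q)"
    and est: "\<And>k. k \<ge> k1 \<Longrightarrow> (LINT x|M. max 0 (z x - k) powr q) powr (p / q) \<le>
      C * (k powr q * measure M {x \<in> space M. z x > k} + measure M {x \<in> space M. z x > k} powr \<sigma>)"
  shows "\<exists>K. AE x in M. z x \<le> K"
proof -
  note [measurable] = z(1)
  define A where "A k = {x \<in> space M. z x > k}" for k
  have A[measurable]: "A k \<in> sets M" for k unfolding A_def by measurable
  define g where "g k = measure M (A k)" for k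
  have g0: "g k \<ge> 0" for k by (simp add: g_def)
  have gm: "g h \<le> g k" if "k \<le> h" for h k unfolding g_def using that by (intro finite_measure_mono) (auto simp: A_def)
  have "\<exists>K. g K = 0"
  proof (rule De_Giorgi_vanishing[where g = g and p = p and q = q and \<sigma> = \<sigma> and ?k1.0 = k1 and C = C])
    fix h k assume k: "k1 \<le> k" "k < h"
    have kk: "k \<ge> 0" using k k1 by simp
    have i: "integrable M (\<lambda>x. max 0 (z x - k) powr q)"
    proof (rule Bochner_Integration.integrable_bound[OF z(3)])
      show "AE x in M. norm (max 0 (z x - k) powr q) \<le> norm (z x powr q)"
        using kk z(2) q by (intro AE_I2) (auto intro!: powr_mono2)
    qed measurable
    have "(h - k) powr q * g h = (LINT x|M. indicator (A h) x * (h - k) powr q)"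
      using sets.sets_into_space[OF A[of h]] by (simp add: g_def Int_absorb2)
    also have "\<dots> \<le> (LINT x|M. max 0 (z x - k) powr q)"
      using k q by (intro integral_mono' i) (auto simp: indicator_def A_def intro!: powr_mono2)
    finally have "((h - k) powr q * g h) powr (p / q) \<le> (LINT x|M. max 0 (z x - k) powr q) powr (p / q)"
      using p q g0 by (intro powr_mono2) auto
    then have "(h - k) powr p * g h powr (p / q) \<le> (LINT x|M. max 0 (z x - k) powr q) powr (p / q)"
      using p q g0 k by (simp add: powr_mult powr_powr)
    also have "\<dots> \<le> C * (k powr q * g k + g k powr \<sigma>)" using est[OF k(1)] by (simp add: g_def A_def)
    finally show "(h - k) powr p * g h powr (p / q) \<le> C * (k powr q * g k + g k powr \<sigma>)" .
  next
    show "((\<lambda>k. k powr q * g k) \<longlongrightarrow> 0) at_top"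
      unfolding g_def A_def by (rule measure_superlevel_tendsto_0[OF z(1,3) q])
  qed (use p q \<sigma> C g0 gm in auto)
  then obtain K where "g K = 0" by blast
  then have "A K \<in> null_sets M" by (auto simp: g_def null_sets_def emeasure_eq_measure)
  then have "AE x in M. x \<notin> A K" by (rule AE_not_in)
  then show ?thesis using AE_space by (intro exI[of _ K]) (auto simp: A_def elim!: eventually_elim2)
qed

text \<open>For large levels the parts of the right-hand side that are proportional to the left-hand side
  have small coefficients and are absorbed.\<close>

lemma (in finite_measure) bounded_if_level_set_estimate:
  fixes z b1 b3 :: "'a \<Rightarrow> real"
  assumes p: "1 \<le> p" "p < q" and C: "C \<ge> 0" and k0: "k0 \<ge> 1"
    and z: "z \<in> borel_measurable M" "\<And>x. z x \<ge> 0" "integrable M (\<lambda>x. z x powr q)"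
    and b1: "b1 \<in> borel_measurable M" "s1 > 1" "1 - 1 / s1 > p / q" "integrable M (\<lambda>x. \<bar>b1 x\<bar> powr s1)"
    and b3: "b3 \<in> borel_measurable M" "s3 > 1" "1 - 1 / s3 > p / q" "integrable M (\<lambda>x. \<bar>b3 x\<bar> powr s3)"
    and est: "\<And>k. k \<ge> k0 \<Longrightarrow> (LINT x|M. max 0 (z x - k) powr q) powr (p / q) \<le>
      C * (LINT x|M. indicator {x \<in> space M. z x > k} x * (z x powr q + \<bar>b1 x\<bar> + \<bar>b3 x\<bar> * (z x - k)))"
  shows "\<exists>K. AE x in M. z x \<le> K"
proof -
  note [measurable] = z(1) b1(1) b3(1)
  have q0: "q > 0" using p by simp
  define A where "A k = {x \<in> space M. z x > k}" for k
  have A[measurable]: "A k \<in> sets M" for k unfolding A_def by measurable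
  define g where "g k = measure M (A k)" for k
  have g0: "g k \<ge> 0" for k by (simp add: g_def)
  define \<zeta> where "\<zeta> k = (LINT x|M. max 0 (z x - k) powr q)" for k
  have \<zeta>0: "\<zeta> k \<ge> 0" for k by (simp add: \<zeta>_def Bochner_Integration.integral_nonneg)
  have mle: "max 0 (z x - k) powr q \<le> z x powr q" if "k \<ge> 0" for x k
    using that z(2)[of x] q0 by (intro powr_mono2) auto
  have \<zeta>i: "integrable M (\<lambda>x. max 0 (z x - k) powr q)" if "k \<ge> 0" for k
    by (rule Bochner_Integration.integrable_bound[OF z(3)]) (use mle[OF that] in auto)
  have Azi: "integrable M (\<lambda>x. indicator (A k) x * z x powr q)" for k
    by (rule integrable_mult_bounded[OF z(3), of _ 1]) (auto simp: indicator_def)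
  \<comment> \<open>The exponent conjugate to \<open>q/p\<close>. It estimates the integral of \<open>|b3| (z - k)^p\<close> by the factor
    \<open>\<omega> k \<longrightarrow> 0\<close> times the left-hand side.\<close>
  define r where "r = q / (q - p)"
  have r: "r > 1" using p by (simp add: r_def field_simps)
  have rinv: "1 / r = 1 - p / q" using p by (simp add: r_def field_simps)
  have rs: "r \<le> s3"
  proof -
    have "1 / s3 < 1 / r" using b3 rinv by simp
    then show ?thesis using r b3 by (simp add: divide_simps split: if_splits)
  qed
  have b3r: "integrable M (\<lambda>x. \<bar>b3 x\<bar> powr r)"
  proof (rule Bochner_Integration.integrable_bound)
    show "integrable M (\<lambda>x. 1 + \<bar>b3 x\<bar> powr s3)" using b3 by simp
    show "AE x in M. norm (\<bar>b3 x\<bar> powr r) \<le> norm (1 + \<bar>b3 x\<bar> powr s3)"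
      using powr_le_one_add_powr[of r s3] r rs by (intro AE_I2) simp
  qed measurable
  define \<omega> where "\<omega> k = (LINT x|M. indicator (A k) x * \<bar>b3 x\<bar> powr r) powr (1 / r)" for k
  note vanish = integral_superlevel_tendsto_0[OF z(1), folded A_def]
  have \<omega>lim: "(\<omega> \<longlongrightarrow> 0) at_top"
  proof -
    have "((\<lambda>k. (LINT x|M. indicator (A k) x * \<bar>b3 x\<bar> powr r) powr (1 / r)) \<longlongrightarrow> 0 powr (1 / r)) at_top"
      using r by (intro tendsto_powr' vanish[OF b3r] tendsto_const) auto
    then show ?thesis by (simp add: \<omega>_def[abs_def])
  qed
  have klim: "((\<lambda>k. k powr q * g k) \<longlongrightarrow> 0) at_top"
    unfolding g_def A_def by (rule measure_superlevel_tendsto_0[OF z(1,3) q0])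
  have \<zeta>lim: "((\<lambda>k. \<zeta> k powr (1 - p / q)) \<longlongrightarrow> 0) at_top"
  proof -
    have "(\<zeta> \<longlongrightarrow> 0) at_top"
    proof (rule tendsto_sandwich[OF _ _ tendsto_const vanish[OF z(3)]])
      show "\<forall>\<^sub>F k in at_top. 0 \<le> \<zeta> k" by (simp add: \<zeta>0)
      show "\<forall>\<^sub>F k in at_top. \<zeta> k \<le> (LINT x|M. indicator (A k) x * z x powr q)"
        using eventually_ge_at_top[of 0]
      proof eventually_elim
        case (elim k)
        show ?case unfolding \<zeta>_def
        proof (rule integral_mono[OF \<zeta>i[OF elim] Azi])
          fix x assume "x \<in> space M"
          then show "max 0 (z x - k) powr q \<le> indicator (A k) x * z x powr q"
            using mle[OF elim, of x] by (cases "x \<in> A k") (auto simp: A_def max_def)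
        qed
      qed
    qed
    then have "((\<lambda>k. \<zeta> k powr (1 - p / q)) \<longlongrightarrow> 0 powr (1 - p / q)) at_top"
      using p \<zeta>0 by (intro tendsto_powr' tendsto_const) auto
    then show ?thesis by simp
  qed
  \<comment> \<open>For large \<open>k\<close> the measures of the superlevel sets are at most \<open>1\<close>, so the smaller of the two
    exponents serves for both terms.\<close>
  define \<sigma> where "\<sigma> = min (1 - 1 / s1) (1 - 1 / s3)"
  have \<sigma>: "p / q < \<sigma>" "\<sigma> \<le> 1" using b1 b3 by (auto simp: \<sigma>_def min_def)
  define D where "D = (LINT x|M. \<bar>b1 x\<bar> powr s1) powr (1 / s1) + (LINT x|M. \<bar>b3 x\<bar> powr s3) powr (1 / s3)"
  have D0: "D \<ge> 0" by (simp add: D_def)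
  have sml: "((\<lambda>k. C * (2 powr q * \<zeta> k powr (1 - p / q) + \<omega> k)) \<longlongrightarrow> C * (2 powr q * 0 + 0)) at_top"
    by (intro tendsto_intros \<zeta>lim \<omega>lim)
  have "\<forall>\<^sub>F k in at_top. C * (2 powr q * \<zeta> k powr (1 - p / q) + \<omega> k) < 1 / 2"
    using order_tendstoD(2)[OF sml, of "1 / 2"] by simp
  moreover have "\<forall>\<^sub>F k in at_top. k powr q * g k < 1" using order_tendstoD(2)[OF klim, of 1] by simp
  ultimately have "\<forall>\<^sub>F k in at_top. C * (2 powr q * \<zeta> k powr (1 - p / q) + \<omega> k) < 1 / 2 \<and> k powr q * g k < 1"
    by eventually_elim simp
  then obtain k1' where k1': "\<And>k. k \<ge> k1' \<Longrightarrow> C * (2 powr q * \<zeta> k powr (1 - p / q) + \<omega> k) < 1 / 2 \<and> k powr q * g k < 1"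
    by (auto simp: eventually_at_top_linorder)
  define k1 where "k1 = max k0 k1'"
  have X: "\<zeta> k powr (p / q) \<le> 2 * C * (2 powr q + D) * (k powr q * g k + g k powr \<sigma>)" if k: "k \<ge> k1" for k
  proof -
    have kk: "k \<ge> k0" "k \<ge> 1" "k \<ge> 0" "k \<ge> k1'" using k k0 by (auto simp: k1_def)
    have g1: "g k \<le> 1"
    proof -
      have "1 * g k \<le> k powr q * g k" using kk q0 g0 by (intro mult_right_mono ge_one_powr_ge_zero) auto
      then show ?thesis using k1'[OF kk(4)] by simp
    qed
    define X where "X = \<zeta> k powr (p / q)"
    have X0: "X \<ge> 0" by (simp add: X_def)
    have t1: "(LINT x|M. indicator (A k) x * z x powr q) \<le> 2 powr q * (\<zeta> k + k powr q * g k)"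
    proof -
      have i: "integrable M (\<lambda>x. indicator (A k) x :: real)" by (simp add: less_top[symmetric])
      have "(LINT x|M. indicator (A k) x * z x powr q) \<le> (LINT x|M. 2 powr q * (max 0 (z x - k) powr q + k powr q * indicator (A k) x))"
      proof (rule integral_mono[OF Azi])
        show "integrable M (\<lambda>x. 2 powr q * (max 0 (z x - k) powr q + k powr q * indicator (A k) x))"
          using \<zeta>i[OF kk(3)] i by simp
        fix x
        show "indicator (A k) x * z x powr q \<le> 2 powr q * (max 0 (z x - k) powr q + k powr q * indicator (A k) x)"
        proof (cases "x \<in> A k")
          case True
          then have "max 0 (z x - k) = z x - k" by (auto simp: A_def)
          with True show ?thesis using powr_add_le[of q "z x - k" k] q0 kk z(2)[of x] by (auto simp: A_def)
        qed auto
      qed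
      also have "\<dots> = 2 powr q * (\<zeta> k + k powr q * g k)"
        using \<zeta>i[OF kk(3)] i sets.sets_into_space[OF A[of k]] by (simp add: \<zeta>_def g_def Int_absorb2)
      finally show ?thesis .
    qed
    have gs: "g k powr s \<le> g k powr \<sigma>" if "s \<ge> \<sigma>" for s
    proof (cases "g k = 0")
      case False
      then show ?thesis using g0[of k] g1 that by (intro powr_mono') auto
    qed simp
    have t2: "(LINT x|M. indicator (A k) x * \<bar>b1 x\<bar>) \<le> (LINT x|M. \<bar>b1 x\<bar> powr s1) powr (1 / s1) * g k powr \<sigma>"
      by (rule order_trans[OF Holder_on_set[OF b1(2,1,4) A]], unfold g_def[symmetric], intro mult_left_mono gs) (auto simp: \<sigma>_def)
    have t3: "(LINT x|M. indicator (A k) x * \<bar>b3 x\<bar>) \<le> (LINT x|M. \<bar>b3 x\<bar> powr s3) powr (1 / s3) * g k powr \<sigma>"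
      by (rule order_trans[OF Holder_on_set[OF b3(2,1,4) A]], unfold g_def[symmetric], intro mult_left_mono gs) (auto simp: \<sigma>_def)
    have bi: "integrable M (\<lambda>x. \<bar>b x\<bar>)" if "b \<in> borel_measurable M" "integrable M (\<lambda>x. \<bar>b x\<bar> powr s)" "s > 1" for b :: "'a \<Rightarrow> real" and s
    proof (rule Bochner_Integration.integrable_bound)
      show "integrable M (\<lambda>x. 1 + \<bar>b x\<bar> powr s)" using that by simp
      show "AE x in M. norm \<bar>b x\<bar> \<le> norm (1 + \<bar>b x\<bar> powr s)"
      proof (rule AE_I2)
        fix x
        show "norm \<bar>b x\<bar> \<le> norm (1 + \<bar>b x\<bar> powr s)"
          using powr_le_one_add_powr[of 1 s "\<bar>b x\<bar>"] that(3) by simp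
      qed
    qed (use that in measurable)
    have i1: "integrable M (\<lambda>x. indicator (A k) x * \<bar>b1 x\<bar>)"
      by (rule integrable_mult_bounded[OF bi[OF b1(1,4,2)], of _ 1]) (auto simp: indicator_def)
    have i3: "integrable M (\<lambda>x. indicator (A k) x * \<bar>b3 x\<bar>)"
      by (rule integrable_mult_bounded[OF bi[OF b3(1,4,2)], of _ 1]) (auto simp: indicator_def)
    have e: "q / p > 1" "1 / r + 1 / (q / p) = 1" using p rinv by auto
    have ib: "\<bar>indicator (A k) x * b3 x\<bar> powr r = indicator (A k) x * \<bar>b3 x\<bar> powr r" for x by (simp add: indicator_def)
    have ib': "integrable M (\<lambda>x. \<bar>indicator (A k) x * b3 x\<bar> powr r)"
      unfolding ib by (rule integrable_mult_bounded[OF b3r, of _ 1]) (auto simp: indicator_def)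
    have iz: "\<bar>max 0 (z x - k) powr p\<bar> powr (q / p) = max 0 (z x - k) powr q" for x using p by (simp add: powr_powr)
    have iz': "integrable M (\<lambda>x. \<bar>max 0 (z x - k) powr p\<bar> powr (q / p))" unfolding iz by (rule \<zeta>i[OF kk(3)])
    have H: "integrable M (\<lambda>x. (indicator (A k) x * b3 x) * max 0 (z x - k) powr p)"
      "(LINT x|M. \<bar>(indicator (A k) x * b3 x) * max 0 (z x - k) powr p\<bar>) \<le> (LINT x|M. \<bar>indicator (A k) x * b3 x\<bar> powr r) powr (1 / r) * (LINT x|M. \<bar>max 0 (z x - k) powr p\<bar> powr (q / p)) powr (1 / (q / p))"
      by (rule Holder_inequality[OF r e(1,2) _ ib' _ iz']; measurable)+
    have H2: "(LINT x|M. \<bar>(indicator (A k) x * b3 x) * max 0 (z x - k) powr p\<bar>) \<le> \<omega> k * X"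
      using H(2) unfolding ib iz by (simp add: \<omega>_def X_def \<zeta>_def)
    have "(LINT x|M. indicator (A k) x * (z x powr q + \<bar>b1 x\<bar> + \<bar>b3 x\<bar> * (z x - k))) \<le>
      (LINT x|M. indicator (A k) x * z x powr q + indicator (A k) x * \<bar>b1 x\<bar> + (indicator (A k) x * \<bar>b3 x\<bar> + \<bar>(indicator (A k) x * b3 x) * max 0 (z x - k) powr p\<bar>))"
    proof (rule integral_mono')
      show "integrable M (\<lambda>x. indicator (A k) x * z x powr q + indicator (A k) x * \<bar>b1 x\<bar> + (indicator (A k) x * \<bar>b3 x\<bar> + \<bar>(indicator (A k) x * b3 x) * max 0 (z x - k) powr p\<bar>))"
        by (intro Bochner_Integration.integrable_add Azi i1 i3 integrable_abs H(1))
      fix x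
      show "indicator (A k) x * (z x powr q + \<bar>b1 x\<bar> + \<bar>b3 x\<bar> * (z x - k)) \<le> indicator (A k) x * z x powr q + indicator (A k) x * \<bar>b1 x\<bar> + (indicator (A k) x * \<bar>b3 x\<bar> + \<bar>(indicator (A k) x * b3 x) * max 0 (z x - k) powr p\<bar>)"
      proof (cases "x \<in> A k")
        case True
        then have m: "max 0 (z x - k) = z x - k" "z x - k > 0" by (auto simp: A_def)
        have "z x - k \<le> 1 + (z x - k) powr p"
          using powr_le_one_add_powr[of 1 p "z x - k"] p m by simp
        then have "\<bar>b3 x\<bar> * (z x - k) \<le> \<bar>b3 x\<bar> * (1 + (z x - k) powr p)" by (intro mult_left_mono) auto
        then show ?thesis using True m by (simp add: abs_mult distrib_left)
      qed auto
    qed (auto simp: indicator_def A_def intro!: add_nonneg_nonneg)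
    also have "\<dots> = (LINT x|M. indicator (A k) x * z x powr q) + (LINT x|M. indicator (A k) x * \<bar>b1 x\<bar>) + ((LINT x|M. indicator (A k) x * \<bar>b3 x\<bar>) + (LINT x|M. \<bar>(indicator (A k) x * b3 x) * max 0 (z x - k) powr p\<bar>))"
      using Azi i1 i3 integrable_abs[OF H(1)] by simp
    also have "\<dots> \<le> 2 powr q * (\<zeta> k + k powr q * g k) + (LINT x|M. \<bar>b1 x\<bar> powr s1) powr (1 / s1) * g k powr \<sigma>
      + ((LINT x|M. \<bar>b3 x\<bar> powr s3) powr (1 / s3) * g k powr \<sigma> + \<omega> k * X)"
      by (intro add_mono t1 t2 t3 H2)
    also have "\<dots> = 2 powr q * \<zeta> k + \<omega> k * X + (2 powr q * (k powr q * g k) + D * g k powr \<sigma>)"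
      by (simp add: D_def algebra_simps)
    also have "\<zeta> k = \<zeta> k powr (1 - p / q) * X"
      unfolding X_def using \<zeta>0[of k] by (simp flip: powr_add)
    finally have "X \<le> C * (2 powr q * (\<zeta> k powr (1 - p / q) * X) + \<omega> k * X + (2 powr q * (k powr q * g k) + D * g k powr \<sigma>))"
      using est[OF kk(1)] C unfolding X_def \<zeta>_def A_def by (meson mult_left_mono order_trans)
    also have "\<dots> = (C * (2 powr q * \<zeta> k powr (1 - p / q) + \<omega> k)) * X + C * (2 powr q * (k powr q * g k) + D * g k powr \<sigma>)"
      by (simp add: algebra_simps)
    also have "\<dots> \<le> (1 / 2) * X + C * (2 powr q * (k powr q * g k) + D * g k powr \<sigma>)"
      using k1'[OF kk(4)] X0 by (intro add_right_mono mult_right_mono) auto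
    finally have "X \<le> 2 * (C * (2 powr q * (k powr q * g k) + D * g k powr \<sigma>))" by simp
    also have "\<dots> \<le> 2 * (C * ((2 powr q + D) * (k powr q * g k) + (2 powr q + D) * g k powr \<sigma>))"
      using C D0 g0 by (intro mult_left_mono add_mono mult_right_mono) auto
    finally show ?thesis by (simp add: X_def algebra_simps)
  qed
  show ?thesis
  proof (rule bounded_if_superlevel_decay[OF _ q0 \<sigma> _ _ z])
    show "(LINT x|M. max 0 (z x - k) powr q) powr (p / q) \<le> 2 * C * (2 powr q + D) *
      (k powr q * measure M {x \<in> space M. z x > k} + measure M {x \<in> space M. z x > k} powr \<sigma>)" if "k \<ge> k1" for k
      using X[OF that] by (simp add: \<zeta>_def g_def A_def)
  qed (use p C D0 k0 in \<open>auto simp: k1_def\<close>)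
qed

section \<open>Smooth truncation\<close>

text \<open>A \<open>C\<^sup>1\<close> substitute for the positive part: convex, with derivative between \<open>0\<close> and \<open>1\<close>,
  and increasing to \<open>max 0 s\<close> as \<open>\<delta>\<close> decreases to \<open>0\<close>. Convexity gives
  \<open>soft_pos \<delta> s \<le> soft_pos' \<delta> s \<cdot> max 0 s\<close>; thus terms that carry the truncation and terms that carry
  its derivative can be estimated by one another.\<close>

definition soft_pos :: "real \<Rightarrow> real \<Rightarrow> real" where
  "soft_pos \<delta> s = (max 0 s)\<^sup>2 / (max 0 s + \<delta>)"

definition soft_pos' :: "real \<Rightarrow> real \<Rightarrow> real" where
  "soft_pos' \<delta> s = 1 - (\<delta> / (max 0 s + \<delta>))\<^sup>2"

text \<open>The smooth counterpart of \<open>sgn t \<cdot> max 0 (\<bar>t\<bar> - k)\<close>.\<close>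

definition soft_excess :: "real \<Rightarrow> real \<Rightarrow> real \<Rightarrow> real" where
  "soft_excess \<delta> k t = soft_pos \<delta> (t - k) - soft_pos \<delta> (- t - k)"

definition soft_excess' :: "real \<Rightarrow> real \<Rightarrow> real \<Rightarrow> real" where
  "soft_excess' \<delta> k t = soft_pos' \<delta> (t - k) + soft_pos' \<delta> (- t - k)"

lemma soft_pos_has_derivative:
  assumes "\<delta> > 0"
  shows "(soft_pos \<delta> has_real_derivative soft_pos' \<delta> s) (at s)"
proof -
  consider "s > 0" | "s < 0" | "s = 0" by linarith
  then show ?thesis
  proof cases
    case 1
    have "((\<lambda>s. s\<^sup>2 / (s + \<delta>)) has_real_derivative (2 * s * (s + \<delta>) - s\<^sup>2 * 1) / ((s + \<delta>) * (s + \<delta>))) (at s)"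
      using 1 assms by (intro DERIV_divide) (auto intro!: derivative_eq_intros)
    moreover have "(2 * s * (s + \<delta>) - s\<^sup>2 * 1) / ((s + \<delta>) * (s + \<delta>)) = soft_pos' \<delta> s"
    proof -
      have "soft_pos' \<delta> s = ((s + \<delta>)\<^sup>2 - \<delta>\<^sup>2) / (s + \<delta>)\<^sup>2"
        using 1 assms by (simp add: soft_pos'_def power_divide diff_divide_distrib)
      then show ?thesis by (simp add: power2_eq_square algebra_simps)
    qed
    moreover have "\<forall>\<^sub>F x in nhds s. soft_pos \<delta> x = x\<^sup>2 / (x + \<delta>)"
      using eventually_nhds_in_open[of "{0<..}" s] 1 by (auto elim!: eventually_mono simp: soft_pos_def)
    ultimately show ?thesis by (subst DERIV_cong_ev[OF refl _ refl]) auto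
  next
    case 2
    have "\<forall>\<^sub>F x in nhds s. soft_pos \<delta> x = 0"
      using eventually_nhds_in_open[of "{..<0}" s] 2 by (auto elim!: eventually_mono simp: soft_pos_def)
    moreover have "soft_pos' \<delta> s = 0" using 2 assms by (simp add: soft_pos'_def)
    ultimately show ?thesis by (subst DERIV_cong_ev[OF refl _ refl]) auto
  next
    case 3
    have l: "((\<lambda>h. \<bar>h\<bar> / \<delta>) \<longlongrightarrow> 0) (at 0)" using assms by (auto intro!: tendsto_eq_intros)
    have "((\<lambda>h. (soft_pos \<delta> (0 + h) - soft_pos \<delta> 0) / h) \<longlongrightarrow> 0) (at 0)"
    proof (rule Lim_null_comparison[OF always_eventually l], rule allI)
      fix h :: real
      show "norm ((soft_pos \<delta> (0 + h) - soft_pos \<delta> 0) / h) \<le> \<bar>h\<bar> / \<delta>"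
      proof (cases "h > 0")
        case True
        then have "h / (h + \<delta>) \<le> h / \<delta>" using assms by (intro divide_left_mono) auto
        then show ?thesis using True assms by (simp add: soft_pos_def power2_eq_square)
      qed (use assms in \<open>simp add: soft_pos_def divide_nonpos_pos\<close>)
    qed
    moreover have "soft_pos' \<delta> s = 0" using 3 assms by (simp add: soft_pos'_def)
    ultimately show ?thesis using 3 by (simp add: DERIV_def)
  qed
qed

lemma soft_pos_bounds:
  assumes "\<delta> > 0"
  shows "0 \<le> soft_pos \<delta> s" "soft_pos \<delta> s \<le> max 0 s" "soft_pos \<delta> s \<le> soft_pos' \<delta> s * max 0 s"
    "0 \<le> soft_pos' \<delta> s" "soft_pos' \<delta> s \<le> 1"
proof -
  define m where "m = max 0 s"
  have m: "m \<ge> 0" by (simp add: m_def)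
  show "0 \<le> soft_pos \<delta> s" using assms by (simp add: soft_pos_def)
  have "m * m \<le> m * (m + \<delta>)" using m assms by (intro mult_left_mono) auto
  then show "soft_pos \<delta> s \<le> max 0 s"
    using m assms by (simp add: soft_pos_def m_def[symmetric] pos_divide_le_eq power2_eq_square)
  have r: "0 \<le> \<delta> / (m + \<delta>)" "\<delta> / (m + \<delta>) \<le> 1" using m assms by auto
  have "(\<delta> / (m + \<delta>))\<^sup>2 \<le> \<delta> / (m + \<delta>)" unfolding power2_eq_square by (rule mult_left_le_one_le[OF r(1,1,2)])
  then have "1 - \<delta> / (m + \<delta>) \<le> soft_pos' \<delta> s" by (simp add: soft_pos'_def m_def)
  moreover have "1 - \<delta> / (m + \<delta>) = m / (m + \<delta>)" using m assms by (simp add: field_simps)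
  ultimately have "m / (m + \<delta>) * m \<le> soft_pos' \<delta> s * m" using m by (intro mult_right_mono) auto
  then show "soft_pos \<delta> s \<le> soft_pos' \<delta> s * max 0 s" by (simp add: soft_pos_def m_def power2_eq_square)
  show "0 \<le> soft_pos' \<delta> s" using r by (simp add: soft_pos'_def m_def[symmetric] power_le_one)
  show "soft_pos' \<delta> s \<le> 1" by (simp add: soft_pos'_def)
qed

lemma soft_pos_nonpos: "s \<le> 0 \<Longrightarrow> \<delta> > 0 \<Longrightarrow> soft_pos \<delta> s = 0 \<and> soft_pos' \<delta> s = 0"
  by (simp add: soft_pos_def soft_pos'_def max_def)

lemma soft_excess_has_derivative:
  assumes "\<delta> > 0"
  shows "(soft_excess \<delta> k has_real_derivative soft_excess' \<delta> k t) (at t)"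
proof -
  have "((\<lambda>t. soft_pos \<delta> (t - k)) has_real_derivative soft_pos' \<delta> (t - k) * 1) (at t)"
    by (rule DERIV_chain2[OF soft_pos_has_derivative[OF assms]]) (auto intro!: derivative_eq_intros)
  moreover have "((\<lambda>t. soft_pos \<delta> (- t - k)) has_real_derivative soft_pos' \<delta> (- t - k) * (- 1)) (at t)"
    by (rule DERIV_chain2[OF soft_pos_has_derivative[OF assms]]) (auto intro!: derivative_eq_intros)
  ultimately show ?thesis
    unfolding soft_excess_def[abs_def] soft_excess'_def by (auto intro!: derivative_eq_intros)
qed

lemma soft_excess'_continuous: "\<delta> > 0 \<Longrightarrow> continuous_on UNIV (soft_excess' \<delta> k)"
  unfolding soft_excess'_def[abs_def] soft_pos'_def
  by (intro continuous_intros) (auto simp: add_nonneg_eq_0_iff max_def)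

lemma soft_excess_cases:
  assumes "k \<ge> 0" "\<delta> > 0"
  shows "\<bar>soft_excess \<delta> k t\<bar> = soft_pos \<delta> (\<bar>t\<bar> - k)" "soft_excess' \<delta> k t = soft_pos' \<delta> (\<bar>t\<bar> - k)"
    "soft_excess \<delta> k t = sgn t * \<bar>soft_excess \<delta> k t\<bar>"
proof -
  have "\<bar>soft_excess \<delta> k t\<bar> = soft_pos \<delta> (\<bar>t\<bar> - k) \<and> soft_excess' \<delta> k t = soft_pos' \<delta> (\<bar>t\<bar> - k) \<and>
    soft_excess \<delta> k t = sgn t * \<bar>soft_excess \<delta> k t\<bar>"
  proof (cases "t \<ge> 0")
    case True
    then show ?thesis
      using assms soft_pos_nonpos[of "- t - k" \<delta>] soft_pos_nonpos[of "- k" \<delta>] soft_pos_bounds(1)[OF assms(2), of "t - k"]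
      by (auto simp: soft_excess_def soft_excess'_def sgn_if)
  next
    case False
    then show ?thesis
      using assms soft_pos_nonpos[of "t - k" \<delta>] soft_pos_bounds(1)[OF assms(2), of "- t - k"]
      by (auto simp: soft_excess_def soft_excess'_def sgn_if)
  qed
  then show "\<bar>soft_excess \<delta> k t\<bar> = soft_pos \<delta> (\<bar>t\<bar> - k)" "soft_excess' \<delta> k t = soft_pos' \<delta> (\<bar>t\<bar> - k)"
    "soft_excess \<delta> k t = sgn t * \<bar>soft_excess \<delta> k t\<bar>" by blast+
qed

lemma soft_excess_bounds:
  assumes "k \<ge> 0" "\<delta> > 0"
  shows "\<bar>soft_excess \<delta> k t\<bar> \<le> max 0 (\<bar>t\<bar> - k)" "\<bar>soft_excess \<delta> k t\<bar> \<le> soft_excess' \<delta> k t * max 0 (\<bar>t\<bar> - k)"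
    "0 \<le> soft_excess' \<delta> k t" "soft_excess' \<delta> k t \<le> 1" "\<bar>t\<bar> \<le> k \<Longrightarrow> soft_excess \<delta> k t = 0" "\<bar>t\<bar> \<le> k \<Longrightarrow> soft_excess' \<delta> k t = 0"
  using soft_pos_bounds[OF assms(2), of "\<bar>t\<bar> - k"] soft_pos_nonpos[of "\<bar>t\<bar> - k" \<delta>] assms soft_excess_cases(1,2)[OF assms, of t]
  by auto

text \<open>By dominated convergence as \<open>\<delta>\<close> tends to \<open>0\<close>; the bound \<open>B\<close> is uniform in \<open>\<delta>\<close>.\<close>

lemma excess_integral_le:
  fixes z :: "'a \<Rightarrow> real"
  assumes z: "z \<in> borel_measurable M" "integrable M (\<lambda>x. \<bar>z x\<bar> powr q)" and q: "q > 0" and k: "k \<ge> 0" and e: "e > 0"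
    and le: "\<And>\<delta>. \<delta> > 0 \<Longrightarrow> (LINT x|M. \<bar>soft_excess \<delta> k (z x)\<bar> powr q) powr e \<le> B"
  shows "(LINT x|M. max 0 (\<bar>z x\<bar> - k) powr q) powr e \<le> B"
proof -
  define \<delta> where "\<delta> j = 1 / real (Suc j)" for j
  have \<delta>: "\<delta> j > 0" for j by (simp add: \<delta>_def)
  have \<delta>0: "\<delta> \<longlonglongrightarrow> 0" using LIMSEQ_inverse_real_of_nat by (simp add: inverse_eq_divide \<delta>_def[abs_def])
  have cont: "continuous_on UNIV (soft_excess d k)" if "d > 0" for d
    using soft_excess_has_derivative[OF that] by (auto intro!: continuous_at_imp_continuous_on DERIV_isCont)
  have [measurable]: "soft_excess (\<delta> j) k \<in> borel_measurable borel" for j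
    by (rule borel_measurable_continuous_onI[OF cont[OF \<delta>]])
  note [measurable] = z(1)
  have "(\<lambda>j. LINT x|M. \<bar>soft_excess (\<delta> j) k (z x)\<bar> powr q) \<longlonglongrightarrow> (LINT x|M. max 0 (\<bar>z x\<bar> - k) powr q)"
  proof (rule integral_dominated_convergence[where w = "\<lambda>x. \<bar>z x\<bar> powr q"])
    show "AE x in M. (\<lambda>j. \<bar>soft_excess (\<delta> j) k (z x)\<bar> powr q) \<longlonglongrightarrow> max 0 (\<bar>z x\<bar> - k) powr q"
    proof (rule AE_I2)
      fix x
      define m where "m = max 0 (\<bar>z x\<bar> - k)"
      have "(\<lambda>j. m\<^sup>2 / (m + \<delta> j)) \<longlonglongrightarrow> m"
      proof (cases "m = 0")
        case False
        then have "(\<lambda>j. m\<^sup>2 / (m + \<delta> j)) \<longlonglongrightarrow> m\<^sup>2 / (m + 0)" by (intro tendsto_intros \<delta>0) simp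
        then show ?thesis using False by (simp add: power2_eq_square)
      qed simp
      then have "(\<lambda>j. \<bar>soft_excess (\<delta> j) k (z x)\<bar>) \<longlonglongrightarrow> m"
        by (simp add: soft_excess_cases(1)[OF k \<delta>] soft_pos_def m_def)
      then show "(\<lambda>j. \<bar>soft_excess (\<delta> j) k (z x)\<bar> powr q) \<longlonglongrightarrow> max 0 (\<bar>z x\<bar> - k) powr q"
        unfolding m_def using q by (intro tendsto_powr' tendsto_const) auto
    qed
    show "AE x in M. norm (\<bar>soft_excess (\<delta> j) k (z x)\<bar> powr q) \<le> \<bar>z x\<bar> powr q" for j
    proof (rule AE_I2)
      fix x
      have "\<bar>soft_excess (\<delta> j) k (z x)\<bar> \<le> \<bar>z x\<bar>" using soft_excess_bounds(1)[OF k \<delta>, of j "z x"] k by auto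
      then show "norm (\<bar>soft_excess (\<delta> j) k (z x)\<bar> powr q) \<le> \<bar>z x\<bar> powr q" using q by (auto intro!: powr_mono2)
    qed
  qed (use z in measurable)
  then have "(\<lambda>j. (LINT x|M. \<bar>soft_excess (\<delta> j) k (z x)\<bar> powr q) powr e) \<longlonglongrightarrow> (LINT x|M. max 0 (\<bar>z x\<bar> - k) powr q) powr e"
    using e by (intro tendsto_powr' tendsto_const) (auto intro!: always_eventually Bochner_Integration.integral_nonneg)
  then show ?thesis by (rule LIMSEQ_le_const2) (auto intro!: le \<delta>)
qed

section \<open>The structure conditions\<close>

text \<open>Stated for arbitrary integrands, because it is applied to an energy density \<open>f x (u x) (Du x)\<close>,
  whose measurability would take an argument of its own. The integral is a supremum over simple
  minorants, and these can be scaled.\<close>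

lemma nn_integral_cmult_finite:
  assumes "(\<integral>\<^sup>+x. f x \<partial>M) < \<infinity>" and c: "c \<ge> 0"
  shows "(\<integral>\<^sup>+x. ennreal c * f x \<partial>M) < \<infinity>"
proof (cases "c = 0")
  case False
  with c have c0: "c > 0" by simp
  have cc: "ennreal c * (ennreal (1 / c) * y) = y" for y :: ennreal
    using c0 by (simp add: mult.assoc[symmetric] flip: ennreal_mult)
  have cc': "ennreal (1 / c) * (ennreal c * y) = y" for y :: ennreal
    using c0 by (simp add: mult.assoc[symmetric] flip: ennreal_mult)
  have "(\<integral>\<^sup>+x. ennreal c * f x \<partial>M) \<le> ennreal c * (\<integral>\<^sup>+x. f x \<partial>M)"
    unfolding nn_integral_def[of M "\<lambda>x. ennreal c * f x"]
  proof (rule SUP_least, clarify)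
    fix g assume g: "simple_function M g" "g \<le> (\<lambda>x. ennreal c * f x)"
    let ?h = "\<lambda>x. ennreal (1 / c) * g x"
    have h: "simple_function M ?h" using g(1) by auto
    have "?h x \<le> f x" for x
    proof -
      have "?h x \<le> ennreal (1 / c) * (ennreal c * f x)" using g(2) by (intro mult_left_mono) (auto simp: le_fun_def)
      then show ?thesis by (simp only: cc')
    qed
    then have "integral\<^sup>S M ?h \<le> (\<integral>\<^sup>+x. f x \<partial>M)"
      unfolding nn_integral_def by (intro SUP_upper) (auto simp: h le_fun_def)
    then have "ennreal c * integral\<^sup>S M ?h \<le> ennreal c * (\<integral>\<^sup>+x. f x \<partial>M)" by (rule mult_left_mono) simp
    moreover have "integral\<^sup>S M g = ennreal c * integral\<^sup>S M ?h"
      using simple_integral_mult[OF h, of "ennreal c"] by (simp only: cc)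
    ultimately show "integral\<^sup>S M g \<le> ennreal c * (\<integral>\<^sup>+x. f x \<partial>M)" by simp
  qed
  also have "\<dots> < \<infinity>" using assms by (simp add: ennreal_mult_less_top)
  finally show ?thesis .
qed simp

text \<open>The exceptional null set in the monotonicity condition may depend on the two arguments;
  restricting to rational ones and using continuity makes it uniform.\<close>

lemma caratheodory_monotone_uniform:
  fixes f :: "real ^ 'n \<Rightarrow> real \<Rightarrow> real ^ 'n \<Rightarrow> real"
  assumes f: "caratheodory \<Omega> f"
    and mono: "\<And>v w. \<bar>w\<bar> \<le> \<bar>v\<bar> \<Longrightarrow> AE x in lebesgue_on \<Omega>. \<forall>\<xi>. f x w \<xi> \<le> c * f x v \<xi>"
  shows "AE x in lebesgue_on \<Omega>. \<forall>v w \<xi>. \<bar>w\<bar> < \<bar>v\<bar> \<longrightarrow> f x w \<xi> \<le> c * f x v \<xi>"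
proof -
  have "AE x in lebesgue_on \<Omega>. \<forall>z\<in>\<rat> \<times> \<rat>. \<bar>snd z\<bar> \<le> \<bar>fst z\<bar> \<longrightarrow> (\<forall>\<xi>. f x (snd z) \<xi> \<le> c * f x (fst z) \<xi>)"
    using mono by (subst AE_ball_countable) (auto intro: countable_rat)
  moreover have "AE x in lebesgue_on \<Omega>. continuous_on UNIV (\<lambda>(u, \<xi>). f x u \<xi>)"
    using f by (simp add: caratheodory_def)
  ultimately show ?thesis
  proof eventually_elim
    case (elim x)
    have cont: "isCont (\<lambda>v. f x v \<xi>) v" for v \<xi>
    proof -
      have "continuous_on UNIV (\<lambda>v. (\<lambda>(u, \<xi>). f x u \<xi>) (v, \<xi>))"
        by (rule continuous_on_compose2[OF elim(2)]) (auto intro!: continuous_intros)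
      then show ?thesis by (simp add: continuous_on_eq_continuous_at)
    qed
    show ?case
    proof (intro allI impI, rule ccontr)
      fix v w \<xi> assume vw: "\<bar>w\<bar> < \<bar>v\<bar>" and n: "\<not> f x w \<xi> \<le> c * f x v \<xi>"
      define m where "m = (f x w \<xi> + c * f x v \<xi>) / 2"
      have m: "c * f x v \<xi> < m" "m < f x w \<xi>" using n by (auto simp: m_def)
      have cv: "isCont (\<lambda>v. c * f x v \<xi>) v" by (intro continuous_intros cont)
      obtain d1 where d1: "d1 > 0" "\<And>v'. dist v' v < d1 \<Longrightarrow> c * f x v' \<xi> < m"
        using order_tendstoD(2)[OF cv[unfolded isCont_def] m(1)] m(1) unfolding eventually_at
        by (metis UNIV_I)
      obtain d2 where d2: "d2 > 0" "\<And>w'. dist w' w < d2 \<Longrightarrow> m < f x w' \<xi>"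
        using order_tendstoD(1)[OF cont[where v = w and \<xi> = \<xi>, unfolded isCont_def] m(2)] m(2) unfolding eventually_at
        by (metis UNIV_I)
      define d where "d = min (min d1 d2) ((\<bar>v\<bar> - \<bar>w\<bar>) / 2)"
      have d: "d > 0" "d \<le> d1" "d \<le> d2" "2 * d \<le> \<bar>v\<bar> - \<bar>w\<bar>" 
      proof -
        have "d \<le> (\<bar>v\<bar> - \<bar>w\<bar>) / 2" unfolding d_def by (rule min.cobounded2)
        then show "2 * d \<le> \<bar>v\<bar> - \<bar>w\<bar>" by simp
      qed (use d1 d2 vw in \<open>auto simp: d_def\<close>)
      obtain v' where v': "v' \<in> \<rat>" "v < v'" "v' < v + d" using Rats_dense_in_real[of v "v + d"] d by auto
      obtain w' where w': "w' \<in> \<rat>" "w < w'" "w' < w + d" using Rats_dense_in_real[of w "w + d"] d by auto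
      have "\<bar>w'\<bar> \<le> \<bar>v'\<bar>" using v' w' d by linarith
      then have "f x w' \<xi> \<le> c * f x v' \<xi>" using elim(1) v' w' by force
      moreover have "c * f x v' \<xi> < m" using d1(2)[of v'] v' d by (simp add: dist_real_def)
      moreover have "m < f x w' \<xi>" using d2(2)[of w'] w' d by (simp add: dist_real_def)
      ultimately show False by simp
    qed
  qed
qed

text \<open>The tangent at \<open>\<xi>\<close> along the ray through \<open>\<xi>\<close>, evaluated at \<open>0\<close>.\<close>

lemma convex_gradient_ge:
  fixes F :: "'a::real_inner \<Rightarrow> real"
  assumes F: "convex_on UNIV F" and D: "GDERIV F \<xi> :> D"
  shows "F \<xi> - F 0 \<le> D \<bullet> \<xi>"
proof -
  have "convex_on UNIV (\<lambda>t. F (t *\<^sub>R \<xi>))"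
  proof (rule convex_onI)
    fix t x y :: real assume t: "0 < t" "t < 1"
    have "F (((1 - t) *\<^sub>R x + t *\<^sub>R y) *\<^sub>R \<xi>) = F ((1 - t) *\<^sub>R (x *\<^sub>R \<xi>) + t *\<^sub>R (y *\<^sub>R \<xi>))"
      by (simp add: algebra_simps)
    also have "\<dots> \<le> (1 - t) * F (x *\<^sub>R \<xi>) + t * F (y *\<^sub>R \<xi>)"
      using t by (intro convex_onD[OF F]) auto
    finally show "F (((1 - t) *\<^sub>R x + t *\<^sub>R y) *\<^sub>R \<xi>) \<le> (1 - t) * F (x *\<^sub>R \<xi>) + t * F (y *\<^sub>R \<xi>)" .
  qed simp
  moreover have "((\<lambda>t. F (t *\<^sub>R \<xi>)) has_real_derivative D \<bullet> \<xi>) (at 1 within UNIV)"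
  proof -
    have "((\<lambda>t. t *\<^sub>R \<xi>) has_derivative (\<lambda>s. s *\<^sub>R \<xi>)) (at (1::real))" by (auto intro!: derivative_eq_intros)
    moreover have "(F has_derivative (\<lambda>h. h \<bullet> D)) (at (1 *\<^sub>R \<xi>))" using D by (simp add: gderiv_def)
    ultimately have "((\<lambda>t. F (t *\<^sub>R \<xi>)) has_derivative (\<lambda>s. (s *\<^sub>R \<xi>) \<bullet> D)) (at 1)"
      by (rule has_derivative_compose)
    moreover have "(\<lambda>s. (s *\<^sub>R \<xi>) \<bullet> D) = (*) (D \<bullet> \<xi>)" by (auto simp: inner_commute)
    ultimately show ?thesis by (simp add: has_field_derivative_def)
  qed
  ultimately have "F (0 *\<^sub>R \<xi>) - F (1 *\<^sub>R \<xi>) \<ge> (D \<bullet> \<xi>) * (0 - 1)"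
    by (intro convex_on_imp_above_tangent[of UNIV]) auto
  then show ?thesis by simp
qed

lemma convex_scale_le:
  fixes F :: "'a::real_vector \<Rightarrow> real"
  assumes F: "convex_on UNIV F" "F 0 = 0" "\<And>\<xi>. F \<xi> \<ge> 0" and t: "0 \<le> t" "t \<le> 1"
  shows "F (t *\<^sub>R \<xi>) \<le> F \<xi>"
proof -
  have "F (t *\<^sub>R \<xi>) = F ((1 - t) *\<^sub>R 0 + t *\<^sub>R \<xi>)" by simp
  also have "\<dots> \<le> (1 - t) * F 0 + t * F \<xi>" using t by (intro convex_onD[OF F(1)]) auto
  also have "\<dots> \<le> F \<xi>" using F(2,3) t by (simp add: mult_left_le_one_le)
  finally show ?thesis .
qed

text \<open>Young's inequality with the exponents \<open>s/(s-1)\<close> and \<open>s\<close>, where the first factor is weighted by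
  \<open>\<epsilon>^(1 - 1/s)\<close>.\<close>

lemma Young_absorb:
  fixes y t c \<epsilon> s :: real
  assumes s: "s > 1" and c: "c \<ge> 0" and \<epsilon>: "\<epsilon> > 0" and y: "y \<ge> 0" and t: "t \<ge> 0"
  shows "c * (y powr (1 - 1 / s) * t) \<le> \<epsilon> * y + (c * \<epsilon> powr (- (1 - 1 / s))) powr s * t powr s"
proof -
  define A where "A = (\<epsilon> * y) powr (1 - 1 / s)"
  define B where "B = c * \<epsilon> powr (- (1 - 1 / s)) * t"
  have B0: "B \<ge> 0" using c t by (simp add: B_def)
  have e: "s / (s - 1) > 1" "1 / (s / (s - 1)) + 1 / s = 1" using s by (auto simp: field_simps)
  have Ap: "A powr (s / (s - 1)) = \<epsilon> * y"
  proof -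
    have "(1 - 1 / s) * (s / (s - 1)) = 1" using s by (simp add: field_simps)
    then have "A powr (s / (s - 1)) = (\<epsilon> * y) powr 1" unfolding A_def powr_powr by (rule arg_cong)
    then show ?thesis using \<epsilon> y by simp
  qed
  have "c * (y powr (1 - 1 / s) * t) = A * B"
  proof -
    have "\<epsilon> powr (1 - 1 / s) * \<epsilon> powr (- (1 - 1 / s)) = 1" using \<epsilon> by (simp flip: powr_add)
    moreover have "A * B = c * (y powr (1 - 1 / s) * t) * (\<epsilon> powr (1 - 1 / s) * \<epsilon> powr (- (1 - 1 / s)))"
      unfolding A_def B_def using \<epsilon> y by (simp only: powr_mult mult_ac)
    ultimately show ?thesis by simp
  qed
  also have "\<dots> \<le> A powr (s / (s - 1)) / (s / (s - 1)) + B powr s / s"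
    by (rule Youngs_inequality[OF e(1) s e(2)]) (auto simp: A_def B0)
  also have "\<dots> \<le> A powr (s / (s - 1)) + B powr s"
  proof -
    have "X / d \<le> X" if "X \<ge> 0" "d > 1" for X d :: real
      using divide_left_mono[of 1 d X] that by simp
    from this[of "A powr (s / (s - 1))" "s / (s - 1)"] this[of "B powr s" s] show ?thesis
      using s e(1) by (intro add_mono) (simp_all del: divide_divide_eq_right)
  qed
  also have "A powr (s / (s - 1)) = \<epsilon> * y" by (rule Ap)
  also have "B powr s = (c * \<epsilon> powr (- (1 - 1 / s))) powr s * t powr s"
    unfolding B_def using c t by (simp add: powr_mult)
  finally show ?thesis .
qed

text \<open>By Young's inequality the term with \<open>f^(1 - 1/p^*)\<close> costs only a part of the energy density. The
  left-hand side is the integrand of the weak formulation: \<open>v\<close> and \<open>\<xi>\<close> are the values of \<open>u\<close> and \<open>Du\<close>,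
  \<open>y\<close> and \<open>D\<close> those of \<open>f\<close> and its gradient, \<open>A\<close> and \<open>bb\<close> those of the coefficients, and \<open>h\<close>, \<open>h'\<close> those
  of a truncation at level \<open>k\<close> and of its derivative. The constant \<open>C\<close> is obtained before all of them,
  since it may depend on the structure constants only.\<close>

lemma structure_absorption:
  fixes \<xi> :: "'a::real_inner"
  assumes ps: "ps > 1" and c: "c1 > 0" "c5 > 0" "c7 \<ge> 0" and p: "p > 0"
  obtains C where "C \<ge> 0"
    "\<And>(A::'a) \<xi> D v y bb \<beta>1 \<beta>3 h h' k.
      \<lbrakk>y \<ge> c5 * norm \<xi> powr p; y \<le> D \<bullet> \<xi>; A \<bullet> \<xi> \<ge> c1 * (D \<bullet> \<xi>) - c2 * \<bar>v\<bar> powr ps - \<beta>1;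
       sgn v * bb \<ge> - c7 * (y powr (1 - 1 / ps) + norm \<xi> powr (p * (1 - 1 / ps)) + \<bar>v\<bar> powr (ps - 1)) - \<beta>3;
       \<beta>3 \<ge> 0; h = sgn v * \<bar>h\<bar>; \<bar>h\<bar> \<le> h' * max 0 (\<bar>v\<bar> - k); 0 \<le> h'; k \<ge> 0\<rbrakk> \<Longrightarrow>
      h' * (A \<bullet> \<xi>) + bb * h \<ge> h' * (c1 / 2 * c5 * norm \<xi> powr p - (c2 + C) * \<bar>v\<bar> powr ps - \<beta>1 - \<beta>3 * max 0 (\<bar>v\<bar> - k))"
proof -
  define e where "e = 1 - 1 / ps"
  have e: "e > 0" using ps by (simp add: e_def)
  \<comment> \<open>By coercivity \<open>|\<xi>|^(p (1 - 1/p^*))\<close> is at most \<open>(1/c5)^(1 - 1/p^*) y^(1 - 1/p^*)\<close>, so the first two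
    terms of the growth condition merge.\<close>
  define c' where "c' = c7 * (1 + (1 / c5) powr e)"
  have c': "c' \<ge> 0" using c by (simp add: c'_def)
  define C where "C = (c' * (c1 / 2) powr (- e)) powr ps + c7"
  have C: "C \<ge> 0" using c by (simp add: C_def)
  show ?thesis
  proof (rule that[OF C])
    fix A \<xi> D :: 'a and v y bb \<beta>1 \<beta>3 h h' k :: real
    assume y: "y \<ge> c5 * norm \<xi> powr p" and D: "y \<le> D \<bullet> \<xi>" and A: "A \<bullet> \<xi> \<ge> c1 * (D \<bullet> \<xi>) - c2 * \<bar>v\<bar> powr ps - \<beta>1"
      and bb: "sgn v * bb \<ge> - c7 * (y powr (1 - 1 / ps) + norm \<xi> powr (p * (1 - 1 / ps)) + \<bar>v\<bar> powr (ps - 1)) - \<beta>3"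
      and \<beta>3: "\<beta>3 \<ge> 0" and h: "h = sgn v * \<bar>h\<bar>" "\<bar>h\<bar> \<le> h' * max 0 (\<bar>v\<bar> - k)" "0 \<le> h'" and k: "k \<ge> 0"
    define m where "m = max 0 (\<bar>v\<bar> - k)"
    have m: "m \<ge> 0" "m \<le> \<bar>v\<bar>" using k by (auto simp: m_def)
    have y0: "y \<ge> 0" using y c by (meson mult_nonneg_nonneg less_imp_le order_trans powr_ge_zero)
    have "norm \<xi> powr p \<le> (1 / c5) * y" using y c by (simp add: field_simps)
    then have "(norm \<xi> powr p) powr e \<le> ((1 / c5) * y) powr e" using e by (intro powr_mono2) auto
    then have n: "norm \<xi> powr (p * e) \<le> (1 / c5) powr e * y powr e" using c y0 by (simp add: powr_powr powr_divide)
    define Q where "Q = c7 * (y powr e + norm \<xi> powr (p * e) + \<bar>v\<bar> powr (ps - 1)) + \<beta>3"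
    have Q0: "Q \<ge> 0" using c \<beta>3 by (simp add: Q_def)
    have "c7 * (y powr e + norm \<xi> powr (p * e) + \<bar>v\<bar> powr (ps - 1)) \<le> c7 * (y powr e + (1 / c5) powr e * y powr e + \<bar>v\<bar> powr (ps - 1))"
      using n c by (intro mult_left_mono) auto
    then have "Q \<le> c' * y powr e + c7 * \<bar>v\<bar> powr (ps - 1) + \<beta>3" by (simp add: Q_def c'_def algebra_simps)
    then have "Q * m \<le> (c' * y powr e + c7 * \<bar>v\<bar> powr (ps - 1) + \<beta>3) * m" using m by (intro mult_right_mono) auto
    also have "\<dots> = (c' * y powr e + c7 * \<bar>v\<bar> powr (ps - 1)) * m + \<beta>3 * m" by (simp add: algebra_simps)
    also have "\<dots> \<le> (c' * y powr e + c7 * \<bar>v\<bar> powr (ps - 1)) * \<bar>v\<bar> + \<beta>3 * m"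
      using m c' c by (intro add_right_mono mult_left_mono) auto
    also have "\<dots> = c' * (y powr e * \<bar>v\<bar>) + c7 * (\<bar>v\<bar> powr (ps - 1) * \<bar>v\<bar>) + \<beta>3 * m" by (simp add: algebra_simps)
    also have "\<bar>v\<bar> powr (ps - 1) * \<bar>v\<bar> = \<bar>v\<bar> powr ps" by (cases "v = 0") (simp_all add: powr_diff)
    also have "c' * (y powr e * \<bar>v\<bar>) \<le> (c1 / 2) * y + (c' * (c1 / 2) powr (- e)) powr ps * \<bar>v\<bar> powr ps"
      unfolding e_def using ps c' c y0 by (intro Young_absorb) auto
    finally have Qm: "Q * m \<le> (c1 / 2) * y + C * \<bar>v\<bar> powr ps + \<beta>3 * m" by (simp add: C_def algebra_simps)
    have "bb * h = (sgn v * bb) * \<bar>h\<bar>" by (subst h(1)) simp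
    also have "\<dots> \<ge> (- Q) * \<bar>h\<bar>"
    proof (rule mult_right_mono)
      show "- Q \<le> sgn v * bb" using bb by (simp add: Q_def e_def)
    qed simp
    finally have "bb * h \<ge> - (Q * \<bar>h\<bar>)" by simp
    moreover have "Q * \<bar>h\<bar> \<le> h' * (Q * m)"
    proof -
      have "Q * \<bar>h\<bar> \<le> Q * (h' * m)" using h(2) Q0 by (intro mult_left_mono) (auto simp: m_def)
      then show ?thesis by (simp add: mult_ac)
    qed
    moreover have "h' * (Q * m) \<le> c1 / 2 * (h' * y) + C * (h' * \<bar>v\<bar> powr ps) + h' * (\<beta>3 * m)"
    proof -
      have "h' * (Q * m) \<le> h' * ((c1 / 2) * y + C * \<bar>v\<bar> powr ps + \<beta>3 * m)" using Qm h(3) by (rule mult_left_mono)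
      also have "\<dots> = c1 / 2 * (h' * y) + C * (h' * \<bar>v\<bar> powr ps) + h' * (\<beta>3 * m)" by (simp add: distrib_left mult_ac)
      finally show ?thesis .
    qed
    moreover have "c1 * (h' * y) - c2 * (h' * \<bar>v\<bar> powr ps) - h' * \<beta>1 \<le> h' * (A \<bullet> \<xi>)"
    proof -
      have "c1 * y \<le> c1 * (D \<bullet> \<xi>)" using D c by (intro mult_left_mono) auto
      then have "c1 * y - c2 * \<bar>v\<bar> powr ps - \<beta>1 \<le> A \<bullet> \<xi>" using A by linarith
      from mult_left_mono[OF this h(3)] show ?thesis by (simp add: right_diff_distrib mult_ac)
    qed
    moreover have "c1 / 2 * (h' * (c5 * norm \<xi> powr p)) \<le> c1 / 2 * (h' * y)"
      using y c h(3) by (intro mult_left_mono) auto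
    moreover have "h' * (c1 / 2 * c5 * norm \<xi> powr p - (c2 + C) * \<bar>v\<bar> powr ps - \<beta>1 - \<beta>3 * m)
      = c1 / 2 * (h' * (c5 * norm \<xi> powr p)) - c2 * (h' * \<bar>v\<bar> powr ps) - C * (h' * \<bar>v\<bar> powr ps) - h' * \<beta>1 - h' * (\<beta>3 * m)"
      by (simp add: right_diff_distrib distrib_right distrib_left mult_ac)
    ultimately show "h' * (A \<bullet> \<xi>) + bb * h \<ge> h' * (c1 / 2 * c5 * norm \<xi> powr p - (c2 + C) * \<bar>v\<bar> powr ps - \<beta>1 - \<beta>3 * max 0 (\<bar>v\<bar> - k))"
      unfolding m_def[symmetric] by linarith
  qed
qed

section \<open>Boundedness of weak solutions\<close>

text \<open>Coercivity bounds the \<open>L\<^sup>p\<close> norm of the gradient by the energy, so functions of finite energy have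
  weak gradients in \<open>L\<^sup>p\<close>, not only in \<open>L\<^sup>1\<close>.\<close>

lemma W1F_weak_gradient:
  fixes f :: "real ^ 'n \<Rightarrow> real \<Rightarrow> real ^ 'n \<Rightarrow> real"
  assumes \<Omega>: "open \<Omega>" and c5: "c5 > 0" and coercive: "AE x in lebesgue_on \<Omega>. \<forall>v \<xi>. f x v \<xi> \<ge> c5 * norm \<xi> powr p"
    and u: "u \<in> W1F \<Omega> f"
  shows "has_weak_gradient \<Omega> u (weak_gradient \<Omega> u)" "weak_gradient \<Omega> u \<in> Lp p \<Omega>" "u \<in> borel_measurable (lebesgue_on \<Omega>)"
proof -
  have uW: "u \<in> W1 1 \<Omega>" and fin: "(\<integral>\<^sup>+x. ennreal (f x (u x) (weak_gradient \<Omega> u x)) \<partial>lebesgue_on \<Omega>) < \<infinity>"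
    using u by (auto simp: W1F_def energy_def)
  then obtain G where "has_weak_gradient \<Omega> u G" by (auto simp: W1_def)
  then show g: "has_weak_gradient \<Omega> u (weak_gradient \<Omega> u)" by (rule weak_gradient_eq_AE(1)[OF \<Omega>])
  show "u \<in> borel_measurable (lebesgue_on \<Omega>)" using uW by (auto simp: W1_def Lp_def)
  have m[measurable]: "weak_gradient \<Omega> u \<in> borel_measurable (lebesgue_on \<Omega>)"
    by (rule LpD(1)[OF W1_weak_gradient_Lp[OF \<Omega> uW g]])
  have "(\<integral>\<^sup>+x. ennreal (norm (weak_gradient \<Omega> u x) powr p) \<partial>lebesgue_on \<Omega>)
    \<le> (\<integral>\<^sup>+x. ennreal (1 / c5) * ennreal (f x (u x) (weak_gradient \<Omega> u x)) \<partial>lebesgue_on \<Omega>)"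
  proof (rule nn_integral_mono_AE)
    show "AE x in lebesgue_on \<Omega>. ennreal (norm (weak_gradient \<Omega> u x) powr p) \<le> ennreal (1 / c5) * ennreal (f x (u x) (weak_gradient \<Omega> u x))"
      using coercive
    proof eventually_elim
      case (elim x)
      then have "c5 * norm (weak_gradient \<Omega> u x) powr p \<le> f x (u x) (weak_gradient \<Omega> u x)" by blast
      then have "norm (weak_gradient \<Omega> u x) powr p \<le> (1 / c5) * f x (u x) (weak_gradient \<Omega> u x)"
        using c5 by (simp add: field_simps)
      then show ?case using c5 by (simp add: ennreal_leI flip: ennreal_mult')
    qed
  qed
  also have "\<dots> < \<infinity>" using fin c5 by (intro nn_integral_cmult_finite) auto
  finally have "integrable (lebesgue_on \<Omega>) (\<lambda>x. norm (weak_gradient \<Omega> u x) powr p)"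
    by (intro integrableI_nonneg) auto
  then show "weak_gradient \<Omega> u \<in> Lp p \<Omega>" using m by (simp add: Lp_def)
qed

theorem theorem2p1:
  fixes \<Omega> :: "(real ^ 'n) set"
    and p ps m M c1 c2 c3 c4 c5 c6 s1 :: real
    and f :: "real ^ 'n \<Rightarrow> real \<Rightarrow> real ^ 'n \<Rightarrow> real"
    and Df a :: "real ^ 'n \<Rightarrow> real \<Rightarrow> real ^ 'n \<Rightarrow> real ^ 'n"
    and b :: "real ^ 'n \<Rightarrow> real \<Rightarrow> real ^ 'n \<Rightarrow> real"
    and b1 b2 u0 u :: "real ^ 'n \<Rightarrow> real"
  defines "n \<equiv> real CARD('n)"
  assumes dim: "CARD('n) \<ge> 2"
    and Omega: "open \<Omega>" "bounded \<Omega>"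
    and p: "p > 1"
    and ps: "sobolev_exponent n p ps"
    (* the energy density *)
    and f_nonneg: "\<forall>x\<in>\<Omega>. \<forall>v \<xi>. f x v \<xi> \<ge> 0"
    and f_carath: "caratheodory \<Omega> f"
    and f_convex: "AE x in lebesgue_on \<Omega>. \<forall>v. convex_on UNIV (\<lambda>\<xi>. f x v \<xi>)"
    and Df_gradient: "AE x in lebesgue_on \<Omega>. \<forall>v \<xi>. GDERIV (\<lambda>\<eta>. f x v \<eta>) \<xi> :> Df x v \<xi>"
    and Df_carath: "caratheodory \<Omega> Df"
    and f_doubling: "M \<ge> m" "m > 1"
      "\<forall>x\<in>\<Omega>. \<forall>v \<xi>. m * f x v \<xi> \<le> f x v (2 *\<^sub>R \<xi>) \<and> f x v (2 *\<^sub>R \<xi>) \<le> M * f x v \<xi>"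
    and f_coercive: "c5 > 0" "AE x in lebesgue_on \<Omega>. \<forall>v \<xi>. f x v \<xi> \<ge> c5 * norm \<xi> powr p"
    and f_monotone: "c6 > 0"
      "\<forall>v w. \<bar>w\<bar> \<le> \<bar>v\<bar> \<longrightarrow> (AE x in lebesgue_on \<Omega>. \<forall>\<xi>. f x w \<xi> \<le> c6 * f x v \<xi>)"
    and f_zero: "(\<lambda>x. f x 0 0) \<in> Lp 1 \<Omega>"
    (* the vector field *)
    and a_carath: "caratheodory \<Omega> a"
    and a_const: "c1 > 0" "c2 \<ge> 0" "c3 > 0" "c4 \<ge> 0"
    and b1: "s1 > max 1 (n / p)" "b1 \<in> Lp s1 \<Omega>" "\<forall>x\<in>\<Omega>. b1 x \<ge> 0"
    and b2: "b2 \<in> Lp 1 \<Omega>" "\<forall>x\<in>\<Omega>. b2 x \<ge> 0"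
    and a_lower: "AE x in lebesgue_on \<Omega>. \<forall>v \<xi>.
      a x v \<xi> \<bullet> \<xi> \<ge> c1 * (Df x v \<xi> \<bullet> \<xi>) - c2 * \<bar>v\<bar> powr ps - b1 x"
    and a_upper: "AE x in lebesgue_on \<Omega>. \<forall>v \<xi>.
      a x v \<xi> \<bullet> \<xi> \<le> c3 * (Df x v \<xi> \<bullet> \<xi>) + c4 * \<bar>v\<bar> powr ps + b2 x"
    (* the right-hand side: condition (A) or condition (B) *)
    and b_carath: "caratheodory \<Omega> b"
    and b_growth:
      "(\<exists>c7 c8 \<epsilon> b3 b4. c7 > 0 \<and> c8 > 0 \<and> \<epsilon> > 0 \<and>
          b3 \<in> Lp (n / p + \<epsilon>) \<Omega> \<and> (\<forall>x\<in>\<Omega>. b3 x \<ge> (0::real)) \<and>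
          b4 \<in> Lp 1 \<Omega> \<and> (\<forall>x\<in>\<Omega>. b4 x \<ge> (0::real)) \<and>
          (AE x in lebesgue_on \<Omega>. \<forall>v \<xi>.
             sgn v * b x v \<xi> \<ge> - c7 * (f x v \<xi> powr (1 - 1 / ps)
                + norm \<xi> powr (p * (1 - 1 / ps)) + \<bar>v\<bar> powr (ps - 1)) - b3 x \<and>
             v * b x v \<xi> \<le> c8 * (f x v \<xi> + \<bar>v\<bar> powr ps) + b4 x))
       \<or>
       (\<exists>c9 \<epsilon> b3. c9 \<ge> 0 \<and> \<epsilon> > 0 \<and>
          b3 \<in> Lp (n / p + \<epsilon>) \<Omega> \<and> (\<forall>x\<in>\<Omega>. b3 x \<ge> (0::real)) \<and>
          (AE x in lebesgue_on \<Omega>. \<forall>v \<xi>.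
             \<bar>b x v \<xi>\<bar> \<le> c9 * (f x v \<xi> powr (1 - 1 / ps) + \<bar>v\<bar> powr (ps - 1)) + b3 x))"
    (* the boundary datum and the solution *)
    and u0: "u0 \<in> Linf \<Omega>" "u0 \<in> W1F \<Omega> f"
    and u: "weak_solution p \<Omega> f a b u0 u"
  shows "u \<in> Linf \<Omega>"
proof -
  have \<nu>: "n \<ge> 2" using dim by (simp add: n_def)
  have \<Omega>m: "\<Omega> \<in> lmeasurable" using Omega by (intro lmeasurable_open)
  have \<Omega>l: "\<Omega> \<in> sets lebesgue" using Omega by simp
  interpret finite_measure "lebesgue_on \<Omega>" using \<Omega>m by (rule finite_measure_lebesgue_on)
  have p1: "p \<ge> 1" and p0: "p \<ge> 0" "p > 0" using p by auto
  have ps1: "ps > p"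
  proof (cases "p < n")
    case True
    then have "n - p < n" "n - p > 0" using p \<nu> by auto
    then have "p * (n - p) < p * n" using p by simp
    then show ?thesis using ps True by (simp add: sobolev_exponent_def less_divide_eq mult.commute)
  qed (use ps in \<open>simp add: sobolev_exponent_def\<close>)
  define G where "G = weak_gradient \<Omega> u"
  define v where "v x = u x - u0 x" for x
  have uF: "u \<in> W1F \<Omega> f" and vF: "v \<in> W1F_0 p \<Omega> f"
    using u by (auto simp: weak_solution_def v_def[abs_def])
  note Gu = W1F_weak_gradient[OF Omega(1) f_coercive uF, folded G_def]
  note G0 = W1F_weak_gradient[OF Omega(1) f_coercive u0(2)]
  have um[measurable]: "u \<in> borel_measurable (lebesgue_on \<Omega>)" by (rule Gu(3))
  have Gm[measurable]: "G \<in> borel_measurable (lebesgue_on \<Omega>)" by (rule LpD(1)[OF Gu(2)])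
  have vW: "v \<in> W1_0 p \<Omega>" using vF by (simp add: W1F_0_def)
  have Gv: "has_weak_gradient \<Omega> v (\<lambda>x. G x - weak_gradient \<Omega> u0 x)"
    unfolding v_def[abs_def] by (rule has_weak_gradient_diff[OF \<Omega>l Gu(1) G0(1)])
  obtain k0 where k0: "AE x in lebesgue_on \<Omega>. \<bar>u0 x\<bar> \<le> k0" using u0(1) by (auto simp: Linf_def)
  have u0Lp: "u0 \<in> Lp s \<Omega>" if "s \<ge> 0" for s
    using k0 that by (intro bounded_imp_Lp[OF \<Omega>m G0(3)]) auto
  \<comment> \<open>At \<open>\<xi> = 0\<close> the lower doubling inequality reads \<open>m f \<le> f\<close> with \<open>m > 1\<close>.\<close>
  have fz: "f x w 0 = 0" if "x \<in> \<Omega>" for x w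
  proof -
    have "m * f x w 0 \<le> f x w 0" using f_doubling(3) that by (metis scaleR_zero_right)
    then have "(m - 1) * f x w 0 \<le> 0" by (simp add: algebra_simps)
    then have "f x w 0 \<le> 0" using f_doubling(2) by (simp add: mult_le_0_iff)
    then show ?thesis using f_nonneg that by (simp add: order_antisym)
  qed
  have fmono: "AE x in lebesgue_on \<Omega>. \<forall>v w \<xi>. \<bar>w\<bar> < \<bar>v\<bar> \<longrightarrow> f x w \<xi> \<le> c6 * f x v \<xi>"
    using f_monotone(2) by (intro caratheodory_monotone_uniform[OF f_carath]) blast

  \<comment> \<open>The truncations of \<open>u\<close> are admissible test functions. Below the level \<open>k\<close> they vanish together
    with their gradients; above it \<open>\<bar>H\<bar> < \<bar>u\<bar>\<close> because \<open>k > 0\<close>, which is where the strict inequality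
    in \<open>fmono\<close> is available.\<close>
  define H where "H \<delta> k x = soft_excess \<delta> k (u x)" for \<delta> k x
  define H' where "H' \<delta> k x = soft_excess' \<delta> k (u x)" for \<delta> k x
  have H_W0: "H \<delta> k \<in> W1_0 p \<Omega>" "has_weak_gradient \<Omega> (H \<delta> k) (\<lambda>x. H' \<delta> k x *\<^sub>R G x)"
    if k: "k \<ge> k0" "k \<ge> 0" and \<delta>: "\<delta> > 0" for k \<delta>
  proof -
    have k': "AE x in lebesgue_on \<Omega>. \<bar>u0 x\<bar> \<le> k" using k0 by (rule eventually_mono) (use k in auto)
    have uv: "u0 x + v x = u x" for x by (simp add: v_def)
    have b': "\<bar>soft_excess' \<delta> k t\<bar> \<le> 1" for t using soft_excess_bounds(3,4)[OF k(2) \<delta>, of t] by simp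
    note T = truncation_W1_0[OF Omega(1) \<Omega>m p1 vW Gv u0Lp[OF p0(1)] G0(2,1) k' soft_excess_has_derivative[OF \<delta>, of k]
        soft_excess'_continuous[OF \<delta>] b' soft_excess_bounds(5,6)[OF k(2) \<delta>]]
    show "H \<delta> k \<in> W1_0 p \<Omega>" using T(1) unfolding uv H_def[abs_def] .
    show "has_weak_gradient \<Omega> (H \<delta> k) (\<lambda>x. H' \<delta> k x *\<^sub>R G x)" using T(2) unfolding uv H_def[abs_def] H'_def[abs_def] by simp
  qed
  have H_adm: "H \<delta> k \<in> W1F_0 p \<Omega> f" "AE x in lebesgue_on \<Omega>. weak_gradient \<Omega> (H \<delta> k) x = H' \<delta> k x *\<^sub>R G x"
    if k: "k \<ge> k0" "k > 0" and \<delta>: "\<delta> > 0" for k \<delta>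
  proof -
    have k': "k \<ge> 0" using k by simp
    note W = H_W0[OF k(1) k' \<delta>]
    note B = soft_excess_bounds[OF k' \<delta>]
    show ae: "AE x in lebesgue_on \<Omega>. weak_gradient \<Omega> (H \<delta> k) x = H' \<delta> k x *\<^sub>R G x"
      by (rule weak_gradient_eq_AE(2)[OF Omega(1) W(2)])
    have HW: "H \<delta> k \<in> W1 p \<Omega>" using W(1) by (simp add: W1_0_def)
    have "H \<delta> k \<in> W1 1 \<Omega>"
      using Lp_mono[OF \<Omega>m _ _ p1, of "H \<delta> k"] HW Lp_mono[OF \<Omega>m W1_weak_gradient_Lp[OF Omega(1) HW W(2)] _ p1] W(2)
      by (auto simp: W1_def)
    moreover have "energy \<Omega> f (H \<delta> k) < \<infinity>"
    proof -
      have "energy \<Omega> f (H \<delta> k) \<le> (\<integral>\<^sup>+x. ennreal c6 * ennreal (f x (u x) (G x)) \<partial>lebesgue_on \<Omega>)"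
        unfolding energy_def
      proof (rule nn_integral_mono_AE)
        show "AE x in lebesgue_on \<Omega>. ennreal (f x (H \<delta> k x) (weak_gradient \<Omega> (H \<delta> k) x)) \<le> ennreal c6 * ennreal (f x (u x) (G x))"
          using ae fmono f_convex AE_space
        proof eventually_elim
          case (elim x)
          have x: "x \<in> \<Omega>" using elim(4) by simp
          have "f x (H \<delta> k x) (H' \<delta> k x *\<^sub>R G x) \<le> c6 * f x (u x) (G x)"
          proof (cases "\<bar>u x\<bar> \<le> k")
            case True
            then have "H \<delta> k x = 0" "H' \<delta> k x = 0" using B(5,6) by (auto simp: H_def H'_def)
            then show ?thesis using fz[OF x] f_nonneg x f_monotone(1) by simp
          next
            case False
            then have "\<bar>H \<delta> k x\<bar> < \<bar>u x\<bar>" using B(1)[of "u x"] k by (simp add: H_def)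
            then have "f x (H \<delta> k x) (H' \<delta> k x *\<^sub>R G x) \<le> c6 * f x (u x) (H' \<delta> k x *\<^sub>R G x)" using elim(2) by blast
            also have "\<dots> \<le> c6 * f x (u x) (G x)"
              using elim(3) f_nonneg x fz[OF x] f_monotone(1) B(3,4)[of "u x"]
              by (intro mult_left_mono convex_scale_le) (auto simp: H'_def)
            finally show ?thesis .
          qed
          then show ?case using elim(1) f_monotone(1) f_nonneg x by (simp add: ennreal_leI flip: ennreal_mult)
        qed
      qed
      also have "\<dots> < \<infinity>"
        using uF f_monotone(1) by (intro nn_integral_cmult_finite) (auto simp: W1F_def energy_def G_def)
      finally show ?thesis .
    qed
    ultimately show "H \<delta> k \<in> W1F_0 p \<Omega> f" using W(1) by (simp add: W1F_0_def W1F_def)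
  qed

  have "\<exists>K. AE x in lebesgue_on \<Omega>. \<bar>u x\<bar> \<le> K"
  proof (cases "p > n")
    \<comment> \<open>The integrability of \<open>Du\<close> exceeds the dimension: the Sobolev inequality with any exponent
      \<open>r < n\<close>, followed by Hoelder's inequality on the superlevel sets, gives the power
      \<open>\<sigma> = 1/r - 1/p\<close> of their measure, and \<open>\<sigma> > 1/q = 1/r - 1/n\<close>.\<close>
    case True
    define r where "r = (1 + n) / 2"
    have r: "1 < r" "r < n" "r < p" "r > 0" using \<nu> True by (auto simp: r_def)
    define q where "q = n * r / (n - r)"
    have q: "q > 0" using r by (simp add: q_def)
    have qinv: "1 / q = 1 / r - 1 / n" using r \<nu> by (simp add: q_def field_simps)
    have uLq: "integrable (lebesgue_on \<Omega>) (\<lambda>x. \<bar>u x\<bar> powr q)"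
    proof -
      have "v \<in> Lp q \<Omega>"
        using Sobolev_W1_0(1)[OF dim Omega(1) \<Omega>m vW Gv r(1)] r by (simp add: n_def q_def)
      from Lp_add[OF u0Lp this] have "(\<lambda>x. u0 x + v x) \<in> Lp q \<Omega>" using q by simp
      then show ?thesis by (simp add: v_def Lp_def)
    qed
    define c where "c = 2 * (r * (n - 1) / (n - r))"
    have c: "c \<ge> 0" using r by (simp add: c_def)
    define D where "D = (LINT x|lebesgue_on \<Omega>. norm (G x) powr p)"
    have D: "D \<ge> 0" by (auto simp: D_def intro!: Bochner_Integration.integral_nonneg)
    have est: "(LINT x|lebesgue_on \<Omega>. max 0 (\<bar>u x\<bar> - k) powr q) powr (1 / q) \<le>
      c * D powr (1 / p) * (k powr q * measure (lebesgue_on \<Omega>) {x \<in> space (lebesgue_on \<Omega>). \<bar>u x\<bar> > k} + measure (lebesgue_on \<Omega>) {x \<in> space (lebesgue_on \<Omega>). \<bar>u x\<bar> > k} powr (1 / r - 1 / p))"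
      if k: "k \<ge> max k0 0" for k
    proof -
      define A where "A = {x \<in> space (lebesgue_on \<Omega>). \<bar>u x\<bar> > k}"
      have A: "A \<in> sets (lebesgue_on \<Omega>)" unfolding A_def by measurable
      have k': "k \<ge> k0" "k \<ge> 0" using k by auto
      have "(LINT x|lebesgue_on \<Omega>. \<bar>soft_excess \<delta> k (u x)\<bar> powr q) powr (1 / q) \<le> c * D powr (1 / p) * measure (lebesgue_on \<Omega>) A powr (1 / r - 1 / p)"
        if \<delta>: "\<delta> > 0" for \<delta>
      proof -
        have iG: "integrable (lebesgue_on \<Omega>) (\<lambda>x. norm (G x) powr r)"
          by (rule LpD(2)[OF Lp_mono[OF \<Omega>m Gu(2)]]) (use r in auto)
        have "(LINT x|lebesgue_on \<Omega>. norm (H' \<delta> k x *\<^sub>R G x) powr r) \<le> (LINT x|lebesgue_on \<Omega>. indicator A x * norm (G x) powr r)"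
        proof (rule integral_mono')
          show "integrable (lebesgue_on \<Omega>) (\<lambda>x. indicator A x * norm (G x) powr r)"
            using A by (intro integrable_mult_bounded[OF iG, of _ 1]) (auto simp: indicator_def)
          fix x assume x: "x \<in> space (lebesgue_on \<Omega>)"
          note B = soft_excess_bounds[OF k'(2) \<delta>, of "u x"]
          show "norm (H' \<delta> k x *\<^sub>R G x) powr r \<le> indicator A x * norm (G x) powr r"
          proof (cases "x \<in> A")
            case True
            have "norm (H' \<delta> k x *\<^sub>R G x) \<le> norm (G x)" using B(3,4) by (simp add: H'_def mult_left_le_one_le)
            then show ?thesis using True r by (auto intro!: powr_mono2)
          next
            case False
            then show ?thesis using B(6) x by (simp add: A_def H'_def)
          qed
        qed auto
        also have "\<dots> \<le> D powr (r / p) * measure (lebesgue_on \<Omega>) A powr (1 - r / p)"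
          unfolding D_def using r by (intro integral_powr_le_measure_powr[OF \<Omega>m Gu(2) _ _ A]) auto
        finally have 1: "(LINT x|lebesgue_on \<Omega>. norm (H' \<delta> k x *\<^sub>R G x) powr r) \<le> D powr (r / p) * measure (lebesgue_on \<Omega>) A powr (1 - r / p)" .
        have "(LINT x|lebesgue_on \<Omega>. \<bar>H \<delta> k x\<bar> powr q) powr (1 / q) \<le> c * (LINT x|lebesgue_on \<Omega>. norm (H' \<delta> k x *\<^sub>R G x) powr r) powr (1 / r)"
          using Sobolev_W1_0(2)[OF dim Omega(1) \<Omega>m H_W0[OF k' \<delta>] r(1)] r by (simp add: n_def q_def c_def)
        also have "\<dots> \<le> c * (D powr (r / p) * measure (lebesgue_on \<Omega>) A powr (1 - r / p)) powr (1 / r)"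
          using 1 c r by (intro mult_left_mono powr_mono2) (auto intro!: Bochner_Integration.integral_nonneg)
        also have "\<dots> = c * D powr (1 / p) * measure (lebesgue_on \<Omega>) A powr ((1 - r / p) / r)"
          using r D by (simp add: powr_mult powr_powr)
        also have "(1 - r / p) / r = 1 / r - 1 / p" using r by (simp add: diff_divide_distrib)
        finally show ?thesis by (simp add: H_def)
      qed
      then have "(LINT x|lebesgue_on \<Omega>. max 0 (\<bar>u x\<bar> - k) powr q) powr (1 / q) \<le> c * D powr (1 / p) * measure (lebesgue_on \<Omega>) A powr (1 / r - 1 / p)"
        using q by (intro excess_integral_le[OF um uLq q k'(2)]) auto
      also have "\<dots> \<le> c * D powr (1 / p) * (k powr q * measure (lebesgue_on \<Omega>) A + measure (lebesgue_on \<Omega>) A powr (1 / r - 1 / p))"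
        using c by (intro mult_left_mono) auto
      finally show ?thesis by (simp add: A_def)
    qed
    have \<sigma>: "1 / q < 1 / r - 1 / p" "1 / r - 1 / p \<le> 1"
    proof -
      have "1 / p < 1 / n" using True \<nu> by (intro divide_strict_left_mono) auto
      then show "1 / q < 1 / r - 1 / p" using qinv by simp
      have "1 / r \<le> 1" "1 / p \<ge> 0" using r p by auto
      then show "1 / r - 1 / p \<le> 1" by linarith
    qed
    show ?thesis
      by (rule bounded_if_superlevel_decay[where ?k1.0 = "max k0 0" and C = "c * D powr (1 / p)", OF _ q \<sigma> _ _ _ _ uLq est])
        (use c in auto)
  next
    case False
    then have pn: "p \<le> n" by simp
    \<comment> \<open>The lower bound in condition (A) with \<open>c7 \<ge> 0\<close> also follows from condition (B).\<close>
    obtain c7 \<epsilon> b3 where b3: "c7 \<ge> 0" "\<epsilon> > 0" "b3 \<in> Lp (n / p + \<epsilon>) \<Omega>" "\<forall>x\<in>\<Omega>. b3 x \<ge> (0::real)"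
      "AE x in lebesgue_on \<Omega>. \<forall>v \<xi>. sgn v * b x v \<xi> \<ge> - c7 * (f x v \<xi> powr (1 - 1 / ps)
        + norm \<xi> powr (p * (1 - 1 / ps)) + \<bar>v\<bar> powr (ps - 1)) - b3 x"
      using b_growth
    proof (elim disjE exE conjE)
      fix c7 c8 \<epsilon> :: real and b3 b4 :: "real ^ 'n \<Rightarrow> real"
      assume *: "c7 > 0" "\<epsilon> > 0" "b3 \<in> Lp (n / p + \<epsilon>) \<Omega>" "\<forall>x\<in>\<Omega>. b3 x \<ge> 0"
        and ae: "AE x in lebesgue_on \<Omega>. \<forall>v \<xi>.
             sgn v * b x v \<xi> \<ge> - c7 * (f x v \<xi> powr (1 - 1 / ps)
                + norm \<xi> powr (p * (1 - 1 / ps)) + \<bar>v\<bar> powr (ps - 1)) - b3 x \<and>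
             v * b x v \<xi> \<le> c8 * (f x v \<xi> + \<bar>v\<bar> powr ps) + b4 x"
      show ?thesis by (rule that[OF less_imp_le[OF *(1)] *(2-4)]) (use ae in \<open>rule eventually_mono; blast\<close>)
    next
      fix c9 \<epsilon> :: real and b3 :: "real ^ 'n \<Rightarrow> real"
      assume *: "c9 \<ge> 0" "\<epsilon> > 0" "b3 \<in> Lp (n / p + \<epsilon>) \<Omega>" "\<forall>x\<in>\<Omega>. b3 x \<ge> 0"
        and ae: "AE x in lebesgue_on \<Omega>. \<forall>v \<xi>. \<bar>b x v \<xi>\<bar> \<le> c9 * (f x v \<xi> powr (1 - 1 / ps) + \<bar>v\<bar> powr (ps - 1)) + b3 x"
      show ?thesis
      proof (rule that[OF *], use ae in eventually_elim, intro allI)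
        fix x v \<xi>
        assume a: "\<forall>v \<xi>. \<bar>b x v \<xi>\<bar> \<le> c9 * (f x v \<xi> powr (1 - 1 / ps) + \<bar>v\<bar> powr (ps - 1)) + b3 x"
        have "- (sgn v * b x v \<xi>) \<le> \<bar>sgn v * b x v \<xi>\<bar>" by simp
        also have "\<dots> \<le> \<bar>b x v \<xi>\<bar>" by (simp add: abs_mult abs_sgn_eq)
        also have "\<dots> \<le> c9 * (f x v \<xi> powr (1 - 1 / ps) + \<bar>v\<bar> powr (ps - 1)) + b3 x" using a by blast
        also have "\<dots> \<le> c9 * (f x v \<xi> powr (1 - 1 / ps) + norm \<xi> powr (p * (1 - 1 / ps)) + \<bar>v\<bar> powr (ps - 1)) + b3 x"
          using *(1) by (intro add_right_mono mult_left_mono) auto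
        finally show "sgn v * b x v \<xi> \<ge> - c9 * (f x v \<xi> powr (1 - 1 / ps)
          + norm \<xi> powr (p * (1 - 1 / ps)) + \<bar>v\<bar> powr (ps - 1)) - b3 x" by simp
      qed
    qed
    define s3 where "s3 = n / p + \<epsilon>"
    have np: "n / p \<ge> 1" using pn p by simp
    have s3: "s3 > 1" "s3 > n / p" using np b3(2) by (auto simp: s3_def)
    have s1: "s1 > 1" "s1 > n / p" using b1(1) by auto
    \<comment> \<open>For \<open>p = n\<close> the Sobolev inequality is used with an exponent \<open>r < n\<close> so close to \<open>n\<close> that
      the conjugate exponent \<open>q\<close> is as large as needed.\<close>
    obtain r where r: "1 < r" "r < n" "r \<le> p" and q: "ps \<le> n * r / (n - r)"
      "p / (n * r / (n - r)) < 1 - 1 / s1" "p / (n * r / (n - r)) < 1 - 1 / s3"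
    proof (cases "p < n")
      case True
      have e: "ps = n * p / (n - p)" using ps True by (simp add: sobolev_exponent_def)
      have pq: "p / (n * p / (n - p)) = 1 - p / n" using True p \<nu> by (simp add: field_simps)
      have "1 / s < p / n" if "s > n / p" for s
      proof -
        have "n < s * p" using that p by (simp add: pos_divide_less_eq)
        moreover have "s > 0" using that np by linarith
        ultimately show ?thesis using \<nu> by (simp add: field_simps)
      qed
      then show ?thesis using that[of p] True p s1 s3 pq e by auto
    next
      case False
      then have "p = n" using pn by simp
      \<comment> \<open>The value intended for \<open>q\<close>; \<open>3\<close> makes the corresponding \<open>r\<close> greater than \<open>1\<close>, as \<open>n \<ge> 2\<close>.\<close>
      define Q where "Q = ps + 3 + p / (1 - 1 / s1) + p / (1 - 1 / s3)"
      have d: "1 - 1 / s1 > 0" "1 - 1 / s3 > 0" using s1 s3 by auto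
      have dd: "p / (1 - 1 / s1) > 0" "p / (1 - 1 / s3) > 0" using d p by auto
      have Q: "Q \<ge> ps" "Q > 3" "p / (1 - 1 / s1) < Q" "p / (1 - 1 / s3) < Q" using dd ps1 p by (auto simp: Q_def)
      define r where "r = n * Q / (n + Q)"
      have nr: "n - r = n * n / (n + Q)" using \<nu> Q by (simp add: r_def field_simps)
      have qr: "n * r / (n - r) = Q" unfolding nr using \<nu> Q by (simp add: r_def)
      have "n - r > 0" unfolding nr using \<nu> Q by simp
      moreover have "1 < r"
      proof -
        have "2 * Q \<le> n * Q" using \<nu> Q by simp
        moreover have "(n - 2) * 3 \<le> (n - 2) * Q" using \<nu> Q by (intro mult_left_mono) auto
        ultimately have "n + Q < n * Q" using Q \<nu> by (simp add: algebra_simps)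
        then show ?thesis using \<nu> Q by (simp add: r_def)
      qed
      moreover have "p / Q < 1 - 1 / s1" "p / Q < 1 - 1 / s3"
        using Q d by (simp_all add: pos_divide_less_eq mult.commute)
      ultimately show ?thesis using that[of r] Q \<open>p = n\<close> qr by auto
    qed
    define q where "q = n * r / (n - r)"
    note q = q[folded q_def]
    have qp: "p < q" "q > 0" using q ps1 p by auto
    obtain S where S: "S \<ge> 0" "\<And>w G. w \<in> W1_0 p \<Omega> \<Longrightarrow> has_weak_gradient \<Omega> w G \<Longrightarrow>
      (LINT x|lebesgue_on \<Omega>. \<bar>w x\<bar> powr q) powr (p / q) \<le> S * (LINT x|lebesgue_on \<Omega>. norm (G x) powr p)"
      using Sobolev_W1_0_powr[OF dim Omega(1) \<Omega>m r(1) r(2)[unfolded n_def] r(3)] unfolding q_def n_def by blast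
    have uLq: "integrable (lebesgue_on \<Omega>) (\<lambda>x. \<bar>u x\<bar> powr q)"
    proof -
      have "v \<in> Lp q \<Omega>"
        using Sobolev_W1_0(1)[OF dim Omega(1) \<Omega>m vW Gv r(1)] r by (simp add: n_def q_def)
      from Lp_add[OF u0Lp this] have "(\<lambda>x. u0 x + v x) \<in> Lp q \<Omega>" using qp by simp
      then show ?thesis by (simp add: v_def Lp_def)
    qed
    have b1m[measurable]: "b1 \<in> borel_measurable (lebesgue_on \<Omega>)" by (rule LpD(1)[OF b1(2)])
    have b3m[measurable]: "b3 \<in> borel_measurable (lebesgue_on \<Omega>)" by (rule LpD(1)[OF b3(3)])
    have b1i: "integrable (lebesgue_on \<Omega>) b1" by (rule Lp_one_integrable[OF Lp_mono[OF \<Omega>m b1(2)]]) (use s1 in auto)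
    have b3i: "integrable (lebesgue_on \<Omega>) (\<lambda>x. b3 x * \<bar>u x\<bar>)"
    proof (rule Holder_inequality(1)[of "q / (q - 1)" q])
      show e: "q / (q - 1) > 1" "q > 1" "1 / (q / (q - 1)) + 1 / q = 1" using qp p by (auto simp: field_simps)
      have "q / (q - 1) \<le> s3"
      proof -
        have "1 / q \<le> p / q" using p qp by (simp add: divide_right_mono)
        then have "1 / s3 \<le> 1 - 1 / q" using q(3) by linarith
        then have "1 / s3 \<le> (q - 1) / q" using qp by (simp add: diff_divide_distrib)
        then show ?thesis using s3 e(2) by (simp add: field_simps)
      qed
      then show "integrable (lebesgue_on \<Omega>) (\<lambda>x. \<bar>b3 x\<bar> powr (q / (q - 1)))"
        using LpD(2)[OF Lp_mono[OF \<Omega>m b3(3), of "q / (q - 1)"]] e by (simp add: s3_def)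
      show "integrable (lebesgue_on \<Omega>) (\<lambda>x. \<bar>\<bar>u x\<bar>\<bar> powr q)" using uLq by simp
    qed measurable
    have ps1': "ps > 1" using ps1 p by simp
    obtain C where C: "C \<ge> 0"
      "\<And>(A::real^'n) \<xi> D v y bb \<beta>1 \<beta>3 h h' k.
      \<lbrakk>y \<ge> c5 * norm \<xi> powr p; y \<le> D \<bullet> \<xi>; A \<bullet> \<xi> \<ge> c1 * (D \<bullet> \<xi>) - c2 * \<bar>v\<bar> powr ps - \<beta>1;
       sgn v * bb \<ge> - c7 * (y powr (1 - 1 / ps) + norm \<xi> powr (p * (1 - 1 / ps)) + \<bar>v\<bar> powr (ps - 1)) - \<beta>3;
       \<beta>3 \<ge> 0; h = sgn v * \<bar>h\<bar>; \<bar>h\<bar> \<le> h' * max 0 (\<bar>v\<bar> - k); 0 \<le> h'; k \<ge> 0\<rbrakk> \<Longrightarrow>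
      h' * (A \<bullet> \<xi>) + bb * h \<ge> h' * (c1 / 2 * c5 * norm \<xi> powr p - (c2 + C) * \<bar>v\<bar> powr ps - \<beta>1 - \<beta>3 * max 0 (\<bar>v\<bar> - k))"
      using structure_absorption[OF ps1' a_const(1) f_coercive(1) b3(1) p0(2)] by blast
    define \<kappa> where "\<kappa> = c1 / 2 * c5"
    have \<kappa>: "\<kappa> > 0" using a_const(1) f_coercive(1) by (simp add: \<kappa>_def)
    \<comment> \<open>At least \<open>1\<close>, to serve as a common factor of the three terms on the right-hand side.\<close>
    define C' where "C' = max 1 (c2 + C)"
    have C': "C' \<ge> 1" "c2 + C \<le> C'" "c2 + C \<ge> 0" using C(1) a_const(2) by (auto simp: C'_def)
    have est: "(LINT x|lebesgue_on \<Omega>. max 0 (\<bar>u x\<bar> - k) powr q) powr (p / q) \<le>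
      S * C' / \<kappa> * (LINT x|lebesgue_on \<Omega>. indicator {x \<in> space (lebesgue_on \<Omega>). \<bar>u x\<bar> > k} x * (\<bar>u x\<bar> powr q + \<bar>b1 x\<bar> + \<bar>b3 x\<bar> * (\<bar>u x\<bar> - k)))"
      if k: "k \<ge> max k0 1" for k
    proof -
      define A where "A = {x \<in> space (lebesgue_on \<Omega>). \<bar>u x\<bar> > k}"
      have A[measurable]: "A \<in> sets (lebesgue_on \<Omega>)" unfolding A_def by measurable
      have k': "k \<ge> k0" "k \<ge> 0" "k > 0" "k \<ge> 1" using k by auto
      define R where "R x = indicator A x * (\<bar>u x\<bar> powr q + \<bar>b1 x\<bar> + \<bar>b3 x\<bar> * (\<bar>u x\<bar> - k))" for x
      have Ri: "integrable (lebesgue_on \<Omega>) R"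
      proof -
        have "integrable (lebesgue_on \<Omega>) (\<lambda>x. indicator A x * (\<bar>u x\<bar> powr q + \<bar>b1 x\<bar> + \<bar>b3 x * \<bar>u x\<bar>\<bar>))"
          using b1i b3i uLq by (intro integrable_mult_bounded[of _ _ _ 1]) (auto simp: indicator_def)
        then show ?thesis
        proof (rule Bochner_Integration.integrable_bound)
          show "R \<in> borel_measurable (lebesgue_on \<Omega>)" unfolding R_def[abs_def] by measurable
          show "AE x in lebesgue_on \<Omega>. norm (R x) \<le> norm (indicator A x * (\<bar>u x\<bar> powr q + \<bar>b1 x\<bar> + \<bar>b3 x * \<bar>u x\<bar>\<bar>))"
          proof (rule AE_I2)
            fix x
            show "norm (R x) \<le> norm (indicator A x * (\<bar>u x\<bar> powr q + \<bar>b1 x\<bar> + \<bar>b3 x * \<bar>u x\<bar>\<bar>))"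
            proof (cases "x \<in> A")
              case True
              then have "0 \<le> \<bar>u x\<bar> - k" "\<bar>u x\<bar> - k \<le> \<bar>u x\<bar>" using k' by (auto simp: A_def)
              then have "0 \<le> \<bar>b3 x\<bar> * (\<bar>u x\<bar> - k)" "\<bar>b3 x\<bar> * (\<bar>u x\<bar> - k) \<le> \<bar>b3 x\<bar> * \<bar>u x\<bar>"
                by (auto intro!: mult_left_mono)
              moreover have "\<bar>u x\<bar> powr q \<ge> 0" by simp
              ultimately show ?thesis using True by (simp add: R_def abs_mult)
            qed (simp add: R_def)
          qed
        qed
      qed
      have "(LINT x|lebesgue_on \<Omega>. \<bar>soft_excess \<delta> k (u x)\<bar> powr q) powr (p / q) \<le> S * C' / \<kappa> * (LINT x|lebesgue_on \<Omega>. R x)"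
        if \<delta>: "\<delta> > 0" for \<delta>
      proof -
        note B = soft_excess_bounds[OF k'(2) \<delta>]
        define J where "J x = (\<Sum>i\<in>UNIV. a x (u x) (weak_gradient \<Omega> u x) $ i * weak_gradient \<Omega> (H \<delta> k) x $ i)
             + b x (u x) (weak_gradient \<Omega> u x) * H \<delta> k x" for x
        have J: "integrable (lebesgue_on \<Omega>) J" "(LINT x|lebesgue_on \<Omega>. J x) = 0"
          using u H_adm(1)[OF k'(1,3) \<delta>] unfolding weak_solution_def J_def[abs_def] has_bochner_integral_iff by blast+
        \<comment> \<open>Weighting with \<open>H'\<close> itself and not with its \<open>p\<close>-th power keeps the inequality linear in \<open>H'\<close>; in
          the end \<open>H'^p \<le> H'\<close> since \<open>0 \<le> H' \<le> 1\<close>.\<close>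
        define W where "W x = H' \<delta> k x * norm (G x) powr p" for x
        have "AE x in lebesgue_on \<Omega>. \<kappa> * W x \<le> J x + C' * R x"
          using H_adm(2)[OF k'(1,3) \<delta>] f_coercive(2) f_convex Df_gradient a_lower b3(5) AE_space
        proof eventually_elim
          case (elim x)
          have x: "x \<in> \<Omega>" using elim(7) by simp
          have g: "f x (u x) (G x) \<le> Df x (u x) (G x) \<bullet> G x"
            using convex_gradient_ge[of "\<lambda>\<xi>. f x (u x) \<xi>" "G x" "Df x (u x) (G x)"] elim(3,4) fz[OF x] by simp
          have hc: "H \<delta> k x = sgn (u x) * \<bar>H \<delta> k x\<bar>" unfolding H_def by (rule soft_excess_cases(3)[OF k'(2) \<delta>])
          have "J x = H' \<delta> k x * (a x (u x) (G x) \<bullet> G x) + b x (u x) (G x) * H \<delta> k x"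
            unfolding J_def elim(1) by (simp add: G_def inner_vec_def sum_distrib_left mult_ac)
          also have "\<dots> \<ge> H' \<delta> k x * (c1 / 2 * c5 * norm (G x) powr p - (c2 + C) * \<bar>u x\<bar> powr ps - b1 x - b3 x * max 0 (\<bar>u x\<bar> - k))"
            using elim(2,5,6) b3(4) x B(2,3)[of "u x"] k'(2)
            by (intro C(2)[OF _ g _ _ _ hc]) (auto simp: H_def H'_def)
          finally have 1: "H' \<delta> k x * (\<kappa> * norm (G x) powr p - (c2 + C) * \<bar>u x\<bar> powr ps - b1 x - b3 x * max 0 (\<bar>u x\<bar> - k)) \<le> J x"
            by (simp add: \<kappa>_def)
          have "H' \<delta> k x * ((c2 + C) * \<bar>u x\<bar> powr ps + b1 x + b3 x * max 0 (\<bar>u x\<bar> - k)) \<le> C' * R x"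
          proof (cases "x \<in> A")
            case True
            then have ux: "\<bar>u x\<bar> > k" by (simp add: A_def)
            then have "\<bar>u x\<bar> powr ps \<le> \<bar>u x\<bar> powr q" using q(1) k' by (intro powr_mono) auto
            then have "(c2 + C) * \<bar>u x\<bar> powr ps \<le> C' * \<bar>u x\<bar> powr q" using C' by (intro mult_mono) auto
            moreover have "b1 x \<le> C' * \<bar>b1 x\<bar>" using mult_right_mono[OF C'(1), of "\<bar>b1 x\<bar>"] by linarith
            moreover have "b3 x * max 0 (\<bar>u x\<bar> - k) \<le> C' * (\<bar>b3 x\<bar> * (\<bar>u x\<bar> - k))"
            proof -
              have "1 * (\<bar>b3 x\<bar> * (\<bar>u x\<bar> - k)) \<le> C' * (\<bar>b3 x\<bar> * (\<bar>u x\<bar> - k))" using C' ux by (intro mult_right_mono) auto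
              then show ?thesis using ux b3(4) x by simp
            qed
            ultimately have "(c2 + C) * \<bar>u x\<bar> powr ps + b1 x + b3 x * max 0 (\<bar>u x\<bar> - k) \<le> C' * R x"
              using True by (simp add: R_def distrib_left)
            moreover have "0 \<le> (c2 + C) * \<bar>u x\<bar> powr ps + b1 x + b3 x * max 0 (\<bar>u x\<bar> - k)"
              using C(1) a_const(2) b1(3) b3(4) x by (intro add_nonneg_nonneg mult_nonneg_nonneg) auto
            ultimately show ?thesis using B(3,4)[of "u x"] unfolding H'_def by (meson mult_left_le_one_le order_trans)
          next
            case False
            then have "H' \<delta> k x = 0" using B(6) x by (simp add: A_def H'_def)
            then show ?thesis using False by (simp add: R_def)
          qed
          with 1 show ?case unfolding W_def by (simp add: algebra_simps)
        qed
        moreover have iW: "integrable (lebesgue_on \<Omega>) W"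
        proof -
          have m: "H' \<delta> k \<in> borel_measurable (lebesgue_on \<Omega>)"
            unfolding H'_def[abs_def] using borel_measurable_continuous_onI[OF soft_excess'_continuous[OF \<delta>]] by measurable
          have "\<bar>H' \<delta> k x\<bar> \<le> 1" for x using B(3,4) by (simp add: H'_def)
          then show ?thesis unfolding W_def[abs_def] by (rule integrable_mult_bounded[OF LpD(2)[OF Gu(2)] m])
        qed
        ultimately have "(LINT x|lebesgue_on \<Omega>. \<kappa> * W x) \<le> (LINT x|lebesgue_on \<Omega>. J x + C' * R x)"
          using J(1) Ri by (intro integral_mono_AE) auto
        then have WR: "(LINT x|lebesgue_on \<Omega>. W x) \<le> C' / \<kappa> * (LINT x|lebesgue_on \<Omega>. R x)"
          using J Ri \<kappa> by (simp add: field_simps)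
        have "(LINT x|lebesgue_on \<Omega>. \<bar>H \<delta> k x\<bar> powr q) powr (p / q) \<le> S * (LINT x|lebesgue_on \<Omega>. norm (H' \<delta> k x *\<^sub>R G x) powr p)"
          by (rule S(2)[OF H_W0[OF k'(1,2) \<delta>]])
        also have "\<dots> \<le> S * (LINT x|lebesgue_on \<Omega>. W x)"
        proof (intro mult_left_mono[OF integral_mono'] iW S(1))
          fix x
          have h: "0 \<le> H' \<delta> k x" "H' \<delta> k x \<le> 1" using B(3,4) by (auto simp: H'_def)
          have "H' \<delta> k x powr p \<le> H' \<delta> k x"
          proof (cases "H' \<delta> k x = 0")
            case False
            then have "H' \<delta> k x powr p \<le> H' \<delta> k x powr 1" using h p1 by (intro powr_mono') auto
            then show ?thesis using h False by simp
          qed simp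
          then show "norm (H' \<delta> k x *\<^sub>R G x) powr p \<le> W x"
            using h by (simp add: W_def powr_mult mult_right_mono)
        qed (use B(3) in \<open>auto simp: W_def H'_def\<close>)
        also have "\<dots> \<le> S * (C' / \<kappa> * (LINT x|lebesgue_on \<Omega>. R x))" using WR S(1) by (rule mult_left_mono)
        finally show ?thesis by (simp add: H_def)
      qed
      then have "(LINT x|lebesgue_on \<Omega>. max 0 (\<bar>u x\<bar> - k) powr q) powr (p / q) \<le> S * C' / \<kappa> * (LINT x|lebesgue_on \<Omega>. R x)"
        using qp p by (intro excess_integral_le[OF um uLq qp(2) k'(2)]) auto
      then show ?thesis by (simp add: R_def A_def)
    qed
    show ?thesis
    proof (rule bounded_if_level_set_estimate[where ?k0.0 = "max k0 1", OF p1 qp(1) _ _ _ _ uLq b1m s1(1) q(2) _ b3m s3(1) q(3) _ est])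
      show "S * C' / \<kappa> \<ge> 0" using S(1) C' \<kappa> by simp
    qed (use LpD(2)[OF b1(2)] LpD(2)[OF b3(3)] in \<open>auto simp: s3_def\<close>)
  qed
  then show ?thesis using um by (auto simp: Linf_def)
qed

end
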